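(* Let $\Lambda$ be the (formal) space of unparametrized analytic curves, identified with the space of their Schwarz functions, with product $S\cdot T=S\circ\bar T\circ S$. (a) The equation $$S_{tt}-\frac{S_t}{S_z}S_{tz}=0$$ for a time-dependent Schwarz function $S(t,z)$ (the equation of continuous Schwarzian reflection) is the geodesic equation $\nabla_{S_t}S_t=0$ for a (formal) symmetric (i.e. torsion-free) affine connection on $\Lambda$, defined at a Schwarz function $S$ by $$\nabla_XY=\overline{\nabla}_XY-\frac{1}{2S_z}\left(X_zY+Y_zX\right).$$ (b) In fact, $\nabla$ is the canonical connection on the (formal) symmetric space $\Lambda$ determined by the multiplication $S\cdot T=S\circ \bar T\circ S$; accordingly, $\nabla$ is conformally invariant, and its Riemann tensor is covariant-constant.
   Context: Analytic curves: $\Gamma=\gamma(\mathbb{R})$ with $\gamma$ holomorphic, $\gamma'\ne0$ and invertible near the real axis. For holomorphic $f$, $\bar f(z)=\overline{f(\bar z)}$. The Schwarz function of $\Gamma$ is $S=\bar\gamma\circ\gamma^{-1}$, the unique holomorphic function near $\Gamma$ with $S(z)=\bar z$ on $\Gamma$; then $\Gamma=\{z:\bar z=S(z)\}$. The correspondence $\Gamma\leftrightarrow S$ identifies $\Lambda$ with a subset of a linear space $\mathcal{H}$ of holomorphic functions (defined near $\Gamma$). Everything is understood formally/locally (no manifold structure on $\Lambda$ is fixed): subscripts are partial derivatives, and identities are asserted where the functions are defined. A tangent vector to $\Lambda$ at $S(z)=S(0,z)$ is a holomorphic function near $\Gamma$ of the form $X=\frac{\partial}{\partial t}S(t,z)|_{t=0}$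 for a variation $S(t,z)$ through Schwarz functions. $X_z$ and $X_zY$ denote ordinary differentiation and pointwise multiplication. $\overline\nabla_XY$ is the ordinary (flat) covariant derivative in $\mathcal H$: if $S(r,t,z)$ is a two-parameter family of Schwarz functions and $X=S_r$, $Y=S_t$, then $\overline\nabla_XY=S_{rt}$. Thus $\nabla_{S_r}S_t=S_{rt}-\frac{1}{2S_z}(S_{rz}S_t+S_{tz}S_r)$. To be an affine connection on $\Lambda$ means in particular that $\nabla_XY$ is again tangent to $\Lambda$ for $X,Y$ tangent vector fields, and that $\nabla_{fX}Y=f\nabla_XY$, $\nabla_X(fY)=f\nabla_XY+X(f)Y$ for $f:\Lambda\to\mathbb{R}$. The canonical connection of a symmetric space $(\mathcal M,\mu)$, $\mu(p,q)=p\cdot q$, is $\nabla_XY=X(Y)+\frac12X\cdot Y$, an equality of differential operators on functions $F:\mathcal M\to\mathbb R$. Here $X(Y)[F]=X[Y[F]]$, and for $X=\frac{\partial p}{\partial r}$, $Y=\frac{\partial p}{\partial t}$ coming from a two-parameter family $p(r,t)$ with $p=p(0,0)$, $(X\cdot Y)[F](p)=\frac{\partial}{\partial r}\frac{\partial}{\partial t}F(p(r,0)\cdot p(0,t))|_{r=t=0}$. Conformal invariance: for a conformal (injective holomorphic) map $\varphi$ defined near $\Gamma$, put $\lambda(\varphi)(S)=\bar\varphi\circ S\circ\varphi^{-1}$ (the Schwarz function of $\varphi(\Gamma)$), with induced map on tangent vectors $\lambda(\varphi)_*X=\left((\bar\varphi_z\circ S)\,X\right)\circ\varphi^{-1}$;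 the invariance is $\lambda(\varphi)_*\nabla_XY=\nabla_{\lambda(\varphi)_*X}\lambda(\varphi)_*Y$. The Riemann tensor is $R(X,Y)Z=\nabla_X\nabla_YZ-\nabla_Y\nabla_XZ-\nabla_{[X,Y]}Z$; covariant-constant means $\nabla R=0$. *)

theory Defs
  imports "HOL-Analysis.Analysis"
begin

text \<open>
  The space of analytic curves carries no manifold structure; it is handled through its smooth
  finite-parameter families. Throughout, \<open>K\<close> is a compact connected piece of an analytic curve,
  functions holomorphic near the curve are total functions of which only the germ along \<open>K\<close>
  matters, and families depend on a parameter near \<open>0\<close> in a Euclidean space, with \<open>K\<close> lying on
  the curve at parameter \<open>0\<close>. Since \<open>K\<close> and the family are arbitrary, this covers every point
  of every curve and, after translation, every parameter value.
\<close>

type_synonym cfun = "complex \<Rightarrow> complex"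

type_synonym field_on_curves = "cfun \<Rightarrow> cfun"


subsection \<open>Smoothness and germs\<close>

primrec Ck_on :: "nat \<Rightarrow> 'a::real_normed_vector set \<Rightarrow> ('a \<Rightarrow> 'b::real_normed_vector) \<Rightarrow> bool" where
  "Ck_on 0 A f \<longleftrightarrow> continuous_on A f"
| "Ck_on (Suc k) A f \<longleftrightarrow>
     (\<forall>x\<in>A. f differentiable (at x)) \<and> (\<forall>v. Ck_on k A (\<lambda>x. frechet_derivative f (at x) v))"

definition smooth_on :: "'a::real_normed_vector set \<Rightarrow> ('a \<Rightarrow> 'b::real_normed_vector) \<Rightarrow> bool" where
  "smooth_on A f \<longleftrightarrow> (\<forall>k. Ck_on k A f)"

definition smooth_near0 :: "('a::real_normed_vector \<Rightarrow> 'b::real_normed_vector) \<Rightarrow> bool" where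
  "smooth_near0 f \<longleftrightarrow> (\<exists>N. open N \<and> 0 \<in> N \<and> smooth_on N f)"

definition near :: "complex set \<Rightarrow> (complex \<Rightarrow> bool) \<Rightarrow> bool" where
  "near K Q \<longleftrightarrow> (\<exists>U. open U \<and> K \<subseteq> U \<and> (\<forall>z\<in>U. Q z))"

definition near0 :: "complex set \<Rightarrow> ('p::real_normed_vector \<Rightarrow> complex \<Rightarrow> bool) \<Rightarrow> bool" where
  "near0 K Q \<longleftrightarrow>
     (\<exists>N U. open N \<and> 0 \<in> N \<and> open U \<and> K \<subseteq> U \<and> (\<forall>r\<in>N. \<forall>z\<in>U. Q r z))"


subsection \<open>Schwarz functions and their families\<close>

definition cbar :: "cfun \<Rightarrow> cfun" where
  "cbar f = (\<lambda>z. cnj (f (cnj z)))"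

definition analytic_param :: "cfun \<Rightarrow> complex set \<Rightarrow> bool" where
  "analytic_param \<gamma> D \<longleftrightarrow> open D \<and> connected D \<and> \<real> \<subseteq> D \<and> cnj ` D = D \<and>
     \<gamma> holomorphic_on D \<and> inj_on \<gamma> D \<and> (\<forall>w\<in>D. deriv \<gamma> w \<noteq> 0)"

text \<open>\<open>S\<close> is, on \<open>U\<close>, the Schwarz function of some analytic curve \<open>\<gamma> ` \<real>\<close>.\<close>

definition schwarz_on :: "complex set \<Rightarrow> cfun \<Rightarrow> bool" where
  "schwarz_on U S \<longleftrightarrow>
     (\<exists>\<gamma> D. analytic_param \<gamma> D \<and> U \<subseteq> \<gamma> ` D \<and> (\<forall>z\<in>U. S z = cbar \<gamma> (the_inv_into D \<gamma> z)))"

text \<open>On the domain of a Schwarz function the curve is the set where \<open>S z = cnj z\<close>, so the last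
  conjunct says that \<open>K\<close> lies on the curve.\<close>

definition schwarz_along :: "complex set \<Rightarrow> cfun \<Rightarrow> bool" where
  "schwarz_along K S \<longleftrightarrow> compact K \<and> connected K \<and> K \<noteq> {} \<and>
     (\<exists>U. open U \<and> K \<subseteq> U \<and> schwarz_on U S) \<and> (\<forall>z\<in>K. S z = cnj z)"

definition schwarz_family ::
    "complex set \<Rightarrow> cfun \<Rightarrow> ('p::euclidean_space \<Rightarrow> cfun) \<Rightarrow> bool" where
  "schwarz_family K S T \<longleftrightarrow>
     (\<exists>N U. open N \<and> 0 \<in> N \<and> open U \<and> K \<subseteq> U \<and>
        smooth_on (N \<times> U) (\<lambda>(r, z). T r z) \<and> (\<forall>r\<in>N. schwarz_on U (T r))) \<and>
     near K (\<lambda>z. T 0 z = S z)"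

text \<open>Partial derivative in the parameter, in the (parameter-dependent) direction \<open>u\<close>.\<close>

definition dpar ::
    "('p::real_normed_vector \<Rightarrow> 'p) \<Rightarrow> ('p \<Rightarrow> cfun) \<Rightarrow> 'p \<Rightarrow> cfun" where
  "dpar u T r z = vector_derivative (\<lambda>t. T (r + t *\<^sub>R u r) z) (at 0)"

definition variation :: "complex set \<Rightarrow> cfun \<Rightarrow> cfun \<Rightarrow> (real \<Rightarrow> cfun) \<Rightarrow> bool" where
  "variation K S X T \<longleftrightarrow>
     schwarz_family K S T \<and> near K (\<lambda>z. dpar (\<lambda>_. 1) T 0 z = X z)"

definition tangent :: "complex set \<Rightarrow> cfun \<Rightarrow> cfun \<Rightarrow> bool" where
  "tangent K S X \<longleftrightarrow> (\<exists>T. variation K S X T)"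

text \<open>A tangent field along a family \<open>T\<close>: the velocity of a variation of \<open>T\<close> through Schwarz
  functions. This includes the smooth dependence on the parameter of \<open>T\<close>.\<close>

definition tangent_field ::
    "complex set \<Rightarrow> cfun \<Rightarrow> ('p::euclidean_space \<Rightarrow> cfun) \<Rightarrow> ('p \<Rightarrow> cfun) \<Rightarrow> bool" where
  "tangent_field K S T Y \<longleftrightarrow>
     (\<exists>T' :: 'p \<times> real \<Rightarrow> cfun. schwarz_family K S T' \<and>
        near0 K (\<lambda>r z. T' (r, 0) z = T r z) \<and>
        near0 K (\<lambda>r z. dpar (\<lambda>_. (0, 1)) T' (r, 0) z = Y r z))"


subsection \<open>Functions and vector fields near a point of the space of curves\<close>

definition smooth_function :: "complex set \<Rightarrow> cfun \<Rightarrow> (cfun \<Rightarrow> real) \<Rightarrow> bool" where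
  "smooth_function K S F \<longleftrightarrow>
     (\<forall>T :: real \<times> real \<Rightarrow> cfun. schwarz_family K S T \<longrightarrow> smooth_near0 (\<lambda>p. F (T p)))"

definition vector_field :: "complex set \<Rightarrow> cfun \<Rightarrow> field_on_curves \<Rightarrow> bool" where
  "vector_field K S X \<longleftrightarrow>
     (\<forall>T :: real \<times> real \<Rightarrow> cfun. schwarz_family K S T \<longrightarrow>
        tangent_field K S T (\<lambda>p. X (T p)))"

text \<open>\<open>X[F](S) = d\<close>.\<close>

definition has_derivation ::
    "complex set \<Rightarrow> cfun \<Rightarrow> cfun \<Rightarrow> (cfun \<Rightarrow> real) \<Rightarrow> real \<Rightarrow> bool" where
  "has_derivation K S X F d \<longleftrightarrow>
     (\<forall>T. variation K S X T \<longrightarrow> ((\<lambda>t. F (T t)) has_real_derivative d) (at 0))"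

definition derivation :: "complex set \<Rightarrow> cfun \<Rightarrow> cfun \<Rightarrow> (cfun \<Rightarrow> real) \<Rightarrow> real" where
  "derivation K S X F = (THE d. has_derivation K S X F d)"

text \<open>Flat covariant derivative of the field \<open>Y\<close> at \<open>S\<close> in the direction of a tangent vector \<open>X\<close>.
  It is determined as a germ along \<open>K\<close> only, whence the choice operator.\<close>

definition has_flat_derivative ::
    "complex set \<Rightarrow> cfun \<Rightarrow> cfun \<Rightarrow> field_on_curves \<Rightarrow> cfun \<Rightarrow> bool" where
  "has_flat_derivative K S X Y E \<longleftrightarrow>
     (\<forall>T. variation K S X T \<longrightarrow>
        near K (\<lambda>z. ((\<lambda>t. Y (T t) z) has_vector_derivative E z) (at 0)))"

definition flat_derivative ::
    "complex set \<Rightarrow> cfun \<Rightarrow> cfun \<Rightarrow> field_on_curves \<Rightarrow> cfun" where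
  "flat_derivative K S X Y = (SOME E. has_flat_derivative K S X Y E)"


subsection \<open>The connection\<close>

definition nabla ::
    "complex set \<Rightarrow> cfun \<Rightarrow> field_on_curves \<Rightarrow> field_on_curves \<Rightarrow> cfun" where
  "nabla K S X Y = (\<lambda>z. flat_derivative K S (X S) Y z
     - 1 / (2 * deriv S z) * (deriv (X S) z * Y S z + deriv (Y S) z * X S z))"

text \<open>The same connection along a family \<open>T\<close>: covariant derivative, in the parameter direction
  \<open>u\<close>, of a field \<open>Y\<close> along \<open>T\<close>. For \<open>u\<close> the \<open>r\<close>-direction and \<open>Y = T\<^sub>t\<close> it is
  \<open>T\<^sub>r\<^sub>t - (T\<^sub>r\<^sub>z T\<^sub>t + T\<^sub>t\<^sub>z T\<^sub>r) / (2 T\<^sub>z)\<close>.\<close>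

definition cov ::
    "('p::real_normed_vector \<Rightarrow> cfun) \<Rightarrow> ('p \<Rightarrow> 'p) \<Rightarrow> ('p \<Rightarrow> cfun) \<Rightarrow> 'p \<Rightarrow> cfun" where
  "cov T u Y r z = dpar u Y r z
     - 1 / (2 * deriv (T r) z) * (deriv (dpar u T r) z * Y r z + deriv (Y r) z * dpar u T r z)"

definition geodesic :: "complex set \<Rightarrow> (real \<Rightarrow> cfun) \<Rightarrow> bool" where
  "geodesic K T \<longleftrightarrow> near0 K (\<lambda>t z. cov T (\<lambda>_. 1) (dpar (\<lambda>_. 1) T) t z = 0)"

definition continuous_reflection :: "complex set \<Rightarrow> (real \<Rightarrow> cfun) \<Rightarrow> bool" where
  "continuous_reflection K T \<longleftrightarrow>
     (let dt = dpar (\<lambda>_::real. 1) in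
      near0 K (\<lambda>t z. dt (dt T) t z - dt T t z / deriv (T t) z * deriv (dt T t) z = 0))"

definition affine_connection ::
    "complex set \<Rightarrow> cfun \<Rightarrow> (field_on_curves \<Rightarrow> field_on_curves \<Rightarrow> cfun) \<Rightarrow> bool" where
  "affine_connection K S D \<longleftrightarrow>
     (\<forall>X Y. vector_field K S X \<and> vector_field K S Y \<longrightarrow> tangent K S (D X Y)) \<and>
     (\<forall>X X' Y. vector_field K S X \<and> vector_field K S X' \<and> vector_field K S Y \<longrightarrow>
        near K (\<lambda>z. D (\<lambda>T z. X T z + X' T z) Y z = D X Y z + D X' Y z)) \<and>
     (\<forall>X Y Y'. vector_field K S X \<and> vector_field K S Y \<and> vector_field K S Y' \<longrightarrow>
        near K (\<lambda>z. D X (\<lambda>T z. Y T z + Y' T z) z = D X Y z + D X Y' z)) \<and>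
     (\<forall>f X Y. smooth_function K S f \<and> vector_field K S X \<and> vector_field K S Y \<longrightarrow>
        near K (\<lambda>z. D (\<lambda>T z. of_real (f T) * X T z) Y z = of_real (f S) * D X Y z)) \<and>
     (\<forall>f X Y. smooth_function K S f \<and> vector_field K S X \<and> vector_field K S Y \<longrightarrow>
        has_derivation K S (X S) f (derivation K S (X S) f) \<and>
        near K (\<lambda>z. D X (\<lambda>T z. of_real (f T) * Y T z) z
          = of_real (f S) * D X Y z + of_real (derivation K S (X S) f) * Y S z))"

text \<open>Lie bracket of vector fields on the parameter space.\<close>

definition bracket ::
    "('p::real_normed_vector \<Rightarrow> 'p) \<Rightarrow> ('p \<Rightarrow> 'p) \<Rightarrow> 'p \<Rightarrow> 'p" where
  "bracket u v = (\<lambda>r. frechet_derivative v (at r) (u r) - frechet_derivative u (at r) (v r))"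


subsection \<open>The symmetric space product and its canonical connection\<close>

definition reflect_mult :: "cfun \<Rightarrow> cfun \<Rightarrow> cfun" where
  "reflect_mult S T = S \<circ> cbar T \<circ> S"

definition mixed_partial :: "(real \<Rightarrow> real \<Rightarrow> real) \<Rightarrow> real" where
  "mixed_partial G = deriv (\<lambda>r. deriv (\<lambda>t. G r t) 0) 0"

text \<open>\<open>(\<nabla>\<^sub>X Y)[F] = X[Y[F]] + (X \<cdot> Y)[F] / 2\<close> at \<open>S = p (0, 0)\<close>, where \<open>X\<close>, \<open>Y\<close> are the two partial
  derivatives of a two-parameter family \<open>p\<close>. The connection enters as the tangent vector \<open>V p\<close>
  that it assigns to \<open>p\<close>.\<close>

definition canonical_connection ::
    "complex set \<Rightarrow> cfun \<Rightarrow> (cfun \<Rightarrow> cfun \<Rightarrow> cfun) \<Rightarrow> ((real \<times> real \<Rightarrow> cfun) \<Rightarrow> cfun) \<Rightarrow> bool" where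
  "canonical_connection K S m V \<longleftrightarrow>
     (\<forall>p. schwarz_family K S p \<longrightarrow> tangent K S (V p) \<and>
       (\<forall>F. smooth_function K S F \<longrightarrow>
          has_derivation K S (V p) F
            (mixed_partial (\<lambda>r t. F (p (r, t)))
              + 1/2 * mixed_partial (\<lambda>r t. F (m (p (r, 0)) (p (0, t)))))))"


subsection \<open>Conformal maps\<close>

definition lam :: "cfun \<Rightarrow> complex set \<Rightarrow> cfun \<Rightarrow> cfun" where
  "lam \<phi> V S = cbar \<phi> \<circ> S \<circ> the_inv_into V \<phi>"

definition lam_vec :: "cfun \<Rightarrow> complex set \<Rightarrow> cfun \<Rightarrow> cfun \<Rightarrow> cfun" where
  "lam_vec \<phi> V S X = (\<lambda>z. deriv (cbar \<phi>) (S z) * X z) \<circ> the_inv_into V \<phi>"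

definition lam_field :: "cfun \<Rightarrow> complex set \<Rightarrow> field_on_curves \<Rightarrow> field_on_curves" where
  "lam_field \<phi> V X = (\<lambda>T. let S = lam (the_inv_into V \<phi>) (\<phi> ` V) T in lam_vec \<phi> V S (X S))"

definition conformally_invariant ::
    "complex set \<Rightarrow> cfun \<Rightarrow>
     (complex set \<Rightarrow> cfun \<Rightarrow> field_on_curves \<Rightarrow> field_on_curves \<Rightarrow> cfun) \<Rightarrow> bool" where
  "conformally_invariant K S D \<longleftrightarrow>
     (\<forall>\<phi> V. open V \<and> K \<subseteq> V \<and> \<phi> holomorphic_on V \<and> inj_on \<phi> V \<longrightarrow>
        schwarz_along (\<phi> ` K) (lam \<phi> V S) \<and>
        (\<forall>X Y. vector_field K S X \<and> vector_field K S Y \<longrightarrow>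
           vector_field (\<phi> ` K) (lam \<phi> V S) (lam_field \<phi> V X) \<and>
           near (\<phi> ` K) (\<lambda>z. lam_vec \<phi> V S (D K S X Y) z
             = D (\<phi> ` K) (lam \<phi> V S) (lam_field \<phi> V X) (lam_field \<phi> V Y) z)))"


subsection \<open>Curvature\<close>

type_synonym curvature = "cfun \<Rightarrow> cfun \<Rightarrow> cfun \<Rightarrow> cfun \<Rightarrow> cfun"

text \<open>\<open>R\<close> is the Riemann tensor near \<open>S\<close>: on fields \<open>X\<close>, \<open>Y\<close> induced by parameter fields \<open>u\<close>, \<open>v\<close>,
  \<open>R(X,Y)Z = \<nabla>\<^sub>X\<nabla>\<^sub>Y Z - \<nabla>\<^sub>Y\<nabla>\<^sub>X Z - \<nabla>\<^bsub>[X,Y]\<^esub> Z\<close>. Two parameters realize arbitrary tangent vectors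
  \<open>X\<close>, \<open>Y\<close> at \<open>S\<close>; the third one allows this at the nearby points of a curve through \<open>S\<close>, so that
  \<open>R\<close> can be differentiated along it.\<close>

definition riemann_tensor :: "complex set \<Rightarrow> cfun \<Rightarrow> curvature \<Rightarrow> bool" where
  "riemann_tensor K S R \<longleftrightarrow>
     (\<forall>(T :: real \<times> real \<times> real \<Rightarrow> cfun) u v Z.
        schwarz_family K S T \<and> smooth_near0 u \<and> smooth_near0 v \<and> tangent_field K S T Z \<longrightarrow>
        near0 K (\<lambda>r z. R (T r) (dpar u T r) (dpar v T r) (Z r) z
          = cov T u (cov T v Z) r z - cov T v (cov T u Z) r z - cov T (bracket u v) Z r z))"

text \<open>\<open>(\<nabla>\<^sub>W R)(X,Y)Z = 0\<close> for \<open>W\<close> the velocity of a curve \<open>T\<close> and \<open>X\<close>, \<open>Y\<close>, \<open>Z\<close> fields along it.\<close>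

definition covariant_constant :: "complex set \<Rightarrow> cfun \<Rightarrow> curvature \<Rightarrow> bool" where
  "covariant_constant K S R \<longleftrightarrow>
     (\<forall>(T :: real \<Rightarrow> cfun) X Y Z.
        schwarz_family K S T \<and> tangent_field K S T X \<and> tangent_field K S T Y \<and>
        tangent_field K S T Z \<longrightarrow>
        (let D = cov T (\<lambda>_. 1) in
         near0 K (\<lambda>t z. D (\<lambda>t. R (T t) (X t) (Y t) (Z t)) t z
           - R (T t) (D X t) (Y t) (Z t) z
           - R (T t) (X t) (D Y t) (Z t) z
           - R (T t) (X t) (Y t) (D Z t) z = 0)))"

end

theory Submission
  imports Defs "HOL-Complex_Analysis.Complex_Analysis"
begin

text \<open>
  \<open>S\<close> is a Schwarz function exactly when \<open>\<sigma> z = cnj (S z)\<close> is an antiholomorphic involution fixing the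
  curve. If \<open>g\<close> straightens the curve at the base point, then for a smooth family of such involutions
  \<open>(g + cnj \<circ> g \<circ> \<sigma>) / 2\<close> straightens the whole family, and conversely every smooth family of
  deformations of \<open>g\<close> is the straightening of a family of Schwarz functions. Hence smooth families, and
  fields along them, are recognized by the involution property and its linearization
  \<open>Y = - S\<^sub>z \<cdot> (cnj \<circ> Y \<circ> \<sigma>)\<close>, which the connection, conformal maps and the product \<open>S \<circ> cbar T \<circ> S\<close>
  visibly preserve. The same chart joins two curves with equal velocity in a two-parameter family, so
  that first and second derivatives of functions and fields depend only on the expected jets.

  For \<open>Q (r, t) = p (r, 0) \<cdot> p (0, t)\<close> the mixed derivative is computed by the chain rule from
  \<open>Q = A \<circ> cbar B \<circ> A\<close>, and \<open>p\<^sub>r\<^sub>t + Q\<^sub>r\<^sub>t / 2\<close> is the covariant derivative of \<open>p\<^sub>t\<close>. Dividing tangent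
  fields by \<open>S\<^sub>z\<close> turns the connection into \<open>\<partial>\<^sub>u \<zeta> + [\<zeta>, \<alpha>] / 2\<close>, where \<open>\<alpha> = S\<^sub>u / S\<^sub>z\<close> and the bracket is that of
  holomorphic vector fields. As \<open>\<partial>\<^sub>u\<close> is flat, the Jacobi identity gives the curvature \<open>[\<zeta>, [\<alpha>, \<beta>]] / 4\<close>
  and its parallelism.
\<close>

section \<open>Smooth functions\<close>

text \<open>The definition of a Schwarz function demands, for each parameter, a curve parametrized
  near the whole real axis, which is awkward to produce, whereas \<sigma> \<circ> \<sigma> = id is
  an identity that can be checked. The chart bridges the two: replacing z by \<sigma> z in the
  average exchanges its two terms up to conjugation, precisely because \<sigma> is an involution. So
  the chart turns \<sigma> into complex conjugation, and inverting this coordinate, with domains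
  made uniform by compactness of \<open>K\<close>, gives the parametrization. A second obstacle:
  functions and fields on the space of curves are known to be smooth only along two-parameter
  families, and their values are not assumed to depend on germs alone. Every comparison therefore
  needs an actual family that contains both objects, be they curves with equal velocity or curves
  with equal germs. For the canonical connection this means that a second-order operator on
  arbitrary functions can be identified only by comparing second derivatives along pairs of curves
  with the same velocity; the difference is then a derivation by a tangent vector that is visible
  pointwise.\<close>

lemma frechet_derivative_cong_open:
  assumes "open A" "x \<in> A" "\<And>y. y \<in> A \<Longrightarrow> f y = g y"
  shows "frechet_derivative f (at x) = frechet_derivative g (at x)"
proof -
  have "(f has_derivative D) (at x) \<longleftrightarrow> (g has_derivative D) (at x)" for D
    using has_derivative_transform_within_open[OF _ assms(1,2), of f _ UNIV g]
      has_derivative_transform_within_open[OF _ assms(1,2), of g _ UNIV f] assms(3) by auto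
  then show ?thesis unfolding frechet_derivative_def by simp
qed

lemma differentiable_cong_open:
  assumes "open A" "x \<in> A" "\<And>y. y \<in> A \<Longrightarrow> f y = g y"
  shows "f differentiable (at x) \<longleftrightarrow> g differentiable (at x)"
  using has_derivative_transform_within_open[OF _ assms(1,2), of f _ UNIV g]
      has_derivative_transform_within_open[OF _ assms(1,2), of g _ UNIV f] assms(3)
  unfolding differentiable_def by auto

lemma has_derivative_frechetI: "f differentiable (at x) \<Longrightarrow> (f has_derivative frechet_derivative f (at x)) (at x)"
  using frechet_derivative_works by blast

lemma Ck_on_cong:
  "open A \<Longrightarrow> (\<And>x. x \<in> A \<Longrightarrow> f x = g x) \<Longrightarrow> Ck_on k A f \<longleftrightarrow> Ck_on k A g"
proof (induction k arbitrary: f g)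
  case 0
  then show ?case by (auto cong: continuous_on_cong)
next
  case (Suc k)
  have "Ck_on k A (\<lambda>x. frechet_derivative f (at x) v) \<longleftrightarrow> Ck_on k A (\<lambda>x. frechet_derivative g (at x) v)" for v
    by (rule Suc.IH) (simp_all add: Suc.prems(1) frechet_derivative_cong_open[OF Suc.prems(1) _ Suc.prems(2)])
  then show ?case using differentiable_cong_open[OF Suc.prems(1) _ Suc.prems(2)] by simp
qed

text \<open>\<open>Ck_on (Suc k)\<close> has no continuity clause; continuity is recovered from
  differentiability, which makes the classes nested.\<close>

lemma Ck_on_Suc_imp: "Ck_on (Suc k) A f \<Longrightarrow> Ck_on k A f"
proof (induction k arbitrary: f)
  case 0
  then show ?case by (auto intro!: continuous_at_imp_continuous_on differentiable_imp_continuous_within)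
next
  case (Suc k)
  then show ?case by (metis Ck_on.simps(2))
qed

lemma Ck_on_subset: "Ck_on k A f \<Longrightarrow> B \<subseteq> A \<Longrightarrow> Ck_on k B f"
  by (induction k arbitrary: f) (auto intro: continuous_on_subset)

text \<open>The inductive step of the closure lemmas: it is enough to exhibit a formula
  \<open>D v x\<close> for the derivative in a fixed direction, built from ingredients of the lower
  class.\<close>

lemma Ck_on_SucI:
  assumes "open A" "\<And>x. x \<in> A \<Longrightarrow> (f has_derivative (\<lambda>v. D v x)) (at x)" "\<And>v. Ck_on k A (D v)"
  shows "Ck_on (Suc k) A f"
proof -
  have "frechet_derivative f (at x) v = D v x" if "x \<in> A" for x v
    using assms(2)[OF that] by (metis frechet_derivative_at)
  then show ?thesis using assms Ck_on_cong[OF assms(1), of "\<lambda>x. frechet_derivative f (at x) v" "D v" k for v]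
    by (auto simp: differentiable_def)
qed

lemma Ck_on_has_derivative:
  "Ck_on (Suc k) A f \<Longrightarrow> x \<in> A \<Longrightarrow> (f has_derivative frechet_derivative f (at x)) (at x)"
  by (simp add: has_derivative_frechetI)

lemma Ck_on_const: "Ck_on k A (\<lambda>x. c)"
  by (induction k arbitrary: c) auto

lemma Ck_on_add:
  "open A \<Longrightarrow> Ck_on k A f \<Longrightarrow> Ck_on k A g \<Longrightarrow> Ck_on k A (\<lambda>x. f x + g x)"
proof (induction k arbitrary: f g)
  case 0
  then show ?case by (auto intro: continuous_intros)
next
  case (Suc k)
  show ?case
    by (rule Ck_on_SucI[OF Suc.prems(1)
          has_derivative_add[OF Ck_on_has_derivative[OF Suc.prems(2)] Ck_on_has_derivative[OF Suc.prems(3)]]])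
       (use Suc in auto)
qed

lemma Ck_on_bounded_linear:
  "open A \<Longrightarrow> bounded_linear L \<Longrightarrow> Ck_on k A f \<Longrightarrow> Ck_on k A (\<lambda>x. L (f x))"
proof (induction k arbitrary: f)
  case 0
  then show ?case by (auto intro: bounded_linear.continuous_on)
next
  case (Suc k)
  show ?case
    by (rule Ck_on_SucI[OF Suc.prems(1)
          bounded_linear.has_derivative[OF Suc.prems(2) Ck_on_has_derivative[OF Suc.prems(3)]]])
       (use Suc in auto)
qed

lemma Ck_on_linear: "bounded_linear L \<Longrightarrow> Ck_on k A L"
proof (induction k)
  case 0
  then show ?case by (auto intro: bounded_linear.continuous_on continuous_on_id)
next
  case (Suc k)
  have "(L has_derivative L) (at x)" for x by (rule bounded_linear_imp_has_derivative[OF Suc.prems])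
  then have "frechet_derivative L (at x) = L" for x by (metis frechet_derivative_at)
  then show ?case using Ck_on_const bounded_linear_imp_differentiable[OF Suc.prems] by auto
qed

lemma Ck_on_bilinear:
  assumes "bounded_bilinear B"
  shows "open A \<Longrightarrow> Ck_on k A f \<Longrightarrow> Ck_on k A g \<Longrightarrow> Ck_on k A (\<lambda>x. B (f x) (g x))"
proof (induction k arbitrary: f g)
  case 0
  then show ?case using bounded_bilinear.continuous_on[OF assms] by auto
next
  case (Suc k)
  show ?case
  proof (rule Ck_on_SucI[OF Suc.prems(1)])
    fix x assume "x \<in> A"
    show "((\<lambda>x. B (f x) (g x)) has_derivative
        (\<lambda>v. B (f x) (frechet_derivative g (at x) v) + B (frechet_derivative f (at x) v) (g x))) (at x)"
      by (rule bounded_bilinear.FDERIV[OF assms Ck_on_has_derivative[OF Suc.prems(2) \<open>x \<in> A\<close>]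
            Ck_on_has_derivative[OF Suc.prems(3) \<open>x \<in> A\<close>]])
  next
    show "Ck_on k A (\<lambda>x. B (f x) (frechet_derivative g (at x) v) + B (frechet_derivative f (at x) v) (g x))" for v
      by (rule Ck_on_add[OF Suc.prems(1) Suc.IH[OF Suc.prems(1) Ck_on_Suc_imp[OF Suc.prems(2)]]
            Suc.IH[OF Suc.prems(1) _ Ck_on_Suc_imp[OF Suc.prems(3)]]])
        (use Suc.prems in auto)
  qed
qed

lemma Ck_on_sum:
  "open A \<Longrightarrow> (\<And>i. i \<in> I \<Longrightarrow> Ck_on k A (f i)) \<Longrightarrow> Ck_on k A (\<lambda>x. \<Sum>i\<in>I. f i x)"
  by (induction I rule: infinite_finite_induct) (auto simp: Ck_on_const Ck_on_add)

text \<open>\<open>Ck_on\<close> controls derivatives in fixed directions only. The expansion turns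
  a derivative in a moving direction into a finite sum of products of controlled functions; hence
  the Euclidean spaces below.\<close>

lemma linear_basis_expansion:
  fixes v :: "'a::euclidean_space"
  assumes "linear L" shows "L v = (\<Sum>b\<in>Basis. (v \<bullet> b) *\<^sub>R L b)"
proof -
  have "L (\<Sum>b\<in>Basis. (v \<bullet> b) *\<^sub>R b) = (\<Sum>b\<in>Basis. (v \<bullet> b) *\<^sub>R L b)"
    by (simp add: linear_sum[OF assms] linear_cmul[OF assms])
  then show ?thesis by (simp add: euclidean_representation)
qed

text \<open>In the chain rule the derivative of \<open>g\<close> is taken in a direction that moves
  with \<open>x\<close>. Expanded in a basis it becomes a sum of products, whose factors are covered
  by the hypotheses and the induction.\<close>

lemma Ck_on_compose:
  fixes f :: "'a::real_normed_vector \<Rightarrow> 'b::euclidean_space" and g :: "'b \<Rightarrow> 'c::real_normed_vector"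
  shows "open A \<Longrightarrow> Ck_on k A f \<Longrightarrow> Ck_on k B g \<Longrightarrow> f ` A \<subseteq> B \<Longrightarrow> Ck_on k A (\<lambda>x. g (f x))"
proof (induction k arbitrary: f g)
  case 0
  then show ?case using continuous_on_compose2[of B g A f] by simp
next
  case (Suc k)
  show ?case
  proof (rule Ck_on_SucI[OF Suc.prems(1)])
    fix x assume x: "x \<in> A"
    have g: "(g has_derivative frechet_derivative g (at (f x))) (at (f x))"
      by (rule Ck_on_has_derivative[OF Suc.prems(3)]) (use Suc.prems(4) x in auto)
    have "(\<lambda>v. frechet_derivative g (at (f x)) (frechet_derivative f (at x) v))
        = (\<lambda>v. \<Sum>b\<in>Basis. (frechet_derivative f (at x) v \<bullet> b) *\<^sub>R frechet_derivative g (at (f x)) b)"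
      by (rule ext, rule linear_basis_expansion, rule has_derivative_linear[OF g])
    with has_derivative_compose[OF Ck_on_has_derivative[OF Suc.prems(2) x] g]
    show "((\<lambda>x. g (f x)) has_derivative
        (\<lambda>v. \<Sum>b\<in>Basis. (frechet_derivative f (at x) v \<bullet> b) *\<^sub>R frechet_derivative g (at (f x)) b)) (at x)"
      by (rule back_subst)
  next
    fix v
    show "Ck_on k A (\<lambda>x. \<Sum>b\<in>Basis. (frechet_derivative f (at x) v \<bullet> b) *\<^sub>R frechet_derivative g (at (f x)) b)"
    proof (intro Ck_on_sum Ck_on_bilinear[OF bounded_bilinear_scaleR] Suc.prems)
      show "Ck_on k A (\<lambda>x. frechet_derivative f (at x) v \<bullet> b)" for b
        by (rule Ck_on_bounded_linear[OF Suc.prems(1) bounded_linear_inner_left]) (use Suc.prems(2) in simp)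
      show "Ck_on k A (\<lambda>x. frechet_derivative g (at (f x)) b)" for b
        by (rule Suc.IH[OF Suc.prems(1) Ck_on_Suc_imp[OF Suc.prems(2)] _ Suc.prems(4)])
          (use Suc.prems(3) in simp)
    qed
  qed
qed

lemma Ck_on_inverse:
  fixes f :: "'a::real_normed_vector \<Rightarrow> 'b::real_normed_field"
  shows "open A \<Longrightarrow> Ck_on k A f \<Longrightarrow> (\<And>x. x \<in> A \<Longrightarrow> f x \<noteq> 0) \<Longrightarrow> Ck_on k A (\<lambda>x. inverse (f x))"
proof (induction k arbitrary: f)
  case 0
  then show ?case by (auto intro: continuous_on_inverse)
next
  case (Suc k)
  have inv: "Ck_on k A (\<lambda>x. inverse (f x))"
    by (rule Suc.IH[OF Suc.prems(1) Ck_on_Suc_imp[OF Suc.prems(2)] Suc.prems(3)])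
  show ?case
  proof (rule Ck_on_SucI[OF Suc.prems(1)])
    fix x assume "x \<in> A"
    show "((\<lambda>x. inverse (f x)) has_derivative (\<lambda>v. - (inverse (f x) * frechet_derivative f (at x) v * inverse (f x)))) (at x)"
      by (rule Deriv.has_derivative_inverse[OF Suc.prems(3)[OF \<open>x \<in> A\<close>] Ck_on_has_derivative[OF Suc.prems(2) \<open>x \<in> A\<close>]])
  next
    have "Ck_on k A (\<lambda>x. inverse (f x) * frechet_derivative f (at x) v * inverse (f x))" for v
      by (intro Ck_on_bilinear[OF bounded_bilinear_mult] inv) (use Suc.prems in auto)
    from Ck_on_bounded_linear[OF Suc.prems(1) bounded_linear_minus[OF bounded_linear_ident] this]
    show "Ck_on k A (\<lambda>x. - (inverse (f x) * frechet_derivative f (at x) v * inverse (f x)))" for v .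
  qed
qed

lemma Ck_on_holomorphic:
  "open A \<Longrightarrow> f holomorphic_on A \<Longrightarrow> Ck_on k A f"
proof (induction k arbitrary: f)
  case 0
  then show ?case by (auto intro: holomorphic_on_imp_continuous_on)
next
  case (Suc k)
  show ?case
  proof (rule Ck_on_SucI[OF Suc.prems(1)])
    fix x assume "x \<in> A"
    then have "(f has_field_derivative deriv f x) (at x)" using Suc.prems holomorphic_derivI by blast
    then show "(f has_derivative (\<lambda>v. v * deriv f x)) (at x)"
      by (simp add: has_field_derivative_def mult.commute[of _ "deriv f x"])
  next
    show "Ck_on k A (\<lambda>x. v * deriv f x)" for v
      using Ck_on_bounded_linear[OF Suc.prems(1) bounded_linear_mult_right Suc.IH[OF Suc.prems(1) holomorphic_deriv[OF Suc.prems(2,1)]]] .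
  qed
qed

section \<open>Smoothness at a point\<close>

definition smooth_at :: "('a::real_normed_vector \<Rightarrow> 'b::real_normed_vector) \<Rightarrow> 'a \<Rightarrow> bool" where
  "smooth_at f x \<longleftrightarrow> (\<exists>A. open A \<and> x \<in> A \<and> smooth_on A f)"

lemma smooth_atI: "open A \<Longrightarrow> x \<in> A \<Longrightarrow> (\<And>k. Ck_on k A f) \<Longrightarrow> smooth_at f x"
  unfolding smooth_at_def smooth_on_def by (intro exI[of _ A]) simp

text \<open>The class is defined through derivatives at single points, so regularity near every
  point suffices. This is how pointwise smoothness is reassembled into smoothness on a set, one
  order at a time.\<close>

lemma Ck_on_local:
  assumes "\<And>x. x \<in> A \<Longrightarrow> \<exists>B. open B \<and> x \<in> B \<and> Ck_on k B f"
  shows "Ck_on k A f"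
  using assms
proof (induction k arbitrary: f)
  case 0
  have "isCont f x" if "x \<in> A" for x
    using 0[OF that] continuous_on_eq_continuous_at by auto
  then show ?case by (simp add: continuous_at_imp_continuous_on)
next
  case (Suc k)
  have "Ck_on k A (\<lambda>x. frechet_derivative f (at x) v)" for v
  proof (rule Suc.IH)
    fix x assume "x \<in> A"
    then show "\<exists>B. open B \<and> x \<in> B \<and> Ck_on k B (\<lambda>x. frechet_derivative f (at x) v)"
      using Suc.prems[of x] by auto
  qed
  moreover have "f differentiable (at x)" if "x \<in> A" for x
    using Suc.prems[OF that] by auto
  ultimately show ?case by simp
qed

lemma smooth_on_iff_smooth_at:
  assumes "open A" shows "smooth_on A f \<longleftrightarrow> (\<forall>x\<in>A. smooth_at f x)"
proof
  show "\<forall>x\<in>A. smooth_at f x" if "smooth_on A f"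
    using that assms smooth_at_def by blast
  assume r: "\<forall>x\<in>A. smooth_at f x"
  show "smooth_on A f"
    unfolding smooth_on_def
  proof (intro allI Ck_on_local)
    fix k x assume "x \<in> A"
    then have "smooth_at f x" using r by simp
    then obtain B where "open B" "x \<in> B" "smooth_on B f" unfolding smooth_at_def by (elim exE conjE)
    then show "\<exists>B. open B \<and> x \<in> B \<and> Ck_on k B f" unfolding smooth_on_def by (intro exI[of _ B]) simp
  qed
qed

lemma smooth_at_eventually: "smooth_at f x \<Longrightarrow> \<forall>\<^sub>F y in nhds x. smooth_at f y"
  unfolding smooth_at_def eventually_nhds by blast

lemma smooth_near0_iff: "smooth_near0 f \<longleftrightarrow> smooth_at f 0"
  unfolding smooth_near0_def smooth_at_def ..

lemma smooth_at_cong: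
  assumes "\<forall>\<^sub>F y in nhds x. f y = g y"
  shows "smooth_at f x \<longleftrightarrow> smooth_at g x"
proof -
  have "smooth_at g x" if ev: "\<forall>\<^sub>F y in nhds x. f y = g y" and sm: "smooth_at f x" for f g :: "'a \<Rightarrow> 'b"
  proof -
    obtain A where A: "open A" "x \<in> A" "\<And>k. Ck_on k A f"
      using sm unfolding smooth_at_def smooth_on_def by blast
    obtain B where B: "open B" "x \<in> B" "\<And>y. y \<in> B \<Longrightarrow> f y = g y"
      using ev unfolding eventually_nhds by blast
    have AB: "open (A \<inter> B)" using A B by blast
    show ?thesis
    proof (rule smooth_atI[OF AB])
      show "Ck_on k (A \<inter> B) g" for k
        using Ck_on_cong[OF AB, of f g k] B(3) Ck_on_subset[OF A(3), of "A \<inter> B" k] by simp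
    qed (use A B in simp)
  qed
  moreover have "\<forall>\<^sub>F y in nhds x. g y = f y" using assms by eventually_elim simp
  ultimately show ?thesis using assms by blast
qed

lemma smooth_at_differentiable: "smooth_at f x \<Longrightarrow> f differentiable (at x)"
  unfolding smooth_at_def smooth_on_def by (metis Ck_on.simps(2))

lemma smooth_at_has_derivative: "smooth_at f x \<Longrightarrow> (f has_derivative frechet_derivative f (at x)) (at x)"
  by (simp add: smooth_at_differentiable has_derivative_frechetI)

lemma smooth_at_continuous: "smooth_at f x \<Longrightarrow> isCont f x"
  by (simp add: differentiable_imp_continuous_within smooth_at_differentiable)

lemma smooth_at_frechet: "smooth_at f x \<Longrightarrow> smooth_at (\<lambda>y. frechet_derivative f (at y) v) x"
  unfolding smooth_at_def smooth_on_def by (metis Ck_on.simps(2))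

lemma smooth_at_const [simp]: "smooth_at (\<lambda>x. c) x"
  unfolding smooth_at_def smooth_on_def using Ck_on_const open_UNIV by blast

lemma smooth_at_linear: "bounded_linear L \<Longrightarrow> smooth_at L x"
  unfolding smooth_at_def smooth_on_def using Ck_on_linear open_UNIV by blast

lemma smooth_at_ident [simp]: "smooth_at (\<lambda>x. x) x"
  by (rule smooth_at_linear[OF bounded_linear_ident])

lemma smooth_at_lift2:
  assumes "\<And>A k. open A \<Longrightarrow> Ck_on k A f \<Longrightarrow> Ck_on k A g \<Longrightarrow> Ck_on k A h"
    and "smooth_at f x" "smooth_at g x"
  shows "smooth_at h x"
proof -
  obtain A B where "open A" "x \<in> A" "\<forall>k. Ck_on k A f" "open B" "x \<in> B" "\<forall>k. Ck_on k B g"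
    using assms unfolding smooth_at_def smooth_on_def by blast
  then have "open (A \<inter> B)" "x \<in> A \<inter> B" "\<forall>k. Ck_on k (A \<inter> B) h"
    using Ck_on_subset[of _ A f "A \<inter> B"] Ck_on_subset[of _ B g "A \<inter> B"]
      assms(1)[of "A \<inter> B", OF open_Int] by auto
  then show ?thesis by (intro smooth_atI[of "A \<inter> B"]) auto
qed

lemma smooth_at_add: "smooth_at f x \<Longrightarrow> smooth_at g x \<Longrightarrow> smooth_at (\<lambda>x. f x + g x) x"
  by (rule smooth_at_lift2[OF Ck_on_add])

lemma smooth_at_bilinear:
  "bounded_bilinear B \<Longrightarrow> smooth_at f x \<Longrightarrow> smooth_at g x \<Longrightarrow> smooth_at (\<lambda>x. B (f x) (g x)) x"
  by (rule smooth_at_lift2[OF Ck_on_bilinear])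

lemmas smooth_at_scaleR = smooth_at_bilinear[OF bounded_bilinear_scaleR]

lemmas smooth_at_mult = smooth_at_bilinear[OF bounded_bilinear_mult]

lemma smooth_at_bounded_linear: "bounded_linear L \<Longrightarrow> smooth_at f x \<Longrightarrow> smooth_at (\<lambda>x. L (f x)) x"
  by (rule smooth_at_lift2[OF Ck_on_bounded_linear, where g=f and f=f]) auto

lemmas smooth_at_minus = smooth_at_bounded_linear[OF bounded_linear_minus[OF bounded_linear_ident]]

lemma smooth_at_diff: "smooth_at f x \<Longrightarrow> smooth_at g x \<Longrightarrow> smooth_at (\<lambda>x. f x - g x) x"
  using smooth_at_add[OF _ smooth_at_minus[of g]] by force

lemma smooth_at_sum:
  "(\<And>i. i \<in> I \<Longrightarrow> smooth_at (f i) x) \<Longrightarrow> smooth_at (\<lambda>x. \<Sum>i\<in>I. f i x) x"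
  by (induction I rule: infinite_finite_induct) (auto intro: smooth_at_add)

lemma smooth_at_Pair:
  assumes "smooth_at f x" "smooth_at g x" shows "smooth_at (\<lambda>x. (f x, g x)) x"
proof -
  have "bounded_linear (\<lambda>a::'b. (a, 0::'c))" "bounded_linear (\<lambda>b::'c. (0::'b, b))"
    by (auto intro!: bounded_linear_intros)
  from smooth_at_add[OF smooth_at_bounded_linear[OF this(1) assms(1)] smooth_at_bounded_linear[OF this(2) assms(2)]]
  show ?thesis by simp
qed

lemma smooth_at_compose:
  fixes f :: "'a::real_normed_vector \<Rightarrow> 'b::euclidean_space"
  assumes "smooth_at f x" "smooth_at g (f x)"
  shows "smooth_at (\<lambda>x. g (f x)) x"
proof -
  obtain A B where A: "open A" "x \<in> A" "\<forall>k. Ck_on k A f" and B: "open B" "f x \<in> B" "\<forall>k. Ck_on k B g"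
    using assms unfolding smooth_at_def smooth_on_def by blast
  have "continuous_on A f" using A(3) Ck_on.simps(1) by blast
  then have "open (A \<inter> f -` B)" using A(1) B(1) by (rule continuous_open_preimage)
  moreover have "Ck_on k (A \<inter> f -` B) (\<lambda>x. g (f x))" for k
    by (rule Ck_on_compose[OF calculation _ B(3)[rule_format]])
      (use A Ck_on_subset[of k A f "A \<inter> f -` B"] in auto)
  moreover have "x \<in> A \<inter> f -` B" using A B by simp
  ultimately show ?thesis by (intro smooth_atI[of "A \<inter> f -` B"]) auto
qed

lemma smooth_at_inverse:
  fixes f :: "'a::real_normed_vector \<Rightarrow> 'b::real_normed_field"
  assumes "smooth_at f x" "f x \<noteq> 0"
  shows "smooth_at (\<lambda>x. inverse (f x)) x"
proof -
  obtain A where A: "open A" "x \<in> A" "\<forall>k. Ck_on k A f"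
    using assms unfolding smooth_at_def smooth_on_def by blast
  have "continuous_on A f" using A(3) Ck_on.simps(1) by blast
  then have o: "open (A \<inter> f -` (- {0}))" using A(1) by (rule continuous_open_preimage) auto
  moreover have "Ck_on k (A \<inter> f -` (-{0})) (\<lambda>x. inverse (f x))" for k
    by (rule Ck_on_inverse[OF o]) (use A Ck_on_subset[of k A f] in auto)
  moreover have "x \<in> A \<inter> f -` (- {0})" using A assms(2) by simp
  ultimately show ?thesis by (intro smooth_atI[of "A \<inter> f -` (- {0})"]) auto
qed

lemma smooth_at_analytic: "f analytic_on {z} \<Longrightarrow> smooth_at f z"
  unfolding analytic_at smooth_at_def smooth_on_def using Ck_on_holomorphic by blast

lemma smooth_at_fst [simp]: "smooth_at fst x" and smooth_at_snd [simp]: "smooth_at snd x"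
  by (auto intro: smooth_at_linear bounded_linear_fst bounded_linear_snd)

lemma smooth_at_frechet_dir:
  fixes f :: "'a::euclidean_space \<Rightarrow> 'b::real_normed_vector"
  assumes "smooth_at f x" "smooth_at w x"
  shows "smooth_at (\<lambda>y. frechet_derivative f (at y) (w y)) x"
proof -
  have "\<forall>\<^sub>F y in nhds x. (\<Sum>b\<in>Basis. (w y \<bullet> b) *\<^sub>R frechet_derivative f (at y) b) = frechet_derivative f (at y) (w y)"
    using smooth_at_eventually[OF assms(1)]
  proof eventually_elim
    case (elim y)
    show ?case
      by (rule linear_basis_expansion[OF has_derivative_linear[OF smooth_at_has_derivative[OF elim]], symmetric])
  qed
  moreover have "smooth_at (\<lambda>y. \<Sum>b\<in>Basis. (w y \<bullet> b) *\<^sub>R frechet_derivative f (at y) b) x"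
    by (intro smooth_at_sum smooth_at_scaleR smooth_at_frechet assms
        smooth_at_bounded_linear[OF bounded_linear_inner_left])
  ultimately show ?thesis by (rule smooth_at_cong[THEN iffD1])
qed

text \<open>Product rule for a derivative in a moving direction: the second-order part is the one
  for the direction frozen at \<open>x\<close>, and the first-order remainder records the motion of
  \<open>w\<close>. Such remainders later combine to the bracket of parameter fields.\<close>

lemma frechet_derivative_frechet_dir:
  fixes f :: "'a::euclidean_space \<Rightarrow> 'b::real_normed_vector"
  assumes f: "smooth_at f x" and w: "smooth_at w x"
  shows "frechet_derivative (\<lambda>y. frechet_derivative f (at y) (w y)) (at x) h
    = frechet_derivative (\<lambda>y. frechet_derivative f (at y) (w x)) (at x) h
      + frechet_derivative f (at x) (frechet_derivative w (at x) h)"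
proof -
  have lin: "linear (frechet_derivative f (at y))" if "smooth_at f y" for y
    by (rule has_derivative_linear[OF smooth_at_has_derivative[OF that]])
  obtain A where A: "open A" "x \<in> A" "\<And>y. y \<in> A \<Longrightarrow> smooth_at f y"
    using smooth_at_eventually[OF f] unfolding eventually_nhds by blast
  let ?G = "\<lambda>b. frechet_derivative (\<lambda>y. frechet_derivative f (at y) b) (at x)"
  have G: "((\<lambda>y. frechet_derivative f (at y) b) has_derivative ?G b) (at x)" for b
    by (rule smooth_at_has_derivative[OF smooth_at_frechet[OF f]])
  have w': "((\<lambda>y. w y \<bullet> b) has_derivative (\<lambda>h. frechet_derivative w (at x) h \<bullet> b)) (at x)" for b
    by (rule bounded_linear.has_derivative[OF bounded_linear_inner_left smooth_at_has_derivative[OF w]])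
  have key: "((\<lambda>y. \<Sum>b\<in>Basis. (v y \<bullet> b) *\<^sub>R frechet_derivative f (at y) b) has_derivative
      (\<lambda>h. \<Sum>b\<in>Basis. (v x \<bullet> b) *\<^sub>R ?G b h + (frechet_derivative v (at x) h \<bullet> b) *\<^sub>R frechet_derivative f (at x) b)) (at x)"
    if "smooth_at v x" for v
    by (intro has_derivative_sum has_derivative_scaleR G
        bounded_linear.has_derivative[OF bounded_linear_inner_left smooth_at_has_derivative[OF that]])
  \<comment> \<open>Proved for a general \<open>v\<close> because it is applied twice: to
    \<open>w\<close>, and to the constant direction \<open>w x\<close>, for which the last term
    vanishes.\<close>
  have eq: "frechet_derivative (\<lambda>y. frechet_derivative f (at y) (v y)) (at x) h =
      (\<Sum>b\<in>Basis. (v x \<bullet> b) *\<^sub>R ?G b h) + frechet_derivative f (at x) (frechet_derivative v (at x) h)"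
    if "smooth_at v x" for v
  proof -
    have "frechet_derivative (\<lambda>y. frechet_derivative f (at y) (v y)) (at x)
        = frechet_derivative (\<lambda>y. \<Sum>b\<in>Basis. (v y \<bullet> b) *\<^sub>R frechet_derivative f (at y) b) (at x)"
      by (rule frechet_derivative_cong_open[OF A(1,2)]) (rule linear_basis_expansion[OF lin[OF A(3)]])
    also have "\<dots> = (\<lambda>h. \<Sum>b\<in>Basis. (v x \<bullet> b) *\<^sub>R ?G b h + (frechet_derivative v (at x) h \<bullet> b) *\<^sub>R frechet_derivative f (at x) b)"
      using frechet_derivative_at[OF key[OF that]] by simp
    finally have "frechet_derivative (\<lambda>y. frechet_derivative f (at y) (v y)) (at x) h =
      (\<Sum>b\<in>Basis. (v x \<bullet> b) *\<^sub>R ?G b h)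
        + (\<Sum>b\<in>Basis. (frechet_derivative v (at x) h \<bullet> b) *\<^sub>R frechet_derivative f (at x) b)"
      by (simp only: sum.distrib)
    then show ?thesis
      by (simp only: linear_basis_expansion[OF lin[OF f], of "frechet_derivative v (at x) h", symmetric])
  qed
  have "frechet_derivative (\<lambda>y. frechet_derivative f (at y) (w x)) (at x) h = (\<Sum>b\<in>Basis. (w x \<bullet> b) *\<^sub>R ?G b h)"
    by (simp only: eq[of "\<lambda>_. w x", OF smooth_at_const] frechet_derivative_const linear_0[OF lin[OF f]] add_0_right)
  from trans[OF eq[OF w] arg_cong2[where f="(+)", OF this[symmetric] refl]] show ?thesis .
qed

section \<open>Symmetry of second derivatives\<close>

lemma line_has_vector_derivative:
  assumes "(f has_derivative D) (at y)" "(p has_vector_derivative u) (at s)" "p s = y"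
  shows "((\<lambda>t. f (p t)) has_vector_derivative D u) (at s)"
proof -
  have "((\<lambda>t. f (p t)) has_derivative (\<lambda>h. D (h *\<^sub>R u))) (at s)"
    by (rule has_derivative_compose[OF assms(2)[unfolded has_vector_derivative_def]]) (use assms(1,3) in simp)
  then show ?thesis
    unfolding has_vector_derivative_def
    by (simp add: linear_cmul[OF has_derivative_linear[OF assms(1)]])
qed

lemma eventually_nhds_compose:
  fixes g :: "'a::t2_space \<Rightarrow> 'b::t2_space"
  assumes "isCont g x" "\<forall>\<^sub>F y in nhds (g x). P y" shows "\<forall>\<^sub>F y in nhds x. P (g y)"
proof -
  have "(g \<longlongrightarrow> g x) (nhds x)" using assms(1) by (simp add: isCont_def tendsto_nhds_iff)
  then show ?thesis using assms(2) by (rule eventually_compose_filterlim[rotated])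
qed

text \<open>The mean value theorem twice: in the direction \<open>u\<close> for the increment of
  \<open>f\<close> in \<open>v\<close>, then in the direction \<open>v\<close> for the derivative.
  The left side is symmetric in \<open>u\<close> and \<open>v\<close>, while the right side samples
  one of the two mixed derivatives.\<close>

lemma second_difference:
  fixes f :: "'a::real_normed_vector \<Rightarrow> real"
  assumes h: "0 < h" and sm: "\<And>s t. 0 \<le> s \<Longrightarrow> s \<le> h \<Longrightarrow> 0 \<le> t \<Longrightarrow> t \<le> h \<Longrightarrow> smooth_at f (x + s *\<^sub>R u + t *\<^sub>R v)"
  shows "\<exists>s t. 0 < s \<and> s < h \<and> 0 < t \<and> t < h \<and>
    f (x + h *\<^sub>R u + h *\<^sub>R v) - f (x + h *\<^sub>R u) - f (x + h *\<^sub>R v) + f x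
      = h * (h * frechet_derivative (\<lambda>y. frechet_derivative f (at y) u) (at (x + s *\<^sub>R u + t *\<^sub>R v)) v)"
proof -
  have du: "((\<lambda>s. f (x + s *\<^sub>R u + t *\<^sub>R v)) has_real_derivative frechet_derivative f (at (x + s *\<^sub>R u + t *\<^sub>R v)) u) (at s)"
    if "0 \<le> s" "s \<le> h" "0 \<le> t" "t \<le> h" for s t
    unfolding has_real_derivative_iff_has_vector_derivative
    by (rule line_has_vector_derivative[OF smooth_at_has_derivative[OF sm[OF that]]])
      (auto intro!: derivative_eq_intros)
  have "\<exists>s>0. s < h \<and> (f (x + h *\<^sub>R u + h *\<^sub>R v) - f (x + h *\<^sub>R u + 0 *\<^sub>R v)) - (f (x + 0 *\<^sub>R u + h *\<^sub>R v) - f (x + 0 *\<^sub>R u + 0 *\<^sub>R v))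
      = (h - 0) * (frechet_derivative f (at (x + s *\<^sub>R u + h *\<^sub>R v)) u - frechet_derivative f (at (x + s *\<^sub>R u + 0 *\<^sub>R v)) u)"
    by (rule MVT2[OF h]) (use du[of _ h] du[of _ 0] h in \<open>intro DERIV_diff; simp\<close>)
  then obtain s where s: "0 < s" "s < h" and 1: "f (x + h *\<^sub>R u + h *\<^sub>R v) - f (x + h *\<^sub>R u) - f (x + h *\<^sub>R v) + f x
      = h * (frechet_derivative f (at (x + s *\<^sub>R u + h *\<^sub>R v)) u - frechet_derivative f (at (x + s *\<^sub>R u + 0 *\<^sub>R v)) u)"
    by (auto simp: algebra_simps)
  have "((\<lambda>t. frechet_derivative f (at (x + s *\<^sub>R u + t *\<^sub>R v)) u) has_real_derivative
      frechet_derivative (\<lambda>y. frechet_derivative f (at y) u) (at (x + s *\<^sub>R u + t *\<^sub>R v)) v) (at t)"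
    if "0 \<le> t" "t \<le> h" for t
    unfolding has_real_derivative_iff_has_vector_derivative
    by (rule line_has_vector_derivative[OF smooth_at_has_derivative[OF smooth_at_frechet[OF sm]]])
      (use that s in \<open>auto intro!: derivative_eq_intros\<close>)
  then have "\<exists>t>0. t < h \<and>
      frechet_derivative f (at (x + s *\<^sub>R u + h *\<^sub>R v)) u - frechet_derivative f (at (x + s *\<^sub>R u + 0 *\<^sub>R v)) u
      = (h - 0) * frechet_derivative (\<lambda>y. frechet_derivative f (at y) u) (at (x + s *\<^sub>R u + t *\<^sub>R v)) v"
    by (intro MVT2[OF h]) auto
  then obtain t where "0 < t" "t < h"
      "frechet_derivative f (at (x + s *\<^sub>R u + h *\<^sub>R v)) u - frechet_derivative f (at (x + s *\<^sub>R u + 0 *\<^sub>R v)) u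
      = (h - 0) * frechet_derivative (\<lambda>y. frechet_derivative f (at y) u) (at (x + s *\<^sub>R u + t *\<^sub>R v)) v"
    by (elim exE conjE)
  with 1 s show ?thesis by (intro exI[of _ s] exI[of _ t]) simp
qed


text \<open>If the two mixed derivatives differed at \<open>x\<close>, continuity would keep them
  apart nearby; but the second difference over a small parallelogram equals a sampled value of
  either of them.\<close>

lemma frechet_derivative_commute_real:
  fixes f :: "'a::real_normed_vector \<Rightarrow> real"
  assumes "smooth_at f x"
  shows "frechet_derivative (\<lambda>y. frechet_derivative f (at y) u) (at x) v
    = frechet_derivative (\<lambda>y. frechet_derivative f (at y) v) (at x) u" (is "?A x = ?B x")
proof (rule ccontr)
  assume ne: "?A x \<noteq> ?B x"
  define e where "e = \<bar>?A x - ?B x\<bar> / 2"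
  have "e > 0" using ne by (simp add: e_def)
  have c: "isCont (\<lambda>y. frechet_derivative (\<lambda>y. frechet_derivative f (at y) u) (at y) v) x" for u v
    by (intro smooth_at_continuous smooth_at_frechet assms)
  have ev: "\<forall>\<^sub>F w in nhds a. dist w a < e" for a :: real
    unfolding eventually_nhds_metric using \<open>e > 0\<close> by blast
  have "\<forall>\<^sub>F y in nhds x. dist (?A y) (?A x) < e" "\<forall>\<^sub>F y in nhds x. dist (?B y) (?B x) < e"
    by (rule eventually_nhds_compose[OF c ev])+
  then have "\<forall>\<^sub>F y in nhds x. smooth_at f y \<and> dist (?A y) (?A x) < e \<and> dist (?B y) (?B x) < e"
    using smooth_at_eventually[OF assms] by eventually_elim simp
  then obtain d where d: "d > 0" "\<And>y. dist y x < d \<Longrightarrow> smooth_at f y \<and> dist (?A y) (?A x) < e \<and> dist (?B y) (?B x) < e"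
    unfolding eventually_nhds_metric by (elim exE conjE) blast
  \<comment> \<open>Chosen so that \<open>h * (norm u + norm v + 1) = d / 2\<close>, which keeps the
    whole parallelogram within distance \<open>d\<close>; the summand 1 avoids a zero denominator
    when both directions vanish.\<close>
  define h where "h = d / (2 * (norm u + norm v + 1))"
  have npos: "norm u + norm v + 1 > 0" by (simp add: add_nonneg_pos)
  have h: "h > 0" unfolding h_def using d(1) npos by simp
  have near: "dist (x + s *\<^sub>R u + t *\<^sub>R v) x < d" "dist (x + s *\<^sub>R v + t *\<^sub>R u) x < d"
    if "0 \<le> s" "s \<le> h" "0 \<le> t" "t \<le> h" for s t
  proof -
    have hd: "h * (norm u + norm v + 1) = d / 2"
      using npos nonzero_divide_eq_eq[of "norm u + norm v + 1" "d / 2" h] unfolding h_def by simp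
    have "norm (s *\<^sub>R u + t *\<^sub>R v) \<le> s * norm u + t * norm v" "norm (s *\<^sub>R v + t *\<^sub>R u) \<le> s * norm v + t * norm u"
      using norm_triangle_ineq[of "s *\<^sub>R u" "t *\<^sub>R v"] norm_triangle_ineq[of "s *\<^sub>R v" "t *\<^sub>R u"] that by simp_all
    moreover have "s * norm u + t * norm v \<le> h * norm u + h * norm v" "s * norm v + t * norm u \<le> h * norm v + h * norm u"
      using that by (intro add_mono mult_right_mono; simp)+
    moreover have "h * norm u + h * norm v < d"
      using hd h d(1) by (simp add: algebra_simps)
    moreover have "norm (x + s *\<^sub>R u + t *\<^sub>R v - x) = norm (s *\<^sub>R u + t *\<^sub>R v)" "norm (x + s *\<^sub>R v + t *\<^sub>R u - x) = norm (s *\<^sub>R v + t *\<^sub>R u)"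
      by (simp_all add: add.assoc)
    ultimately have "norm (x + s *\<^sub>R u + t *\<^sub>R v - x) < d \<and> norm (x + s *\<^sub>R v + t *\<^sub>R u - x) < d"
      by argo
    then show "dist (x + s *\<^sub>R u + t *\<^sub>R v) x < d" "dist (x + s *\<^sub>R v + t *\<^sub>R u) x < d"
      unfolding dist_norm by simp_all
  qed
  obtain s t where st: "0 < s" "s < h" "0 < t" "t < h"
    and 1: "f (x + h *\<^sub>R u + h *\<^sub>R v) - f (x + h *\<^sub>R u) - f (x + h *\<^sub>R v) + f x = h * (h * ?A (x + s *\<^sub>R u + t *\<^sub>R v))"
    using second_difference[OF h, of f x u v] near d(2) by blast
  obtain s' t' where st': "0 < s'" "s' < h" "0 < t'" "t' < h"
    and 2: "f (x + h *\<^sub>R v + h *\<^sub>R u) - f (x + h *\<^sub>R v) - f (x + h *\<^sub>R u) + f x = h * (h * ?B (x + s' *\<^sub>R v + t' *\<^sub>R u))"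
    using second_difference[OF h, of f x v u] near d(2) by blast
  have "x + h *\<^sub>R v + h *\<^sub>R u = x + h *\<^sub>R u + h *\<^sub>R v" by (simp add: ac_simps)
  then have "f (x + h *\<^sub>R v + h *\<^sub>R u) = f (x + h *\<^sub>R u + h *\<^sub>R v)" by (rule arg_cong)
  with 1 2 have "h * (h * ?A (x + s *\<^sub>R u + t *\<^sub>R v)) = h * (h * ?B (x + s' *\<^sub>R v + t' *\<^sub>R u))" by argo
  then have "?A (x + s *\<^sub>R u + t *\<^sub>R v) = ?B (x + s' *\<^sub>R v + t' *\<^sub>R u)" using h by simp
  moreover have "dist (?A (x + s *\<^sub>R u + t *\<^sub>R v)) (?A x) < e" "dist (?B (x + s' *\<^sub>R v + t' *\<^sub>R u)) (?B x) < e"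
    using d(2) near st st' by simp_all
  ultimately show False unfolding dist_real_def e_def by argo
qed

lemma frechet_derivative_commute:
  fixes f :: "'a::real_normed_vector \<Rightarrow> 'b::euclidean_space"
  assumes "smooth_at f x"
  shows "frechet_derivative (\<lambda>y. frechet_derivative f (at y) u) (at x) v
    = frechet_derivative (\<lambda>y. frechet_derivative f (at y) v) (at x) u"
proof (rule euclidean_eqI)
  fix b :: 'b
  have inner: "frechet_derivative (\<lambda>y. g y \<bullet> b) (at y) w = frechet_derivative g (at y) w \<bullet> b"
    if "smooth_at g y" for g :: "'a \<Rightarrow> 'b" and y w
    using frechet_derivative_at[OF bounded_linear.has_derivative[OF bounded_linear_inner_left
          smooth_at_has_derivative[OF that]], of b] by metis
  obtain A where A: "open A" "x \<in> A" "\<And>y. y \<in> A \<Longrightarrow> smooth_at f y"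
    using smooth_at_eventually[OF assms] unfolding eventually_nhds by (elim exE conjE) blast
  have key: "frechet_derivative (\<lambda>y. frechet_derivative f (at y) u) (at x) v \<bullet> b
    = frechet_derivative (\<lambda>y. frechet_derivative (\<lambda>y. f y \<bullet> b) (at y) u) (at x) v" for u v
  proof -
    have "frechet_derivative (\<lambda>y. frechet_derivative (\<lambda>y. f y \<bullet> b) (at y) u) (at x)
      = frechet_derivative (\<lambda>y. frechet_derivative f (at y) u \<bullet> b) (at x)"
      by (rule frechet_derivative_cong_open[OF A(1,2)]) (rule inner[OF A(3)])
    then show ?thesis by (simp only: inner[OF smooth_at_frechet[OF assms]])
  qed
  have "smooth_at (\<lambda>y. f y \<bullet> b) x"
    by (rule smooth_at_bounded_linear[OF bounded_linear_inner_left assms])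
  from frechet_derivative_commute_real[OF this]
  show "frechet_derivative (\<lambda>y. frechet_derivative f (at y) u) (at x) v \<bullet> b
    = frechet_derivative (\<lambda>y. frechet_derivative f (at y) v) (at x) u \<bullet> b"
    by (simp only: key)
qed

section \<open>Slices, analyticity and neighbourhoods in terms of filters\<close>

lemma eventually_slice_snd:
  fixes r :: "'a::metric_space" and z :: "'b::metric_space"
  assumes "\<forall>\<^sub>F x in nhds (r, z). P (fst x) (snd x)" shows "\<forall>\<^sub>F w in nhds z. P r w"
  using eventually_nhds_compose[where g="Pair r" and x=z, OF _ assms] by (simp add: continuous_Pair)

lemma eventually_slice_fst:
  fixes r :: "'a::metric_space" and z :: "'b::metric_space"
  assumes "\<forall>\<^sub>F x in nhds (r, z). P (fst x) (snd x)" shows "\<forall>\<^sub>F s in nhds r. P s z"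
  using eventually_nhds_compose[where g="\<lambda>s. (s, z)" and x=r, OF _ assms] by (simp add: continuous_Pair)

lemma eventually_nhds_open: "(\<forall>\<^sub>F y in nhds x. P y) \<Longrightarrow> (\<forall>\<^sub>F x in nhds x. \<forall>\<^sub>F y in nhds x. P y)"
  by (simp add: eventually_eventually)

text \<open>Puts analyticity at a point into filter form, so that it combines with other eventual
  statements.\<close>

lemma analytic_at_iff_eventually:
  "f analytic_on {z} \<longleftrightarrow> (\<forall>\<^sub>F w in nhds z. f field_differentiable (at w))"
proof
  assume "f analytic_on {z}"
  then obtain S where "open S" "z \<in> S" "f holomorphic_on S" unfolding analytic_at by (elim exE conjE)
  then show "\<forall>\<^sub>F w in nhds z. f field_differentiable (at w)"
    unfolding eventually_nhds using holomorphic_on_imp_differentiable_at by (intro exI[of _ S]) simp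
next
  assume "\<forall>\<^sub>F w in nhds z. f field_differentiable (at w)"
  then obtain S where "open S" "z \<in> S" "\<And>w. w \<in> S \<Longrightarrow> f field_differentiable (at w)"
    unfolding eventually_nhds by (elim exE conjE) blast
  then show "f analytic_on {z}"
    unfolding analytic_at holomorphic_on_def by (intro exI[of _ S]) (auto intro: field_differentiable_at_within)
qed

lemma field_differentiable_cong_eventually:
  fixes f :: "'a::real_normed_field \<Rightarrow> 'a"
  assumes "\<forall>\<^sub>F w in nhds z. f w = g w"
  shows "f field_differentiable (at z) \<longleftrightarrow> g field_differentiable (at z)"
  unfolding field_differentiable_def using DERIV_cong_ev[OF refl assms refl] by simp

lemma near_iff: "near K Q \<longleftrightarrow> (\<forall>k\<in>K. \<forall>\<^sub>F z in nhds k. Q z)"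
proof
  assume "near K Q"
  then show "\<forall>k\<in>K. \<forall>\<^sub>F z in nhds k. Q z" unfolding near_def eventually_nhds by blast
next
  assume r: "\<forall>k\<in>K. \<forall>\<^sub>F z in nhds k. Q z"
  then have "\<forall>k\<in>K. k \<in> interior {z. Q z}" unfolding eventually_nhds interior_def by fast
  then show "near K Q" unfolding near_def
    by (intro exI[of _ "interior {z. Q z}"]) (use interior_subset in blast)
qed

text \<open>\<open>near0\<close> asks for a product of a parameter neighbourhood with a
  neighbourhood of all of \<open>K\<close>, while the right side is local at each point. Compactness
  provides one radius for all points, as in the tube lemma.\<close>

lemma near0_iff:
  fixes Q :: "'p::real_normed_vector \<Rightarrow> complex \<Rightarrow> bool"
  assumes "compact K"
  shows "near0 K Q \<longleftrightarrow> (\<forall>k\<in>K. \<forall>\<^sub>F x in nhds (0, k). Q (fst x) (snd x))"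
proof
  assume "near0 K Q"
  then obtain N U where NU: "open N" "0 \<in> N" "open U" "K \<subseteq> U" "\<forall>r\<in>N. \<forall>z\<in>U. Q r z"
    unfolding near0_def by (elim exE conjE)
  show "\<forall>k\<in>K. \<forall>\<^sub>F x in nhds (0, k). Q (fst x) (snd x)"
  proof
    fix k assume "k \<in> K"
    then show "\<forall>\<^sub>F x in nhds (0, k). Q (fst x) (snd x)"
      unfolding eventually_nhds by (intro exI[of _ "N \<times> U"]) (use NU open_Times in auto)
  qed
next
  assume r: "\<forall>k\<in>K. \<forall>\<^sub>F x in nhds (0, k). Q (fst x) (snd x)"
  let ?M = "interior {x. Q (fst x) (snd x)}"
  have "{0::'p} \<times> K \<subseteq> ?M"
  proof (rule subsetI)
    fix x assume "x \<in> {0::'p} \<times> K"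
    with r obtain S where "open S" "x \<in> S" "\<forall>y\<in>S. Q (fst y) (snd y)" unfolding eventually_nhds by auto
    then show "x \<in> ?M" by (intro interiorI[of S]) auto
  qed
  moreover have "compact ({0::'p} \<times> K)" using assms by (intro compact_Times) auto
  ultimately obtain e where e: "e > 0" "(\<Union>x\<in>{0} \<times> K. ball x e) \<subseteq> ?M"
    using compact_subset_open_imp_ball_epsilon_subset[OF _ open_interior] by metis
  \<comment> \<open>Half the radius for each factor, because the distance in the product is at most
    the sum of the two distances.\<close>
  have "Q s z" if "s \<in> ball 0 (e/2)" "k \<in> K" "z \<in> ball k (e/2)" for s z k
  proof -
    have "dist (0, k) (s, z) \<le> dist 0 s + dist k z"
      unfolding dist_Pair_Pair by (rule sqrt_sum_squares_le_sum) auto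
    then have "(s, z) \<in> ball (0, k) e" using that by simp
    then have "(s, z) \<in> ?M" using e(2) that(2) by blast
    then show ?thesis using interior_subset by fastforce
  qed
  then show "near0 K Q" unfolding near0_def
    by (intro exI[of _ "ball 0 (e/2)"] exI[of _ "\<Union>k\<in>K. ball k (e/2)"]) (use e(1) in auto)
qed

section \<open>Smooth families of holomorphic functions\<close>

text \<open>Short for holomorphic and smooth: jointly smooth in parameter and point, complex
  differentiable in the point. The second condition is imposed at all nearby points, which makes
  this a property of germs that passes to the derivatives in both variables.\<close>

definition hsm :: "('p::euclidean_space \<Rightarrow> cfun) \<Rightarrow> 'p \<times> complex \<Rightarrow> bool" where
  "hsm Y x \<longleftrightarrow> smooth_at (\<lambda>x. Y (fst x) (snd x)) x \<and>
     (\<forall>\<^sub>F y in nhds x. Y (fst y) field_differentiable (at (snd y)))"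

lemma hsm_eventually: "hsm Y x \<Longrightarrow> \<forall>\<^sub>F y in nhds x. hsm Y y"
  unfolding hsm_def
  by (rule eventually_conj[OF smooth_at_eventually eventually_nhds_open]) simp_all

lemma hsm_smooth: "hsm Y x \<Longrightarrow> smooth_at (\<lambda>x. Y (fst x) (snd x)) x"
  by (simp add: hsm_def)

lemma hsm_continuous: "hsm Y x \<Longrightarrow> isCont (\<lambda>x. Y (fst x) (snd x)) x"
  by (rule smooth_at_continuous[OF hsm_smooth])

lemma hsm_field_differentiable: "hsm Y (r, z) \<Longrightarrow> Y r field_differentiable (at z)"
  unfolding hsm_def using eventually_nhds_x_imp_x by fastforce

lemma hsm_has_deriv: "hsm Y (r, z) \<Longrightarrow> (Y r has_field_derivative deriv (Y r) z) (at z)"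
  by (simp add: hsm_field_differentiable field_differentiable_derivI)

lemma hsm_analytic: "hsm Y (r, z) \<Longrightarrow> Y r analytic_on {z}"
  unfolding hsm_def analytic_at_iff_eventually
  by (rule eventually_slice_snd[where P="\<lambda>r z. Y r field_differentiable (at z)"]) simp

lemma hsm_cong:
  assumes "\<forall>\<^sub>F y in nhds x. Y (fst y) (snd y) = Y' (fst y) (snd y)" "hsm Y x"
  shows "hsm Y' x"
proof -
  have "smooth_at (\<lambda>x. Y' (fst x) (snd x)) x"
    using smooth_at_cong[OF assms(1)] assms(2) hsm_smooth by blast
  moreover have "\<forall>\<^sub>F y in nhds x. Y' (fst y) field_differentiable (at (snd y))"
    using eventually_nhds_open[OF assms(1)] hsm_eventually[OF assms(2)]
  proof eventually_elim
    case (elim y)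
    have "\<forall>\<^sub>F w in nhds (snd y). Y (fst y) w = Y' (fst y) w"
      by (rule eventually_slice_snd) (use elim in simp)
    moreover have "Y (fst y) field_differentiable (at (snd y))"
      by (rule hsm_field_differentiable) (use elim(2) in simp)
    ultimately show ?case by (rule field_differentiable_cong_eventually[THEN iffD1])
  qed
  ultimately show ?thesis unfolding hsm_def by blast
qed

section \<open>Derivatives in the parameter and along curves\<close>

lemma dpar_direction: "dpar u Y r z = dpar (\<lambda>_. u r) Y r z"
  by (simp add: dpar_def)

lemma dpar_eqI:
  "((\<lambda>t. Y (r + t *\<^sub>R u r) z) has_vector_derivative d) (at 0) \<Longrightarrow> dpar u Y r z = d"
  unfolding dpar_def by (rule vector_derivative_at)

lemma dpar_eq_frechet:
  assumes "smooth_at (\<lambda>x. Y (fst x) (snd x)) (r, z)"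
  shows "dpar u Y r z = frechet_derivative (\<lambda>x. Y (fst x) (snd x)) (at (r, z)) (u r, 0)"
proof (rule dpar_eqI)
  have "((\<lambda>t. (r + t *\<^sub>R u r, z)) has_vector_derivative (u r, 0)) (at 0)"
    by (auto intro!: derivative_eq_intros)
  from line_has_vector_derivative[OF smooth_at_has_derivative[OF assms] this]
  show "((\<lambda>t. Y (r + t *\<^sub>R u r) z) has_vector_derivative
     frechet_derivative (\<lambda>x. Y (fst x) (snd x)) (at (r, z)) (u r, 0)) (at 0)"
    by simp
qed

lemma deriv_eq_frechet:
  assumes "hsm Y (r, z)"
  shows "frechet_derivative (\<lambda>x. Y (fst x) (snd x)) (at (r, z)) (0, h) = deriv (Y r) z * h"
proof -
  have "((\<lambda>w. (r, w)) has_derivative (\<lambda>h. (0, h))) (at z)"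
    by (auto intro!: derivative_eq_intros)
  from has_derivative_compose[OF this smooth_at_has_derivative[OF hsm_smooth[OF assms]]]
  have "(Y r has_derivative (\<lambda>h. frechet_derivative (\<lambda>x. Y (fst x) (snd x)) (at (r, z)) (0, h))) (at z)"
    by simp
  moreover have "(Y r has_derivative (\<lambda>h. deriv (Y r) z * h)) (at z)"
    using hsm_has_deriv[OF assms] by (simp add: has_field_derivative_def)
  ultimately show ?thesis by (metis has_derivative_unique)
qed

lemma hsm_has_derivative:
  assumes "hsm Y (r, z)"
  shows "((\<lambda>x. Y (fst x) (snd x)) has_derivative
    (\<lambda>x. dpar (\<lambda>_. fst x) Y r z + deriv (Y r) z * snd x)) (at (r, z))"
proof -
  let ?D = "frechet_derivative (\<lambda>x. Y (fst x) (snd x)) (at (r, z))"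
  have D: "((\<lambda>x. Y (fst x) (snd x)) has_derivative ?D) (at (r, z))"
    by (rule smooth_at_has_derivative[OF hsm_smooth[OF assms]])
  have "?D x = dpar (\<lambda>_. fst x) Y r z + deriv (Y r) z * snd x" for x
  proof -
    have "?D ((fst x, 0) + (0, snd x)) = ?D (fst x, 0) + ?D (0, snd x)"
      by (rule linear_add[OF has_derivative_linear[OF D]])
    then show ?thesis
      by (simp add: deriv_eq_frechet[OF assms] dpar_eq_frechet[OF hsm_smooth[OF assms]])
  qed
  then have "?D = (\<lambda>x. dpar (\<lambda>_. fst x) Y r z + deriv (Y r) z * snd x)" by (rule ext)
  with D show ?thesis by simp
qed

text \<open>Chain rule along a curve that moves the parameter and the point at the same time; it is
  the source of the derivative formulas for reflected points.\<close>

lemma hsm_path: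
  assumes "hsm Y (p s, c s)" "(p has_vector_derivative q) (at s)" "(c has_vector_derivative w) (at s)"
  shows "((\<lambda>t. Y (p t) (c t)) has_vector_derivative dpar (\<lambda>_. q) Y (p s) (c s) + deriv (Y (p s)) (c s) * w) (at s)"
proof -
  have "((\<lambda>t. (p t, c t)) has_vector_derivative (q, w)) (at s)"
    by (rule has_vector_derivative_Pair[OF assms(2,3)])
  from line_has_vector_derivative[OF hsm_has_derivative[OF assms(1)] this] show ?thesis by simp
qed

lemma hsm_dpar_has_vector_derivative:
  assumes "hsm Y (r, z)"
  shows "((\<lambda>t. Y (r + t *\<^sub>R u r) z) has_vector_derivative dpar u Y r z) (at 0)"
proof -
  have "((\<lambda>t. Y (r + t *\<^sub>R u r) z) has_vector_derivative
      dpar (\<lambda>_. u r) Y (r + 0 *\<^sub>R u r) z + deriv (Y (r + 0 *\<^sub>R u r)) z * 0) (at 0)"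
    by (rule hsm_path) (use assms in \<open>auto intro!: derivative_eq_intros\<close>)
  then show ?thesis by (simp add: dpar_direction[of u])
qed

section \<open>Closure properties of smooth holomorphic families\<close>

lemma hsm_const [simp]: "hsm (\<lambda>r z. c) x"
  by (simp add: hsm_def)

lemma hsm_ident [simp]: "hsm (\<lambda>r z. z) x"
  by (simp add: hsm_def)

lemma hsm_param: "smooth_at c (fst x) \<Longrightarrow> hsm (\<lambda>r z. c r) x"
  unfolding hsm_def by (auto intro: smooth_at_compose[OF smooth_at_fst])

lemma hsm_add: "hsm Y x \<Longrightarrow> hsm Z x \<Longrightarrow> hsm (\<lambda>r z. Y r z + Z r z) x"
  unfolding hsm_def by (auto intro: smooth_at_add eventually_elim2 field_differentiable_add)

lemma hsm_diff: "hsm Y x \<Longrightarrow> hsm Z x \<Longrightarrow> hsm (\<lambda>r z. Y r z - Z r z) x"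
  unfolding hsm_def by (auto intro: smooth_at_diff eventually_elim2 field_differentiable_diff)

lemma hsm_mult: "hsm Y x \<Longrightarrow> hsm Z x \<Longrightarrow> hsm (\<lambda>r z. Y r z * Z r z) x"
  unfolding hsm_def by (auto intro: smooth_at_mult eventually_elim2 field_differentiable_mult)

lemma hsm_nonzero: "hsm Y x \<Longrightarrow> Y (fst x) (snd x) \<noteq> 0 \<Longrightarrow> \<forall>\<^sub>F y in nhds x. Y (fst y) (snd y) \<noteq> 0"
  by (rule eventually_nhds_compose[OF hsm_continuous])
    (auto simp: eventually_nhds intro!: exI[of _ "- {0}"])

lemma hsm_inverse:
  assumes "hsm Y x" "Y (fst x) (snd x) \<noteq> 0" shows "hsm (\<lambda>r z. inverse (Y r z)) x"
proof -
  have "\<forall>\<^sub>F y in nhds x. (\<lambda>z. inverse (Y (fst y) z)) field_differentiable at (snd y)"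
    using hsm_nonzero[OF assms] hsm_eventually[OF assms(1)]
  proof eventually_elim
    case (elim y)
    then show ?case using hsm_field_differentiable[of Y "fst y" "snd y"]
      by (intro field_differentiable_inverse) auto
  qed
  then show ?thesis using smooth_at_inverse[OF hsm_smooth[OF assms(1)] assms(2)] by (simp add: hsm_def)
qed

lemma hsm_divide:
  "hsm Y x \<Longrightarrow> hsm Z x \<Longrightarrow> Z (fst x) (snd x) \<noteq> 0 \<Longrightarrow> hsm (\<lambda>r z. Y r z / Z r z) x"
  using hsm_mult[OF _ hsm_inverse] by (simp add: divide_inverse)

lemma hsm_compose:
  fixes Y :: "'q::euclidean_space \<Rightarrow> cfun" and h :: "'p::euclidean_space \<Rightarrow> 'q"
  assumes Y: "hsm Y (h (fst x), f (fst x) (snd x))" and h: "smooth_at h (fst x)" and f: "hsm f x"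
  shows "hsm (\<lambda>r z. Y (h r) (f r z)) x"
proof -
  let ?g = "\<lambda>x. (h (fst x), f (fst x) (snd x))"
  have g: "smooth_at ?g x"
    by (intro smooth_at_Pair smooth_at_compose[OF smooth_at_fst h] hsm_smooth[OF f])
  have "smooth_at (\<lambda>x. Y (fst (?g x)) (snd (?g x))) x"
    by (rule smooth_at_compose[OF g hsm_smooth[OF Y]])
  moreover have "\<forall>\<^sub>F y in nhds x. hsm Y (?g y)"
    by (rule eventually_nhds_compose[OF smooth_at_continuous[OF g] hsm_eventually[OF Y]])
  then have "\<forall>\<^sub>F y in nhds x. (\<lambda>z. Y (h (fst y)) (f (fst y) z)) field_differentiable at (snd y)"
    using hsm_eventually[OF f]
  proof eventually_elim
    case (elim y)
    have "(Y (h (fst y)) \<circ> f (fst y)) field_differentiable at (snd y)"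
      by (rule field_differentiable_compose)
        (use elim hsm_field_differentiable[of f "fst y" "snd y"] hsm_field_differentiable[of Y] in auto)
    then show ?case by (simp add: o_def)
  qed
  ultimately show ?thesis by (simp add: hsm_def)
qed

lemma hsm_analytic_const:
  fixes x :: "'p::euclidean_space \<times> complex"
  assumes "g analytic_on {snd x}" shows "hsm (\<lambda>r. g) x"
proof -
  have "smooth_at (\<lambda>x::'p \<times> complex. g (snd x)) x"
    by (rule smooth_at_compose[OF smooth_at_snd smooth_at_analytic[OF assms]])
  moreover have "\<forall>\<^sub>F y in nhds x. g field_differentiable (at (snd y))"
    using assms unfolding analytic_at_iff_eventually
    by (rule eventually_nhds_compose[rotated]) (intro continuous_intros)
  ultimately show ?thesis unfolding hsm_def by blast
qed

lemma hsm_analytic_compose: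
  assumes "g analytic_on {f (fst x) (snd x)}" "hsm f x" shows "hsm (\<lambda>r z. g (f r z)) x"
  by (rule hsm_compose[where h="\<lambda>r. r"]) (use assms hsm_analytic_const in auto)

text \<open>Two conjugations cancel: cnj \<circ> Y \<circ> cnj is holomorphic, hence so is its
  composite with \<open>f\<close>. Reflected quantities such as
  \<open>cnj (Y r (cnj (T r z)))\<close> enter the class through this rule.\<close>

lemma hsm_cnj_compose:
  fixes Y :: "'q::euclidean_space \<Rightarrow> cfun" and h :: "'p::euclidean_space \<Rightarrow> 'q"
  assumes Y: "hsm Y (h (fst x), cnj (f (fst x) (snd x)))" and h: "smooth_at h (fst x)" and f: "hsm f x"
  shows "hsm (\<lambda>r z. cnj (Y (h r) (cnj (f r z)))) x"
proof -
  let ?g = "\<lambda>x. (h (fst x), cnj (f (fst x) (snd x)))"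
  have g: "smooth_at ?g x"
    by (intro smooth_at_Pair smooth_at_compose[OF smooth_at_fst h]
        smooth_at_bounded_linear[OF bounded_linear_cnj] hsm_smooth[OF f])
  have "smooth_at (\<lambda>x. cnj (Y (fst (?g x)) (snd (?g x)))) x"
    by (rule smooth_at_bounded_linear[OF bounded_linear_cnj smooth_at_compose[OF g hsm_smooth[OF Y]]])
  moreover have "\<forall>\<^sub>F y in nhds x. hsm Y (?g y)"
    by (rule eventually_nhds_compose[OF smooth_at_continuous[OF g] hsm_eventually[OF Y]])
  then have "\<forall>\<^sub>F y in nhds x. (\<lambda>z. cnj (Y (h (fst y)) (cnj (f (fst y) z)))) field_differentiable at (snd y)"
    using hsm_eventually[OF f]
  proof eventually_elim
    case (elim y)
    have "(cnj \<circ> Y (h (fst y)) \<circ> cnj) field_differentiable at (f (fst y) (snd y))"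
      using elim(1) hsm_field_differentiable[of Y "h (fst y)" "cnj (f (fst y) (snd y))"]
      by (simp add: field_differentiable_cnj_cnj)
    moreover have "f (fst y) field_differentiable at (snd y)"
      by (rule hsm_field_differentiable) (use elim(2) in simp)
    ultimately have "((cnj \<circ> Y (h (fst y)) \<circ> cnj) \<circ> f (fst y)) field_differentiable at (snd y)"
      by (intro field_differentiable_compose[of "f (fst y)"])
    then show ?case by (simp add: o_def)
  qed
  ultimately show ?thesis by (simp add: hsm_def)
qed

lemma hsm_deriv:
  assumes "hsm Y x" shows "hsm (\<lambda>r. deriv (Y r)) x"
proof -
  let ?F = "\<lambda>x. Y (fst x) (snd x)"
  have "\<forall>\<^sub>F y in nhds x. frechet_derivative ?F (at y) (0, 1) = deriv (Y (fst y)) (snd y)"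
    using hsm_eventually[OF assms]
  proof eventually_elim
    case (elim y)
    then show ?case using deriv_eq_frechet[of Y "fst y" "snd y" 1] by simp
  qed
  then have "smooth_at (\<lambda>x. deriv (Y (fst x)) (snd x)) x"
    by (rule smooth_at_cong[THEN iffD1]) (rule smooth_at_frechet[OF hsm_smooth[OF assms]])
  moreover have "\<forall>\<^sub>F y in nhds x. deriv (Y (fst y)) field_differentiable (at (snd y))"
    using hsm_eventually[OF assms]
  proof eventually_elim
    case (elim y)
    then have "deriv (Y (fst y)) analytic_on {snd y}"
      by (intro analytic_deriv hsm_analytic) simp
    then show ?case using analytic_on_imp_differentiable_at by blast
  qed
  ultimately show ?thesis unfolding hsm_def by blast
qed

text \<open>Symmetry of second derivatives, with one direction in the parameter space and one in the
  plane. As it holds for every \<open>h\<close>, the real derivative of \<open>dpar u Y r\<close> in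
  the plane is multiplication by a complex number; this gives holomorphy together with the
  interchange of the derivatives.\<close>

lemma dpar_has_deriv:
  assumes "hsm Y (r, z)"
  shows "(dpar u Y r has_field_derivative dpar u (\<lambda>r. deriv (Y r)) r z) (at z)"
proof -
  let ?F = "\<lambda>x. Y (fst x) (snd x)" and ?w = "(u r, 0::complex)"
  let ?G = "\<lambda>x. frechet_derivative ?F (at x) ?w"
  obtain A where A: "open A" "(r, z) \<in> A" "\<And>y. y \<in> A \<Longrightarrow> hsm Y y"
    using hsm_eventually[OF assms] unfolding eventually_nhds by (elim exE conjE) blast
  have G: "smooth_at ?G (r, z)" by (rule smooth_at_frechet[OF hsm_smooth[OF assms]])
  have h: "frechet_derivative ?G (at (r, z)) (0, h) = dpar u (\<lambda>r. deriv (Y r)) r z * h" for h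
  proof -
    have "frechet_derivative ?G (at (r, z)) (0, h)
        = frechet_derivative (\<lambda>x. frechet_derivative ?F (at x) (0, h)) (at (r, z)) ?w"
      by (rule frechet_derivative_commute[OF hsm_smooth[OF assms]])
    also have "\<dots> = frechet_derivative (\<lambda>x. deriv (Y (fst x)) (snd x) * h) (at (r, z)) ?w"
      by (rule arg_cong[where f="\<lambda>D. D ?w"], rule frechet_derivative_cong_open[OF A(1,2)])
        (use deriv_eq_frechet[where Y=Y and r="fst y" and z="snd y" for y] A(3) in simp)
    also have "\<dots> = frechet_derivative (\<lambda>x. deriv (Y (fst x)) (snd x)) (at (r, z)) ?w * h"
    proof -
      have "((\<lambda>x. deriv (Y (fst x)) (snd x) * h) has_derivative
          (\<lambda>v. frechet_derivative (\<lambda>x. deriv (Y (fst x)) (snd x)) (at (r, z)) v * h)) (at (r, z))"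
        by (rule has_derivative_mult_left[OF smooth_at_has_derivative[OF hsm_smooth[OF hsm_deriv[OF assms]]]])
      from fun_cong[OF frechet_derivative_at[OF this], of ?w] show ?thesis by (rule sym)
    qed
    also have "\<dots> = dpar u (\<lambda>r. deriv (Y r)) r z * h"
      by (subst dpar_eq_frechet[OF hsm_smooth[OF hsm_deriv[OF assms]]]) simp
    finally show ?thesis .
  qed
  have "((\<lambda>w. (r, w)) has_derivative (\<lambda>h. (0, h))) (at z)"
    by (auto intro!: derivative_eq_intros)
  from has_derivative_compose[OF this smooth_at_has_derivative[OF G]]
  have "((\<lambda>z. ?G (r, z)) has_derivative (\<lambda>h. dpar u (\<lambda>r. deriv (Y r)) r z * h)) (at z)"
    by (simp add: h)
  then have D: "((\<lambda>z. ?G (r, z)) has_field_derivative dpar u (\<lambda>r. deriv (Y r)) r z) (at z)"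
    by (simp add: has_field_derivative_def)
  \<comment> \<open>\<open>?G\<close> freezes the direction at \<open>u r\<close>, whereas
    \<open>dpar\<close> evaluates \<open>u\<close> at the moving parameter. They agree on the slice
    through \<open>r\<close>, which is where the equality is used.\<close>
  have "\<forall>\<^sub>F y in nhds (r, z). (\<lambda>r z. dpar u Y r z = ?G (r, z)) (fst y) (snd y)
      \<or> fst y \<noteq> r"
    using hsm_eventually[OF assms]
  proof eventually_elim
    case (elim y)
    then show ?case using dpar_eq_frechet[OF hsm_smooth, where Y=Y and r="fst y" and z="snd y" and u=u] by auto
  qed
  then have "\<forall>\<^sub>F w in nhds z. dpar u Y r w = ?G (r, w) \<or> r \<noteq> r"
    by (rule eventually_slice_snd)
  then have "\<forall>\<^sub>F w in nhds z. dpar u Y r w = ?G (r, w)" by simp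
  from DERIV_cong_ev[OF refl this refl] D show ?thesis by simp
qed

lemma deriv_dpar: "hsm Y (r, z) \<Longrightarrow> deriv (dpar u Y r) z = dpar u (\<lambda>r. deriv (Y r)) r z"
  by (rule DERIV_imp_deriv[OF dpar_has_deriv])

lemma hsm_dpar:
  assumes "hsm Y x" "smooth_at u (fst x)" shows "hsm (dpar u Y) x"
proof -
  let ?F = "\<lambda>x. Y (fst x) (snd x)"
  have "\<forall>\<^sub>F y in nhds x. frechet_derivative ?F (at y) (u (fst y), 0) = dpar u Y (fst y) (snd y)"
    using hsm_eventually[OF assms(1)]
  proof eventually_elim
    case (elim y)
    then show ?case using dpar_eq_frechet[OF hsm_smooth, where Y=Y and r="fst y" and z="snd y" and u=u] by simp
  qed
  moreover have "smooth_at (\<lambda>y. frechet_derivative ?F (at y) (u (fst y), 0)) x"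
    by (intro smooth_at_frechet_dir hsm_smooth[OF assms(1)] smooth_at_Pair
        smooth_at_compose[OF smooth_at_fst assms(2)] smooth_at_const)
  ultimately have "smooth_at (\<lambda>x. dpar u Y (fst x) (snd x)) x"
    by (rule smooth_at_cong[THEN iffD1])
  moreover have "\<forall>\<^sub>F y in nhds x. dpar u Y (fst y) field_differentiable (at (snd y))"
    using hsm_eventually[OF assms(1)]
  proof eventually_elim
    case (elim y)
    then show ?case using dpar_has_deriv[where Y=Y and r="fst y" and z="snd y" and u=u] unfolding field_differentiable_def by auto
  qed
  ultimately show ?thesis unfolding hsm_def by blast
qed

lemma dpar_cong:
  assumes "\<forall>\<^sub>F y in nhds (r, z). Y (fst y) (snd y) = Y' (fst y) (snd y)"
  shows "dpar u Y r z = dpar u Y' r z"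
proof -
  have "\<forall>\<^sub>F t in nhds 0. Y (r + t *\<^sub>R u r) z = Y' (r + t *\<^sub>R u r) z"
    using eventually_nhds_compose[where g="\<lambda>t. (r + t *\<^sub>R u r, z)" and x=0 and P="\<lambda>y. Y (fst y) (snd y) = Y' (fst y) (snd y)"]
      assms by (simp add: continuous_intros)
  then show ?thesis unfolding dpar_def by (intro vector_derivative_cong_eq) auto
qed

text \<open>The first term has both directions frozen at \<open>r\<close>; the second comes from
  differentiating the direction field \<open>v\<close> along \<open>u\<close>.\<close>

lemma dpar_dpar:
  assumes "hsm Y (r, z)" "smooth_at u r" "smooth_at v r"
  shows "dpar u (dpar v Y) r z = dpar (\<lambda>_. u r) (dpar (\<lambda>_. v r) Y) r z
    + dpar (\<lambda>r. frechet_derivative v (at r) (u r)) Y r z"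
proof -
  let ?F = "\<lambda>x. Y (fst x) (snd x)"
  obtain A where A: "open A" "(r, z) \<in> A" "\<And>y. y \<in> A \<Longrightarrow> hsm Y y"
    using hsm_eventually[OF assms(1)] unfolding eventually_nhds by (elim exE conjE) blast
  have c: "frechet_derivative (\<lambda>x. dpar v Y (fst x) (snd x)) (at (r, z))
      = frechet_derivative (\<lambda>x. frechet_derivative ?F (at x) (v (fst x), 0)) (at (r, z))" for v
    by (rule frechet_derivative_cong_open[OF A(1,2)])
      (use A(3) dpar_eq_frechet[OF hsm_smooth, where Y=Y] in auto)
  have w: "smooth_at (\<lambda>x. (v (fst x), 0::complex)) (r, z)"
    by (intro smooth_at_Pair smooth_at_compose[OF smooth_at_fst] smooth_at_const) (simp add: assms)
  have "((\<lambda>x. (v (fst x), 0::complex)) has_derivative (\<lambda>h. (frechet_derivative v (at r) (fst h), 0))) (at (r, z))"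
    by (intro has_derivative_Pair has_derivative_compose[OF has_derivative_fst[OF has_derivative_ident]] has_derivative_const)
      (simp add: smooth_at_has_derivative[OF assms(3)])
  from fun_cong[OF frechet_derivative_at[OF this], of "(u r, 0)"]
  have w': "frechet_derivative (\<lambda>x. (v (fst x), 0::complex)) (at (r, z)) (u r, 0) = (frechet_derivative v (at r) (u r), 0)"
    by simp
  have "dpar u (dpar v Y) r z = frechet_derivative (\<lambda>x. frechet_derivative ?F (at x) (v (fst x), 0)) (at (r, z)) (u r, 0)"
    by (subst dpar_eq_frechet) (auto simp: c assms intro!: hsm_smooth hsm_dpar)
  also have "\<dots> = frechet_derivative (\<lambda>x. frechet_derivative ?F (at x) (v r, 0)) (at (r, z)) (u r, 0)
      + frechet_derivative ?F (at (r, z)) (frechet_derivative v (at r) (u r), 0)"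
    using frechet_derivative_frechet_dir[OF hsm_smooth[OF assms(1)] w, of "(u r, 0)"] w' by simp
  also have "frechet_derivative (\<lambda>x. frechet_derivative ?F (at x) (v r, 0)) (at (r, z)) (u r, 0)
      = dpar (\<lambda>_. u r) (dpar (\<lambda>_. v r) Y) r z"
    by (subst dpar_eq_frechet[of "dpar (\<lambda>_. v r) Y"]) (auto simp: c assms intro!: hsm_smooth hsm_dpar)
  also have "frechet_derivative ?F (at (r, z)) (frechet_derivative v (at r) (u r), 0)
      = dpar (\<lambda>r. frechet_derivative v (at r) (u r)) Y r z"
    by (rule dpar_eq_frechet[OF hsm_smooth[OF assms(1)], symmetric])
  finally show ?thesis .
qed

lemma dpar_commute_const:
  assumes "hsm Y (r, z)"
  shows "dpar (\<lambda>_. p) (dpar (\<lambda>_. q) Y) r z = dpar (\<lambda>_. q) (dpar (\<lambda>_. p) Y) r z"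
proof -
  let ?F = "\<lambda>x. Y (fst x) (snd x)"
  obtain A where A: "open A" "(r, z) \<in> A" "\<And>y. y \<in> A \<Longrightarrow> hsm Y y"
    using hsm_eventually[OF assms(1)] unfolding eventually_nhds by (elim exE conjE) blast
  have "dpar (\<lambda>_. p) (dpar (\<lambda>_. q) Y) r z
      = frechet_derivative (\<lambda>x. frechet_derivative ?F (at x) (q, 0)) (at (r, z)) (p, 0)" for p q
  proof -
    have "frechet_derivative (\<lambda>x. dpar (\<lambda>_. q) Y (fst x) (snd x)) (at (r, z))
      = frechet_derivative (\<lambda>x. frechet_derivative ?F (at x) (q, 0)) (at (r, z))"
      by (rule frechet_derivative_cong_open[OF A(1,2)])
        (use A(3) dpar_eq_frechet[OF hsm_smooth, where Y=Y] in auto)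
    then show ?thesis by (subst dpar_eq_frechet) (auto simp: assms intro!: hsm_smooth hsm_dpar)
  qed
  then show ?thesis using frechet_derivative_commute[OF hsm_smooth[OF assms]] by simp
qed

lemma dpar_bracket:
  assumes "hsm Y (r, z)" "smooth_at u r" "smooth_at v r"
  shows "dpar u (dpar v Y) r z - dpar v (dpar u Y) r z = dpar (bracket u v) Y r z"
proof -
  have "linear (frechet_derivative (\<lambda>x. Y (fst x) (snd x)) (at (r, z)))"
    by (rule has_derivative_linear[OF smooth_at_has_derivative[OF hsm_smooth[OF assms(1)]]])
  from linear_diff[OF this, of "(a, 0)" "(b, 0)" for a b]
  have "dpar (bracket u v) Y r z = dpar (\<lambda>r. frechet_derivative v (at r) (u r)) Y r z
      - dpar (\<lambda>r. frechet_derivative u (at r) (v r)) Y r z"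
    by (simp add: dpar_eq_frechet[OF hsm_smooth[OF assms(1)]] bracket_def)
  then show ?thesis
    using dpar_dpar[OF assms] dpar_dpar[OF assms(1,3,2)] dpar_commute_const[OF assms(1), of "u r" "v r"] by simp
qed

section \<open>Inverting a family of injective holomorphic functions\<close>

text \<open>The tube lemma with one radius for both factors; it turns local statements at the points
  of a compact set into uniform ones.\<close>

lemma eventually_nhds_uniform:
  fixes a :: "'a::metric_space" and C :: "'b::metric_space set"
  assumes "compact C" "\<forall>c\<in>C. \<forall>\<^sub>F x in nhds (a, c). P (fst x) (snd x)"
  shows "\<exists>e>0. \<forall>r y. \<forall>c\<in>C. dist a r < e \<longrightarrow> dist c y < e \<longrightarrow> P r y"
proof -
  let ?M = "interior {x. P (fst x) (snd x)}"
  have "{a} \<times> C \<subseteq> ?M"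
  proof (rule subsetI)
    fix x assume "x \<in> {a} \<times> C"
    with assms(2) obtain S where "open S" "x \<in> S" "\<forall>y\<in>S. P (fst y) (snd y)" unfolding eventually_nhds by auto
    then show "x \<in> ?M" by (intro interiorI[of S]) auto
  qed
  moreover have "compact ({a} \<times> C)" using assms(1) by (intro compact_Times) auto
  ultimately obtain e where e: "e > 0" "(\<Union>x\<in>{a} \<times> C. ball x e) \<subseteq> ?M"
    using compact_subset_open_imp_ball_epsilon_subset[OF _ open_interior] by metis
  have "P r y" if "dist a r < e/2" "c \<in> C" "dist c y < e/2" for r c y
  proof -
    have "dist (a, c) (r, y) \<le> dist a r + dist c y"
      unfolding dist_Pair_Pair by (rule sqrt_sum_squares_le_sum) auto
    then have "(r, y) \<in> ball (a, c) e" using that by simp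
    then have "(r, y) \<in> ?M" using e(2) that(2) by blast
    then show ?thesis using interior_subset by fastforce
  qed
  then show ?thesis using e(1) by (intro exI[of _ "e/2"]) simp
qed

text \<open>With \<open>?c\<close> the derivative at the base point, the derivative of
  \<open>\<kappa> r z - ?c * z\<close> is at most half of \<open>norm ?c\<close> for all nearby
  parameters and points, so this difference cannot compensate the linear part. The ball obtained is
  the same for all these parameters.\<close>

lemma hsm_locally_injective:
  fixes \<kappa> :: "'p::euclidean_space \<Rightarrow> cfun"
  assumes "hsm \<kappa> (r0, k)" "deriv (\<kappa> r0) k \<noteq> 0"
  shows "\<forall>\<^sub>F x in nhds (r0, k, k). \<kappa> (fst x) (fst (snd x)) = \<kappa> (fst x) (snd (snd x)) \<longrightarrow> fst (snd x) = snd (snd x)"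
proof -
  let ?c = "deriv (\<kappa> r0) k"
  have "isCont (\<lambda>x. deriv (\<kappa> (fst x)) (snd x)) (r0, k)"
    by (rule hsm_continuous[OF hsm_deriv[OF assms(1)]])
  moreover have "\<forall>\<^sub>F w in nhds (deriv (\<kappa> (fst (r0, k))) (snd (r0, k))). norm (w - ?c) \<le> norm ?c / 2"
    unfolding fst_conv snd_conv eventually_nhds_metric dist_norm
    by (intro exI[of _ "norm ?c / 2"]) (use assms(2) in auto)
  ultimately have "\<forall>\<^sub>F x in nhds (r0, k). norm (deriv (\<kappa> (fst x)) (snd x) - ?c) \<le> norm ?c / 2"
    by (rule eventually_nhds_compose)
  with hsm_eventually[OF assms(1)]
  have "\<forall>\<^sub>F x in nhds (r0, k). hsm \<kappa> (fst x, snd x) \<and> norm (deriv (\<kappa> (fst x)) (snd x) - ?c) \<le> norm ?c / 2"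
    by eventually_elim simp
  then have ev: "\<forall>c\<in>{k}. \<forall>\<^sub>F x in nhds (r0, c). hsm \<kappa> (fst x, snd x) \<and> norm (deriv (\<kappa> (fst x)) (snd x) - ?c) \<le> norm ?c / 2"
    by simp
  have "compact {k}" by simp
  from eventually_nhds_uniform[OF this ev] obtain e where e1: "e > 0"
    and e2: "\<forall>r y. \<forall>c\<in>{k}. dist r0 r < e \<longrightarrow> dist c y < e \<longrightarrow> hsm \<kappa> (r, y) \<and> norm (deriv (\<kappa> r) y - ?c) \<le> norm ?c / 2"
    by (elim exE conjE)
  have e: "e > 0" "\<And>r z. dist r0 r < e \<Longrightarrow> dist k z < e \<Longrightarrow> hsm \<kappa> (r, z) \<and> norm (deriv (\<kappa> r) z - ?c) \<le> norm ?c / 2"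
    using e1 e2 by simp_all
  have inj: "z = w" if "dist r0 r < e" "dist k z < e" "dist k w < e" "\<kappa> r z = \<kappa> r w" for r z w
  proof -
    have "norm ((\<kappa> r z - ?c * z) - (\<kappa> r w - ?c * w)) \<le> norm ?c / 2 * norm (z - w)"
    proof (rule field_differentiable_bound[where S="ball k e" and f="\<lambda>z. \<kappa> r z - ?c * z" and f'="\<lambda>z. deriv (\<kappa> r) z - ?c"])
      fix z assume "z \<in> ball k e"
      then have "hsm \<kappa> (r, z)" using e(2) that by simp
      then show "((\<lambda>z. \<kappa> r z - ?c * z) has_field_derivative deriv (\<kappa> r) z - ?c) (at z within ball k e)"
        by (rule has_field_derivative_at_within[OF DERIV_diff[OF hsm_has_deriv DERIV_cmult_Id]])
    next
      show "norm (deriv (\<kappa> r) z - ?c) \<le> norm ?c / 2" if "z \<in> ball k e" for z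
        using e(2)[OF \<open>dist r0 r < e\<close>, of z] that by simp
    qed (use that in simp_all)
    moreover have "(\<kappa> r z - ?c * z) - (\<kappa> r w - ?c * w) = ?c * (w - z)"
      using that(4) by (simp add: algebra_simps)
    ultimately have "norm ?c * norm (w - z) \<le> norm ?c * (norm (w - z) / 2)"
      by (simp add: norm_mult norm_minus_commute)
    then show "z = w" using assms(2) by simp
  qed
  show ?thesis unfolding eventually_nhds
  proof (intro exI[of _ "ball r0 e \<times> ball k e \<times> ball k e"] conjI)
    show "open (ball r0 e \<times> ball k e \<times> ball k e)" by (intro open_Times open_ball)
  qed (use e(1) inj in auto)
qed

text \<open>Pairs of points of \<open>K\<close> are of two kinds: on the diagonal, local injectivity
  applies; off the diagonal, the values are distinct and remain so by continuity. Compactness of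
  \<open>K \<times> K\<close> gives one radius for all pairs.\<close>

lemma hsm_injective_near:
  fixes \<kappa> :: "'p::euclidean_space \<Rightarrow> cfun"
  assumes "compact K" and \<kappa>: "\<And>k. k \<in> K \<Longrightarrow> hsm \<kappa> (0, k)" and inj: "inj_on (\<kappa> 0) K"
    and d: "\<And>k. k \<in> K \<Longrightarrow> deriv (\<kappa> 0) k \<noteq> 0"
  obtains e where "e > 0"
    "\<And>r k z k' w. dist 0 r < e \<Longrightarrow> k \<in> K \<Longrightarrow> dist k z < e \<Longrightarrow> k' \<in> K \<Longrightarrow> dist k' w < e \<Longrightarrow> \<kappa> r z = \<kappa> r w \<Longrightarrow> z = w"
proof -
  have ev: "\<forall>\<^sub>F x in nhds (0, c). \<kappa> (fst x) (fst (snd x)) = \<kappa> (fst x) (snd (snd x)) \<longrightarrow> fst (snd x) = snd (snd x)"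
    if "c \<in> K \<times> K" for c
  proof (cases "fst c = snd c")
    case True
    then have c: "c = (fst c, fst c)" by (simp add: prod_eq_iff)
    have k: "fst c \<in> K" using that by (simp add: mem_Times_iff)
    from hsm_locally_injective[OF \<kappa>[OF k] d[OF k]] show ?thesis unfolding c[symmetric] .
  next
    case False
    have k: "fst c \<in> K" "snd c \<in> K" using that by (simp_all add: mem_Times_iff)
    have ne: "\<kappa> 0 (fst c) - \<kappa> 0 (snd c) \<noteq> 0"
      using inj_onD[OF inj _ k] False by auto
    have sm: "smooth_at (\<lambda>x. \<kappa> (fst x) (fst (snd x)) - \<kappa> (fst x) (snd (snd x))) (0, c)"
    proof (rule smooth_at_diff)
      have p: "smooth_at (\<lambda>x::'p \<times> complex \<times> complex. (fst x, fst (snd x))) (0, c)"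
        "smooth_at (\<lambda>x::'p \<times> complex \<times> complex. (fst x, snd (snd x))) (0, c)"
        by (intro smooth_at_linear bounded_linear_Pair bounded_linear_fst bounded_linear_fst_comp[OF bounded_linear_snd] bounded_linear_snd_comp[OF bounded_linear_snd])+
      show "smooth_at (\<lambda>x. \<kappa> (fst x) (fst (snd x))) (0, c)"
        using smooth_at_compose[OF p(1), of "\<lambda>x. \<kappa> (fst x) (snd x)"] hsm_smooth[OF \<kappa>[OF k(1)]] by simp
      show "smooth_at (\<lambda>x. \<kappa> (fst x) (snd (snd x))) (0, c)"
        using smooth_at_compose[OF p(2), of "\<lambda>x. \<kappa> (fst x) (snd x)"] hsm_smooth[OF \<kappa>[OF k(2)]] by simp
    qed
    have "\<forall>\<^sub>F w in nhds (\<kappa> 0 (fst c) - \<kappa> 0 (snd c)). w \<noteq> 0"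
      unfolding eventually_nhds by (intro exI[of _ "- {0}"]) (use ne in auto)
    with eventually_nhds_compose[OF smooth_at_continuous[OF sm], of "\<lambda>w. w \<noteq> 0"]
    have "\<forall>\<^sub>F x in nhds (0, c). \<kappa> (fst x) (fst (snd x)) - \<kappa> (fst x) (snd (snd x)) \<noteq> 0"
      by (simp only: fst_conv snd_conv)
    then show ?thesis by eventually_elim simp
  qed
  then have "\<forall>c\<in>K \<times> K. \<forall>\<^sub>F x in nhds (0, c). \<kappa> (fst x) (fst (snd x)) = \<kappa> (fst x) (snd (snd x)) \<longrightarrow> fst (snd x) = snd (snd x)"
    by blast
  from eventually_nhds_uniform[OF compact_Times[OF assms(1,1)] this] obtain e where "e > 0"
    and e: "\<forall>r y. \<forall>c\<in>K \<times> K. dist 0 r < e \<longrightarrow> dist c y < e \<longrightarrow> \<kappa> r (fst y) = \<kappa> r (snd y) \<longrightarrow> fst y = snd y"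
    by (elim exE conjE)
  show thesis
  proof (rule that[of "e/2"])
    fix r k z k' w assume *: "dist 0 r < e/2" "k \<in> K" "dist k z < e/2" "k' \<in> K" "dist k' w < e/2" "\<kappa> r z = \<kappa> r w"
    have "dist (k, k') (z, w) \<le> dist k z + dist k' w"
      unfolding dist_Pair_Pair by (rule sqrt_sum_squares_le_sum) auto
    then have "dist (k, k') (z, w) < e" using * by simp
    moreover have "dist 0 r < e" using *(1) \<open>e > 0\<close> by simp
    ultimately show "z = w" using e[rule_format, of "(k, k')" r "(z, w)"] * by simp
  qed (use \<open>e > 0\<close> in simp)
qed

lemma Ck_on_Pair:
  assumes "open A" "Ck_on k A f" "Ck_on k A g" shows "Ck_on k A (\<lambda>x. (f x, g x))"
proof -
  have "bounded_linear (\<lambda>a::'b. (a, 0::'c))" "bounded_linear (\<lambda>b::'c. (0::'b, b))"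
    by (auto intro!: bounded_linear_intros)
  from Ck_on_add[OF assms(1) Ck_on_bounded_linear[OF assms(1) this(1) assms(2)]
      Ck_on_bounded_linear[OF assms(1) this(2) assms(3)]]
  show ?thesis by simp
qed

text \<open>Bootstrapping for a continuous inverse: the derivative of \<open>\<psi>\<close> is a
  smooth function of \<open>(r, \<psi> r y)\<close>, hence as regular as \<open>\<psi>\<close>
  itself, so that each order of regularity yields the next.\<close>

lemma hsm_local_inverse:
  fixes \<kappa> \<psi> :: "'p::euclidean_space \<Rightarrow> cfun"
  assumes M: "open M" and \<kappa>: "\<And>r y. (r, y) \<in> M \<Longrightarrow> hsm \<kappa> (r, \<psi> r y)"
    and d: "\<And>r y. (r, y) \<in> M \<Longrightarrow> deriv (\<kappa> r) (\<psi> r y) \<noteq> 0"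
    and inv: "\<And>r y. (r, y) \<in> M \<Longrightarrow> \<kappa> r (\<psi> r y) = y"
    and cont: "continuous_on M (\<lambda>x. \<psi> (fst x) (snd x))"
  shows "(r, y) \<in> M \<Longrightarrow> hsm \<psi> (r, y)"
proof -
  let ?K = "\<lambda>x. \<kappa> (fst x) (snd x)" and ?P = "\<lambda>x. (fst x, \<psi> (fst x) (snd x))"
  \<comment> \<open>The increment of \<open>z\<close> that solves the linearized equation: the
    prescribed increment \<open>snd v\<close> of the value, minus the part caused by the parameter,
    divided by the complex derivative. It inverts the triangular derivative of the map from
    \<open>(r, z)\<close> to \<open>(r, \<kappa> r z)\<close>.\<close>
  define D where "D v x = (snd v - frechet_derivative ?K (at x) (fst v, 0)) * inverse (deriv (\<kappa> (fst x)) (snd x))" for v x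
  have der: "((\<lambda>x. \<psi> (fst x) (snd x)) has_derivative (\<lambda>v. D v (?P p))) (at p)" if p: "p \<in> M" for p
  proof -
    let ?x = "?P p"
    have h: "hsm \<kappa> ?x" and c0: "deriv (\<kappa> (fst p)) (\<psi> (fst p) (snd p)) \<noteq> 0"
      using \<kappa>[of "fst p" "snd p"] d[of "fst p" "snd p"] p by auto
    let ?F = "frechet_derivative ?K (at ?x)"
    have F: "(?K has_derivative ?F) (at ?x)" by (rule smooth_at_has_derivative[OF hsm_smooth[OF h]])
    have split: "?F v = ?F (fst v, 0) + deriv (\<kappa> (fst p)) (\<psi> (fst p) (snd p)) * snd v" for v
    proof -
      have "?F ((fst v, 0) + (0, snd v)) = ?F (fst v, 0) + ?F (0, snd v)"
        by (rule linear_add[OF has_derivative_linear[OF F]])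
      then show ?thesis by (simp add: deriv_eq_frechet[OF h])
    qed
    have \<Phi>: "((\<lambda>x. (fst x, ?K x)) has_derivative (\<lambda>v. (fst v, ?F v))) (at ?x)"
      by (intro has_derivative_Pair F has_derivative_fst has_derivative_ident)
    have bl: "bounded_linear (\<lambda>v::'p \<times> complex. (fst v, 0::complex))"
      by (intro bounded_linear_Pair bounded_linear_fst bounded_linear_zero)
    have "bounded_linear (\<lambda>v. (fst v, D v ?x))"
      unfolding D_def
      by (intro bounded_linear_Pair bounded_linear_fst bounded_linear_mult_const bounded_linear_sub bounded_linear_snd
          bounded_linear_compose[OF has_derivative_bounded_linear[OF F] bl])
    then have "(?P has_derivative (\<lambda>v. (fst v, D v ?x))) (at p)"
    proof (rule has_derivative_inverse_basic[where f="\<lambda>x. (fst x, ?K x)" and g="?P" and y=p and T=M, OF \<Phi>])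
      have "D (fst v, ?F v) ?x = snd v" for v
      proof -
        have "?F v - ?F (fst v, 0) = deriv (\<kappa> (fst p)) (\<psi> (fst p) (snd p)) * snd v"
          unfolding diff_eq_eq by (subst split) (rule add.commute)
        then show ?thesis unfolding D_def fst_conv snd_conv using c0 by simp
      qed
      then show "(\<lambda>v. (fst v, D v ?x)) \<circ> (\<lambda>v. (fst v, ?F v)) = id"
        by (simp add: fun_eq_iff)
      have "continuous_on M ?P" by (intro continuous_on_Pair cont continuous_on_fst continuous_on_id)
      then show "isCont ?P p" using M p continuous_on_eq_continuous_at by blast
    qed (use M p inv in auto)
    from has_derivative_snd[OF this] show ?thesis by simp
  qed
  have "Ck_on k M (\<lambda>x. \<psi> (fst x) (snd x))" for k
  proof (induction k)
    case 0
    then show ?case using cont by simp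
  next
    case (Suc k)
    show ?case
    proof (rule Ck_on_SucI[OF M der])
      fix v
      let ?A = "{x. hsm \<kappa> x \<and> deriv (\<kappa> (fst x)) (snd x) \<noteq> 0}"
      have "\<exists>A. open A \<and> ?P p \<in> A \<and> smooth_on A (D v)" if "p \<in> M" for p
      proof -
        have "hsm \<kappa> (?P p)" "deriv (\<kappa> (fst (?P p))) (snd (?P p)) \<noteq> 0"
          using \<kappa>[of "fst p" "snd p"] d[of "fst p" "snd p"] that by auto
        then have "smooth_at (D v) (?P p)"
          unfolding D_def
          by (intro smooth_at_mult smooth_at_diff smooth_at_const smooth_at_frechet smooth_at_inverse
              hsm_smooth hsm_deriv) simp_all
        then show ?thesis unfolding smooth_at_def .
      qed
      note loc = this
      show "Ck_on k M (\<lambda>p. D v (?P p))"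
      proof (rule Ck_on_local)
        fix p assume p: "p \<in> M"
        obtain A where A: "open A" "?P p \<in> A" "smooth_on A (D v)" using loc[OF p] by (elim exE conjE)
        have "Ck_on k M fst" by (rule Ck_on_linear[OF bounded_linear_fst])
        then have P: "Ck_on k M ?P" by (rule Ck_on_Pair[OF M _ Suc.IH])
        have "continuous_on M ?P" by (intro continuous_on_Pair cont continuous_on_fst continuous_on_id)
        then have B: "open (M \<inter> ?P -` A)" using M A(1) by (rule continuous_open_preimage)
        have "Ck_on k (M \<inter> ?P -` A) (\<lambda>p. D v (?P p))"
          by (rule Ck_on_compose[OF B Ck_on_subset[OF P], of A "D v"])
            (use A(3) in \<open>auto simp: smooth_on_def\<close>)
        with B A(2) p show "\<exists>B. open B \<and> p \<in> B \<and> Ck_on k B (\<lambda>p. D v (?P p))"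
          by (intro exI[of _ "M \<inter> ?P -` A"]) simp
      qed
    qed
  qed
  then have sm: "smooth_at (\<lambda>x. \<psi> (fst x) (snd x)) p" if "p \<in> M" for p
    using that by (intro smooth_atI[OF M])
  have fd: "\<psi> (fst p) field_differentiable (at (snd p))" if p: "p \<in> M" for p
  proof -
    have h: "hsm \<kappa> (?P p)" using \<kappa>[of "fst p" "snd p"] p by auto
    have z: "frechet_derivative ?K (at (?P p)) (0, 0) = 0"
      using deriv_eq_frechet[OF h, of 0] by simp
    have "((\<lambda>w. (fst p, w)) has_derivative (\<lambda>h. (0, h))) (at (snd p))"
      by (auto intro!: derivative_eq_intros)
    from has_derivative_compose[OF this, of "\<lambda>x. \<psi> (fst x) (snd x)"] der[OF p]
    have "(\<psi> (fst p) has_derivative (\<lambda>h. D (0, h) (?P p))) (at (snd p))" by simp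
    \<comment> \<open>In the plane directions the parameter part drops out; what remains is
      multiplication by the inverse of the complex derivative.\<close>
    moreover have "(\<lambda>h. D (0, h) (?P p)) = (*) (inverse (deriv (\<kappa> (fst p)) (\<psi> (fst p) (snd p))))"
      using z by (simp add: D_def fun_eq_iff)
    ultimately have "(\<psi> (fst p) has_field_derivative inverse (deriv (\<kappa> (fst p)) (\<psi> (fst p) (snd p)))) (at (snd p))"
      by (simp add: has_field_derivative_def)
    then show ?thesis unfolding field_differentiable_def by blast
  qed
  assume "(r, y) \<in> M"
  then show "hsm \<psi> (r, y)"
    unfolding hsm_def eventually_nhds using sm fd M by (intro conjI exI[of _ M]) auto
qed

text \<open>On uniform neighbourhoods the map from \<open>(r, z)\<close> to
  \<open>(r, \<kappa> r z)\<close> is injective and continuous, so invariance of domain supplies an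
  open image and a continuous inverse; its smoothness and holomorphy are then local
  questions.\<close>

lemma hsm_inverse_family:
  fixes \<kappa> :: "'p::euclidean_space \<Rightarrow> cfun"
  assumes K: "compact K" and \<kappa>: "\<And>k. k \<in> K \<Longrightarrow> hsm \<kappa> (0, k)" and inj: "inj_on (\<kappa> 0) K"
    and d: "\<And>k. k \<in> K \<Longrightarrow> deriv (\<kappa> 0) k \<noteq> 0"
  obtains N U W \<psi> where "open N" "(0::'p) \<in> N" "open U" "K \<subseteq> U" "open W" "\<kappa> 0 ` K \<subseteq> W"
    "\<And>r z. r \<in> N \<Longrightarrow> z \<in> U \<Longrightarrow> hsm \<kappa> (r, z)"
    "\<And>r. r \<in> N \<Longrightarrow> inj_on (\<kappa> r) U"
    "\<And>r y. r \<in> N \<Longrightarrow> y \<in> W \<Longrightarrow> \<psi> r y \<in> U \<and> \<kappa> r (\<psi> r y) = y \<and> hsm \<psi> (r, y)"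
proof -
  obtain e1 where e1: "e1 > 0"
    "\<And>r k z k' w. dist 0 r < e1 \<Longrightarrow> k \<in> K \<Longrightarrow> dist k z < e1 \<Longrightarrow> k' \<in> K \<Longrightarrow> dist k' w < e1 \<Longrightarrow> \<kappa> r z = \<kappa> r w \<Longrightarrow> z = w"
    using hsm_injective_near[OF assms] by blast
  have "\<forall>\<^sub>F x in nhds (0, k). hsm \<kappa> (fst x, snd x) \<and> deriv (\<kappa> (fst x)) (snd x) \<noteq> 0" if "k \<in> K" for k
    using hsm_eventually[OF \<kappa>[OF that]] hsm_nonzero[OF hsm_deriv[OF \<kappa>[OF that]]] d[OF that]
    by (auto intro: eventually_conj)
  then have "\<forall>k\<in>K. \<forall>\<^sub>F x in nhds (0, k). hsm \<kappa> (fst x, snd x) \<and> deriv (\<kappa> (fst x)) (snd x) \<noteq> 0" by blast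
  from eventually_nhds_uniform[OF K this] obtain e2 where e2: "e2 > 0"
    "\<forall>r y. \<forall>c\<in>K. dist 0 r < e2 \<longrightarrow> dist c y < e2 \<longrightarrow> hsm \<kappa> (r, y) \<and> deriv (\<kappa> r) y \<noteq> 0"
    by (elim exE conjE)
  define e where "e = min e1 e2"
  define N where "N = ball (0::'p) e"
  define U where "U = (\<Union>k\<in>K. ball k e)"
  have e: "e > 0" "e \<le> e1" "e \<le> e2" using e1 e2 by (auto simp: e_def)
  have oN: "open N" "0 \<in> N" and oU: "open U" "K \<subseteq> U" using e(1) by (auto simp: N_def U_def)
  have hs: "hsm \<kappa> (r, z)" "deriv (\<kappa> r) z \<noteq> 0" if "r \<in> N" "z \<in> U" for r z
  proof -
    obtain k where "k \<in> K" "dist k z < e" using \<open>z \<in> U\<close> by (auto simp: U_def)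
    then show "hsm \<kappa> (r, z)" "deriv (\<kappa> r) z \<noteq> 0"
      using e2(2)[rule_format, of k r z] \<open>r \<in> N\<close> e by (simp_all add: N_def)
  qed
  have injU: "inj_on (\<kappa> r) U" if "r \<in> N" for r
  proof (rule inj_onI)
    fix z w assume "z \<in> U" "w \<in> U" and eq: "\<kappa> r z = \<kappa> r w"
    then obtain k k' where "k \<in> K" "dist k z < e" "k' \<in> K" "dist k' w < e" by (auto simp: U_def)
    moreover have "dist 0 r < e1" using that e by (simp add: N_def)
    ultimately show "z = w" using e1(2)[of r k z k' w] eq e by linarith
  qed
  let ?\<Phi> = "\<lambda>x. (fst x, \<kappa> (fst x) (snd x))"
  have A: "open (N \<times> U)" using oN oU by (intro open_Times)
  have "continuous_on (N \<times> U) (\<lambda>x. \<kappa> (fst x) (snd x))"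
    by (intro continuous_at_imp_continuous_on ballI hsm_continuous) (use hs in auto)
  then have c\<Phi>: "continuous_on (N \<times> U) ?\<Phi>"
    by (intro continuous_on_Pair continuous_on_fst continuous_on_id)
  have i\<Phi>: "inj_on ?\<Phi> (N \<times> U)"
    using injU by (auto simp: inj_on_def)
  let ?M = "?\<Phi> ` (N \<times> U)"
  have M: "open ?M" by (rule invariance_of_domain[OF c\<Phi> A i\<Phi>])
  obtain g where "homeomorphism (N \<times> U) ?M ?\<Phi> g"
    using invariance_of_domain_homeomorphism[OF A c\<Phi> _ i\<Phi>] by auto
  then have g: "continuous_on ?M g" "\<And>x. x \<in> N \<times> U \<Longrightarrow> g (?\<Phi> x) = x" unfolding homeomorphism_def by auto
  define \<psi> where "\<psi> r y = snd (g (r, y))" for r y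
  have \<psi>: "\<psi> r (\<kappa> r z) = z" if "r \<in> N" "z \<in> U" for r z
    using g(2)[of "(r, z)"] that by (simp add: \<psi>_def)
  have M': "r \<in> N \<and> \<psi> r y \<in> U \<and> \<kappa> r (\<psi> r y) = y" if "(r, y) \<in> ?M" for r y
    using that \<psi> by auto
  have c\<psi>: "continuous_on ?M (\<lambda>x. \<psi> (fst x) (snd x))"
    unfolding \<psi>_def prod.collapse by (intro continuous_on_snd g(1))
  have h\<psi>: "hsm \<psi> (r, y)" if "(r, y) \<in> ?M" for r y
  proof (rule hsm_local_inverse[OF M _ _ _ c\<psi> that])
    fix r y assume "(r, y) \<in> ?M"
    from M'[OF this] show "hsm \<kappa> (r, \<psi> r y)" "deriv (\<kappa> r) (\<psi> r y) \<noteq> 0" "\<kappa> r (\<psi> r y) = y"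
      using hs by auto
  qed
  have "continuous_on K (\<kappa> 0)"
    by (intro continuous_at_imp_continuous_on ballI DERIV_isCont[OF hsm_has_deriv] hs(1)) (use oN oU in auto)
  then have "compact (\<kappa> 0 ` K)" using K by (rule compact_continuous_image)
  moreover have "\<forall>\<^sub>F x in nhds (0, c). (fst x, snd x) \<in> ?M" if "c \<in> \<kappa> 0 ` K" for c
  proof -
    obtain k where "k \<in> K" "c = \<kappa> 0 k" using \<open>c \<in> \<kappa> 0 ` K\<close> by blast
    then have "(0, c) \<in> ?M" using oN oU by (intro image_eqI[of _ _ "(0, k)"]) auto
    then show ?thesis unfolding eventually_nhds prod.collapse using M by (intro exI[of _ ?M]) simp
  qed
  \<comment> \<open>The open image contains the product of parameter 0 with the compact image of
    \<open>K\<close>, hence a whole box around it. This gives a target \<open>W\<close> common to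
    all parameters.\<close>
  ultimately have "\<exists>e3>0. \<forall>r y. \<forall>c\<in>\<kappa> 0 ` K. dist 0 r < e3 \<longrightarrow> dist c y < e3 \<longrightarrow> (r, y) \<in> ?M"
    by (intro eventually_nhds_uniform ballI)
  then obtain e3 where e3: "e3 > 0" "\<forall>r y. \<forall>c\<in>\<kappa> 0 ` K. dist 0 r < e3 \<longrightarrow> dist c y < e3 \<longrightarrow> (r, y) \<in> ?M"
    by (elim exE conjE)
  define W where "W = (\<Union>c\<in>\<kappa> 0 ` K. ball c e3)"
  show thesis
  proof (rule that[of "N \<inter> ball 0 e3" U W \<psi>])
    show "\<psi> r y \<in> U \<and> \<kappa> r (\<psi> r y) = y \<and> hsm \<psi> (r, y)" if "r \<in> N \<inter> ball 0 e3" "y \<in> W" for r y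
    proof -
      obtain c where "c \<in> \<kappa> 0 ` K" "dist c y < e3" using \<open>y \<in> W\<close> unfolding W_def by (elim UN_E) simp
      then have "(r, y) \<in> ?M" using e3(2)[rule_format, of c r y] \<open>r \<in> N \<inter> ball 0 e3\<close> by simp
      then show ?thesis using M' h\<psi> by blast
    qed
    show "open W" unfolding W_def by blast
    show "\<kappa> 0 ` K \<subseteq> W" unfolding W_def using e3(1) by force
  qed (use oN oU hs injU e3(1) in auto)
qed

section \<open>Schwarz functions as antiholomorphic involutions\<close>

text \<open>Clearing denominators factors the equation as \<open>(z - w) * (1 + z * w) = 0\<close>,
  and the second factor cannot vanish for points of the unit disc.\<close>

lemma inj_dual_koebe: "inj_on (\<lambda>z::complex. z / (1 - z\<^sup>2)) (ball 0 1)"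
proof (rule inj_onI)
  fix z w :: complex
  assume z: "z \<in> ball 0 1" and w: "w \<in> ball 0 1" and eq: "z / (1 - z\<^sup>2) = w / (1 - w\<^sup>2)"
  have "norm (z\<^sup>2) < 1" "norm (w\<^sup>2) < 1" "norm (z * w) < 1"
    using z w mult_strict_mono'[of "norm z" 1 "norm w" 1] by (auto simp: norm_power norm_mult power_less_one_iff)
  then have "1 \<noteq> z\<^sup>2" "1 \<noteq> w\<^sup>2" "z * w \<noteq> - 1" by (metis norm_one less_irrefl norm_minus_cancel)+
  then have ne: "1 - z\<^sup>2 \<noteq> 0" "1 - w\<^sup>2 \<noteq> 0" "1 + z * w \<noteq> 0"
    by (auto simp: add_eq_0_iff)
  then have "z * (1 - w\<^sup>2) = w * (1 - z\<^sup>2)" using eq by (simp add: frac_eq_eq)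
  then have "(z - w) * (1 + z * w) = 0" by (simp add: algebra_simps power2_eq_square)
  then show "z = w" using ne by simp
qed

text \<open>\<open>t\<close> is the small root of y t^2 + t - y = 0, written as 2 y / (1 + s)
  instead of (s - 1) / (2 y), so that the formula covers y = 0.\<close>

lemma dual_koebe_real: "\<exists>t. -1 < t \<and> t < 1 \<and> t / (1 - t\<^sup>2) = (y::real)"
proof -
  define s where "s = sqrt (1 + 4 * y\<^sup>2)"
  have s2: "s\<^sup>2 = 1 + 4 * y\<^sup>2" and s0: "s \<ge> 0" by (simp_all add: s_def)
  define t where "t = 2 * y / (1 + s)"
  have "1 - t\<^sup>2 = ((1 + s)\<^sup>2 - 4 * y\<^sup>2) / (1 + s)\<^sup>2"
    using s0 by (simp add: t_def power_divide power_mult_distrib field_simps)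
  also have "(1 + s)\<^sup>2 - 4 * y\<^sup>2 = 2 * (1 + s)" using s2 by (simp add: power2_eq_square algebra_simps)
  also have "2 * (1 + s) / (1 + s)\<^sup>2 = 2 / (1 + s)"
    by (subst frac_eq_eq) (use s0 in \<open>auto simp: power2_eq_square\<close>)
  finally have d: "1 - t\<^sup>2 = 2 / (1 + s)" .
  then have "1 - t\<^sup>2 > 0" using s0 by simp
  then have "t\<^sup>2 < 1" by simp
  then have "\<bar>t\<bar> < 1" by (simp add: abs_square_less_1)
  moreover have "t / (1 - t\<^sup>2) = y" unfolding d using s0 by (simp add: t_def)
  ultimately show ?thesis by (intro exI[of _ t]) auto
qed

text \<open>The parametrization of a curve has to be defined near the whole real axis. A bounded real segment
  is covered by the inverse of \<open>t \<mapsto> t / (1 - t\<^sup>2)\<close>, which maps \<open>{-1<..<1}\<close> onto the real line and is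
  injective on the unit disc.\<close>

lemma schwarz_on_of_segment:
  fixes a b :: real
  assumes "open W" "complex_of_real ` {a..b} \<subseteq> W" "a \<le> b"
  obtains \<Omega> where "open \<Omega>" "complex_of_real ` {a..b} \<subseteq> \<Omega>" "\<Omega> \<subseteq> W"
    "\<And>w. w \<in> \<Omega> \<Longrightarrow> cnj w \<in> \<Omega>"
    "\<And>\<psi> T V. \<psi> holomorphic_on \<Omega> \<Longrightarrow> inj_on \<psi> \<Omega> \<Longrightarrow> V \<subseteq> \<psi> ` \<Omega> \<Longrightarrow>
      (\<And>w. w \<in> \<Omega> \<Longrightarrow> \<psi> w \<in> V \<Longrightarrow> T (\<psi> w) = cnj (\<psi> (cnj w))) \<Longrightarrow> schwarz_on V T"
proof -
  have "compact (complex_of_real ` {a..b})"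
    by (intro compact_continuous_image compact_Icc continuous_on_of_real continuous_on_id)
  from compact_subset_open_imp_ball_epsilon_subset[OF this assms(1,2)]
  obtain e where e: "e > 0" "(\<Union>x\<in>complex_of_real ` {a..b}. ball x e) \<subseteq> W" by blast
  define c where "c = complex_of_real ((a + b) / 2)"
  \<comment> \<open>Half the length of the segment plus e / 2: the disc about the midpoint
    overshoots the ends by e / 2 only, and cut with the strip of half-width e / 2 it stays within
    distance \<open>e\<close> of the segment. The intersection is convex and symmetric under
    conjugation.\<close>
  define \<rho> where "\<rho> = (b - a) / 2 + e / 2"
  have \<rho>: "\<rho> > 0" unfolding \<rho>_def using e(1) assms(3) by (intro add_nonneg_pos) simp_all
  define \<Omega> where "\<Omega> = ball c \<rho> \<inter> {w. \<bar>Im w\<bar> < e / 2}"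
  have Rec: "Re c = (a + b) / 2" "Im c = 0" "cnj c = c" by (simp_all add: c_def)
  have strip: "{w. \<bar>Im w\<bar> < e / 2} = {w. Im w < e / 2} \<inter> {w. - (e / 2) < Im w}" by auto
  have o: "open \<Omega>" unfolding \<Omega>_def strip
    by (intro open_Int open_ball open_halfspace_Im_lt open_halfspace_Im_gt)
  have "convex \<Omega>" unfolding \<Omega>_def strip
    by (intro convex_Int convex_ball convex_halfspace_Im_lt convex_halfspace_Im_gt)
  have cnj\<Omega>: "cnj w \<in> \<Omega>" if "w \<in> \<Omega>" for w
  proof -
    have "dist (cnj c) (cnj w) = dist c w" unfolding dist_norm complex_cnj_diff[symmetric] complex_mod_cnj ..
    then show ?thesis using that by (simp add: \<Omega>_def Rec(3))
  qed
  have sub: "\<Omega> \<subseteq> W"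
  proof
    fix w assume w: "w \<in> \<Omega>"
    \<comment> \<open>The point of the interval nearest to \<open>Re w\<close>.\<close>
    define x where "x = max a (min b (Re w))"
    have x: "x \<in> {a..b}" using assms(3) by (auto simp: x_def)
    have "\<bar>Re (c - w)\<bar> \<le> norm (c - w)" by (rule abs_Re_le_cmod)
    also have "norm (c - w) < \<rho>" using w by (simp add: \<Omega>_def dist_norm)
    finally have "\<bar>Re w - (a + b) / 2\<bar> < \<rho>" by (simp add: Rec abs_minus_commute)
    then have "\<bar>x - Re w\<bar> < e / 2"
      using assms(3) e(1) unfolding x_def \<rho>_def by (simp split: split_max split_min add: abs_if field_simps split: if_splits)
    moreover have "\<bar>Im w\<bar> < e / 2" using w by (simp add: \<Omega>_def)
    moreover have "norm (complex_of_real x - w) \<le> \<bar>x - Re w\<bar> + \<bar>Im w\<bar>"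
      using cmod_le[of "complex_of_real x - w"] by simp
    ultimately have "w \<in> ball (complex_of_real x) e" by (simp add: dist_norm)
    then show "w \<in> W" using e(2) x by blast
  qed
  have seg: "complex_of_real ` {a..b} \<subseteq> \<Omega>"
  proof
    fix w assume "w \<in> complex_of_real ` {a..b}"
    then obtain x where x: "w = of_real x" "a \<le> x" "x \<le> b" by auto
    have "c - w = of_real ((a + b) / 2 - x)" by (simp add: c_def x)
    then have "norm (c - w) = \<bar>(a + b) / 2 - x\<bar>" by (simp only: norm_of_real)
    also have "\<dots> < \<rho>" using x e(1) unfolding \<rho>_def by (simp add: abs_if field_simps)
    finally show "w \<in> \<Omega>" using e(1) x(1) by (simp add: \<Omega>_def dist_norm)
  qed
  \<comment> \<open>After rescaling to the unit disc, the real diameter of the ball is mapped onto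
    the whole real line; the real coefficients and real centre make \<open>h\<close> commute with
    conjugation.\<close>
  define h where "h w = ((w - c) / of_real \<rho>) / (1 - ((w - c) / of_real \<rho>)\<^sup>2)" for w
  have disc: "(w - c) / of_real \<rho> \<in> ball 0 1" if "w \<in> \<Omega>" for w
    using that \<rho> by (simp add: \<Omega>_def norm_divide dist_norm norm_minus_commute)
  have h: "h holomorphic_on \<Omega>" unfolding h_def
  proof (intro holomorphic_intros)
    fix w assume "w \<in> \<Omega>"
    then have "norm (((w - c) / of_real \<rho>)\<^sup>2) < 1" using disc[of w] by (simp add: norm_power power_less_one_iff)
    then show "1 - ((w - c) / of_real \<rho>)\<^sup>2 \<noteq> 0" by auto
  qed (use \<rho> in simp_all)
  have ih: "inj_on h \<Omega>"
  proof (rule inj_onI)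
    fix z w assume "z \<in> \<Omega>" "w \<in> \<Omega>" "h z = h w"
    then have "(z - c) / of_real \<rho> = (w - c) / of_real \<rho>"
      using inj_onD[OF inj_dual_koebe _ disc disc, of z w] by (simp add: h_def)
    then show "z = w" using \<rho> by simp
  qed
  have cnjh: "h (cnj w) = cnj (h w)" for w by (simp add: h_def Rec)
  define D where "D = h ` \<Omega>"
  obtain k where k: "k holomorphic_on D" "\<And>w. w \<in> \<Omega> \<Longrightarrow> k (h w) = w"
    using holomorphic_has_inverse[OF h o ih] unfolding D_def by metis
  have oD: "open D" unfolding D_def by (rule open_mapping_thm3[OF h o ih])
  have "connected D" unfolding D_def
    by (intro connected_continuous_image holomorphic_on_imp_continuous_on h convex_connected \<open>convex \<Omega>\<close>)
  have real: "\<real> \<subseteq> D"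
  proof
    fix y :: complex assume "y \<in> \<real>"
    then obtain y' where y: "y = of_real y'" by (auto elim: Reals_cases)
    obtain t where t: "-1 < t" "t < 1" "t / (1 - t\<^sup>2) = y'" using dual_koebe_real by blast
    have "c + of_real (\<rho> * t) \<in> \<Omega>"
    proof -
      have "norm (of_real (\<rho> * t) :: complex) = \<rho> * \<bar>t\<bar>" using \<rho> by (simp add: norm_mult)
      also have "\<dots> < \<rho>" using t \<rho> by simp
      finally show ?thesis using e(1) by (simp add: \<Omega>_def dist_norm Rec)
    qed
    moreover have "h (c + of_real (\<rho> * t)) = y"
    proof -
      have "(c + of_real (\<rho> * t) - c) / of_real \<rho> = complex_of_real t" using \<rho> by simp
      then have "h (c + of_real (\<rho> * t)) = of_real (t / (1 - t\<^sup>2))" by (simp add: h_def)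
      then show ?thesis using t y by simp
    qed
    ultimately show "y \<in> D" unfolding D_def by blast
  qed
  have cnjD: "cnj ` D = D"
  proof -
    have c: "cnj x \<in> D" if "x \<in> D" for x
    proof -
      obtain w where "w \<in> \<Omega>" "x = h w" using \<open>x \<in> D\<close> unfolding D_def by (rule imageE)
      then show ?thesis unfolding D_def using cnj\<Omega>[of w] cnjh[of w] by (intro image_eqI[of _ _ "cnj w"]) simp_all
    qed
    then have sub: "cnj ` D \<subseteq> D" by (rule image_subsetI)
    have "D \<subseteq> cnj ` D"
    proof
      fix x assume "x \<in> D"
      from c[OF this] show "x \<in> cnj ` D" by (intro image_eqI[of _ _ "cnj x"]) simp_all
    qed
    with sub show ?thesis by (rule equalityI)
  qed
  show thesis
  proof (rule that[OF o seg sub cnj\<Omega>])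
    fix \<psi> :: cfun and T V
    assume \<psi>: "\<psi> holomorphic_on \<Omega>" "inj_on \<psi> \<Omega>" and V: "V \<subseteq> \<psi> ` \<Omega>"
      and T: "\<And>w. w \<in> \<Omega> \<Longrightarrow> \<psi> w \<in> V \<Longrightarrow> T (\<psi> w) = cnj (\<psi> (cnj w))"
    \<comment> \<open>\<open>k\<close> shrinks the real line to a bounded interval containing the
      segment, so the composite is defined near all of the real axis.\<close>
    let ?g = "\<psi> \<circ> k"
    have kD: "k ` D = \<Omega>" unfolding D_def using k(2) by (auto simp: image_image)
    have hol: "?g holomorphic_on D" by (rule holomorphic_on_compose[OF k(1)]) (use \<psi>(1) kD in simp)
    have "inj_on k D" unfolding D_def using k(2) by (auto simp: inj_on_def)
    then have inj: "inj_on ?g D" using \<psi>(2) kD by (intro comp_inj_on) auto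
    have ap: "analytic_param ?g D"
      unfolding analytic_param_def
      using oD \<open>connected D\<close> real cnjD hol inj holomorphic_injective_imp_regular[OF hol oD inj] by blast
    show "schwarz_on V T"
      unfolding schwarz_on_def
    proof (intro exI[of _ ?g] exI[of _ D] conjI ballI)
      show "analytic_param ?g D" by (rule ap)
      have "?g ` D = \<psi> ` \<Omega>" using kD by (metis image_comp)
      then show "V \<subseteq> ?g ` D" using V by simp
      fix z assume "z \<in> V"
      then obtain w where w: "w \<in> \<Omega>" "z = \<psi> w" using V by blast
      have "h w \<in> D" using w by (simp add: D_def)
      then have "the_inv_into D ?g z = h w" using the_inv_into_f_f[OF inj, of "h w"] w k(2) by simp
      moreover have "k (cnj (h w)) = cnj w" using k(2)[OF cnj\<Omega>[OF w(1)]] by (simp add: cnjh)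
      ultimately show "T z = cbar ?g (the_inv_into D ?g z)"
        using T w \<open>z \<in> V\<close> by (simp add: cbar_def)
    qed
  qed
qed

text \<open>Replaces the parametrization by its inverse \<open>g\<close>: in this coordinate the
  reflection of \<open>z\<close> at the curve is complex conjugation, \<open>y\<close> being the
  reflected point.\<close>

lemma schwarz_onD:
  assumes "schwarz_on U S" "open U"
  obtains g D where "open D" "U \<subseteq> D" "g holomorphic_on D" "inj_on g D" "open (g ` D)" "\<And>w. w \<in> g ` D \<Longrightarrow> cnj w \<in> g ` D"
    "\<And>z. z \<in> U \<Longrightarrow> \<exists>y\<in>D. g y = cnj (g z) \<and> S z = cnj y" "S holomorphic_on U"
proof -
  obtain \<gamma> E where ap: "analytic_param \<gamma> E" and U: "U \<subseteq> \<gamma> ` E"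
    and S: "\<And>z. z \<in> U \<Longrightarrow> S z = cbar \<gamma> (the_inv_into E \<gamma> z)"
    using assms(1) unfolding schwarz_on_def by blast
  have E: "open E" "cnj ` E = E" "\<gamma> holomorphic_on E" "inj_on \<gamma> E" using ap by (auto simp: analytic_param_def)
  obtain g where g: "g holomorphic_on \<gamma> ` E" "\<And>w. w \<in> E \<Longrightarrow> g (\<gamma> w) = w"
    using holomorphic_has_inverse[OF E(3,1,4)] by metis
  have gE: "g ` \<gamma> ` E = E" using g(2) by (auto simp: image_image)
  have cE: "cnj w \<in> E" if "w \<in> E" for w using that E(2) by blast
  have inv: "the_inv_into E \<gamma> z = g z" if "z \<in> \<gamma> ` E" for z
    using that the_inv_into_f_f[OF E(4)] g(2) by auto
  have Sz: "S z = cnj (\<gamma> (cnj (g z)))" if "z \<in> U" for z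
    using S[OF that] inv[of z] U that by (auto simp: cbar_def)
  have "cnj \<circ> \<gamma> \<circ> cnj holomorphic_on E" by (rule holomorphic_on_compose_cnj_cnj) (use E in auto)
  then have "(cnj \<circ> \<gamma> \<circ> cnj) \<circ> g holomorphic_on \<gamma> ` E"
    by (intro holomorphic_on_compose[of g "\<gamma> ` E"] g(1)) (simp add: gE)
  then have "(\<lambda>z. cnj (\<gamma> (cnj (g z)))) holomorphic_on U"
    using U by (auto simp: o_def intro: holomorphic_on_subset)
  then have hol: "S holomorphic_on U" by (rule holomorphic_transform) (simp add: Sz)
  show thesis
  proof (rule that[of "\<gamma> ` E" g])
    show "open (\<gamma> ` E)" by (rule open_mapping_thm3[OF E(3,1,4)])
    show "inj_on g (\<gamma> ` E)" using g(2) by (auto simp: inj_on_def)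
    show "\<exists>y\<in>\<gamma> ` E. g y = cnj (g z) \<and> S z = cnj y" if "z \<in> U" for z
    proof (rule bexI[of _ "\<gamma> (cnj (g z))"])
      have "g z \<in> E" using that U gE by blast
      then show "\<gamma> (cnj (g z)) \<in> \<gamma> ` E" "g (\<gamma> (cnj (g z))) = cnj (g z) \<and> S z = cnj (\<gamma> (cnj (g z)))"
        using cE g(2) Sz[OF that] by auto
    qed
  qed (use U g(1) gE E(1) cE hol in auto)
qed

lemma schwarz_on_subset: "schwarz_on U S \<Longrightarrow> V \<subseteq> U \<Longrightarrow> schwarz_on V S"
  unfolding schwarz_on_def by (meson subset_iff)

text \<open>Reflection conjugates the coordinate, so reflecting twice restores its value, and the
  coordinate is injective. The reflected point has to lie in \<open>U\<close> for the second
  reflection to be covered.\<close>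

lemma schwarz_on_involution:
  assumes "schwarz_on U S" "open U" "z \<in> U" "cnj (S z) \<in> U"
  shows "cnj (S (cnj (S z))) = z"
proof -
  obtain g D where D: "U \<subseteq> D" "inj_on g D" "\<And>z. z \<in> U \<Longrightarrow> \<exists>y\<in>D. g y = cnj (g z) \<and> S z = cnj y"
    using schwarz_onD[OF assms(1,2)] by metis
  obtain y where y: "y \<in> D" "g y = cnj (g z)" "S z = cnj y" using D(3)[OF assms(3)] by blast
  have "y \<in> U" using assms(4) y(3) by simp
  then obtain x where x: "x \<in> D" "g x = cnj (g y)" "S y = cnj x" using D(3) by blast
  have "x = z" using inj_onD[OF D(2), of x z] x y assms(3) D(1) by auto
  then show ?thesis using x y by simp
qed

section \<open>Germs along the curve for parameters near zero\<close>

lemma near0_mono: "near0 K P \<Longrightarrow> (\<And>r z. P r z \<Longrightarrow> Q r z) \<Longrightarrow> near0 K Q"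
  unfolding near0_def by meson

lemma near0_conj:
  assumes "near0 K P" "near0 K Q" shows "near0 K (\<lambda>r z. P r z \<and> Q r z)"
proof -
  obtain N U where 1: "open N" "0 \<in> N" "open U" "K \<subseteq> U" "\<forall>r\<in>N. \<forall>z\<in>U. P r z"
    using assms(1) unfolding near0_def by (elim exE conjE)
  obtain N' U' where 2: "open N'" "0 \<in> N'" "open U'" "K \<subseteq> U'" "\<forall>r\<in>N'. \<forall>z\<in>U'. Q r z"
    using assms(2) unfolding near0_def by (elim exE conjE)
  show ?thesis unfolding near0_def
    by (intro exI[of _ "N \<inter> N'"] exI[of _ "U \<inter> U'"]) (use 1 2 in auto)
qed

lemma near0_open:
  assumes "near0 K P" shows "near0 K (\<lambda>r z. \<forall>\<^sub>F x in nhds (r, z). P (fst x) (snd x))"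
proof -
  obtain N U where 1: "open N" "0 \<in> N" "open U" "K \<subseteq> U" "\<forall>r\<in>N. \<forall>z\<in>U. P r z"
    using assms(1) unfolding near0_def by (elim exE conjE)
  have "\<forall>\<^sub>F x in nhds (r, z). P (fst x) (snd x)" if "r \<in> N" "z \<in> U" for r z
    unfolding eventually_nhds by (intro exI[of _ "N \<times> U"]) (use that 1 open_Times in auto)
  then show ?thesis unfolding near0_def by (intro exI[of _ N] exI[of _ U]) (use 1 in auto)
qed

lemma near0_at0: "near0 K P \<Longrightarrow> near K (P 0)"
  unfolding near0_def near_def by meson

lemma near0_const: "near K P \<Longrightarrow> near0 K (\<lambda>_. P)"
  unfolding near0_def near_def by (meson UNIV_I open_UNIV)

lemma near0_param:
  fixes h :: "'q::real_normed_vector \<Rightarrow> 'p::real_normed_vector"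
  assumes "near0 K P" "isCont h 0" "h 0 = 0" shows "near0 K (\<lambda>r. P (h r))"
proof -
  obtain N U where 1: "open N" "0 \<in> N" "open U" "K \<subseteq> U" "\<forall>r\<in>N. \<forall>z\<in>U. P r z"
    using assms(1) unfolding near0_def by (elim exE conjE)
  have "\<forall>\<^sub>F s in nhds (h 0). s \<in> N" using 1 assms(3) by (simp add: eventually_nhds_in_open)
  then have "\<forall>\<^sub>F r in nhds 0. h r \<in> N" by (rule eventually_nhds_compose[OF assms(2)])
  then obtain M where "open M" "0 \<in> M" "\<forall>r\<in>M. h r \<in> N" unfolding eventually_nhds by (elim exE conjE)
  then show ?thesis unfolding near0_def by (intro exI[of _ M] exI[of _ U]) (use 1 in auto)
qed

lemma near0_smooth: "smooth_at u 0 \<Longrightarrow> near0 K (\<lambda>r z. smooth_at u r)"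
  using smooth_at_eventually[of u 0] unfolding near0_def eventually_nhds
  by (meson UNIV_I open_UNIV subset_UNIV)

lemma near_conj: "near K P \<Longrightarrow> near K Q \<Longrightarrow> near K (\<lambda>z. P z \<and> Q z)"
  unfolding near_iff by (simp add: eventually_conj_iff)

lemma near_mono: "near K P \<Longrightarrow> (\<And>z. P z \<Longrightarrow> Q z) \<Longrightarrow> near K Q"
  unfolding near_def by meson

lemma near_open: "near K P \<Longrightarrow> near K (\<lambda>z. \<forall>\<^sub>F w in nhds z. P w)"
  unfolding near_def eventually_nhds by meson

lemma near0_hsm:
  assumes "compact K" shows "near0 K (\<lambda>r z. hsm Y (r, z)) \<longleftrightarrow> (\<forall>k\<in>K. hsm Y (0, k))"
proof
  assume "near0 K (\<lambda>r z. hsm Y (r, z))"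
  then show "\<forall>k\<in>K. hsm Y (0, k)" unfolding near0_def by blast
next
  assume "\<forall>k\<in>K. hsm Y (0, k)"
  then show "near0 K (\<lambda>r z. hsm Y (r, z))" unfolding near0_iff[OF assms] prod.collapse
    using hsm_eventually by blast
qed

lemma schwarz_on_cong: "schwarz_on U S \<Longrightarrow> (\<And>z. z \<in> U \<Longrightarrow> S z = S' z) \<Longrightarrow> schwarz_on U S'"
  unfolding schwarz_on_def by (metis (no_types, lifting))

text \<open>All conditions on a family concern values near \<open>K\<close> and parameters near 0,
  so the domains may be shrunk to the part where both families agree.\<close>

lemma schwarz_family_cong:
  assumes "schwarz_family K S T" "near0 K (\<lambda>r z. T r z = T' r z)"
  shows "schwarz_family K S T'"
proof -
  obtain N U where 1: "open N" "0 \<in> N" "open U" "K \<subseteq> U" "smooth_on (N \<times> U) (\<lambda>(r, z). T r z)"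
      "\<forall>r\<in>N. schwarz_on U (T r)" and b: "near K (\<lambda>z. T 0 z = S z)"
    using assms(1) unfolding schwarz_family_def by (elim exE conjE)
  obtain N' U' where 2: "open N'" "0 \<in> N'" "open U'" "K \<subseteq> U'" "\<forall>r\<in>N'. \<forall>z\<in>U'. T r z = T' r z"
    using assms(2) unfolding near0_def by (elim exE conjE)
  have o: "open ((N \<inter> N') \<times> (U \<inter> U'))" using 1 2 by (intro open_Times open_Int)
  have "smooth_on ((N \<inter> N') \<times> (U \<inter> U')) (\<lambda>(r, z). T' r z)"
    unfolding smooth_on_def
  proof
    fix k
    have "Ck_on k ((N \<inter> N') \<times> (U \<inter> U')) (\<lambda>(r, z). T r z)"
      by (rule Ck_on_subset[of _ "N \<times> U"]) (use 1(5) in \<open>auto simp: smooth_on_def\<close>)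
    then show "Ck_on k ((N \<inter> N') \<times> (U \<inter> U')) (\<lambda>(r, z). T' r z)"
      by (rule Ck_on_cong[OF o, THEN iffD1, rotated]) (use 2(5) in auto)
  qed
  moreover have "schwarz_on (U \<inter> U') (T' r)" if "r \<in> N \<inter> N'" for r
    by (rule schwarz_on_cong[OF schwarz_on_subset[of U "T r"]]) (use 1 2 that in auto)
  moreover have "near K (\<lambda>z. T' 0 z = S z)"
    by (rule near_mono[OF near_conj[OF near0_at0[OF assms(2)] b]]) metis
  ultimately show ?thesis unfolding schwarz_family_def
    by (intro conjI exI[of _ "N \<inter> N'"] exI[of _ "U \<inter> U'"]) (use 1 2 in auto)
qed

text \<open>The inverse of a parametrization; \<open>K\<close> corresponds to a segment of the real axis.\<close>

definition straightening :: "complex set \<Rightarrow> cfun \<Rightarrow> cfun \<Rightarrow> bool" where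
  "straightening K S g \<longleftrightarrow> (\<exists>a b::real. a \<le> b \<and> g ` K = complex_of_real ` {a..b}) \<and> inj_on g K \<and>
     (\<forall>k\<in>K. g analytic_on {k} \<and> deriv g k \<noteq> 0) \<and> near K (\<lambda>z. g (cnj (S z)) = cnj (g z))"

locale schwarz_germ =
  fixes K :: "complex set" and S :: cfun
  assumes along: "schwarz_along K S"
begin

lemma compact_K: "compact K" and K_nonempty: "K \<noteq> {}" and S_on_K: "k \<in> K \<Longrightarrow> S k = cnj k"
  using along by (auto simp: schwarz_along_def)

lemma S_analytic: "k \<in> K \<Longrightarrow> S analytic_on {k}"
  using along schwarz_onD unfolding schwarz_along_def analytic_at by (metis subsetD)

lemma near0_pull:
  assumes "near0 K P" "\<And>k. k \<in> K \<Longrightarrow> isCont (\<lambda>x. f (fst x) (snd x)) (0, k)" "\<And>k. k \<in> K \<Longrightarrow> f 0 k = k"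
  shows "near0 K (\<lambda>r z. P r (f r z))"
  unfolding near0_iff[OF compact_K]
proof
  fix k assume k: "k \<in> K"
  have "isCont (\<lambda>x. (fst x, f (fst x) (snd x))) (0, k)"
    by (intro continuous_Pair continuous_fst continuous_ident assms(2)[OF k])
  moreover have "\<forall>\<^sub>F x in nhds (fst (0, k), f (fst (0, k)) (snd (0, k))). P (fst x) (snd x)"
    using assms(1) k assms(3)[OF k] by (simp add: near0_iff[OF compact_K])
  ultimately have "\<forall>\<^sub>F x in nhds (0, k). P (fst (fst x, f (fst x) (snd x))) (snd (fst x, f (fst x) (snd x)))"
    by (rule eventually_nhds_compose)
  then show "\<forall>\<^sub>F x in nhds (0, k). P (fst x) (f (fst x) (snd x))" by simp
qed

text \<open>At parameter 0 the points of \<open>K\<close> are fixed by the reflection, so the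
  reflections of points near \<open>K\<close> stay near \<open>K\<close>: what holds near
  \<open>K\<close> also holds at reflected points.\<close>

lemma near0_pull_cnj:
  fixes T :: "'p::euclidean_space \<Rightarrow> cfun"
  assumes "near0 K P" "\<And>k. k \<in> K \<Longrightarrow> hsm T (0, k)" "\<And>k. k \<in> K \<Longrightarrow> T 0 k = cnj k"
  shows "near0 K (\<lambda>r z. P r (cnj (T r z)))"
proof (rule near0_pull[OF assms(1)])
  fix k assume k: "k \<in> K"
  show "isCont (\<lambda>x. cnj (T (fst x) (snd x))) (0, k)"
    by (intro isCont_o2[OF hsm_continuous[OF assms(2)[OF k]]] continuous_intros)
qed (simp add: assms)

text \<open>The coordinate is real on \<open>K\<close> because \<open>K\<close> is fixed by the
  reflection, and a nonempty compact connected set of reals is an interval.\<close>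

lemma straightening_exists: "\<exists>g. straightening K S g"
proof -
  obtain U where U: "open U" "K \<subseteq> U" "schwarz_on U S"
    using along unfolding schwarz_along_def by (elim exE conjE)
  obtain g D where D: "open D" "U \<subseteq> D" "g holomorphic_on D" "inj_on g D" 
      "\<And>z. z \<in> U \<Longrightarrow> \<exists>y\<in>D. g y = cnj (g z) \<and> S z = cnj y" "S holomorphic_on U"
    using schwarz_onD[OF U(3,1)] by metis
  have eq: "g (cnj (S z)) = cnj (g z)" if "z \<in> U" for z
    using D(5)[OF that] by auto
  have re: "g k = of_real (Re (g k))" if "k \<in> K" for k
  proof -
    have "cnj (g k) = g k" using eq[of k] S_on_K[OF that] U(2) that by auto
    then show ?thesis by (simp add: complex_eq_iff)
  qed
  have cont: "continuous_on K g"
    by (rule continuous_on_subset[OF holomorphic_on_imp_continuous_on[OF D(3)] order_trans[OF U(2) D(2)]])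
  have "connected (Re ` g ` K) \<and> compact (Re ` g ` K)"
    using along compact_K cont unfolding schwarz_along_def
    by (intro conjI connected_continuous_image compact_continuous_image continuous_intros) auto
  then have "\<exists>a b. Re ` g ` K = {a..b}" by (simp only: connected_compact_interval_1)
  then obtain a b where ab: "Re ` g ` K = {a..b}" by (elim exE)
  have "Re ` g ` K \<noteq> {}" using K_nonempty by blast
  then have "a \<le> b" unfolding ab by simp
  moreover have "complex_of_real ` {a..b} = g ` K"
    unfolding ab[symmetric] image_image by (rule image_cong[OF refl re[symmetric]])
  moreover have "inj_on g K" by (rule inj_on_subset[OF D(4) order_trans[OF U(2) D(2)]])
  moreover have "g analytic_on {k} \<and> deriv g k \<noteq> 0" if "k \<in> K" for k
  proof
    have kD: "k \<in> D" using that U(2) D(2) by blast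
    then show "g analytic_on {k}" unfolding analytic_at by (intro exI[of _ D] conjI D(1,3))
    show "deriv g k \<noteq> 0" by (rule holomorphic_injective_imp_regular[OF D(3,1,4) kD])
  qed
  moreover have "near K (\<lambda>z. g (cnj (S z)) = cnj (g z))"
    unfolding near_def by (intro exI[of _ U] conjI U ballI eq)
  ultimately show ?thesis unfolding straightening_def
    by (intro exI[of _ g] conjI ballI exI[of _ a] exI[of _ b]) simp_all
qed

lemma family_base: "schwarz_family K S T \<Longrightarrow> near K (\<lambda>z. T 0 z = S z)"
  by (simp add: schwarz_family_def)

lemma family_base_at: "schwarz_family K S T \<Longrightarrow> k \<in> K \<Longrightarrow> T 0 k = cnj k"
  using family_base S_on_K unfolding near_def by force

lemma family_hsm:
  assumes "schwarz_family K S T" "k \<in> K" shows "hsm T (0, k)"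
proof -
  obtain N U where 1: "open N" "0 \<in> N" "open U" "K \<subseteq> U" "smooth_on (N \<times> U) (\<lambda>(r, z). T r z)"
      "\<forall>r\<in>N. schwarz_on U (T r)"
    using assms(1) unfolding schwarz_family_def by (elim exE conjE)
  have o: "open (N \<times> U)" using 1 by (intro open_Times)
  have "smooth_at (\<lambda>x. T (fst x) (snd x)) (0, k)"
    unfolding smooth_at_def using o 1 assms(2) by (intro exI[of _ "N \<times> U"]) (auto simp: case_prod_beta')
  moreover have "T r field_differentiable (at z)" if "r \<in> N" "z \<in> U" for r z
    using schwarz_onD[of U "T r"] 1 that holomorphic_on_imp_differentiable_at by metis
  ultimately show ?thesis unfolding hsm_def eventually_nhds using o 1 assms(2)
    by (intro conjI exI[of _ "N \<times> U"]) auto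
qed

lemma family_near0_hsm: "schwarz_family K S T \<Longrightarrow> near0 K (\<lambda>r z. hsm T (r, z))"
  using family_hsm near0_hsm[OF compact_K] by blast

lemma near0_reflect:
  "schwarz_family K S T \<Longrightarrow> near0 K P \<Longrightarrow> near0 K (\<lambda>r z. P r (cnj (T r z)))"
  by (rule near0_pull_cnj) (auto simp: family_hsm family_base_at)

lemma family_involution:
  assumes "schwarz_family K S T" shows "near0 K (\<lambda>r z. cnj (T r (cnj (T r z))) = z)"
proof -
  obtain N U where 1: "open N" "0 \<in> N" "open U" "K \<subseteq> U" "\<forall>r\<in>N. schwarz_on U (T r)"
    using assms(1) unfolding schwarz_family_def by (elim exE conjE)
  have "near0 K (\<lambda>r z. r \<in> N \<and> z \<in> U)" unfolding near0_def using 1 by blast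
  from near0_conj[OF this near0_reflect[OF assms this]]
  show ?thesis by (rule near0_mono) (use schwarz_on_involution 1 in blast)
qed

lemma straightening_param:
  fixes \<kappa> :: "'p::euclidean_space \<Rightarrow> cfun"
  assumes g: "straightening K S g" and \<kappa>: "near0 K (\<lambda>r z. hsm \<kappa> (r, z))" and base: "near K (\<lambda>z. \<kappa> 0 z = g z)"
  obtains N U W \<psi> where "open N" "(0::'p) \<in> N" "open U" "K \<subseteq> U" "open W" "g ` K \<subseteq> W"
    "\<And>r. r \<in> N \<Longrightarrow> inj_on (\<kappa> r) U"
    "\<And>r y. r \<in> N \<Longrightarrow> y \<in> W \<Longrightarrow> \<psi> r y \<in> U \<and> \<kappa> r (\<psi> r y) = y \<and> hsm \<psi> (r, y)"
proof -
  have h: "hsm \<kappa> (0, k)" if "k \<in> K" for k using \<kappa> near0_hsm[OF compact_K] that by blast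
  have eq: "\<kappa> 0 k = g k" if "k \<in> K" for k using base that unfolding near_def by blast
  have "deriv (\<kappa> 0) k = deriv g k" if "k \<in> K" for k
    by (rule deriv_cong_ev) (use base that near_iff in auto)
  then have "deriv (\<kappa> 0) k \<noteq> 0" if "k \<in> K" for k using g that by (simp add: straightening_def)
  moreover have "inj_on (\<kappa> 0) K" using g eq by (simp add: straightening_def inj_on_def)
  moreover have "\<kappa> 0 ` K = g ` K" using eq by simp
  ultimately show thesis using hsm_inverse_family[OF compact_K h] that by (metis (no_types, lifting))
qed

text \<open>Conjugation in the coordinate \<open>\<kappa> r\<close>, carried back by its inverse
  \<open>\<psi> r\<close>, is the reflection in the curve on which \<open>\<kappa> r\<close> is
  real. Coordinates can be perturbed by adding functions, which Schwarz functions do not allow; this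
  is what makes families with prescribed behaviour easy to write down.\<close>

lemma realize:
  fixes \<kappa> :: "'p::euclidean_space \<Rightarrow> cfun"
  assumes g: "straightening K S g" and \<kappa>: "near0 K (\<lambda>r z. hsm \<kappa> (r, z))" and base: "near K (\<lambda>z. \<kappa> 0 z = g z)"
  shows "\<exists>T. schwarz_family K S T \<and> near0 K (\<lambda>r z. \<kappa> r (cnj (T r z)) = cnj (\<kappa> r z))"
proof -
  obtain N U W \<psi> where N: "open N" "(0::'p) \<in> N" "open U" "K \<subseteq> U" "open W" "g ` K \<subseteq> W"
    and inj: "\<And>r. r \<in> N \<Longrightarrow> inj_on (\<kappa> r) U"
    and \<psi>: "\<And>r y. r \<in> N \<Longrightarrow> y \<in> W \<Longrightarrow> \<psi> r y \<in> U \<and> \<kappa> r (\<psi> r y) = y \<and> hsm \<psi> (r, y)"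
    using straightening_param[OF assms] by metis
  obtain a b where ab: "a \<le> b" "g ` K = complex_of_real ` {a..b}"
    using g by (auto simp: straightening_def)
  obtain \<Omega> where \<Omega>: "open \<Omega>" "complex_of_real ` {a..b} \<subseteq> \<Omega>" "\<Omega> \<subseteq> W" "\<And>w. w \<in> \<Omega> \<Longrightarrow> cnj w \<in> \<Omega>"
    and son: "\<And>\<psi> T V. \<psi> holomorphic_on \<Omega> \<Longrightarrow> inj_on \<psi> \<Omega> \<Longrightarrow> V \<subseteq> \<psi> ` \<Omega> \<Longrightarrow>
      (\<And>w. w \<in> \<Omega> \<Longrightarrow> \<psi> w \<in> V \<Longrightarrow> T (\<psi> w) = cnj (\<psi> (cnj w))) \<Longrightarrow> schwarz_on V T"
    using schwarz_on_of_segment[OF N(5) _ ab(1)] N(6) ab(2) by metis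
  define T where "T r z = cnj (\<psi> r (cnj (\<kappa> r z)))" for r z
  have eq0: "\<kappa> 0 k = g k" if "k \<in> K" for k using base that unfolding near_def by blast
  have "near0 K (\<lambda>r z. \<kappa> r z \<in> \<Omega>)"
    unfolding near0_iff[OF compact_K]
  proof
    fix k assume k: "k \<in> K"
    have "\<kappa> 0 k \<in> \<Omega>" using eq0[OF k] k ab \<Omega>(2) by auto
    then have "\<forall>\<^sub>F w in nhds (\<kappa> (fst (0, k)) (snd (0, k))). w \<in> \<Omega>" using \<Omega>(1) by (simp add: eventually_nhds_in_open)
    moreover have "isCont (\<lambda>x. \<kappa> (fst x) (snd x)) (0, k)"
      using \<kappa> near0_hsm[OF compact_K] k by (intro hsm_continuous) blast
    ultimately show "\<forall>\<^sub>F x in nhds (0, k). \<kappa> (fst x) (snd x) \<in> \<Omega>"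
      by (intro eventually_nhds_compose[where P="\<lambda>w. w \<in> \<Omega>" and g="\<lambda>x. \<kappa> (fst x) (snd x)"])
  qed
  moreover have "near0 K (\<lambda>r z. r \<in> N \<and> z \<in> U)" unfolding near0_def using N by blast
  ultimately have "near0 K (\<lambda>r z. hsm \<kappa> (r, z) \<and> \<kappa> r z \<in> \<Omega> \<and> r \<in> N \<and> z \<in> U)"
    by (rule near0_conj[OF \<kappa> near0_conj])
  then obtain M V where M: "open M" "0 \<in> M" "open V" "K \<subseteq> V"
    and V: "\<And>r z. r \<in> M \<Longrightarrow> z \<in> V \<Longrightarrow> hsm \<kappa> (r, z) \<and> \<kappa> r z \<in> \<Omega> \<and> r \<in> N \<and> z \<in> U"
    unfolding near0_def by (elim exE conjE) blast
  have h: "hsm T (r, z)" if "r \<in> M" "z \<in> V" for r z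
    unfolding T_def
  proof (rule hsm_cnj_compose[where h="\<lambda>r. r" and Y=\<psi>])
    have "cnj (\<kappa> r z) \<in> W" using V[OF that] \<Omega>(3,4) by blast
    then show "hsm \<psi> (fst (r, z), cnj (\<kappa> (fst (r, z)) (snd (r, z))))" using V[OF that] \<psi> by simp
  qed (use V[OF that] in simp_all)
  have "smooth_on (M \<times> V) (\<lambda>(r, z). T r z)"
    using h hsm_smooth smooth_on_iff_smooth_at[OF open_Times[OF M(1,3)]] by (fastforce simp: case_prod_beta')
  moreover have "schwarz_on V (T r)" if r: "r \<in> M" for r
  proof (rule son[of "\<psi> r"])
    \<comment> \<open>The point only serves to extract \<open>r \<in> N\<close> from a statement
      about pairs of a parameter and a point.\<close>
    obtain k where "k \<in> V" using M(4) K_nonempty by blast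
    then have rN: "r \<in> N" using V[OF r] by blast
    show "\<psi> r holomorphic_on \<Omega>" unfolding holomorphic_on_def
      using \<psi>[OF rN] \<Omega>(3) hsm_field_differentiable field_differentiable_at_within by blast
    show "inj_on (\<psi> r) \<Omega>" using \<psi>[OF rN] \<Omega>(3) by (metis inj_onI subsetD)
    show "V \<subseteq> \<psi> r ` \<Omega>"
    proof
      fix z assume "z \<in> V"
      then have z: "\<kappa> r z \<in> \<Omega>" "z \<in> U" using V[OF r] by blast+
      then have "\<psi> r (\<kappa> r z) = z" using \<psi>[OF rN, of "\<kappa> r z"] \<Omega>(3) inj_onD[OF inj[OF rN], of "\<psi> r (\<kappa> r z)" z] by blast
      then show "z \<in> \<psi> r ` \<Omega>" using z by (metis imageI)
    qed
    show "T r (\<psi> r w) = cnj (\<psi> r (cnj w))" if "w \<in> \<Omega>" for w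
      using \<psi>[OF rN, of w] \<Omega>(3) that by (auto simp: T_def)
  qed
  \<comment> \<open>At parameter 0 both \<open>\<psi> 0 (cnj (\<kappa> 0 z))\<close> and
    \<open>cnj (S z)\<close> have the coordinate \<open>cnj (g z)\<close>, and the coordinate is
    injective on \<open>U\<close>.\<close>
  moreover have "near K (\<lambda>z. T 0 z = S z)"
  proof -
    have refl: "near K (\<lambda>z. P (cnj (S z)))" if "near K P" for P
    proof -
      have c: "isCont (\<lambda>x::'p \<times> complex. cnj (S (snd x))) (0, k)" if "k \<in> K" for k
      proof -
        have "isCont S k"
          by (rule field_differentiable_imp_continuous_at[OF analytic_on_imp_differentiable_at[OF S_analytic[OF that]]]) simp
        then have "isCont (\<lambda>z. cnj (S z)) k" by (intro continuous_intros)
        moreover have s: "isCont snd (0::'p, k)" by (intro continuous_intros)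
        ultimately show ?thesis by (intro isCont_o2[OF s]) (simp only: snd_conv)
      qed
      have "near0 K (\<lambda>r::'p. \<lambda>z. P (cnj (S z)))"
        by (rule near0_pull[OF near0_const[OF that]]) (use c S_on_K in auto)
      from near0_at0[OF this] show ?thesis .
    qed
    have "near K (\<lambda>z. z \<in> V)" "near K (\<lambda>z. z \<in> U)" unfolding near_def using M N by blast+
    then have "near K (\<lambda>z. z \<in> V \<and> \<kappa> 0 z = g z \<and> cnj (S z) \<in> U \<and> \<kappa> 0 (cnj (S z)) = g (cnj (S z)) \<and> g (cnj (S z)) = cnj (g z))"
      using base g refl[OF base] refl[of "\<lambda>z. z \<in> U"] unfolding straightening_def by (intro near_conj) auto
    then show ?thesis
    proof (rule near_mono)
      fix z assume z: "z \<in> V \<and> \<kappa> 0 z = g z \<and> cnj (S z) \<in> U \<and> \<kappa> 0 (cnj (S z)) = g (cnj (S z)) \<and> g (cnj (S z)) = cnj (g z)"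
      then have "cnj (\<kappa> 0 z) \<in> W" using V[OF M(2)] \<Omega> by blast
      then have "\<psi> 0 (cnj (\<kappa> 0 z)) \<in> U" "\<kappa> 0 (\<psi> 0 (cnj (\<kappa> 0 z))) = cnj (\<kappa> 0 z)" using \<psi>[OF N(2)] by blast+
      then have "\<psi> 0 (cnj (\<kappa> 0 z)) = cnj (S z)" using inj_onD[OF inj[OF N(2)], of "\<psi> 0 (cnj (\<kappa> 0 z))" "cnj (S z)"] z by simp
      then show "T 0 z = S z" by (simp add: T_def)
    qed
  qed
  ultimately have "schwarz_family K S T" unfolding schwarz_family_def using M by blast
  moreover have "\<kappa> r (cnj (T r z)) = cnj (\<kappa> r z)" if "r \<in> M" "z \<in> V" for r z
    using V[OF that] \<psi>[of r "cnj (\<kappa> r z)"] \<Omega> by (auto simp: T_def)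
  then have "near0 K (\<lambda>r z. \<kappa> r (cnj (T r z)) = cnj (\<kappa> r z))" unfolding near0_def using M by blast
  ultimately show ?thesis by blast
qed

text \<open>The reflected point is the only point near \<open>K\<close> with the conjugate
  coordinate, so a family is identified by any coordinate in which its reflection becomes
  conjugation.\<close>

lemma realize_unique:
  fixes \<kappa> T T' :: "'p::euclidean_space \<Rightarrow> cfun"
  assumes g: "straightening K S g" and \<kappa>: "near0 K (\<lambda>r z. hsm \<kappa> (r, z))" and base: "near K (\<lambda>z. \<kappa> 0 z = g z)"
    and T: "\<And>k. k \<in> K \<Longrightarrow> hsm T (0, k)" "\<And>k. k \<in> K \<Longrightarrow> T 0 k = cnj k" "near0 K (\<lambda>r z. \<kappa> r (cnj (T r z)) = cnj (\<kappa> r z))"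
    and T': "\<And>k. k \<in> K \<Longrightarrow> hsm T' (0, k)" "\<And>k. k \<in> K \<Longrightarrow> T' 0 k = cnj k" "near0 K (\<lambda>r z. \<kappa> r (cnj (T' r z)) = cnj (\<kappa> r z))"
  shows "near0 K (\<lambda>r z. T r z = T' r z)"
proof -
  obtain N U where N: "open N" "(0::'p) \<in> N" "open U" "K \<subseteq> U" and inj: "\<And>r. r \<in> N \<Longrightarrow> inj_on (\<kappa> r) U"
    using straightening_param[OF g \<kappa> base] by metis
  have NU: "near0 K (\<lambda>r z. r \<in> N \<and> z \<in> U)" unfolding near0_def using N by blast
  from near0_conj[OF near0_conj[OF T(3) T'(3)]
      near0_conj[OF near0_pull_cnj[OF NU T(1,2)] near0_pull_cnj[OF NU T'(1,2)]]]
  show ?thesis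
  proof (rule near0_mono)
    fix r z assume "(\<kappa> r (cnj (T r z)) = cnj (\<kappa> r z) \<and> \<kappa> r (cnj (T' r z)) = cnj (\<kappa> r z)) \<and>
      (r \<in> N \<and> cnj (T r z) \<in> U) \<and> r \<in> N \<and> cnj (T' r z) \<in> U"
    then have "cnj (T r z) = cnj (T' r z)" using inj_onD[OF inj, of r "cnj (T r z)" "cnj (T' r z)"] by simp
    then show "T r z = T' r z" by simp
  qed
qed

definition chart :: "cfun \<Rightarrow> ('p \<Rightarrow> cfun) \<Rightarrow> 'p \<Rightarrow> cfun" where
  "chart g T r z = (g z + cnj (g (cnj (T r z)))) / 2"

text \<open>At parameter 0 both terms of the average equal \<open>g\<close>, by the straightening
  property, so the average is a deformation of \<open>g\<close> itself.\<close>

lemma chart_props: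
  fixes T :: "'p::euclidean_space \<Rightarrow> cfun"
  assumes g: "straightening K S g" and T: "\<And>k. k \<in> K \<Longrightarrow> hsm T (0, k)" "near K (\<lambda>z. T 0 z = S z)"
    "near0 K (\<lambda>r z. cnj (T r (cnj (T r z))) = z)"
  shows "near0 K (\<lambda>r z. hsm (chart g T) (r, z))" "near K (\<lambda>z. chart g T 0 z = g z)"
    "near0 K (\<lambda>r z. chart g T r (cnj (T r z)) = cnj (chart g T r z))"
proof -
  have T0: "T 0 k = cnj k" if "k \<in> K" for k using T(2) S_on_K that unfolding near_def by force
  have "hsm (chart g T) (0, k)" if "k \<in> K" for k
  proof -
    have ga: "g analytic_on {k}" using g that by (simp add: straightening_def)
    have "hsm (\<lambda>r z. cnj (g (cnj (T r z)))) (0, k)"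
      by (rule hsm_cnj_compose[where h="\<lambda>r. r" and Y="\<lambda>_. g"])
        (use ga T(1)[OF that] T0[OF that] hsm_analytic_const in auto)
    then show ?thesis unfolding chart_def
      by (intro hsm_divide hsm_add hsm_analytic_const hsm_const) (use ga in simp_all)
  qed
  then show "near0 K (\<lambda>r z. hsm (chart g T) (r, z))" using near0_hsm[OF compact_K] by blast
  have "near K (\<lambda>z. g (cnj (S z)) = cnj (g z))" using g by (simp add: straightening_def)
  from near_conj[OF this T(2)] show "near K (\<lambda>z. chart g T 0 z = g z)"
    by (rule near_mono) (simp add: chart_def)
  show "near0 K (\<lambda>r z. chart g T r (cnj (T r z)) = cnj (chart g T r z))"
    by (rule near0_mono[OF T(3)]) (simp add: chart_def add.commute)
qed

text \<open>The chart of \<open>T\<close> is realized by some family \<open>T'\<close>; both have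
  the reflection that the chart turns into conjugation, hence they agree. Products,
  reparametrizations and conformal images are recognized as families by this criterion.\<close>

lemma schwarz_familyI:
  fixes T :: "'p::euclidean_space \<Rightarrow> cfun"
  assumes "\<And>k. k \<in> K \<Longrightarrow> hsm T (0, k)" "near K (\<lambda>z. T 0 z = S z)" "near0 K (\<lambda>r z. cnj (T r (cnj (T r z))) = z)"
  shows "schwarz_family K S T"
proof -
  obtain g where g: "straightening K S g" using straightening_exists by blast
  have T0: "T 0 k = cnj k" if "k \<in> K" for k using assms(2) S_on_K that unfolding near_def by force
  note c = chart_props[OF g assms]
  obtain T' where T': "schwarz_family K S T'" "near0 K (\<lambda>r z. chart g T r (cnj (T' r z)) = cnj (chart g T r z))"
    using realize[OF g c(1,2)] by blast
  have "near0 K (\<lambda>r z. T' r z = T r z)"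
    by (rule realize_unique[OF g c(1,2) _ _ T'(2) assms(1) T0 c(3)])
      (use family_hsm[OF T'(1)] family_base_at[OF T'(1)] in auto)
  then show ?thesis by (rule schwarz_family_cong[OF T'(1)])
qed

end

section \<open>Division by the parameter\<close>

text \<open>Differentiation under the integral sign. Differentiating \<open>G (x * s, z)\<close> in
  \<open>s\<close> brings out a factor \<open>x\<close>, so a weight \<open>\<omega>\<close> is
  carried along to make this class of integrals closed under differentiation.\<close>

lemma integral_has_derivative:
  fixes G :: "real \<times> complex \<Rightarrow> complex" and \<omega> :: "real \<Rightarrow> real"
  assumes G: "Ck_on 1 (ball 0 e \<times> ball k d) G" and \<omega>: "continuous_on (cbox 0 1) \<omega>" and p: "p \<in> ball 0 e \<times> ball k d"
  shows "((\<lambda>p. integral (cbox 0 1) (\<lambda>x. \<omega> x *\<^sub>R G (x * fst p, snd p))) has_derivative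
    (\<lambda>v. fst v *\<^sub>R integral (cbox 0 1) (\<lambda>x. (x * \<omega> x) *\<^sub>R frechet_derivative G (at (x * fst p, snd p)) (1, 0))
       + integral (cbox 0 1) (\<lambda>x. \<omega> x *\<^sub>R frechet_derivative G (at (x * fst p, snd p)) (0, snd v)))) (at p)"
proof -
  let ?M = "ball (0::real) e \<times> ball k d"
  let ?s = "\<lambda>x p. (x * fst p, snd p)"
  let ?D = "\<lambda>x p v. \<omega> x *\<^sub>R frechet_derivative G (at (?s x p)) (x * fst v, snd v)"
  have M: "open ?M" "convex ?M" by (intro open_Times convex_Times open_ball convex_ball)+
  have s: "?s x q \<in> ?M" if "q \<in> ?M" "x \<in> cbox 0 1" for x q
  proof -
    have "\<bar>x * fst q\<bar> \<le> 1 * \<bar>fst q\<bar>" unfolding abs_mult using that by (intro mult_right_mono) auto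
    then show ?thesis using that by auto
  qed
  have cs: "continuous_on (?M \<times> cbox 0 1) (\<lambda>y. ?s (snd y) (fst y))"
    by (intro continuous_intros)
  have c\<omega>: "continuous_on (?M \<times> cbox 0 1) (\<lambda>y. \<omega> (snd y))"
    by (rule continuous_on_compose2[OF \<omega>]) (auto intro!: continuous_intros)
  have G': "(G has_derivative frechet_derivative G (at y)) (at y)" if "y \<in> ?M" for y
    by (rule Ck_on_has_derivative[OF G[unfolded One_nat_def] that])
  have cG: "continuous_on ?M G"
    using G' has_derivative_continuous continuous_at_imp_continuous_on by blast
  have cD: "continuous_on ?M (\<lambda>y. frechet_derivative G (at y) w)" for w
    using G unfolding One_nat_def Ck_on.simps by (elim conjE allE)
  have lin: "frechet_derivative G (at y) (x * fst v, snd v)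
      = (x * fst v) *\<^sub>R frechet_derivative G (at y) (1, 0) + frechet_derivative G (at y) (0, snd v)" if "y \<in> ?M" for x y v
  proof -
    note l = has_derivative_linear[OF G'[OF that]]
    have "frechet_derivative G (at y) ((x * fst v) *\<^sub>R (1, 0) + (0, snd v))
      = (x * fst v) *\<^sub>R frechet_derivative G (at y) (1, 0) + frechet_derivative G (at y) (0, snd v)"
      by (simp only: linear_add[OF l] linear_cmul[OF l])
    then show ?thesis by simp
  qed
  have bl: "bounded_linear (?D x q)" if "q \<in> ?M" "x \<in> cbox 0 1" for x q
  proof -
    have "bounded_linear (\<lambda>v::real \<times> complex. (x * fst v, snd v))"
      by (intro bounded_linear_Pair bounded_linear_snd bounded_linear_const_mult bounded_linear_fst)
    from bounded_linear_compose[OF has_derivative_bounded_linear[OF G'[OF s[OF that]]] this]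
    show ?thesis by (rule bounded_linear_compose[OF bounded_linear_scaleR_right])
  qed
  have app: "blinfun_apply (Blinfun (?D x q)) = ?D x q" if "q \<in> ?M" "x \<in> cbox 0 1" for x q
    by (rule bounded_linear_Blinfun_apply[OF bl[OF that]])
  have der: "((\<lambda>p. \<omega> x *\<^sub>R G (?s x p)) has_derivative blinfun_apply (Blinfun (?D x q))) (at q within ?M)"
    if "q \<in> ?M" "x \<in> cbox 0 1" for x q
  proof -
    have "((\<lambda>p. ?s x p) has_derivative (\<lambda>v. (x * fst v, snd v))) (at q)"
      by (auto intro!: derivative_eq_intros)
    from has_derivative_scaleR_right[OF has_derivative_compose[OF this G'[OF s[OF that]]], of "\<omega> x"]
    show ?thesis unfolding app[OF that] by (rule has_derivative_at_withinI)
  qed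
  \<comment> \<open>Continuity in the operator norm is checked on single vectors, the domain of the
    operators being finite-dimensional.\<close>
  have cc: "continuous_on (?M \<times> cbox 0 1) (\<lambda>(q, x). Blinfun (?D x q))"
  proof (rule continuous_on_blinfun_componentwise)
    fix i :: "real \<times> complex"
    have "continuous_on (?M \<times> cbox 0 1) (\<lambda>y. \<omega> (snd y) *\<^sub>R ((snd y * fst i) *\<^sub>R frechet_derivative G (at (?s (snd y) (fst y))) (1, 0)
        + frechet_derivative G (at (?s (snd y) (fst y))) (0, snd i)))"
      by (intro continuous_on_scaleR continuous_on_add c\<omega> continuous_on_mult continuous_on_snd continuous_on_id
          continuous_on_const continuous_on_compose2[OF cD cs]) (use s in auto)
    then show "continuous_on (?M \<times> cbox 0 1) (\<lambda>y. blinfun_apply (case y of (q, x) \<Rightarrow> Blinfun (?D x q)) i)"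
    proof (rule continuous_on_eq)
      fix y :: "(real \<times> complex) \<times> real" assume y: "y \<in> ?M \<times> cbox 0 1"
      then have q: "fst y \<in> ?M" "snd y \<in> cbox 0 1" by auto
      have D: "blinfun_apply (case y of (q, x) \<Rightarrow> Blinfun (?D x q)) i = ?D (snd y) (fst y) i"
        unfolding case_prod_beta app[OF q] ..
      show "\<omega> (snd y) *\<^sub>R ((snd y * fst i) *\<^sub>R frechet_derivative G (at (?s (snd y) (fst y))) (1, 0)
        + frechet_derivative G (at (?s (snd y) (fst y))) (0, snd i)) = blinfun_apply (case y of (q, x) \<Rightarrow> Blinfun (?D x q)) i"
        unfolding D by (simp only: lin[OF s[OF q]])
    qed
  qed
  have integrable: "(\<lambda>x. f x *\<^sub>R g (?s x q)) integrable_on cbox 0 1"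
    if "q \<in> ?M" "continuous_on ?M g" "continuous_on (cbox 0 1) f" for f and g :: "real \<times> complex \<Rightarrow> complex" and q
  proof (rule integrable_continuous)
    have "continuous_on (cbox 0 1) (\<lambda>x. ?s x q)" by (intro continuous_intros)
    then show "continuous_on (cbox 0 1) (\<lambda>x. f x *\<^sub>R g (?s x q))"
      by (intro continuous_on_scaleR that continuous_on_compose2[OF that(2)]) (use s[OF that(1)] in auto)
  qed
  have L: "((\<lambda>p. integral (cbox 0 1) (\<lambda>x. \<omega> x *\<^sub>R G (?s x p))) has_derivative
      blinfun_apply (integral (cbox 0 1) (\<lambda>x. Blinfun (?D x p)))) (at p within ?M)"
    by (rule leibniz_rule[where fx="\<lambda>q x. Blinfun (?D x q)" and f="\<lambda>p x. \<omega> x *\<^sub>R G (?s x p)", OF der integrable[OF _ cG \<omega>] cc p M(2)])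
  have "blinfun_apply (integral (cbox 0 1) (\<lambda>x. Blinfun (?D x p))) v
      = fst v *\<^sub>R integral (cbox 0 1) (\<lambda>x. (x * \<omega> x) *\<^sub>R frechet_derivative G (at (?s x p)) (1, 0))
       + integral (cbox 0 1) (\<lambda>x. \<omega> x *\<^sub>R frechet_derivative G (at (?s x p)) (0, snd v))" for v
  proof -
    have "continuous_on (cbox 0 1) (\<lambda>x. Blinfun (?D x p))"
    proof -
      have "continuous_on (cbox 0 1) (\<lambda>x::real. (p, x))" by (intro continuous_intros)
      from continuous_on_compose2[OF cc this] p show ?thesis by fastforce
    qed
    then have "(\<lambda>x. Blinfun (?D x p)) integrable_on cbox 0 1" by (rule integrable_continuous)
    then have "blinfun_apply (integral (cbox 0 1) (\<lambda>x. Blinfun (?D x p))) v = integral (cbox 0 1) (\<lambda>x. blinfun_apply (Blinfun (?D x p)) v)"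
      by (rule blinfun_apply_integral)
    also have "\<dots> = integral (cbox 0 1) (\<lambda>x. fst v *\<^sub>R ((x * \<omega> x) *\<^sub>R frechet_derivative G (at (?s x p)) (1, 0))
        + \<omega> x *\<^sub>R frechet_derivative G (at (?s x p)) (0, snd v))"
    proof (rule integral_cong)
      fix x :: real assume x: "x \<in> cbox 0 1"
      show "blinfun_apply (Blinfun (?D x p)) v = fst v *\<^sub>R ((x * \<omega> x) *\<^sub>R frechet_derivative G (at (?s x p)) (1, 0))
        + \<omega> x *\<^sub>R frechet_derivative G (at (?s x p)) (0, snd v)"
        unfolding app[OF p x] by (simp only: lin[OF s[OF p x]] scaleR_add_right scaleR_scaleR ac_simps)
    qed
    also have "\<dots> = integral (cbox 0 1) (\<lambda>x. fst v *\<^sub>R ((x * \<omega> x) *\<^sub>R frechet_derivative G (at (?s x p)) (1, 0)))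
        + integral (cbox 0 1) (\<lambda>x. \<omega> x *\<^sub>R frechet_derivative G (at (?s x p)) (0, snd v))"
      by (intro integral_add integrable_cmul integrable[OF p cD] continuous_intros \<omega>)
    finally show ?thesis by (simp only: integral_cmul)
  qed
  then have "blinfun_apply (integral (cbox 0 1) (\<lambda>x. Blinfun (?D x p)))
    = (\<lambda>v. fst v *\<^sub>R integral (cbox 0 1) (\<lambda>x. (x * \<omega> x) *\<^sub>R frechet_derivative G (at (?s x p)) (1, 0))
       + integral (cbox 0 1) (\<lambda>x. \<omega> x *\<^sub>R frechet_derivative G (at (?s x p)) (0, snd v)))" by (rule ext)
  with L show ?thesis unfolding at_within_open[OF p M(1)] by (simp only:)
qed

text \<open>The derivative is again a combination of such integrals, with a new integrand and a new
  weight; both are therefore generalized in the induction.\<close>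

lemma integral_Ck_on:
  fixes G :: "real \<times> complex \<Rightarrow> complex" and \<omega> :: "real \<Rightarrow> real"
  shows "(\<And>k. Ck_on k (ball 0 e \<times> ball a d) G) \<Longrightarrow> continuous_on (cbox 0 1) \<omega> \<Longrightarrow>
    Ck_on k (ball 0 e \<times> ball a d) (\<lambda>p. integral (cbox 0 1) (\<lambda>x. \<omega> x *\<^sub>R G (x * fst p, snd p)))"
proof (induction k arbitrary: G \<omega>)
  case 0
  show ?case unfolding Ck_on.simps
    by (intro continuous_at_imp_continuous_on ballI has_derivative_continuous[OF integral_has_derivative[OF 0(1,2)]])
next
  case (Suc k)
  have o: "open (ball (0::real) e \<times> ball a d)" by (intro open_Times open_ball)
  have G': "Ck_on k (ball 0 e \<times> ball a d) (\<lambda>y. frechet_derivative G (at y) w)" for k w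
    using Suc.prems(1)[of "Suc k"] unfolding Ck_on.simps by (elim conjE allE)
  show ?case
  proof (rule Ck_on_SucI[OF o integral_has_derivative[OF Suc.prems]])
    fix v
    have \<omega>: "continuous_on (cbox 0 1) (\<lambda>x. x * \<omega> x)" by (intro continuous_intros Suc.prems)
    show "Ck_on k (ball 0 e \<times> ball a d) (\<lambda>p. fst v *\<^sub>R integral (cbox 0 1) (\<lambda>x. (x * \<omega> x) *\<^sub>R frechet_derivative G (at (x * fst p, snd p)) (1, 0))
       + integral (cbox 0 1) (\<lambda>x. \<omega> x *\<^sub>R frechet_derivative G (at (x * fst p, snd p)) (0, snd v)))"
      by (rule Ck_on_add[OF o Ck_on_bounded_linear[OF o bounded_linear_scaleR_right Suc.IH[OF G' \<omega>]] Suc.IH[OF G' Suc.prems(2)]])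
  qed
qed

text \<open>The segment from 0 to \<open>s\<close> stays inside the ball on which \<open>Y\<close>
  is regular, so the Leibniz rule applies. In the plane directions it yields the average of the
  complex derivatives, hence holomorphy.\<close>

lemma hsm_average:
  fixes Y :: "real \<Rightarrow> cfun"
  assumes "hsm Y (0, k)" shows "hsm (\<lambda>s z. integral (cbox 0 1) (\<lambda>x. Y (x * s) z)) (0, k)"
proof -
  have ev: "\<forall>c\<in>{k}. \<forall>\<^sub>F x in nhds (0, c). hsm Y (fst x, snd x)"
    using hsm_eventually[OF assms] by simp
  from eventually_nhds_uniform[OF _ ev] obtain e where e: "e > 0" "\<forall>r y. \<forall>c\<in>{k}. dist 0 r < e \<longrightarrow> dist c y < e \<longrightarrow> hsm Y (r, y)"
    by auto
  let ?M = "ball (0::real) e \<times> ball k e" and ?G = "\<lambda>x. Y (fst x) (snd x)"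
  let ?F = "\<lambda>p. integral (cbox 0 1) (\<lambda>x. 1 *\<^sub>R ?G (x * fst p, snd p))"
  have o: "open ?M" by (intro open_Times open_ball)
  have h: "hsm Y p" if "p \<in> ?M" for p
    using e(2)[rule_format, of k "fst p" "snd p"] that by (cases p) simp
  have "smooth_on ?M ?G" unfolding smooth_on_iff_smooth_at[OF o] using h hsm_smooth by blast
  then have C: "Ck_on n ?M ?G" for n unfolding smooth_on_def by simp
  have k: "(0, k) \<in> ?M" using e(1) by simp
  have "smooth_at ?F (0, k)"
    by (rule smooth_atI[OF o k integral_Ck_on[OF C continuous_on_const]])
  moreover have "(\<lambda>z. integral (cbox 0 1) (\<lambda>x. Y (x * fst p) z)) field_differentiable (at (snd p))" if p: "p \<in> ?M" for p
  proof -
    let ?c = "integral (cbox 0 1) (\<lambda>x. deriv (Y (x * fst p)) (snd p))"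
    have s: "(x * fst p, snd p) \<in> ?M" if "x \<in> cbox 0 1" for x
    proof -
      have "\<bar>x * fst p\<bar> \<le> 1 * \<bar>fst p\<bar>" unfolding abs_mult using that by (intro mult_right_mono) auto
      then show ?thesis using p by auto
    qed
    have "((\<lambda>w. (fst p, w)) has_derivative (\<lambda>h. (0, h))) (at (snd p))"
      by (auto intro!: derivative_eq_intros)
    from has_derivative_compose[OF this, of ?F] integral_has_derivative[OF C continuous_on_const p, of 1]
    have "((\<lambda>w. ?F (fst p, w)) has_derivative (\<lambda>h. fst (0, h) *\<^sub>R integral (cbox 0 1) (\<lambda>x. (x * 1) *\<^sub>R frechet_derivative ?G (at (x * fst p, snd p)) (1, 0))
       + integral (cbox 0 1) (\<lambda>x. 1 *\<^sub>R frechet_derivative ?G (at (x * fst p, snd p)) (0, snd (0::real, h))))) (at (snd p))"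
      by (simp only: prod.collapse)
    moreover have "integral (cbox 0 1) (\<lambda>x. frechet_derivative ?G (at (x * fst p, snd p)) (0, h)) = ?c * h" for h
    proof -
      have "integral (cbox 0 1) (\<lambda>x. frechet_derivative ?G (at (x * fst p, snd p)) (0, h))
          = integral (cbox 0 1) (\<lambda>x. deriv (Y (x * fst p)) (snd p) * h)"
        by (rule integral_cong) (rule deriv_eq_frechet[OF h[OF s]])
      also have "\<dots> = ?c * h" by (rule integral_mult_left)
      finally show ?thesis .
    qed
    ultimately have "((\<lambda>w. ?F (fst p, w)) has_derivative (\<lambda>h. ?c * h)) (at (snd p))" by simp
    then have "((\<lambda>w. ?F (fst p, w)) has_field_derivative ?c) (at (snd p))" by (simp add: has_field_derivative_def)
    then show ?thesis unfolding field_differentiable_def by auto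
  qed
  then have "\<forall>\<^sub>F p in nhds (0, k). (\<lambda>z. integral (cbox 0 1) (\<lambda>x. Y (x * fst p) z)) field_differentiable (at (snd p))"
    unfolding eventually_nhds using o k by (intro exI[of _ ?M]) simp
  ultimately show ?thesis unfolding hsm_def by simp
qed

text \<open>Hadamard's lemma: \<open>Y s\<close> is \<open>s\<close> times the integral of the
  parameter derivative over the segment from 0 to \<open>s\<close>, by the fundamental theorem of
  calculus. The integral is smooth also at s = 0, where it equals the derivative.\<close>

lemma hsm_divide_param:
  fixes Y :: "real \<Rightarrow> cfun"
  assumes K: "compact K" and Y: "near0 K (\<lambda>s z. hsm Y (s, z))" and Y0: "near K (\<lambda>z. Y 0 z = 0)"
  obtains w where "near0 K (\<lambda>s z. hsm w (s, z))" "near0 K (\<lambda>s z. Y s z = of_real s * w s z)"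
    "near K (\<lambda>z. w 0 z = dpar (\<lambda>_. 1) Y 0 z)"
proof -
  define w where "w s z = integral (cbox 0 1) (\<lambda>x. dpar (\<lambda>_. 1) Y (x * s) z)" for s z
  have hY: "hsm Y (0, k)" if "k \<in> K" for k using Y that near0_hsm[OF K] by blast
  have "hsm w (0, k)" if "k \<in> K" for k
    unfolding w_def by (rule hsm_average[OF hsm_dpar[OF hY[OF that] smooth_at_const]])
  then have 1: "near0 K (\<lambda>s z. hsm w (s, z))" using near0_hsm[OF K] by blast
  have 2: "near0 K (\<lambda>s z. Y s z = of_real s * w s z)"
    unfolding near0_iff[OF K]
  proof
    fix k assume k: "k \<in> K"
    have "\<forall>\<^sub>F x in nhds (0::real, c). hsm Y (fst x, snd x) \<and> Y 0 (snd x) = 0" if "c \<in> {k}" for c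
    proof -
      have "\<forall>\<^sub>F z in nhds k. Y 0 z = 0" using Y0 k unfolding near_iff by blast
      then have "\<forall>\<^sub>F x in nhds (0::real, k). Y 0 (snd x) = 0"
        by (intro eventually_nhds_compose[where g=snd and P="\<lambda>z. Y 0 z = 0"] continuous_intros) simp
      with hsm_eventually[OF hY[OF k]] show ?thesis using \<open>c \<in> {k}\<close> by (auto intro: eventually_conj)
    qed
    then have "\<forall>c\<in>{k}. \<forall>\<^sub>F x in nhds (0::real, c). hsm Y (fst x, snd x) \<and> Y 0 (snd x) = 0" by blast
    from eventually_nhds_uniform[OF _ this] obtain e where e: "e > 0"
      "\<forall>r y. \<forall>c\<in>{k}. dist 0 r < e \<longrightarrow> dist c y < e \<longrightarrow> hsm Y (r, y) \<and> Y 0 y = 0" by auto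
    have "Y s z = of_real s * w s z" if sz: "s \<in> ball 0 e" "z \<in> ball k e" for s z
    proof -
      have "((\<lambda>x. s *\<^sub>R dpar (\<lambda>_. 1) Y (x * s) z) has_integral (Y (1 * s) z - Y (0 * s) z)) {0..1}"
      proof (rule fundamental_theorem_of_calculus)
        fix x :: real assume x: "x \<in> {0..1}"
        have "\<bar>x * s\<bar> \<le> 1 * \<bar>s\<bar>" unfolding abs_mult using x by (intro mult_right_mono) auto
        then have h: "hsm Y (x * s, z)" using e(2) sz by simp
        have "((\<lambda>x. Y (x * s) z) has_vector_derivative
          dpar (\<lambda>_. s) Y (x * s) z + deriv (Y (x * s)) z * 0) (at x)"
          by (rule hsm_path) (use h in \<open>auto intro!: derivative_eq_intros\<close>)
        moreover have "dpar (\<lambda>_. s) Y (x * s) z = s *\<^sub>R dpar (\<lambda>_. 1) Y (x * s) z"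
          using linear_cmul[OF has_derivative_linear[OF smooth_at_has_derivative[OF hsm_smooth[OF h]]], of s "(1, 0)"]
          by (simp add: dpar_eq_frechet[OF hsm_smooth[OF h]])
        ultimately show "((\<lambda>x. Y (x * s) z) has_vector_derivative s *\<^sub>R dpar (\<lambda>_. 1) Y (x * s) z) (at x within {0..1})"
          by (simp add: has_vector_derivative_at_within)
      qed simp
      note I = integral_unique[OF this]
      have "s *\<^sub>R w s z = integral (cbox 0 1) (\<lambda>x. s *\<^sub>R dpar (\<lambda>_. 1) Y (x * s) z)"
        unfolding w_def by (rule integral_cmul[symmetric])
      also have "\<dots> = Y (1 * s) z - Y (0 * s) z" unfolding cbox_interval by (rule I)
      also have "\<dots> = Y s z" using e(2)[rule_format, of k s z] sz by simp
      finally show ?thesis by (simp add: scaleR_conv_of_real)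
    qed
    then show "\<forall>\<^sub>F x in nhds (0, k). Y (fst x) (snd x) = of_real (fst x) * w (fst x) (snd x)"
      unfolding eventually_nhds
      by (intro exI[of _ "ball 0 e \<times> ball k e"] conjI open_Times open_ball) (use e(1) in auto)
  qed
  have "w 0 z = dpar (\<lambda>_. 1) Y 0 z" for z unfolding w_def by simp
  then have 3: "near K (\<lambda>z. w 0 z = dpar (\<lambda>_. 1) Y 0 z)" unfolding near_def by blast
  from that[OF 1 2 3] show thesis .
qed

section \<open>Tangent vectors\<close>

text \<open>What a calculation at \<open>z\<close> uses: regularity at \<open>z\<close> and at its
  reflected point, and the involution identity on a full neighbourhood, so that it can be
  differentiated in the parameter and in the point.\<close>

definition reflecting :: "('p::euclidean_space \<Rightarrow> cfun) \<Rightarrow> 'p \<Rightarrow> complex \<Rightarrow> bool" where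
  "reflecting T r z \<longleftrightarrow> hsm T (r, z) \<and> hsm T (r, cnj (T r z)) \<and>
     (\<forall>\<^sub>F x in nhds (r, z). cnj (T (fst x) (cnj (T (fst x) (snd x)))) = snd x)"

definition tangent_at :: "cfun \<Rightarrow> cfun \<Rightarrow> complex \<Rightarrow> bool" where
  "tangent_at S Y z \<longleftrightarrow> Y z = - deriv S z * cnj (Y (cnj (S z)))"

lemma has_vector_derivative_const_unique:
  assumes "(f has_vector_derivative d) (at x)" "\<forall>\<^sub>F t in nhds x. f t = c"
  shows "d = 0"
proof -
  have "((\<lambda>t. c) has_vector_derivative d) (at x)"
    unfolding has_vector_derivative_def
    by (rule has_derivative_transform_eventually[OF assms(1)[unfolded has_vector_derivative_def]])
      (use assms(2) eventually_nhds_x_imp_x[OF assms(2)] in \<open>auto simp: eventually_at_filter elim: eventually_mono\<close>)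
  then show ?thesis using has_vector_derivative_const vector_derivative_unique_at by blast
qed

lemma has_field_derivative_cnj_compose:
  assumes "(f has_field_derivative a) (at (cnj (T z)))" "(T has_field_derivative b) (at z)"
  shows "((\<lambda>z. cnj (f (cnj (T z)))) has_field_derivative cnj a * b) (at z)"
proof -
  have "((cnj \<circ> f \<circ> cnj) has_field_derivative cnj a) (at (T z))"
    by (rule has_field_derivative_cnj_cnj) (use assms(1) in simp)
  from DERIV_chain[OF this assms(2)] show ?thesis by (simp add: o_def)
qed

text \<open>The outer conjugation undoes the one on the motion of the reflected point, so the
  velocity of \<open>T\<close> enters unconjugated.\<close>

lemma hsm_cnj_path:
  assumes "hsm Y (r, cnj (T r z))" "hsm T (r, z)"
  shows "((\<lambda>t. cnj (Y (r + t *\<^sub>R q) (cnj (T (r + t *\<^sub>R q) z)))) has_vector_derivative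
    cnj (dpar (\<lambda>_. q) Y r (cnj (T r z))) + cnj (deriv (Y r) (cnj (T r z))) * dpar (\<lambda>_. q) T r z) (at 0)"
proof -
  have "((\<lambda>t. cnj (T (r + t *\<^sub>R q) z)) has_vector_derivative cnj (dpar (\<lambda>_. q) T r z)) (at 0)"
    by (rule bounded_linear.has_vector_derivative[OF bounded_linear_cnj
          hsm_dpar_has_vector_derivative[OF assms(2), of "\<lambda>_. q"]])
  moreover have "((\<lambda>t. r + t *\<^sub>R q) has_vector_derivative q) (at 0)"
    by (auto intro!: derivative_eq_intros)
  ultimately have "((\<lambda>t. Y (r + t *\<^sub>R q) (cnj (T (r + t *\<^sub>R q) z))) has_vector_derivative
      dpar (\<lambda>_. q) Y (r + 0 *\<^sub>R q) (cnj (T (r + 0 *\<^sub>R q) z))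
      + deriv (Y (r + 0 *\<^sub>R q)) (cnj (T (r + 0 *\<^sub>R q) z)) * cnj (dpar (\<lambda>_. q) T r z)) (at 0)"
    by (intro hsm_path) (use assms(1) in auto)
  from bounded_linear.has_vector_derivative[OF bounded_linear_cnj this] show ?thesis by simp
qed

lemma reflecting_deriv:
  assumes "reflecting T r z"
  shows "cnj (deriv (T r) (cnj (T r z))) * deriv (T r) z = 1"
proof -
  have h: "hsm T (r, z)" "hsm T (r, cnj (T r z))"
    and ev: "\<forall>\<^sub>F x in nhds (r, z). cnj (T (fst x) (cnj (T (fst x) (snd x)))) = snd x"
    using assms by (auto simp: reflecting_def)
  have "((\<lambda>z. cnj (T r (cnj (T r z)))) has_field_derivative cnj (deriv (T r) (cnj (T r z))) * deriv (T r) z) (at z)"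
    by (rule has_field_derivative_cnj_compose[OF hsm_has_deriv[OF h(2)] hsm_has_deriv[OF h(1)]])
  moreover have "\<forall>\<^sub>F w in nhds z. cnj (T r (cnj (T r w))) = w"
    by (rule eventually_slice_snd[OF ev])
  ultimately have "((\<lambda>w. w) has_field_derivative cnj (deriv (T r) (cnj (T r z))) * deriv (T r) z) (at z)"
    using DERIV_cong_ev[OF refl _ refl] by fast
  then show ?thesis using DERIV_ident DERIV_unique by blast
qed

lemma reflecting_deriv_nonzero:
  assumes "reflecting T r z" shows "deriv (T r) z \<noteq> 0"
  using reflecting_deriv[OF assms] by auto

text \<open>The involution identity differentiated in the parameter, multiplied by the derivative of
  \<open>T r\<close>, and simplified by the same identity differentiated in the point.\<close>

lemma reflecting_dpar_tangent:
  assumes R: "reflecting T r z"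
  shows "tangent_at (T r) (dpar u T r) z"
proof -
  have h: "hsm T (r, z)" "hsm T (r, cnj (T r z))"
    and ev: "\<forall>\<^sub>F x in nhds (r, z). cnj (T (fst x) (cnj (T (fst x) (snd x)))) = snd x"
    using assms by (auto simp: reflecting_def)
  have "\<forall>\<^sub>F s in nhds r. cnj (T s (cnj (T s z))) = z" by (rule eventually_slice_fst[OF ev])
  then have "\<forall>\<^sub>F s in nhds (r + 0 *\<^sub>R u r). cnj (T s (cnj (T s z))) = z" by simp
  then have "\<forall>\<^sub>F t in nhds 0. cnj (T (r + t *\<^sub>R u r) (cnj (T (r + t *\<^sub>R u r) z))) = z"
    by (rule eventually_nhds_compose[where g="\<lambda>t. r + t *\<^sub>R u r", rotated]) (intro continuous_intros)
  from has_vector_derivative_const_unique[OF hsm_cnj_path[OF h(2,1)] this]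
  have "cnj (dpar u T r (cnj (T r z))) + cnj (deriv (T r) (cnj (T r z))) * dpar u T r z = 0"
    unfolding dpar_direction[of u, symmetric] .
  then have "deriv (T r) z * cnj (dpar u T r (cnj (T r z))) + (cnj (deriv (T r) (cnj (T r z))) * deriv (T r) z) * dpar u T r z = 0"
    by algebra
  then show ?thesis unfolding tangent_at_def reflecting_deriv[OF R] by (simp add: eq_neg_iff_add_eq_0 add.commute)
qed

lemma tangent_at_cong:
  assumes "\<forall>\<^sub>F w in nhds z. S w = S' w" "Y z = Y' z" "Y (cnj (S z)) = Y' (cnj (S z))"
  shows "tangent_at S Y z \<longleftrightarrow> tangent_at S' Y' z"
proof -
  have "S z = S' z" using eventually_nhds_x_imp_x[OF assms(1)] .
  moreover have "deriv S z = deriv S' z" by (rule deriv_cong_ev[OF assms(1) refl])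
  ultimately show ?thesis using assms(2,3) unfolding tangent_at_def by simp
qed

text \<open>The real-linear map that sends V to - S_z (cnj \<circ> V \<circ> \<sigma>) is an
  involution whose fixed points satisfy the tangency condition; the average over it projects onto
  them. It turns an arbitrary smooth family of functions into a tangent field.\<close>

definition tangent_proj :: "('p::euclidean_space \<Rightarrow> cfun) \<Rightarrow> ('p \<Rightarrow> cfun) \<Rightarrow> 'p \<Rightarrow> cfun" where
  "tangent_proj T V r z = (V r z - deriv (T r) z * cnj (V r (cnj (T r z)))) / 2"

lemma tangent_proj_eq: "tangent_at (T r) (V r) z \<Longrightarrow> tangent_proj T V r z = V r z"
  unfolding tangent_at_def tangent_proj_def by (simp add: minus_equation_iff[of _ "V r z"] eq_commute)

lemma tangent_proj_tangent:
  assumes "reflecting T r z" "cnj (T r (cnj (T r z))) = z"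
  shows "tangent_at (T r) (tangent_proj T V r) z"
proof -
  have 1: "deriv (T r) z * cnj (deriv (T r) (cnj (T r z))) = 1"
    using reflecting_deriv[OF assms(1)] by (simp add: mult.commute)
  have "- deriv (T r) z * cnj (tangent_proj T V r (cnj (T r z)))
    = (deriv (T r) z * cnj (deriv (T r) (cnj (T r z))) * V r z - deriv (T r) z * cnj (V r (cnj (T r z)))) / 2"
    unfolding tangent_proj_def assms(2) by (simp add: field_simps)
  then show ?thesis unfolding tangent_at_def 1 by (simp add: tangent_proj_def)
qed

context schwarz_germ
begin

lemma family_reflecting: "schwarz_family K S T \<Longrightarrow> near0 K (reflecting T)"
  using near0_conj[OF near0_conj[OF family_near0_hsm near0_reflect[OF _ family_near0_hsm]] near0_open[OF family_involution]]
  unfolding reflecting_def by (simp add: conj_assoc)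

text \<open>The involution criterion is stable under substituting \<open>h\<close> for the
  parameter, whereas parametrizations need not be mentioned.\<close>

lemma family_param:
  fixes h :: "'q::euclidean_space \<Rightarrow> 'p::euclidean_space"
  assumes T: "schwarz_family K S T" and h: "smooth_at h 0" "h 0 = 0"
  shows "schwarz_family K S (\<lambda>r. T (h r))"
proof (rule schwarz_familyI)
  show "hsm (\<lambda>r. T (h r)) (0, k)" if "k \<in> K" for k
    by (rule hsm_compose[where f="\<lambda>r z. z"]) (use family_hsm[OF T that] h in simp_all)
  show "near K (\<lambda>z. T (h 0) z = S z)" using family_base[OF T] h by simp
  show "near0 K (\<lambda>r z. cnj (T (h r) (cnj (T (h r) z))) = z)"
    by (rule near0_param[OF family_involution[OF T] smooth_at_continuous[OF h(1)] h(2)])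
qed

lemma family_dpar_tangent: "schwarz_family K S T \<Longrightarrow> near0 K (\<lambda>r z. tangent_at (T r) (dpar u T r) z)"
  by (rule near0_mono[OF family_reflecting reflecting_dpar_tangent])

lemma smooth_at_Pair_0: "smooth_at (\<lambda>r. (r, 0)) x"
  by (intro smooth_at_Pair) simp_all

lemma dpar_snd_eq: "dpar (\<lambda>_. (0, 1)) T (r, t) z = dpar (\<lambda>_. 1) (\<lambda>s. T (r, s)) t z"
  by (simp add: dpar_def)

text \<open>The variation behind the field is itself a family, so its velocity is regular and
  satisfies the linearized involution identity; both are restricted to the value 0 of the extra
  parameter.\<close>

lemma tangent_fieldD:
  fixes T :: "'p::euclidean_space \<Rightarrow> cfun"
  assumes T: "schwarz_family K S T" and Y: "tangent_field K S T Y"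
  shows "near0 K (\<lambda>r z. hsm Y (r, z))" "near0 K (\<lambda>r z. tangent_at (T r) (Y r) z)"
proof -
  obtain T' :: "'p \<times> real \<Rightarrow> cfun" where T': "schwarz_family K S T'"
    and e: "near0 K (\<lambda>r z. T' (r, 0) z = T r z)" "near0 K (\<lambda>r z. dpar (\<lambda>_. (0, 1)) T' (r, 0) z = Y r z)"
    using Y unfolding tangent_field_def by (elim exE conjE)
  have c: "isCont (\<lambda>r::'p. (r, 0::real)) 0" "((0::'p), (0::real)) = 0" by (auto simp: zero_prod_def intro!: continuous_intros)
  have "near0 K (\<lambda>r z. hsm (dpar (\<lambda>_. (0, 1)) T') (r, z))"
    by (rule near0_mono[OF family_near0_hsm[OF T'] hsm_dpar]) simp_all
  from near0_conj[OF near0_param[OF this c] near0_open[OF e(2)]]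
  show "near0 K (\<lambda>r z. hsm Y (r, z))"
  proof (rule near0_mono)
    fix r z assume a: "hsm (dpar (\<lambda>_. (0, 1)) T') ((r, 0), z) \<and> (\<forall>\<^sub>F x in nhds (r, z). dpar (\<lambda>_. (0, 1)) T' (fst x, 0) (snd x) = Y (fst x) (snd x))"
    have "hsm (\<lambda>r z. dpar (\<lambda>_. (0, 1)) T' (r, 0) z) (r, z)"
      by (rule hsm_compose[where h="\<lambda>r. (r, 0)" and f="\<lambda>r z. z"]) (use a smooth_at_Pair_0 in simp_all)
    then show "hsm Y (r, z)" by (rule hsm_cong[rotated]) (use a in simp)
  qed
  have e1: "near0 K (\<lambda>r z. \<forall>\<^sub>F x in nhds (r, z). T' (fst x, 0) (snd x) = T (fst x) (snd x))" by (rule near0_open[OF e(1)])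
  from near0_conj[OF near0_conj[OF near0_param[OF family_dpar_tangent[OF T'] c] e1]
      near0_conj[OF e(2) near0_reflect[OF T e(2)]]]
  show "near0 K (\<lambda>r z. tangent_at (T r) (Y r) z)"
  proof (rule near0_mono)
    fix r z
    assume a: "(tangent_at (T' (r, 0)) (dpar (\<lambda>_. (0, 1)) T' (r, 0)) z \<and>
         (\<forall>\<^sub>F x in nhds (r, z). T' (fst x, 0) (snd x) = T (fst x) (snd x))) \<and>
        dpar (\<lambda>_. (0, 1)) T' (r, 0) z = Y r z \<and>
        dpar (\<lambda>_. (0, 1)) T' (r, 0) (cnj (T r z)) = Y r (cnj (T r z))"
    then have s: "\<forall>\<^sub>F w in nhds z. T' (r, 0) w = T r w"
      by (intro eventually_slice_snd[where P="\<lambda>r z. T' (r, 0) z = T r z"]) simp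
    have "T' (r, 0) z = T r z" using eventually_nhds_x_imp_x[OF s] .
    then show "tangent_at (T r) (Y r) z"
      using a tangent_at_cong[OF s, of "dpar (\<lambda>_. (0, 1)) T' (r, 0)" "Y r"] by simp
  qed
qed

text \<open>A prescribed velocity is attained by moving the chart linearly in an extra parameter and
  realizing the moved chart. That the result extends \<open>T\<close> follows from
  uniqueness.\<close>

lemma tangent_fieldI:
  fixes T :: "'p::euclidean_space \<Rightarrow> cfun"
  assumes T: "schwarz_family K S T" and Y: "near0 K (\<lambda>r z. hsm Y (r, z))" "near0 K (\<lambda>r z. tangent_at (T r) (Y r) z)"
  shows "tangent_field K S T Y"
proof -
  obtain g where g: "straightening K S g" using straightening_exists by blast
  note c = chart_props[OF g family_hsm[OF T] family_base[OF T] family_involution[OF T]]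
  let ?c = "chart g T"
  \<comment> \<open>The factor 1/2: the velocity produced is governed by the difference of
    \<open>\<mu>\<close> and the conjugate of its reflected value, and for tangent \<open>Y\<close>
    the latter is the negative of the former.\<close>
  define \<mu> where "\<mu> r z = deriv (?c r) z * Y r z / (2 * deriv (T r) z)" for r z
  define \<kappa> where "\<kappa> p z = ?c (fst p) z + of_real (snd p) * \<mu> (fst p) z" for p :: "'p \<times> real" and z
  have rfl: "near0 K (reflecting T)" by (rule family_reflecting[OF T])
  have h\<mu>: "near0 K (\<lambda>r z. hsm \<mu> (r, z))"
  proof (rule near0_mono[OF near0_conj[OF near0_conj[OF c(1) Y(1)] rfl]])
    fix r z assume a: "(hsm ?c (r, z) \<and> hsm Y (r, z)) \<and> reflecting T r z"
    then have h: "hsm T (r, z)" by (simp add: reflecting_def)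
    from a reflecting_deriv_nonzero show "hsm \<mu> (r, z)" unfolding \<mu>_def
      by (intro hsm_divide hsm_mult hsm_deriv hsm_const h) auto
  qed
  have fs: "isCont (fst :: 'p \<times> real \<Rightarrow> 'p) 0" "fst (0 :: 'p \<times> real) = 0" by (auto intro!: continuous_intros)
  have h\<kappa>: "near0 K (\<lambda>p z. hsm \<kappa> (p, z))"
  proof (rule near0_mono[OF near0_conj[OF near0_param[OF c(1) fs] near0_param[OF h\<mu> fs]]])
    fix p :: "'p \<times> real" and z assume a: "hsm ?c (fst p, z) \<and> hsm \<mu> (fst p, z)"
    have "hsm (\<lambda>p :: 'p \<times> real. ?c (fst p)) (p, z)" "hsm (\<lambda>p :: 'p \<times> real. \<mu> (fst p)) (p, z)"
      using a by (auto intro: hsm_compose[where h=fst and f="\<lambda>r z. z"])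
    then show "hsm \<kappa> (p, z)" unfolding \<kappa>_def
      by (intro hsm_add hsm_mult hsm_param smooth_at_bounded_linear[OF bounded_linear_of_real]) simp_all
  qed
  have base: "near K (\<lambda>z. \<kappa> 0 z = g z)" using c(2) by (simp add: \<kappa>_def)
  obtain T' :: "'p \<times> real \<Rightarrow> cfun" where T': "schwarz_family K S T'" and eq: "near0 K (\<lambda>p z. \<kappa> p (cnj (T' p z)) = cnj (\<kappa> p z))"
    using realize[OF g h\<kappa> base] by blast
  have e0: "isCont (\<lambda>r::'p. (r, 0::real)) 0" "((0::'p), (0::real)) = 0" by (auto simp: zero_prod_def intro!: continuous_intros)
  have fam0: "schwarz_family K S (\<lambda>r. T' (r, 0))"
    by (rule family_param[OF T' smooth_at_Pair_0 e0(2)])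
  have "near0 K (\<lambda>r z. ?c r (cnj (T' (r, 0) z)) = cnj (?c r z))"
    using near0_param[OF eq e0] by (simp add: \<kappa>_def)
  then have eqT: "near0 K (\<lambda>r z. T' (r, 0) z = T r z)"
    by (intro realize_unique[OF g c(1,2) _ _ _ family_hsm[OF T] family_base_at[OF T] c(3)] family_hsm[OF fam0] family_base_at[OF fam0])
  have d: "near0 K (\<lambda>r z. deriv (?c r) z \<noteq> 0)"
    unfolding near0_iff[OF compact_K]
  proof
    fix k assume k: "k \<in> K"
    have "deriv (?c 0) k = deriv g k" by (rule deriv_cong_ev) (use c(2) k near_iff in auto)
    then have "deriv (?c 0) k \<noteq> 0" using g k by (simp add: straightening_def)
    moreover have "hsm ?c (0, k)" using c(1) k near0_hsm[OF compact_K] by blast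
    ultimately show "\<forall>\<^sub>F x in nhds (0, k). deriv (?c (fst x)) (snd x) \<noteq> 0"
      by (intro hsm_nonzero[where Y="\<lambda>r. deriv (?c r)"] hsm_deriv) simp_all
  qed
  have "near0 K (\<lambda>r z. dpar (\<lambda>_. (0, 1)) T' (r, 0) z = Y r z)"
  proof -
    have "near0 K (\<lambda>r z. (\<forall>\<^sub>F x in nhds ((r, 0), z). \<kappa> (fst x) (cnj (T' (fst x) (snd x))) = cnj (\<kappa> (fst x) (snd x))) \<and>
        (\<forall>\<^sub>F x in nhds (r, z). ?c (fst x) (cnj (T (fst x) (snd x))) = cnj (?c (fst x) (snd x))) \<and>
        deriv (?c r) z \<noteq> 0 \<and> reflecting T r z \<and> hsm ?c (r, z) \<and> hsm ?c (r, cnj (T r z)) \<and>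
        tangent_at (T r) (Y r) z \<and> T' (r, 0) z = T r z \<and> hsm \<kappa> ((r, 0), z) \<and> hsm \<kappa> ((r, 0), cnj (T r z)) \<and>
        hsm T' ((r, 0), z) \<and> cnj (T r (cnj (T r z))) = z)"
      by (rule near0_conj[OF near0_param[OF near0_open[OF eq] e0] near0_conj[OF near0_open[OF c(3)]
            near0_conj[OF d near0_conj[OF rfl near0_conj[OF c(1) near0_conj[OF near0_reflect[OF T c(1)]
            near0_conj[OF Y(2) near0_conj[OF eqT near0_conj[OF near0_param[OF h\<kappa> e0]
            near0_conj[OF near0_reflect[OF T near0_param[OF h\<kappa> e0]]
            near0_conj[OF near0_param[OF family_near0_hsm[OF T'] e0] family_involution[OF T]]]]]]]]]]]])
    then show ?thesis
    proof (rule near0_mono, elim conjE)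
    fix r z
    assume d: "deriv (?c r) z \<noteq> 0" and R: "reflecting T r z" and hc: "hsm ?c (r, z)" "hsm ?c (r, cnj (T r z))"
      and eq: "\<forall>\<^sub>F x in nhds ((r, 0), z). \<kappa> (fst x) (cnj (T' (fst x) (snd x))) = cnj (\<kappa> (fst x) (snd x))"
      and ceq: "\<forall>\<^sub>F x in nhds (r, z). ?c (fst x) (cnj (T (fst x) (snd x))) = cnj (?c (fst x) (snd x))"
      and Y: "tangent_at (T r) (Y r) z" and T0: "T' (r, 0) z = T r z"
      and h\<kappa>: "hsm \<kappa> ((r, 0), z)" "hsm \<kappa> ((r, 0), cnj (T r z))" and hT': "hsm T' ((r, 0), z)"
      and inv: "cnj (T r (cnj (T r z))) = z"
    let ?B = "dpar (\<lambda>_. (0, 1)) T' (r, 0) z" and ?s = "cnj (T r z)"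
    have hT: "hsm T (r, z)" using R by (simp add: reflecting_def)
    have dk: "dpar (\<lambda>_. (0, 1)) \<kappa> (r, 0) w = \<mu> r w" for w
      by (rule dpar_eqI) (auto simp: \<kappa>_def intro!: derivative_eq_intros)
    have k0: "\<kappa> (r, 0) = ?c r" by (simp add: \<kappa>_def fun_eq_iff)
    have "\<forall>\<^sub>F p in nhds (r, 0). \<kappa> p (cnj (T' p z)) = cnj (\<kappa> p z)"
      by (rule eventually_slice_fst[OF eq])
    then have "\<forall>\<^sub>F p in nhds ((r, 0) + 0 *\<^sub>R (0, 1)). \<kappa> p (cnj (T' p z)) = cnj (\<kappa> p z)" by simp
    then have "\<forall>\<^sub>F t in nhds 0. \<kappa> ((r, 0) + t *\<^sub>R (0, 1)) (cnj (T' ((r, 0) + t *\<^sub>R (0, 1)) z)) = cnj (\<kappa> ((r, 0) + t *\<^sub>R (0, 1)) z)"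
      by (rule eventually_nhds_compose[where g="\<lambda>t. (r, 0) + t *\<^sub>R (0, 1)", rotated]) (intro continuous_intros)
    then have ev: "\<forall>\<^sub>F t in nhds 0. cnj (\<kappa> ((r, 0) + t *\<^sub>R (0, 1)) (cnj (T' ((r, 0) + t *\<^sub>R (0, 1)) z))) - \<kappa> ((r, 0) + t *\<^sub>R (0, 1)) z = 0"
      by eventually_elim simp
    have "((\<lambda>t. cnj (\<kappa> ((r, 0) + t *\<^sub>R (0, 1)) (cnj (T' ((r, 0) + t *\<^sub>R (0, 1)) z)))) has_vector_derivative
        cnj (\<mu> r ?s) + cnj (deriv (?c r) ?s) * ?B) (at 0)"
      using hsm_cnj_path[of \<kappa> "(r, 0)" T' z "(0, 1)"] h\<kappa>(2) hT' by (simp add: dk k0 T0)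
    from has_vector_derivative_diff[OF this hsm_dpar_has_vector_derivative[OF h\<kappa>(1), of "\<lambda>_. (0, 1)"]]
    have "cnj (\<mu> r ?s) + cnj (deriv (?c r) ?s) * ?B - \<mu> r z = 0"
      unfolding dk by (rule has_vector_derivative_const_unique[OF _ ev])
    \<comment> \<open>The conjugation identity for \<open>\<kappa>\<close> differentiated in the
      extra parameter.\<close>
    then have 1: "cnj (deriv (?c r) ?s) * ?B = \<mu> r z - cnj (\<mu> r ?s)" by (simp add: algebra_simps)
    have "((\<lambda>z. cnj (?c r (cnj (T r z)))) has_field_derivative cnj (deriv (?c r) ?s) * deriv (T r) z) (at z)"
      by (rule has_field_derivative_cnj_compose[OF hsm_has_deriv[OF hc(2)] hsm_has_deriv[OF hT]])
    moreover have "\<forall>\<^sub>F w in nhds z. ?c r (cnj (T r w)) = cnj (?c r w)"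
      by (rule eventually_slice_snd[OF ceq])
    then have "\<forall>\<^sub>F w in nhds z. cnj (?c r (cnj (T r w))) = ?c r w" by eventually_elim simp
    ultimately have "(?c r has_field_derivative cnj (deriv (?c r) ?s) * deriv (T r) z) (at z)"
      using DERIV_cong_ev[OF refl _ refl] by fast
    \<comment> \<open>The conjugation identity for the chart of \<open>T\<close> differentiated in
      \<open>z\<close>.\<close>
    then have 2: "cnj (deriv (?c r) ?s) * deriv (T r) z = deriv (?c r) z"
      using DERIV_imp_deriv by metis
    define a where "a = deriv (T r) z"
    define b where "b = cnj (deriv (?c r) ?s)"
    define c' where "c' = cnj (deriv (T r) ?s)"
    have a: "c' * a = 1" using reflecting_deriv[OF R] by (simp add: a_def c'_def)
    then have a0: "a \<noteq> 0" "c' \<noteq> 0" by auto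
    have b: "deriv (?c r) z = b * a" using 2 by (simp add: a_def b_def)
    then have b0: "b \<noteq> 0" using d by auto
    have y: "Y r z = - a * cnj (Y r ?s)" using Y by (simp add: tangent_at_def a_def)
    have m1: "\<mu> r z = b * Y r z / 2" using a0 unfolding \<mu>_def b a_def[symmetric] by simp
    have "cnj (\<mu> r ?s) = b * cnj (Y r ?s) / (2 * c')" by (simp add: \<mu>_def b_def c'_def)
    also have "\<dots> = b * (a * cnj (Y r ?s)) / (2 * (c' * a))" using a0 by simp
    also have "\<dots> = - (b * Y r z / 2)" unfolding a y by simp
    finally have "b * ?B = b * Y r z" using 1 m1 unfolding b_def[symmetric] by simp
    then show "?B = Y r z" using b0 by simp
    qed
  qed
  then show ?thesis unfolding tangent_field_def using T' eqT by blast
qed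

end

section \<open>Tangency and torsion of the covariant derivative\<close>

lemma analytic_cong_eventually:
  assumes "\<forall>\<^sub>F w in nhds z. f w = g w" "f analytic_on {z}" shows "g analytic_on {z}"
  using eventually_nhds_open[OF assms(1)] assms(2) unfolding analytic_at_iff_eventually
  by eventually_elim (use field_differentiable_cong_eventually in blast)

text \<open>The tangency identity differentiated in \<open>z\<close> and solved for the derivative
  at the reflected point.\<close>

lemma tangent_at_deriv:
  assumes T: "reflecting T r z" and Y: "Y analytic_on {z}" "Y analytic_on {cnj (T r z)}"
    and ev: "\<forall>\<^sub>F w in nhds z. tangent_at (T r) Y w"
  shows "cnj (deriv Y (cnj (T r z))) = (deriv (deriv (T r)) z * Y z / deriv (T r) z - deriv Y z) / (deriv (T r) z)\<^sup>2"
proof -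
  let ?s = "cnj (T r z)"
  have h: "hsm T (r, z)" using T by (simp add: reflecting_def)
  have nz: "deriv (T r) z \<noteq> 0" by (rule reflecting_deriv_nonzero[OF T])
  have dY: "(Y has_field_derivative deriv Y w) (at w)" if "Y analytic_on {w}" for w
    using analytic_on_imp_differentiable_at[OF that] by (simp add: field_differentiable_derivI)
  have y: "Y z = - deriv (T r) z * cnj (Y ?s)"
    using eventually_nhds_x_imp_x[OF ev] by (simp add: tangent_at_def)
  have "((\<lambda>w. - deriv (T r) w * cnj (Y (cnj (T r w)))) has_field_derivative
      (- deriv (T r) z) * (cnj (deriv Y ?s) * deriv (T r) z) + (- deriv (deriv (T r)) z) * cnj (Y ?s)) (at z)"
    by (rule DERIV_mult'[OF DERIV_minus[OF hsm_has_deriv[OF hsm_deriv[OF h]]]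
          has_field_derivative_cnj_compose[OF dY[OF Y(2)] hsm_has_deriv[OF h]]])
  moreover have "\<forall>\<^sub>F w in nhds z. - deriv (T r) w * cnj (Y (cnj (T r w))) = Y w"
    using ev by eventually_elim (simp add: tangent_at_def)
  ultimately have "(Y has_field_derivative
      (- deriv (T r) z) * (cnj (deriv Y ?s) * deriv (T r) z) + (- deriv (deriv (T r)) z) * cnj (Y ?s)) (at z)"
    by (rule DERIV_cong_ev[OF refl _ refl, THEN iffD1, rotated])
  from DERIV_unique[OF dY[OF Y(1)] this]
  have "deriv Y z = - (deriv (T r) z)\<^sup>2 * cnj (deriv Y ?s) - deriv (deriv (T r)) z * cnj (Y ?s)"
    by algebra
  moreover have "cnj (Y ?s) = - Y z / deriv (T r) z" using y nz by simp
  ultimately show ?thesis using nz by (simp add: field_simps)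
qed

text \<open>The tangency identity is differentiated in the parameter and all reflected quantities
  are expressed by those at \<open>z\<close>. With a coefficient c in place of 1/2 in the correction
  term, reflection would turn c into 1 - c and leave a multiple of (1 - 2 c) T_zz; thus 1/2 is the
  value that keeps covariant derivatives tangent.\<close>

lemma cov_tangent_at:
  assumes T: "reflecting T r z" and Y: "hsm Y (r, z)" "hsm Y (r, cnj (T r z))"
    and ev: "\<forall>\<^sub>F x in nhds (r, z). tangent_at (T (fst x)) (Y (fst x)) (snd x)"
    and evT: "\<forall>\<^sub>F x in nhds (r, z). reflecting T (fst x) (snd x)"
    and u: "smooth_at u r"
  shows "tangent_at (T r) (cov T u Y r) z"
proof -
  let ?s = "cnj (T r z)" and ?A = "dpar u T"
  have h: "hsm T (r, z)" "hsm T (r, ?s)" using T by (auto simp: reflecting_def)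
  have nz: "deriv (T r) z \<noteq> 0" by (rule reflecting_deriv_nonzero[OF T])
  have hA: "hsm ?A (r, z)" "hsm ?A (r, ?s)" by (intro hsm_dpar h; simp add: u)+
  have A: "?A r z = - deriv (T r) z * cnj (?A r ?s)"
    using reflecting_dpar_tangent[OF T] by (simp add: tangent_at_def)
  have "\<forall>\<^sub>F w in nhds z. reflecting T r w" by (rule eventually_slice_snd[OF evT])
  then have "\<forall>\<^sub>F w in nhds z. tangent_at (T r) (?A r) w"
    by eventually_elim (rule reflecting_dpar_tangent)
  from tangent_at_deriv[OF T hsm_analytic[OF hA(1)] hsm_analytic[OF hA(2)] this]
  have A': "cnj (deriv (?A r) ?s) = (deriv (deriv (T r)) z * ?A r z / deriv (T r) z - deriv (?A r) z) / (deriv (T r) z)\<^sup>2" .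
  have y: "Y r z = - deriv (T r) z * cnj (Y r ?s)"
    using eventually_nhds_x_imp_x[OF ev] by (simp add: tangent_at_def)
  have "\<forall>\<^sub>F w in nhds z. tangent_at (T r) (Y r) w" by (rule eventually_slice_snd[OF ev])
  from tangent_at_deriv[OF T hsm_analytic[OF Y(1)] hsm_analytic[OF Y(2)] this]
  have Y': "cnj (deriv (Y r) ?s) = (deriv (deriv (T r)) z * Y r z / deriv (T r) z - deriv (Y r) z) / (deriv (T r) z)\<^sup>2" .
  have T': "cnj (deriv (T r) ?s) = 1 / deriv (T r) z"
    using reflecting_deriv[OF T] nz by (simp add: field_simps)
  have "((\<lambda>t. - deriv (T (r + t *\<^sub>R u r)) z * cnj (Y (r + t *\<^sub>R u r) (cnj (T (r + t *\<^sub>R u r) z)))) has_vector_derivative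
      (- deriv (T (r + 0 *\<^sub>R u r)) z) * (cnj (dpar (\<lambda>_. u r) Y r ?s) + cnj (deriv (Y r) ?s) * dpar (\<lambda>_. u r) T r z)
      + (- dpar u (\<lambda>r. deriv (T r)) r z) * cnj (Y (r + 0 *\<^sub>R u r) (cnj (T (r + 0 *\<^sub>R u r) z)))) (at 0)"
    by (rule has_vector_derivative_mult[OF has_vector_derivative_minus[OF hsm_dpar_has_vector_derivative[OF hsm_deriv[OF h(1)]]]
          hsm_cnj_path[OF Y(2) h(1)]])
  moreover have evp: "\<forall>\<^sub>F p in nhds r. - deriv (T p) z * cnj (Y p (cnj (T p z))) - Y p z = 0"
    using eventually_slice_fst[where P="\<lambda>r z. tangent_at (T r) (Y r) z", OF ev] by eventually_elim (simp add: tangent_at_def)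
  have "\<forall>\<^sub>F t in nhds 0. - deriv (T (r + t *\<^sub>R u r)) z * cnj (Y (r + t *\<^sub>R u r) (cnj (T (r + t *\<^sub>R u r) z))) - Y (r + t *\<^sub>R u r) z = 0"
    by (rule eventually_nhds_compose[where g="\<lambda>t. r + t *\<^sub>R u r" and P="\<lambda>p. - deriv (T p) z * cnj (Y p (cnj (T p z))) - Y p z = 0"])
      (use evp in \<open>auto intro!: continuous_intros\<close>)
  ultimately have "- deriv (T (r + 0 *\<^sub>R u r)) z * (cnj (dpar (\<lambda>_. u r) Y r ?s) + cnj (deriv (Y r) ?s) * dpar (\<lambda>_. u r) T r z)
      + (- dpar u (\<lambda>r. deriv (T r)) r z) * cnj (Y (r + 0 *\<^sub>R u r) (cnj (T (r + 0 *\<^sub>R u r) z))) - dpar u Y r z = 0"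
    by (intro has_vector_derivative_const_unique[OF has_vector_derivative_diff[OF _ hsm_dpar_has_vector_derivative[OF Y(1)]]])
  \<comment> \<open>Next solved for the parameter derivative at the reflected point, the one
    reflected quantity still unknown.\<close>
  then have D: "dpar u Y r z = - deriv (T r) z * (cnj (dpar u Y r ?s) + cnj (deriv (Y r) ?s) * ?A r z) - deriv (?A r) z * cnj (Y r ?s)"
    unfolding dpar_direction[of u, symmetric] deriv_dpar[OF h(1), of u] by (simp add: algebra_simps)
  have cY: "cnj (Y r ?s) = - Y r z / deriv (T r) z" and cA: "cnj (?A r ?s) = - ?A r z / deriv (T r) z"
    using y A nz by simp_all
  have "deriv (T r) z * cnj (dpar u Y r ?s) = - dpar u Y r z - deriv (?A r) z * cnj (Y r ?s)
      - deriv (T r) z * (cnj (deriv (Y r) ?s) * ?A r z)"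
    using D by algebra
  then have "cnj (dpar u Y r ?s) = (- dpar u Y r z - deriv (?A r) z * cnj (Y r ?s)
      - deriv (T r) z * (cnj (deriv (Y r) ?s) * ?A r z)) / deriv (T r) z"
    using nz by (metis nonzero_mult_div_cancel_left)
  then have cD: "cnj (dpar u Y r ?s) = (- dpar u Y r z - deriv (?A r) z * cnj (Y r ?s)) / deriv (T r) z - cnj (deriv (Y r) ?s) * ?A r z"
    using nz by (simp add: diff_divide_distrib)
  have "cnj (cov T u Y r ?s) = cnj (dpar u Y r ?s) - 1 / (2 * cnj (deriv (T r) ?s)) *
      (cnj (deriv (?A r) ?s) * cnj (Y r ?s) + cnj (deriv (Y r) ?s) * cnj (?A r ?s))"
    by (simp add: cov_def)
  also have "- deriv (T r) z * \<dots> = cov T u Y r z"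
    unfolding cD A' Y' cY cA T' cov_def using nz by (simp add: field_simps power2_eq_square)
  finally show ?thesis unfolding tangent_at_def by simp
qed

lemma hsm_cov:
  assumes "hsm T x" "hsm Y x" "smooth_at u (fst x)" "deriv (T (fst x)) (snd x) \<noteq> 0"
  shows "hsm (cov T u Y) x"
  unfolding cov_def
  by (intro hsm_diff hsm_mult hsm_add hsm_divide hsm_deriv hsm_dpar hsm_const assms) (use assms in auto)

text \<open>The correction term is symmetric in the two velocities, so only the flat part
  contributes.\<close>

lemma cov_torsion:
  assumes "hsm T (r, z)" "smooth_at u r" "smooth_at v r"
  shows "cov T u (dpar v T) r z - cov T v (dpar u T) r z = dpar (bracket u v) T r z"
  using dpar_bracket[OF assms] by (simp add: cov_def algebra_simps)

lemma near0_eventually: "near0 K P \<Longrightarrow> \<forall>\<^sub>F r in nhds 0. near K (P r)"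
  unfolding near0_def near_def eventually_nhds by meson

context schwarz_germ
begin

lemma family_const: "schwarz_family K S (\<lambda>r::'p::euclidean_space. S)"
proof -
  obtain U where U: "open U" "K \<subseteq> U" "schwarz_on U S"
    using along unfolding schwarz_along_def by (elim exE conjE)
  have hol: "S holomorphic_on U" using schwarz_onD[OF U(3,1)] by metis
  have "smooth_on (UNIV \<times> U) (\<lambda>x::'p \<times> complex. S (snd x))"
    unfolding smooth_on_iff_smooth_at[OF open_Times[OF open_UNIV U(1)]]
  proof
    fix x :: "'p \<times> complex" assume "x \<in> UNIV \<times> U"
    then have "S analytic_on {snd x}" unfolding analytic_at using U(1) hol by (intro exI[of _ U]) auto
    from hsm_smooth[OF hsm_analytic_const[OF this]] show "smooth_at (\<lambda>x. S (snd x)) x" .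
  qed
  then have "smooth_on (UNIV \<times> U) (\<lambda>(r::'p, z). S z)" by (simp add: case_prod_beta')
  moreover have "near K (\<lambda>z. S z = S z)" unfolding near_def using U by blast
  ultimately show ?thesis unfolding schwarz_family_def
    by (intro conjI exI[of _ UNIV] exI[of _ U]) (simp_all add: U)
qed

section \<open>Tangent fields and tangent vectors along families\<close>

lemma tangent_field_cov:
  fixes T :: "'p::euclidean_space \<Rightarrow> cfun"
  assumes T: "schwarz_family K S T" and u: "smooth_at u 0" and Y: "tangent_field K S T Y"
  shows "tangent_field K S T (cov T u Y)"
proof (rule tangent_fieldI[OF T])
  note y = tangent_fieldD[OF T Y]
  note R = family_reflecting[OF T]
  from near0_conj[OF near0_conj[OF R y(1)] near0_smooth[OF u]]
  show "near0 K (\<lambda>r z. hsm (cov T u Y) (r, z))"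
  proof (rule near0_mono, elim conjE)
    fix r z assume a: "reflecting T r z" "hsm Y (r, z)" "smooth_at u r"
    then show "hsm (cov T u Y) (r, z)"
      using reflecting_deriv_nonzero[OF a(1)] by (intro hsm_cov) (simp_all add: reflecting_def)
  qed
  from near0_conj[OF near0_conj[OF near0_conj[OF near0_open[OF R] y(1)] near0_conj[OF near0_reflect[OF T y(1)] near0_open[OF y(2)]]] near0_smooth[OF u]]
  show "near0 K (\<lambda>r z. tangent_at (T r) (cov T u Y r) z)"
  proof (rule near0_mono, elim conjE)
    fix r z
    assume a: "\<forall>\<^sub>F x in nhds (r, z). reflecting T (fst x) (snd x)" "hsm Y (r, z)" "hsm Y (r, cnj (T r z))"
      "\<forall>\<^sub>F x in nhds (r, z). tangent_at (T (fst x)) (Y (fst x)) (snd x)" "smooth_at u r"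
    have "reflecting T r z" using eventually_nhds_x_imp_x[OF a(1)] by simp
    from cov_tangent_at[OF this a(2-4,1,5)] show "tangent_at (T r) (cov T u Y r) z" .
  qed
qed

lemma tangent_field_dpar:
  assumes T: "schwarz_family K S T" and u: "smooth_at u 0"
  shows "tangent_field K S T (dpar u T)"
  by (rule tangent_fieldI[OF T near0_mono[OF near0_conj[OF family_near0_hsm[OF T] near0_smooth[OF u]]] family_dpar_tangent[OF T]])
    (simp add: hsm_dpar)

lemma tangent_field_proj:
  assumes T: "schwarz_family K S T" and V: "near0 K (\<lambda>r z. hsm V (r, z))"
  shows "tangent_field K S T (tangent_proj T V)"
proof (rule tangent_fieldI[OF T])
  from near0_conj[OF near0_conj[OF family_near0_hsm[OF T] V] near0_reflect[OF T V]]
  show "near0 K (\<lambda>r z. hsm (tangent_proj T V) (r, z))"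
  proof (rule near0_mono, elim conjE)
    fix r z assume h: "hsm T (r, z)" "hsm V (r, z)" "hsm V (r, cnj (T r z))"
    have "hsm (\<lambda>r z. cnj (V r (cnj (T r z)))) (r, z)"
      by (rule hsm_cnj_compose[where h="\<lambda>r. r" and Y=V]) (use h in simp_all)
    then show "hsm (tangent_proj T V) (r, z)" unfolding tangent_proj_def
      by (intro hsm_divide hsm_diff hsm_mult hsm_deriv hsm_const h) simp_all
  qed
  show "near0 K (\<lambda>r z. tangent_at (T r) (tangent_proj T V r) z)"
    by (rule near0_mono[OF near0_conj[OF family_reflecting[OF T] family_involution[OF T]]])
      (auto intro: tangent_proj_tangent)
qed

lemma tangent_field_param:
  fixes h :: "'q::euclidean_space \<Rightarrow> 'p::euclidean_space"
  assumes T: "schwarz_family K S T" and Y: "tangent_field K S T Y" and h: "smooth_at h 0" "h 0 = 0"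
  shows "tangent_field K S (\<lambda>r. T (h r)) (\<lambda>r. Y (h r))"
proof (rule tangent_fieldI[OF family_param[OF T h]])
  note c = smooth_at_continuous[OF h(1)] h(2)
  show "near0 K (\<lambda>r z. hsm (\<lambda>r. Y (h r)) (r, z))"
  proof (rule near0_mono[OF near0_conj[OF near0_param[OF tangent_fieldD(1)[OF T Y] c] near0_smooth[OF h(1)]]])
    fix r z assume "hsm Y (h r, z) \<and> smooth_at h r"
    then have "hsm Y (h (fst (r, z)), snd (r, z))" "smooth_at h (fst (r, z))" by simp_all
    then show "hsm (\<lambda>r. Y (h r)) (r, z)" by (rule hsm_compose[where f="\<lambda>r z. z" and Y=Y]) simp_all
  qed
  show "near0 K (\<lambda>r z. tangent_at (T (h r)) (Y (h r)) z)"
    by (rule near0_param[OF tangent_fieldD(2)[OF T Y] c])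
qed

lemma tangent_field_cong:
  fixes T :: "'p::euclidean_space \<Rightarrow> cfun"
  assumes "tangent_field K S T Y" "near0 K (\<lambda>r z. Y r z = Y' r z)"
  shows "tangent_field K S T Y'"
proof -
  obtain T' :: "'p \<times> real \<Rightarrow> cfun" where T': "schwarz_family K S T'" "near0 K (\<lambda>r z. T' (r, 0) z = T r z)"
    "near0 K (\<lambda>r z. dpar (\<lambda>_. (0, 1)) T' (r, 0) z = Y r z)"
    using assms(1) unfolding tangent_field_def by (elim exE conjE)
  have "near0 K (\<lambda>r z. dpar (\<lambda>_. (0, 1)) T' (r, 0) z = Y' r z)"
    by (rule near0_mono[OF near0_conj[OF T'(3) assms(2)]]) simp
  with T'(1,2) show ?thesis unfolding tangent_field_def by (intro exI[of _ T'] conjI)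
qed

lemma tangent_field_tangent:
  fixes T :: "'p::euclidean_space \<Rightarrow> cfun"
  assumes "tangent_field K S T Y" shows "tangent K S (Y 0)"
proof -
  obtain T' :: "'p \<times> real \<Rightarrow> cfun" where T': "schwarz_family K S T'" "near0 K (\<lambda>r z. dpar (\<lambda>_. (0, 1)) T' (r, 0) z = Y r z)"
    using assms(1) unfolding tangent_field_def by (elim exE conjE)
  have "smooth_at (\<lambda>t::real. (0::'p, t)) 0" by (intro smooth_at_Pair) simp_all
  from family_param[OF T'(1) this] have "schwarz_family K S (\<lambda>t. T' (0, t))" by (simp add: zero_prod_def)
  moreover have "near K (\<lambda>z. dpar (\<lambda>_. 1) (\<lambda>t. T' (0, t)) 0 z = Y 0 z)"
    using near0_at0[OF T'(2)] by (simp add: dpar_snd_eq)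
  ultimately show ?thesis unfolding tangent_def variation_def by (intro exI[of _ "\<lambda>t. T' (0, t)"] conjI)
qed

lemma tangent_cong: "tangent K S X \<Longrightarrow> near K (\<lambda>z. X z = X' z) \<Longrightarrow> tangent K S X'"
proof -
  assume "tangent K S X" and eq: "near K (\<lambda>z. X z = X' z)"
  then obtain T :: "real \<Rightarrow> cfun" where T: "schwarz_family K S T" "near K (\<lambda>z. dpar (\<lambda>_. 1) T 0 z = X z)"
    unfolding tangent_def variation_def by (elim exE conjE)
  have "near K (\<lambda>z. dpar (\<lambda>_. 1) T 0 z = X' z)"
    by (rule near_mono[OF near_conj[OF T(2) eq]]) simp
  with T(1) show "tangent K S X'" unfolding tangent_def variation_def by (intro exI[of _ T] conjI)
qed

lemma tangentD:
  assumes "tangent K S X"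
  shows "near K (\<lambda>z. X analytic_on {z})" "near K (tangent_at S X)"
proof -
  obtain T :: "real \<Rightarrow> cfun" where T: "schwarz_family K S T" "near K (\<lambda>z. dpar (\<lambda>_. 1) T 0 z = X z)"
    using assms unfolding tangent_def variation_def by (elim exE conjE)
  note d = tangent_field_dpar[OF T(1), of "\<lambda>_. 1", OF smooth_at_const]
  from near_conj[OF near0_at0[OF tangent_fieldD(1)[OF T(1) d]] near_open[OF T(2)]]
  show "near K (\<lambda>z. X analytic_on {z})"
  proof (rule near_mono, elim conjE)
    fix z assume "hsm (dpar (\<lambda>_. 1) T) (0, z)" and ev: "\<forall>\<^sub>F w in nhds z. dpar (\<lambda>_. 1) T 0 w = X w"
    from analytic_cong_eventually[OF ev hsm_analytic[OF this(1)]] show "X analytic_on {z}" .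
  qed
  have "near0 K (\<lambda>r::real. \<lambda>z. dpar (\<lambda>_. 1) T 0 (cnj (S z)) = X (cnj (S z)))"
    by (rule near0_reflect[OF family_const near0_const[OF T(2)]])
  from near_conj[OF near_conj[OF near0_at0[OF tangent_fieldD(2)[OF T(1) d]] near_open[OF family_base[OF T(1)]]]
      near_conj[OF T(2) near0_at0[OF this]]]
  show "near K (tangent_at S X)"
  proof (rule near_mono)
    fix z assume a: "(tangent_at (T 0) (dpar (\<lambda>_. 1) T 0) z \<and> (\<forall>\<^sub>F w in nhds z. T 0 w = S w)) \<and>
         dpar (\<lambda>_. 1) T 0 z = X z \<and> dpar (\<lambda>_. 1) T 0 (cnj (S z)) = X (cnj (S z))"
    then have "T 0 z = S z" using eventually_nhds_x_imp_x by blast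
    with a show "tangent_at S X z" using tangent_at_cong[where z=z and S="T 0" and S'=S and Y="dpar (\<lambda>_. 1) T 0" and Y'=X] by simp
  qed
qed

text \<open>Kept constant in the parameter, the germ \<open>X\<close> is in general not tangent to
  the nearby curves; its projection is, and at the base curve it equals \<open>X\<close>
  already.\<close>

lemma tangent_extend:
  fixes T :: "'p::euclidean_space \<Rightarrow> cfun"
  assumes T: "schwarz_family K S T" and X: "tangent K S X"
  obtains Z where "tangent_field K S T Z" "near K (\<lambda>z. Z 0 z = X z)"
proof (rule that)
  have "near0 K (\<lambda>r::'p. \<lambda>z. hsm (\<lambda>_. X) (r, z))"
    by (rule near0_mono[OF near0_const[OF tangentD(1)[OF X]]]) (simp add: hsm_analytic_const)
  then show "tangent_field K S T (tangent_proj T (\<lambda>_. X))" by (rule tangent_field_proj[OF T])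
  from near_conj[OF tangentD(2)[OF X] near_open[OF family_base[OF T]]]
  show "near K (\<lambda>z. tangent_proj T (\<lambda>_. X) 0 z = X z)"
  proof (rule near_mono)
    fix z assume a: "tangent_at S X z \<and> (\<forall>\<^sub>F w in nhds z. T 0 w = S w)"
    then have "tangent_at (T 0) X z" using tangent_at_cong[where z=z and S="T 0" and S'=S and Y=X and Y'=X] by simp
    then show "tangent_proj T (\<lambda>_. X) 0 z = X z" using tangent_proj_eq[of T 0 "\<lambda>_. X" z] by simp
  qed
qed

text \<open>\<open>Y\<close> is extended to a field along a curve with velocity \<open>X\<close>;
  the variation that realizes this field has both velocities.\<close>

lemma two_velocities:
  assumes X: "tangent K S X" and Y: "tangent K S Y"
  obtains P :: "real \<times> real \<Rightarrow> cfun" where "schwarz_family K S P"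
    "near K (\<lambda>z. dpar (\<lambda>_. (1, 0)) P 0 z = X z)" "near K (\<lambda>z. dpar (\<lambda>_. (0, 1)) P 0 z = Y z)"
proof -
  obtain T :: "real \<Rightarrow> cfun" where T: "schwarz_family K S T" "near K (\<lambda>z. dpar (\<lambda>_. 1) T 0 z = X z)"
    using X unfolding tangent_def variation_def by (elim exE conjE)
  obtain Z where Z: "tangent_field K S T Z" "near K (\<lambda>z. Z 0 z = Y z)" by (rule tangent_extend[OF T(1) Y])
  obtain P :: "real \<times> real \<Rightarrow> cfun" where P: "schwarz_family K S P" "near0 K (\<lambda>r z. P (r, 0) z = T r z)"
    "near0 K (\<lambda>r z. dpar (\<lambda>_. (0, 1)) P (r, 0) z = Z r z)"
    using Z(1) unfolding tangent_field_def by (elim exE conjE)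
  have "near K (\<lambda>z. dpar (\<lambda>_. (1, 0)) P 0 z = X z)"
  proof (rule near_mono[OF near_conj[OF near0_at0[OF near0_open[OF P(2)]] T(2)]], elim conjE)
    fix z assume a: "\<forall>\<^sub>F x in nhds (0, z). P (fst x, 0) (snd x) = T (fst x) (snd x)" and "dpar (\<lambda>_. 1) T 0 z = X z"
    have "dpar (\<lambda>_. 1) (\<lambda>r. P (r, 0)) 0 z = dpar (\<lambda>_. 1) T 0 z" by (rule dpar_cong[OF a])
    then show "dpar (\<lambda>_. (1, 0)) P 0 z = X z" using \<open>dpar (\<lambda>_. 1) T 0 z = X z\<close> by (simp add: dpar_def zero_prod_def)
  qed
  moreover have "near K (\<lambda>z. dpar (\<lambda>_. (0, 1)) P 0 z = Y z)"
    using near_conj[OF near0_at0[OF P(3)] Z(2)] by (rule near_mono) (simp add: zero_prod_def)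
  ultimately show thesis using that P(1) by blast
qed

lemma family_chart:
  fixes T :: "'p::euclidean_space \<Rightarrow> cfun"
  assumes "straightening K S g" and T: "schwarz_family K S T"
  shows "near0 K (\<lambda>r z. hsm (chart g T) (r, z))" "near K (\<lambda>z. chart g T 0 z = g z)"
    "near0 K (\<lambda>r z. chart g T r (cnj (T r z)) = cnj (chart g T r z))"
proof -
  note c = chart_props[OF assms(1) _ family_base[OF T] family_involution[OF T]]
  show "near0 K (\<lambda>r z. hsm (chart g T) (r, z))" by (rule c(1)) (simp add: family_hsm[OF T])
  show "near K (\<lambda>z. chart g T 0 z = g z)" by (rule c(2)) (simp add: family_hsm[OF T])
  show "near0 K (\<lambda>r z. chart g T r (cnj (T r z)) = cnj (chart g T r z))" by (rule c(3)) (simp add: family_hsm[OF T])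
qed

text \<open>Two curves through \<open>S\<close> with the same velocity differ, in the chart, by \<open>s\<^sup>2\<close> times a smooth
  family \<open>w\<close>; replacing \<open>s\<^sup>2\<close> by an independent parameter joins them in a two-parameter family.
  This is what reduces first and second derivatives along arbitrary curves to two-parameter
  families.\<close>

lemma contact_family:
  fixes T1 T2 :: "real \<Rightarrow> cfun"
  assumes T1: "schwarz_family K S T1" and T2: "schwarz_family K S T2"
    and vel: "near K (\<lambda>z. dpar (\<lambda>_. 1) T1 0 z = dpar (\<lambda>_. 1) T2 0 z)"
  obtains P :: "real \<times> real \<Rightarrow> cfun" where "schwarz_family K S P"
    "near0 K (\<lambda>s z. P (s, 0) z = T2 s z)" "near0 K (\<lambda>s z. P (s, s\<^sup>2) z = T1 s z)"
proof -
  obtain g where g: "straightening K S g" using straightening_exists by blast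
  note c1 = family_chart[OF g T1]
  note c2 = family_chart[OF g T2]
  let ?c1 = "chart g T1" and ?c2 = "chart g T2"
  \<comment> \<open>Both charts are deformations of the same \<open>g\<close>, so their difference
    vanishes at s = 0.\<close>
  define D where "D s z = ?c1 s z - ?c2 s z" for s z
  have D: "near0 K (\<lambda>s z. hsm D (s, z))" unfolding D_def
    by (rule near0_mono[OF near0_conj[OF c1(1) c2(1)]]) (intro hsm_diff; simp)
  have D0: "near K (\<lambda>z. D 0 z = 0)"
    by (rule near_mono[OF near_conj[OF c1(2) c2(2)]]) (simp add: D_def)
  obtain w1 where w1: "near0 K (\<lambda>s z. hsm w1 (s, z))" "near0 K (\<lambda>s z. D s z = of_real s * w1 s z)"
    "near K (\<lambda>z. w1 0 z = dpar (\<lambda>_. 1) D 0 z)"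
    by (rule hsm_divide_param[OF compact_K D D0])
  \<comment> \<open>The chart depends on the curve only through
    \<open>cnj (g (cnj (T s z)))\<close>, so equal velocities of the curves give equal velocities of
    the charts. This permits the second division by \<open>s\<close>.\<close>
  have w10: "near K (\<lambda>z. w1 0 z = 0)"
    unfolding near_iff
  proof
    fix k assume k: "k \<in> K"
    have ga: "g analytic_on {k}" using g k by (simp add: straightening_def)
    have "near K (\<lambda>z. g analytic_on {cnj (S z)})"
    proof -
      have "near K (\<lambda>z. g analytic_on {z})"
        unfolding near_iff
      proof
        fix k assume "k \<in> K"
        then have "g analytic_on {k}" using g by (simp add: straightening_def)
        from eventually_nhds_open[OF this[unfolded analytic_at_iff_eventually]]
        show "\<forall>\<^sub>F z in nhds k. g analytic_on {z}" unfolding analytic_at_iff_eventually .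
      qed
      from near0_at0[OF near0_reflect[OF family_const[where 'p=real] near0_const[OF this]]] show ?thesis .
    qed
    from near_conj[OF near_conj[OF this w1(3)] near_conj[OF vel near_conj[OF near_conj[OF family_base[OF T1] family_base[OF T2]]
        near_conj[OF near0_at0[OF family_near0_hsm[OF T1]] near0_at0[OF family_near0_hsm[OF T2]]]]]]
    have "near K (\<lambda>z. w1 0 z = 0)"
    proof (rule near_mono, elim conjE)
      fix z assume a: "g analytic_on {cnj (S z)}" and w: "w1 0 z = dpar (\<lambda>_. 1) D 0 z" and v: "dpar (\<lambda>_. 1) T1 0 z = dpar (\<lambda>_. 1) T2 0 z"
        and b: "T1 0 z = S z" "T2 0 z = S z" and h: "hsm T1 (0, z)" "hsm T2 (0, z)"
      have hg: "hsm (\<lambda>_::real. g) (0, cnj (S z))" using a by (simp add: hsm_analytic_const)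
      have p: "((\<lambda>t. cnj (g (cnj (T (0 + t *\<^sub>R 1) z)))) has_vector_derivative
        cnj (dpar (\<lambda>_. 1) (\<lambda>_. g) (0::real) (cnj (T 0 z))) + cnj (deriv g (cnj (T 0 z))) * dpar (\<lambda>_. 1) T 0 z) (at 0)"
        if "hsm T (0, z)" "T 0 z = S z" for T :: "real \<Rightarrow> cfun"
        using hsm_cnj_path[of "\<lambda>_. g" 0 T z 1] hg that by simp
      have "((\<lambda>t. D (0 + t *\<^sub>R 1) z) has_vector_derivative 0) (at 0)"
        unfolding D_def chart_def
        by (rule has_vector_derivative_eq_rhs[OF has_vector_derivative_diff[OF
              has_vector_derivative_divide[OF has_vector_derivative_add[OF has_vector_derivative_const p[OF h(1) b(1)]]]
              has_vector_derivative_divide[OF has_vector_derivative_add[OF has_vector_derivative_const p[OF h(2) b(2)]]]]])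
          (simp add: b v)
      then show "w1 0 z = 0" using w dpar_eqI[of D 0 "\<lambda>_. 1" z 0] by simp
    qed
    then show "\<forall>\<^sub>F z in nhds k. w1 0 z = 0" using k unfolding near_iff by blast
  qed
  obtain w where w: "near0 K (\<lambda>s z. hsm w (s, z))" "near0 K (\<lambda>s z. w1 s z = of_real s * w s z)"
    by (rule hsm_divide_param[OF compact_K w1(1) w10])
  \<comment> \<open>Affine in the second parameter: its value 0 gives the chart of
    \<open>T2\<close>, its value \<open>s\<^sup>2\<close> the chart of \<open>T1\<close>.\<close>
  define \<kappa> where "\<kappa> p z = ?c2 (fst p) z + of_real (snd p) * w (fst p) z" for p :: "real \<times> real" and z
  have fs: "isCont (fst :: real \<times> real \<Rightarrow> real) 0" "fst (0 :: real \<times> real) = 0" by (auto intro!: continuous_intros)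
  have h\<kappa>: "near0 K (\<lambda>p z. hsm \<kappa> (p, z))"
  proof (rule near0_mono[OF near0_conj[OF near0_param[OF c2(1) fs] near0_param[OF w(1) fs]]])
    fix p :: "real \<times> real" and z assume a: "hsm ?c2 (fst p, z) \<and> hsm w (fst p, z)"
    have "hsm (\<lambda>p :: real \<times> real. ?c2 (fst p)) (p, z)" "hsm (\<lambda>p :: real \<times> real. w (fst p)) (p, z)"
      using a by (auto intro: hsm_compose[where h=fst and f="\<lambda>r z. z"])
    then show "hsm \<kappa> (p, z)" unfolding \<kappa>_def
      by (intro hsm_add hsm_mult hsm_param smooth_at_bounded_linear[OF bounded_linear_of_real]) simp_all
  qed
  have base: "near K (\<lambda>z. \<kappa> 0 z = g z)" using c2(2) by (simp add: \<kappa>_def)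
  obtain P :: "real \<times> real \<Rightarrow> cfun" where P: "schwarz_family K S P" and eq: "near0 K (\<lambda>p z. \<kappa> p (cnj (P p z)) = cnj (\<kappa> p z))"
    using realize[OF g h\<kappa> base] by blast
  have s0: "smooth_at (\<lambda>s::real. (s, 0::real)) 0" "((0::real), (0::real)) = 0" by (auto simp: zero_prod_def smooth_at_Pair_0)
  have s2: "smooth_at (\<lambda>s::real. (s, s\<^sup>2)) 0" "((0::real), (0::real)\<^sup>2) = 0"
    unfolding power2_eq_square by (auto simp: zero_prod_def intro!: smooth_at_Pair smooth_at_mult)
  have f0: "schwarz_family K S (\<lambda>s. P (s, 0))" by (rule family_param[OF P s0])
  have f2: "schwarz_family K S (\<lambda>s. P (s, s\<^sup>2))" by (rule family_param[OF P s2])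
  have "near0 K (\<lambda>s z. ?c2 s (cnj (P (s, 0) z)) = cnj (?c2 s z))"
    using near0_param[OF eq smooth_at_continuous[OF s0(1)] s0(2)] by (simp add: \<kappa>_def)
  then have e0: "near0 K (\<lambda>s z. P (s, 0) z = T2 s z)"
    by (intro realize_unique[OF g c2(1,2) _ _ _ family_hsm[OF T2] family_base_at[OF T2] c2(3)] family_hsm[OF f0] family_base_at[OF f0])
  have k2: "near0 K (\<lambda>s z. \<kappa> (s, s\<^sup>2) z = ?c1 s z)"
    by (rule near0_mono[OF near0_conj[OF w1(2) w(2)]]) (simp add: \<kappa>_def D_def power2_eq_square algebra_simps)
  from near0_conj[OF near0_conj[OF k2 near0_reflect[OF f2 k2]] near0_param[OF eq smooth_at_continuous[OF s2(1)] s2(2)]]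
  have "near0 K (\<lambda>s z. ?c1 s (cnj (P (s, s\<^sup>2) z)) = cnj (?c1 s z))"
    by (rule near0_mono) metis
  then have e2: "near0 K (\<lambda>s z. P (s, s\<^sup>2) z = T1 s z)"
    by (intro realize_unique[OF g c1(1,2) _ _ _ family_hsm[OF T1] family_base_at[OF T1] c1(3)] family_hsm[OF f2] family_base_at[OF f2])
  from that[OF P e0 e2] show thesis .
qed

end

section \<open>Functions and vector fields along families\<close>

lemma isCont_isolated_value:
  fixes f :: "real \<Rightarrow> 'b::t2_space"
  assumes "isCont f 0" "\<And>y. y \<noteq> 0 \<Longrightarrow> f y = b" shows "f 0 = b"
proof -
  have "\<forall>\<^sub>F y in at 0. f y = b" unfolding eventually_at_filter using assms(2) by simp
  then have "(f \<longlongrightarrow> b) (at 0)" by (rule tendsto_eventually)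
  with assms(1) show ?thesis unfolding isCont_def using LIM_unique by blast
qed

lemma line_velocity:
  assumes "smooth_at m ((0::real), (0::real))"
  shows "((\<lambda>s. m (a * s, b * s)) has_vector_derivative frechet_derivative m (at (0, 0)) (a, b)) (at 0)"
    "((\<lambda>s. m (s, s\<^sup>2)) has_vector_derivative frechet_derivative m (at (0, 0)) (1, 0)) (at 0)"
proof -
  have "((\<lambda>s. (a * s, b * s)) has_vector_derivative (a, b)) (at 0)"
    "((\<lambda>s::real. (s, s\<^sup>2)) has_vector_derivative (1, 2 * 0)) (at 0)"
    by (auto intro!: derivative_eq_intros simp: has_real_derivative_iff_has_vector_derivative[symmetric])
  from line_has_vector_derivative[OF smooth_at_has_derivative[OF assms] this(1)]
    line_has_vector_derivative[OF smooth_at_has_derivative[OF assms] this(2)]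
  show "((\<lambda>s. m (a * s, b * s)) has_vector_derivative frechet_derivative m (at (0, 0)) (a, b)) (at 0)"
    "((\<lambda>s. m (s, s\<^sup>2)) has_vector_derivative frechet_derivative m (at (0, 0)) (1, 0)) (at 0)" by simp_all
qed

lemma has_vector_derivative_cong_ev:
  assumes "(f has_vector_derivative d) (at x)" "\<forall>\<^sub>F t in nhds x. f t = g t"
  shows "(g has_vector_derivative d) (at x)"
  unfolding has_vector_derivative_def
  by (rule has_derivative_transform_eventually[OF assms(1)[unfolded has_vector_derivative_def]])
    (use assms(2) eventually_nhds_x_imp_x[OF assms(2)] in \<open>auto simp: eventually_at_filter elim: eventually_mono\<close>)

lemma hsm_slice: "hsm W (p, z) \<Longrightarrow> smooth_at (\<lambda>p. W p z) p"
  using smooth_at_compose[where f="\<lambda>p. (p, z)" and g="\<lambda>x. W (fst x) (snd x)" and x=p,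
      OF smooth_at_Pair[OF smooth_at_ident smooth_at_const]] hsm_smooth[of W "(p, z)"] by simp

context schwarz_germ
begin

lemma smooth_functionD: "smooth_function K S F \<Longrightarrow> schwarz_family K S (P :: real \<times> real \<Rightarrow> cfun) \<Longrightarrow> smooth_at (\<lambda>p. F (P p)) 0"
  unfolding smooth_function_def smooth_near0_iff by blast

text \<open>Smoothness of a function does not say by itself that values depend on germs only. The
  glued family is admissible because it agrees with the one built from \<open>T2\<close> near
  \<open>K\<close>; continuity of the function across \<open>snd p = 0\<close> then forces equal
  values on \<open>T1\<close> and \<open>T2\<close>.\<close>

lemma family_glue:
  fixes T1 T2 :: "real \<Rightarrow> cfun"
  assumes T: "schwarz_family K S T2" and eq: "near0 K (\<lambda>s z. T1 s z = T2 s z)"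
  shows "schwarz_family K S (\<lambda>p::real \<times> real. if snd p = 0 then T1 (fst p) else T2 (fst p))"
proof (rule schwarz_family_cong)
  show "schwarz_family K S (\<lambda>p::real \<times> real. T2 (fst p))" by (rule family_param[OF T]) simp_all
  have "isCont (fst :: real \<times> real \<Rightarrow> real) 0" "fst (0 :: real \<times> real) = 0" by (auto intro!: continuous_intros)
  from near0_param[OF eq this]
  show "near0 K (\<lambda>(p::real \<times> real) z. T2 (fst p) z = (if snd p = 0 then T1 (fst p) else T2 (fst p)) z)"
    by (rule near0_mono) simp
qed

lemma function_germ:
  fixes T1 T2 :: "real \<Rightarrow> cfun"
  assumes F: "smooth_function K S F" and T: "schwarz_family K S T2" and eq: "near0 K (\<lambda>s z. T1 s z = T2 s z)"
  shows "\<forall>\<^sub>F s in nhds 0. F (T1 s) = F (T2 s)"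
proof -
  define P where "P = (\<lambda>p::real \<times> real. if snd p = 0 then T1 (fst p) else T2 (fst p))"
  have "smooth_at (\<lambda>p. F (P p)) (0, 0)"
    unfolding P_def zero_prod_def[symmetric] by (rule smooth_functionD[OF F family_glue[OF T eq]])
  from smooth_at_eventually[OF this] have "\<forall>\<^sub>F p in nhds (0, 0). isCont (\<lambda>p. F (P p)) (fst p, snd p)"
    by eventually_elim (simp add: smooth_at_continuous)
  from eventually_slice_fst[OF this] show ?thesis
  proof eventually_elim
    case (elim s)
    have "isCont (\<lambda>y. (s, y)) (0::real)" by (intro continuous_intros)
    from isCont_o2[OF this elim] have "isCont (\<lambda>y. F (P (s, y))) 0" .
    from isCont_isolated_value[OF this, of "F (T2 s)"] show ?case by (simp add: P_def)
  qed
qed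

lemma function_base:
  fixes T :: "real \<Rightarrow> cfun"
  assumes F: "smooth_function K S F" and T: "schwarz_family K S T"
  shows "F (T 0) = F S"
  using eventually_nhds_x_imp_x[OF function_germ[OF F family_const, of "\<lambda>_. T 0", OF near0_const[OF family_base[OF T]]]] .

lemma vector_fieldD: "vector_field K S Y \<Longrightarrow> schwarz_family K S (P :: real \<times> real \<Rightarrow> cfun) \<Longrightarrow> tangent_field K S P (\<lambda>p. Y (P p))"
  unfolding vector_field_def by blast

lemma vector_field_hsm:
  "vector_field K S Y \<Longrightarrow> schwarz_family K S (P :: real \<times> real \<Rightarrow> cfun) \<Longrightarrow> near0 K (\<lambda>p z. hsm (\<lambda>p. Y (P p)) (p, z))"
  by (rule tangent_fieldD[OF _ vector_fieldD])

text \<open>The gluing argument for functions, now applied to the values of the field at each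
  \<open>z\<close>.\<close>

lemma field_germ:
  fixes T1 T2 :: "real \<Rightarrow> cfun"
  assumes Y: "vector_field K S Y" and T: "schwarz_family K S T2" and eq: "near0 K (\<lambda>s z. T1 s z = T2 s z)"
  shows "near0 K (\<lambda>s z. Y (T1 s) z = Y (T2 s) z)"
proof -
  define P where "P = (\<lambda>p::real \<times> real. if snd p = 0 then T1 (fst p) else T2 (fst p))"
  have h: "near0 K (\<lambda>p z. hsm (\<lambda>p. Y (P p)) (p, z))"
    unfolding P_def by (rule vector_field_hsm[OF Y family_glue[OF T eq]])
  have c: "isCont (\<lambda>s::real. (s, 0::real)) 0" "((0::real), (0::real)) = 0" by (auto simp: zero_prod_def intro!: continuous_intros)
  show ?thesis
  proof (rule near0_mono[OF near0_param[OF h c]])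
    fix s z assume "hsm (\<lambda>p. Y (P p)) ((s, 0), z)"
    then have "isCont (\<lambda>x. Y (P (fst x)) (snd x)) ((s, 0), z)" by (rule hsm_continuous)
    moreover have "isCont (\<lambda>y::real. ((s, y), z)) 0" by (intro continuous_intros)
    ultimately have "isCont (\<lambda>y. Y (P (s, y)) z) 0" using isCont_o2[where g="\<lambda>x. Y (P (fst x)) (snd x)" and f="\<lambda>y. ((s, y), z)"] by simp
    from isCont_isolated_value[OF this, of "Y (T2 s) z"] show "Y (T1 s) z = Y (T2 s) z" by (simp add: P_def)
  qed
qed

lemma field_base:
  fixes T :: "'p::euclidean_space \<Rightarrow> cfun"
  assumes Y: "vector_field K S Y" and T: "schwarz_family K S T"
  shows "near K (\<lambda>z. Y (T 0) z = Y S z)"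
  using near0_at0[OF field_germ[OF Y family_const near0_const[OF family_base[OF T]]]] .

lemma vector_field_curve:
  fixes T :: "real \<Rightarrow> cfun"
  assumes Y: "vector_field K S Y" and T: "schwarz_family K S T"
  shows "tangent_field K S T (\<lambda>s. Y (T s))"
proof -
  have P: "schwarz_family K S (\<lambda>p::real \<times> real. T (fst p))" by (rule family_param[OF T]) simp_all
  have "smooth_at (\<lambda>s::real. (s, 0::real)) 0" "((0::real), (0::real)) = 0" by (auto simp: zero_prod_def smooth_at_Pair_0)
  from tangent_field_param[OF P vector_fieldD[OF Y P] this] show ?thesis by simp
qed

lemma vector_field_tangent:
  assumes "vector_field K S X" shows "tangent K S (X S)"
  using tangent_field_tangent[OF vector_field_curve[OF assms family_const]] .

lemma variationD:
  assumes "variation K S X T" shows "schwarz_family K S T" "near K (\<lambda>z. dpar (\<lambda>_. 1) T 0 z = X z)"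
  using assms by (auto simp: variation_def)

lemma variation_line:
  fixes P :: "real \<times> real \<Rightarrow> cfun"
  assumes P: "schwarz_family K S P" and X: "near K (\<lambda>z. dpar (\<lambda>_. (1, 0)) P 0 z = X z)"
    and Y: "near K (\<lambda>z. dpar (\<lambda>_. (0, 1)) P 0 z = Y z)" and Z: "near K (\<lambda>z. Z z = of_real a * X z + of_real b * Y z)"
  shows "variation K S Z (\<lambda>s. P (a * s, b * s))"
  unfolding variation_def
proof
  have "smooth_at (\<lambda>s::real. (a * s, b * s)) 0"
    by (intro smooth_at_Pair smooth_at_bounded_linear[OF bounded_linear_mult_right]) simp_all
  from family_param[OF P this] show "schwarz_family K S (\<lambda>s. P (a * s, b * s))" by (simp add: zero_prod_def)
  show "near K (\<lambda>z. dpar (\<lambda>_. 1) (\<lambda>s. P (a * s, b * s)) 0 z = Z z)"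
  proof (rule near_mono[OF near_conj[OF near0_at0[OF family_near0_hsm[OF P]] near_conj[OF X near_conj[OF Y Z]]]], elim conjE)
    fix z assume h: "hsm P (0, z)" and e: "dpar (\<lambda>_. (1, 0)) P 0 z = X z" "dpar (\<lambda>_. (0, 1)) P 0 z = Y z"
      "Z z = of_real a * X z + of_real b * Y z"
    let ?F = "frechet_derivative (\<lambda>x. P (fst x) (snd x)) (at (0, z))"
    have lin: "linear ?F" by (rule has_derivative_linear[OF smooth_at_has_derivative[OF hsm_smooth[OF h]]])
    have "?F (a *\<^sub>R ((1, 0), 0) + b *\<^sub>R ((0, 1), 0)) = a *\<^sub>R ?F ((1, 0), 0) + b *\<^sub>R ?F ((0, 1), 0)"
      by (simp only: linear_add[OF lin] linear_cmul[OF lin])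
    then have d: "dpar (\<lambda>_. (a, b)) P 0 z = Z z"
      using e by (simp add: dpar_eq_frechet[OF hsm_smooth[OF h]] scaleR_conv_of_real)
    have "((\<lambda>s. (a * s, b * s)) has_vector_derivative (a, b)) (at 0)"
      by (auto intro!: derivative_eq_intros simp: has_real_derivative_iff_has_vector_derivative[symmetric])
    from hsm_path[OF _ this has_vector_derivative_const, of P z] h
    have "((\<lambda>s. P (a * s, b * s) z) has_vector_derivative Z z) (at 0)" by (simp add: zero_prod_def[symmetric] d)
    then show "dpar (\<lambda>_. 1) (\<lambda>s. P (a * s, b * s)) 0 z = Z z" by (intro dpar_eqI) simp
  qed
qed

lemma function_contact:
  assumes F: "smooth_function K S F" and T1: "variation K S X T1" and T2: "variation K S X T2"
  obtains P :: "real \<times> real \<Rightarrow> cfun" where "schwarz_family K S P" "smooth_at (\<lambda>p. F (P p)) (0, 0)"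
    "\<forall>\<^sub>F s in nhds 0. F (P (s, 0)) = F (T2 s)" "\<forall>\<^sub>F s in nhds 0. F (P (s, s\<^sup>2)) = F (T1 s)"
    "near0 K (\<lambda>s z. P (s, 0) z = T2 s z)" "near0 K (\<lambda>s z. P (s, s\<^sup>2) z = T1 s z)"
proof -
  have "near K (\<lambda>z. dpar (\<lambda>_. 1) T1 0 z = dpar (\<lambda>_. 1) T2 0 z)"
    by (rule near_mono[OF near_conj[OF variationD(2)[OF T1] variationD(2)[OF T2]]]) simp
  then obtain P :: "real \<times> real \<Rightarrow> cfun" where P: "schwarz_family K S P" and e: "near0 K (\<lambda>s z. P (s, 0) z = T2 s z)" "near0 K (\<lambda>s z. P (s, s\<^sup>2) z = T1 s z)"
    by (rule contact_family[OF variationD(1)[OF T1] variationD(1)[OF T2]])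
  have "smooth_at (\<lambda>p. F (P p)) (0, 0)" using smooth_functionD[OF F P] by (simp add: zero_prod_def)
  from that[OF P this function_germ[OF F variationD(1)[OF T2] e(1)] function_germ[OF F variationD(1)[OF T1] e(2)] e]
  show thesis .
qed

text \<open>\<open>T\<close> and \<open>T1\<close> are a line and a parabola in one two-parameter
  family. These have the same velocity at the origin, hence the same derivative of \<open>F\<close>;
  so one curve determines the derivative along all curves with its velocity.\<close>

lemma has_derivationI:
  assumes F: "smooth_function K S F" and T: "variation K S X T" and d: "((\<lambda>t. F (T t)) has_real_derivative d) (at 0)"
  shows "has_derivation K S X F d"
  unfolding has_derivation_def
proof (intro allI impI)
  fix T1 assume T1: "variation K S X T1"
  obtain P :: "real \<times> real \<Rightarrow> cfun" where P: "smooth_at (\<lambda>p. F (P p)) (0, 0)"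
    "\<forall>\<^sub>F s in nhds 0. F (P (s, 0)) = F (T s)" "\<forall>\<^sub>F s in nhds 0. F (P (s, s\<^sup>2)) = F (T1 s)"
    by (rule function_contact[OF F T1 T])
  let ?e = "frechet_derivative (\<lambda>p. F (P p)) (at (0, 0)) (1, 0)"
  have "((\<lambda>s. F (P (s, 0))) has_vector_derivative ?e) (at 0)" using line_velocity(1)[OF P(1), of 1 0] by simp
  from has_vector_derivative_cong_ev[OF this P(2)] have "((\<lambda>t. F (T t)) has_real_derivative ?e) (at 0)"
    by (simp add: has_real_derivative_iff_has_vector_derivative)
  then have "?e = d" using d by (rule DERIV_unique)
  with has_vector_derivative_cong_ev[OF line_velocity(2)[OF P(1)] P(3)]
  show "((\<lambda>t. F (T1 t)) has_real_derivative d) (at 0)"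
    by (simp add: has_real_derivative_iff_has_vector_derivative)
qed

lemma has_derivation_exists:
  assumes F: "smooth_function K S F" and T: "variation K S X T"
  shows "\<exists>d. ((\<lambda>t. F (T t)) has_real_derivative d) (at 0)"
proof -
  have "schwarz_family K S (\<lambda>p::real \<times> real. T (fst p))" by (rule family_param[OF variationD(1)[OF T]]) simp_all
  from smooth_functionD[OF F this] have "smooth_at (\<lambda>p::real \<times> real. F (T (fst p))) (0, 0)" by (simp add: zero_prod_def)
  from line_velocity(1)[OF this, of 1 0] show ?thesis
    by (auto simp: has_real_derivative_iff_has_vector_derivative)
qed

lemma derivation_eq:
  assumes F: "smooth_function K S F" and X: "tangent K S X"
  shows "has_derivation K S X F (derivation K S X F)"
proof -
  obtain T where T: "variation K S X T" using X unfolding tangent_def by blast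
  obtain d where "((\<lambda>t. F (T t)) has_real_derivative d) (at 0)" using has_derivation_exists[OF F T] by blast
  from has_derivationI[OF F T this] show ?thesis
    unfolding derivation_def
  proof (rule theI)
    fix d' assume "has_derivation K S X F d'"
    then have "((\<lambda>t. F (T t)) has_real_derivative d') (at 0)" using T unfolding has_derivation_def by blast
    then show "d' = d" using \<open>((\<lambda>t. F (T t)) has_real_derivative d) (at 0)\<close> by (rule DERIV_unique)
  qed
qed

text \<open>The two vectors and their combination are velocities of straight lines in a single
  two-parameter family, on whose parameter plane the derivative of \<open>F\<close> is
  linear.\<close>

lemma has_derivation_linear:
  assumes F: "smooth_function K S F" and X: "tangent K S X" and Y: "tangent K S Y"
    and dX: "has_derivation K S X F a" and dY: "has_derivation K S Y F b" and Z: "near K (\<lambda>z. Z z = X z + of_real c * Y z)"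
  shows "has_derivation K S Z F (a + c * b)"
proof -
  obtain P :: "real \<times> real \<Rightarrow> cfun" where P: "schwarz_family K S P"
    "near K (\<lambda>z. dpar (\<lambda>_. (1, 0)) P 0 z = X z)" "near K (\<lambda>z. dpar (\<lambda>_. (0, 1)) P 0 z = Y z)"
    by (rule two_velocities[OF X Y])
  have m: "smooth_at (\<lambda>p. F (P p)) (0, 0)" using smooth_functionD[OF F P(1)] by (simp add: zero_prod_def)
  let ?D = "frechet_derivative (\<lambda>p. F (P p)) (at (0, 0))"
  have "variation K S X (\<lambda>s. P (1 * s, 0 * s))" by (rule variation_line[OF P]) (simp add: near_def exI[of _ UNIV])
  then have "((\<lambda>s. F (P (1 * s, 0 * s))) has_real_derivative a) (at 0)" using dX unfolding has_derivation_def by blast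
  from DERIV_unique[OF line_velocity(1)[OF m, folded has_real_derivative_iff_has_vector_derivative] this]
  have a: "?D (1, 0) = a" .
  have "variation K S Y (\<lambda>s. P (0 * s, 1 * s))" by (rule variation_line[OF P]) (simp add: near_def exI[of _ UNIV])
  then have "((\<lambda>s. F (P (0 * s, 1 * s))) has_real_derivative b) (at 0)" using dY unfolding has_derivation_def by blast
  from DERIV_unique[OF line_velocity(1)[OF m, folded has_real_derivative_iff_has_vector_derivative] this]
  have b: "?D (0, 1) = b" .
  have lin: "linear ?D" by (rule has_derivative_linear[OF smooth_at_has_derivative[OF m]])
  have "?D ((1, 0) + c *\<^sub>R (0, 1)) = a + c *\<^sub>R b" by (simp only: linear_add[OF lin] linear_cmul[OF lin] a b)
  then have "((\<lambda>s. F (P (1 * s, c * s))) has_real_derivative a + c * b) (at 0)"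
    using line_velocity(1)[OF m, of 1 c] by (simp add: has_real_derivative_iff_has_vector_derivative)
  moreover have "near K (\<lambda>z. Z z = of_real 1 * X z + of_real c * Y z)" using Z by simp
  ultimately show ?thesis by (intro has_derivationI[OF F variation_line[OF P, of Z 1 c]])
qed

text \<open>The contact argument applied to \<open>Y (T s) z\<close> for fixed \<open>z\<close>:
  line and parabola give the same derivative.\<close>

lemma has_flat_derivativeI:
  assumes Y: "vector_field K S Y" and T0: "variation K S X T0"
  shows "has_flat_derivative K S X Y (\<lambda>z. dpar (\<lambda>_. 1) (\<lambda>s. Y (T0 s)) 0 z)"
  unfolding has_flat_derivative_def
proof (intro allI impI)
  fix T assume T: "variation K S X T"
  note f = variationD(1)[OF T] and f0 = variationD(1)[OF T0]
  have "near K (\<lambda>z. dpar (\<lambda>_. 1) T 0 z = dpar (\<lambda>_. 1) T0 0 z)"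
    by (rule near_mono[OF near_conj[OF variationD(2)[OF T] variationD(2)[OF T0]]]) simp
  then obtain P :: "real \<times> real \<Rightarrow> cfun" where P: "schwarz_family K S P" and e: "near0 K (\<lambda>s z. P (s, 0) z = T0 s z)" "near0 K (\<lambda>s z. P (s, s\<^sup>2) z = T s z)"
    by (rule contact_family[OF f f0])
  let ?W = "\<lambda>p. Y (P p)"
  show "near K (\<lambda>z. ((\<lambda>t. Y (T t) z) has_vector_derivative dpar (\<lambda>_. 1) (\<lambda>s. Y (T0 s)) 0 z) (at 0))"
  proof (rule near_mono[OF near_conj[OF near0_at0[OF vector_field_hsm[OF Y P]]
        near_conj[OF near0_at0[OF near0_open[OF field_germ[OF Y f0 e(1)]]] near0_at0[OF near0_open[OF field_germ[OF Y f e(2)]]]]]], elim conjE)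
    fix z assume h: "hsm ?W (0, z)"
      and e0: "\<forall>\<^sub>F x in nhds (0, z). Y (P (fst x, 0)) (snd x) = Y (T0 (fst x)) (snd x)"
      and e2: "\<forall>\<^sub>F x in nhds (0, z). Y (P (fst x, (fst x)\<^sup>2)) (snd x) = Y (T (fst x)) (snd x)"
    have m: "smooth_at (\<lambda>p. Y (P p) z) (0, 0)"
      using hsm_slice[OF h] by (simp add: zero_prod_def)
    let ?d = "frechet_derivative (\<lambda>p. Y (P p) z) (at (0, 0)) (1, 0)"
    have "((\<lambda>s. Y (P (s, 0)) z) has_vector_derivative ?d) (at 0)" using line_velocity(1)[OF m, of 1 0] by simp
    from has_vector_derivative_cong_ev[OF this eventually_slice_fst[OF e0]]
    have "dpar (\<lambda>_. 1) (\<lambda>s. Y (T0 s)) 0 z = ?d" by (intro dpar_eqI) simp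
    moreover have "((\<lambda>t. Y (T t) z) has_vector_derivative ?d) (at 0)"
      by (rule has_vector_derivative_cong_ev[OF line_velocity(2)[OF m] eventually_slice_fst[OF e2]])
    ultimately show "((\<lambda>t. Y (T t) z) has_vector_derivative dpar (\<lambda>_. 1) (\<lambda>s. Y (T0 s)) 0 z) (at 0)" by simp
  qed
qed

lemma flat_derivative_eq:
  assumes T: "variation K S X T" and E: "has_flat_derivative K S X Y E"
  shows "has_flat_derivative K S X Y (flat_derivative K S X Y)" "near K (\<lambda>z. flat_derivative K S X Y z = E z)"
proof -
  show 1: "has_flat_derivative K S X Y (flat_derivative K S X Y)"
    unfolding flat_derivative_def by (rule someI[of "has_flat_derivative K S X Y", OF E])
  have "near K (\<lambda>z. ((\<lambda>t. Y (T t) z) has_vector_derivative flat_derivative K S X Y z) (at 0))"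
    "near K (\<lambda>z. ((\<lambda>t. Y (T t) z) has_vector_derivative E z) (at 0))"
    using 1 E T unfolding has_flat_derivative_def by blast+
  from near_conj[OF this] show "near K (\<lambda>z. flat_derivative K S X Y z = E z)"
    by (rule near_mono) (elim conjE, rule vector_derivative_unique_at)
qed

lemmas flat_derivative_curve = flat_derivative_eq(2)[OF _ has_flat_derivativeI]

text \<open>Links the connection on fields, defined at a single curve, with the formula along
  families. The flat derivative is read off on the straight line through the parameter origin in the
  direction \<open>u 0\<close>.\<close>

lemma nabla_eq_cov:
  fixes T :: "'p::euclidean_space \<Rightarrow> cfun"
  assumes T: "schwarz_family K S T" and Y: "vector_field K S Y" and v: "near K (\<lambda>z. dpar u T 0 z = X S z)"
  shows "near K (\<lambda>z. cov T u (\<lambda>r. Y (T r)) 0 z = nabla K S X Y z)"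
proof -
  have "smooth_at (\<lambda>s::real. s *\<^sub>R u 0) 0" by (rule smooth_at_linear[OF bounded_linear_scaleR_left])
  from family_param[OF T this] have f: "schwarz_family K S (\<lambda>s. T (s *\<^sub>R u 0))" by simp
  have d: "dpar (\<lambda>_. 1) (\<lambda>s. W (s *\<^sub>R u 0)) 0 z = dpar u W 0 z" for W :: "'p \<Rightarrow> cfun" and z
    by (simp add: dpar_def)
  have var: "variation K S (X S) (\<lambda>s. T (s *\<^sub>R u 0))"
    unfolding variation_def using f v by (simp add: d)
  have fl: "near K (\<lambda>z. flat_derivative K S (X S) Y z = dpar u (\<lambda>r. Y (T r)) 0 z)"
    using flat_derivative_curve[OF var Y var] by (simp add: d[of "\<lambda>r. Y (T r)"])
  show ?thesis
  proof (rule near_mono[OF near_conj[OF fl near_conj[OF near_open[OF v] near_conj[OF near_open[OF family_base[OF T]] near_open[OF field_base[OF Y T]]]]]], elim conjE)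
    fix z assume e: "flat_derivative K S (X S) Y z = dpar u (\<lambda>r. Y (T r)) 0 z"
      and ev: "\<forall>\<^sub>F w in nhds z. dpar u T 0 w = X S w" "\<forall>\<^sub>F w in nhds z. T 0 w = S w" "\<forall>\<^sub>F w in nhds z. Y (T 0) w = Y S w"
    show "cov T u (\<lambda>r. Y (T r)) 0 z = nabla K S X Y z"
      unfolding cov_def nabla_def e
      using deriv_cong_ev[OF ev(1) HOL.refl] deriv_cong_ev[OF ev(2) HOL.refl] deriv_cong_ev[OF ev(3) HOL.refl]
        eventually_nhds_x_imp_x[OF ev(1)] eventually_nhds_x_imp_x[OF ev(3)] by simp
  qed
qed

section \<open>The laws of an affine connection\<close>

lemma field_flat:
  assumes X: "vector_field K S X" and Y: "vector_field K S Y"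
  shows "has_flat_derivative K S (X S) Y (flat_derivative K S (X S) Y)"
proof -
  obtain T where T: "variation K S (X S) T" using vector_field_tangent[OF X] unfolding tangent_def by blast
  show ?thesis by (rule flat_derivative_eq(1)[OF T has_flat_derivativeI[OF Y T]])
qed

lemma nabla_tangent:
  assumes X: "vector_field K S X" and Y: "vector_field K S Y"
  shows "tangent K S (nabla K S X Y)"
proof -
  obtain T where T: "variation K S (X S) T" using vector_field_tangent[OF X] unfolding tangent_def by blast
  note f = variationD(1)[OF T]
  have "tangent_field K S T (cov T (\<lambda>_. 1) (\<lambda>s. Y (T s)))"
    by (rule tangent_field_cov[OF f smooth_at_const vector_field_curve[OF Y f]])
  from tangent_cong[OF tangent_field_tangent[OF this] nabla_eq_cov[where u="\<lambda>_. 1" and X=X, OF f Y variationD(2)[OF T]]] show ?thesis .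
qed

lemma tangent_deriv:
  "tangent K S X \<Longrightarrow> near K (\<lambda>z. (X has_field_derivative deriv X z) (at z))"
  by (rule near_mono[OF tangentD(1)], assumption, rule field_differentiable_derivI,
      erule analytic_on_imp_differentiable_at, simp)

text \<open>Lines in the parameter plane of \<open>P\<close> realize all combinations of its two
  velocities, and the derivative of \<open>Y (P p) z\<close> on that plane is linear in the
  direction.\<close>

lemma flat_derivative_lines:
  fixes P :: "real \<times> real \<Rightarrow> cfun"
  assumes P: "schwarz_family K S P" and X: "near K (\<lambda>z. dpar (\<lambda>_. (1, 0)) P 0 z = X z)"
    and X': "near K (\<lambda>z. dpar (\<lambda>_. (0, 1)) P 0 z = X' z)" and Z: "near K (\<lambda>z. Z z = of_real a * X z + of_real b * X' z)"
    and Y: "vector_field K S Y"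
  shows "near K (\<lambda>z. flat_derivative K S Z Y z
    = of_real a * flat_derivative K S X Y z + of_real b * flat_derivative K S X' Y z)"
proof -
  have triv: "near K (\<lambda>z. X z = of_real 1 * X z + of_real 0 * X' z)" "near K (\<lambda>z. X' z = of_real 0 * X z + of_real 1 * X' z)"
    by (auto simp: near_def intro!: exI[of _ UNIV])
  note v = variation_line[OF P X X' Z] variation_line[OF P X X' triv(1)] variation_line[OF P X X' triv(2)]
  show ?thesis
  proof (rule near_mono[OF near_conj[OF near0_at0[OF vector_field_hsm[OF Y P]] near_conj[OF flat_derivative_curve[OF v(1) Y v(1)]
          near_conj[OF flat_derivative_curve[OF v(2) Y v(2)] flat_derivative_curve[OF v(3) Y v(3)]]]]], elim conjE)
    fix z assume h: "hsm (\<lambda>p. Y (P p)) (0, z)"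
      and e: "flat_derivative K S Z Y z = dpar (\<lambda>_. 1) (\<lambda>s. Y (P (a * s, b * s))) 0 z"
       "flat_derivative K S X Y z = dpar (\<lambda>_. 1) (\<lambda>s. Y (P (1 * s, 0 * s))) 0 z"
       "flat_derivative K S X' Y z = dpar (\<lambda>_. 1) (\<lambda>s. Y (P (0 * s, 1 * s))) 0 z"
    have m: "smooth_at (\<lambda>p. Y (P p) z) (0, 0)"
      using hsm_slice[OF h] by (simp add: zero_prod_def)
    let ?D = "frechet_derivative (\<lambda>p. Y (P p) z) (at (0, 0))"
    have d: "dpar (\<lambda>_. 1) (\<lambda>s. Y (P (c * s, d * s))) 0 z = ?D (c, d)" for c d
      by (rule dpar_eqI) (use line_velocity(1)[OF m, of c d] in simp)
    have lin: "linear ?D" by (rule has_derivative_linear[OF smooth_at_has_derivative[OF m]])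
    have "?D (a *\<^sub>R (1, 0) + b *\<^sub>R (0, 1)) = a *\<^sub>R ?D (1, 0) + b *\<^sub>R ?D (0, 1)"
      by (simp only: linear_add[OF lin] linear_cmul[OF lin])
    then show "flat_derivative K S Z Y z = of_real a * flat_derivative K S X Y z + of_real b * flat_derivative K S X' Y z"
      unfolding e d by (simp add: scaleR_conv_of_real)
  qed
qed

lemma nabla_affine: "affine_connection K S (nabla K S)"
  unfolding affine_connection_def
proof (intro conjI allI impI; (elim conjE)?)
  fix X Y assume "vector_field K S X" "vector_field K S Y"
  then show "tangent K S (nabla K S X Y)" by (rule nabla_tangent)
next
  fix X X' Y assume X: "vector_field K S X" "vector_field K S X'" and Y: "vector_field K S Y"
  note t = vector_field_tangent[OF X(1)] vector_field_tangent[OF X(2)]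
  obtain P :: "real \<times> real \<Rightarrow> cfun" where P: "schwarz_family K S P"
    "near K (\<lambda>z. dpar (\<lambda>_. (1, 0)) P 0 z = X S z)" "near K (\<lambda>z. dpar (\<lambda>_. (0, 1)) P 0 z = X' S z)"
    by (rule two_velocities[OF t])
  have triv: "near K (\<lambda>z. X S z + X' S z = of_real 1 * X S z + of_real 1 * X' S z)"
    by (auto simp: near_def intro!: exI[of _ UNIV])
  from near_conj[OF flat_derivative_lines[OF P triv Y] near_conj[OF tangent_deriv[OF t(1)] tangent_deriv[OF t(2)]]]
  show "near K (\<lambda>z. nabla K S (\<lambda>T z. X T z + X' T z) Y z = nabla K S X Y z + nabla K S X' Y z)"
  proof (rule near_mono, elim conjE)
    fix z assume f: "flat_derivative K S (\<lambda>z. X S z + X' S z) Y z = of_real 1 * flat_derivative K S (X S) Y z + of_real 1 * flat_derivative K S (X' S) Y z"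
      and d: "(X S has_field_derivative deriv (X S) z) (at z)" "(X' S has_field_derivative deriv (X' S) z) (at z)"
    have "deriv (\<lambda>z. X S z + X' S z) z = deriv (X S) z + deriv (X' S) z" by (rule DERIV_imp_deriv[OF DERIV_add[OF d]])
    then show "nabla K S (\<lambda>T z. X T z + X' T z) Y z = nabla K S X Y z + nabla K S X' Y z"
      unfolding nabla_def f by (simp add: algebra_simps add_divide_distrib)
  qed
next
  fix X Y Y' assume X: "vector_field K S X" and Y: "vector_field K S Y" "vector_field K S Y'"
  note t = vector_field_tangent[OF Y(1)] vector_field_tangent[OF Y(2)]
  obtain T where T: "variation K S (X S) T" using vector_field_tangent[OF X] unfolding tangent_def by blast
  have "has_flat_derivative K S (X S) (\<lambda>T z. Y T z + Y' T z) (\<lambda>z. flat_derivative K S (X S) Y z + flat_derivative K S (X S) Y' z)"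
    unfolding has_flat_derivative_def
  proof (intro allI impI)
    fix T1 assume "variation K S (X S) T1"
    then have "near K (\<lambda>z. ((\<lambda>t. Y (T1 t) z) has_vector_derivative flat_derivative K S (X S) Y z) (at 0))"
      "near K (\<lambda>z. ((\<lambda>t. Y' (T1 t) z) has_vector_derivative flat_derivative K S (X S) Y' z) (at 0))"
      using field_flat[OF X Y(1)] field_flat[OF X Y(2)] unfolding has_flat_derivative_def by blast+
    from near_conj[OF this] show "near K (\<lambda>z. ((\<lambda>t. Y (T1 t) z + Y' (T1 t) z) has_vector_derivative
       flat_derivative K S (X S) Y z + flat_derivative K S (X S) Y' z) (at 0))"
      by (rule near_mono) (elim conjE, rule has_vector_derivative_add)
  qed
  from near_conj[OF flat_derivative_eq(2)[OF T this] near_conj[OF tangent_deriv[OF t(1)] tangent_deriv[OF t(2)]]]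
  show "near K (\<lambda>z. nabla K S X (\<lambda>T z. Y T z + Y' T z) z = nabla K S X Y z + nabla K S X Y' z)"
  proof (rule near_mono, elim conjE)
    fix z assume f: "flat_derivative K S (X S) (\<lambda>T z. Y T z + Y' T z) z = flat_derivative K S (X S) Y z + flat_derivative K S (X S) Y' z"
      and d: "(Y S has_field_derivative deriv (Y S) z) (at z)" "(Y' S has_field_derivative deriv (Y' S) z) (at z)"
    have "deriv (\<lambda>z. Y S z + Y' S z) z = deriv (Y S) z + deriv (Y' S) z" by (rule DERIV_imp_deriv[OF DERIV_add[OF d]])
    then show "nabla K S X (\<lambda>T z. Y T z + Y' T z) z = nabla K S X Y z + nabla K S X Y' z"
      unfolding nabla_def f by (simp add: algebra_simps add_divide_distrib)
  qed
next
  fix f X Y assume F: "smooth_function K S f" and X: "vector_field K S X" and Y: "vector_field K S Y"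
  note t = vector_field_tangent[OF X]
  \<comment> \<open>Both velocities are taken equal to \<open>X S\<close>, the second with
    coefficient 0, so that homogeneity becomes a case of the rule for combinations.\<close>
  obtain P :: "real \<times> real \<Rightarrow> cfun" where P: "schwarz_family K S P"
    "near K (\<lambda>z. dpar (\<lambda>_. (1, 0)) P 0 z = X S z)" "near K (\<lambda>z. dpar (\<lambda>_. (0, 1)) P 0 z = X S z)"
    by (rule two_velocities[OF t t])
  have triv: "near K (\<lambda>z. of_real (f S) * X S z = of_real (f S) * X S z + of_real 0 * X S z)"
    by (auto simp: near_def intro!: exI[of _ UNIV])
  from near_conj[OF flat_derivative_lines[OF P triv Y] tangent_deriv[OF t]]
  show "near K (\<lambda>z. nabla K S (\<lambda>T z. of_real (f T) * X T z) Y z = of_real (f S) * nabla K S X Y z)"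
  proof (rule near_mono, elim conjE)
    fix z assume e: "flat_derivative K S (\<lambda>z. of_real (f S) * X S z) Y z = of_real (f S) * flat_derivative K S (X S) Y z + of_real 0 * flat_derivative K S (X S) Y z"
      and d: "(X S has_field_derivative deriv (X S) z) (at z)"
    have "deriv (\<lambda>z. of_real (f S) * X S z) z = of_real (f S) * deriv (X S) z" by (rule DERIV_imp_deriv[OF DERIV_cmult[OF d]])
    then show "nabla K S (\<lambda>T z. of_real (f T) * X T z) Y z = of_real (f S) * nabla K S X Y z"
      unfolding nabla_def e by (simp add: algebra_simps)
  qed
next
  fix f X Y assume F: "smooth_function K S f" and X: "vector_field K S X" and Y: "vector_field K S Y"
  show "has_derivation K S (X S) f (derivation K S (X S) f)" by (rule derivation_eq[OF F vector_field_tangent[OF X]])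
next
  fix f X Y assume F: "smooth_function K S f" and X: "vector_field K S X" and Y: "vector_field K S Y"
  note t = vector_field_tangent[OF Y]
  obtain T where T: "variation K S (X S) T" using vector_field_tangent[OF X] unfolding tangent_def by blast
  let ?d = "derivation K S (X S) f"
  have "has_flat_derivative K S (X S) (\<lambda>T z. of_real (f T) * Y T z) (\<lambda>z. of_real (f S) * flat_derivative K S (X S) Y z + of_real ?d * Y S z)"
    unfolding has_flat_derivative_def
  proof (intro allI impI)
    fix T1 assume T1: "variation K S (X S) T1"
    have "near K (\<lambda>z. ((\<lambda>t. Y (T1 t) z) has_vector_derivative flat_derivative K S (X S) Y z) (at 0))"
      using field_flat[OF X Y] T1 unfolding has_flat_derivative_def by blast
    from near_conj[OF this field_base[OF Y variationD(1)[OF T1]]]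
    show "near K (\<lambda>z. ((\<lambda>t. of_real (f (T1 t)) * Y (T1 t) z) has_vector_derivative
       of_real (f S) * flat_derivative K S (X S) Y z + of_real ?d * Y S z) (at 0))"
    proof (rule near_mono, elim conjE)
      fix z assume y: "((\<lambda>t. Y (T1 t) z) has_vector_derivative flat_derivative K S (X S) Y z) (at 0)" and b: "Y (T1 0) z = Y S z"
      have "((\<lambda>t. f (T1 t)) has_real_derivative ?d) (at 0)"
        using derivation_eq[OF F vector_field_tangent[OF X]] T1 unfolding has_derivation_def by blast
      then have "((\<lambda>t. complex_of_real (f (T1 t))) has_vector_derivative of_real ?d) (at 0)"
        by (intro bounded_linear.has_vector_derivative[OF bounded_linear_of_real]) (simp add: has_real_derivative_iff_has_vector_derivative)
      from has_vector_derivative_mult[OF this y]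
      show "((\<lambda>t. of_real (f (T1 t)) * Y (T1 t) z) has_vector_derivative
       of_real (f S) * flat_derivative K S (X S) Y z + of_real ?d * Y S z) (at 0)"
        using function_base[OF F variationD(1)[OF T1]] b by simp
    qed
  qed
  from near_conj[OF flat_derivative_eq(2)[OF T this] tangent_deriv[OF t]]
  show "near K (\<lambda>z. nabla K S X (\<lambda>T z. of_real (f T) * Y T z) z = of_real (f S) * nabla K S X Y z + of_real ?d * Y S z)"
  proof (rule near_mono, elim conjE)
    fix z assume e: "flat_derivative K S (X S) (\<lambda>T z. of_real (f T) * Y T z) z = of_real (f S) * flat_derivative K S (X S) Y z + of_real ?d * Y S z"
      and d: "(Y S has_field_derivative deriv (Y S) z) (at z)"
    have "deriv (\<lambda>z. of_real (f S) * Y S z) z = of_real (f S) * deriv (Y S) z" by (rule DERIV_imp_deriv[OF DERIV_cmult[OF d]])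
    then show "nabla K S X (\<lambda>T z. of_real (f T) * Y T z) z = of_real (f S) * nabla K S X Y z + of_real ?d * Y S z"
      unfolding nabla_def e by (simp add: algebra_simps)
  qed
qed

end

section \<open>The symmetric space\<close>

lemma reflect_mult_apply: "reflect_mult A B z = A (cnj (B (cnj (A z))))"
  by (simp add: reflect_mult_def cbar_def)

context schwarz_germ
begin

text \<open>The reflection belonging to the product is \<sigma>_A \<circ> \<sigma>_B \<circ>
  \<sigma>_A, one involution conjugated by another, hence again an involution.\<close>

lemma reflect_mult_family:
  fixes A B :: "'p::euclidean_space \<Rightarrow> cfun"
  assumes A: "schwarz_family K S A" and B: "schwarz_family K S B"
  shows "schwarz_family K S (\<lambda>r. reflect_mult (A r) (B r))"
proof (rule schwarz_familyI)
  note a0 = family_base_at[OF A] and b0 = family_base_at[OF B]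
  fix k assume k: "k \<in> K"
  have "hsm (\<lambda>r z. cnj (B r (cnj (A r z)))) (0, k)"
    by (rule hsm_cnj_compose[where h="\<lambda>r. r" and Y=B]) (use family_hsm[OF A k] family_hsm[OF B k] a0[OF k] in simp_all)
  then have "hsm (\<lambda>r z. A r (cnj (B r (cnj (A r z))))) (0, k)"
    by (rule hsm_compose[where h="\<lambda>r. r" and Y=A, rotated 2]) (use family_hsm[OF A k] a0[OF k] b0[OF k] in simp_all)
  then show "hsm (\<lambda>r. reflect_mult (A r) (B r)) (0, k)"
    by (rule hsm_cong[rotated]) (simp add: reflect_mult_apply)
next
  have i: "near0 K (\<lambda>(r::'p) z. cnj (S (cnj (S z))) = z)" by (rule family_involution[OF family_const])
  have a: "near0 K (\<lambda>(r::'p) z. A 0 z = S z)" "near0 K (\<lambda>(r::'p) z. B 0 z = S z)"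
    by (rule near0_const[OF family_base[OF A]], rule near0_const[OF family_base[OF B]])
  note c = family_const[where 'p='p]
  have "near0 K (\<lambda>(r::'p) z. reflect_mult (A 0) (B 0) z = S z)"
    by (rule near0_mono[OF near0_conj[OF near0_conj[OF i a(1)] near0_conj[OF near0_reflect[OF c a(2)] near0_reflect[OF c near0_reflect[OF c a(1)]]]]])
      (simp add: reflect_mult_apply)
  from near0_at0[OF this] show "near K (\<lambda>z. reflect_mult (A 0) (B 0) z = S z)" .
next
  note i = family_involution[OF A] and ib = family_involution[OF B]
  show "near0 K (\<lambda>r z. cnj (reflect_mult (A r) (B r) (cnj (reflect_mult (A r) (B r) z))) = z)"
    by (rule near0_mono[OF near0_conj[OF i near0_conj[OF near0_reflect[OF A ib] near0_reflect[OF A near0_reflect[OF B i]]]]])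
      (simp add: reflect_mult_apply)
qed

text \<open>In terms of reflections these are identities between words in the involutions
  \<sigma>_A, \<sigma>_B, \<sigma>_C; each is reduced by cancelling \<sigma>_A \<sigma>_A at the
  appropriate reflected point.\<close>

lemma reflect_mult_laws:
  fixes A B C :: "'p::euclidean_space \<Rightarrow> cfun"
  assumes A: "schwarz_family K S A" and B: "schwarz_family K S B" and C: "schwarz_family K S C"
  shows "near0 K (\<lambda>r z. reflect_mult (A r) (A r) z = A r z)"
    "near0 K (\<lambda>r z. reflect_mult (A r) (reflect_mult (A r) (B r)) z = B r z)"
    "near0 K (\<lambda>r z. reflect_mult (A r) (reflect_mult (B r) (C r)) z
          = reflect_mult (reflect_mult (A r) (B r)) (reflect_mult (A r) (C r)) z)"
proof -
  note i = family_involution[OF A]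
  show "near0 K (\<lambda>r z. reflect_mult (A r) (A r) z = A r z)"
    by (rule near0_mono[OF i]) (simp add: reflect_mult_apply)
  have *: "a = b" if "cnj a = cnj b" for a b using that by simp
  show "near0 K (\<lambda>r z. reflect_mult (A r) (reflect_mult (A r) (B r)) z = B r z)"
    by (rule near0_mono[OF near0_conj[OF i near0_reflect[OF B i]]]) (rule *, simp add: reflect_mult_apply)
  show "near0 K (\<lambda>r z. reflect_mult (A r) (reflect_mult (B r) (C r)) z
          = reflect_mult (reflect_mult (A r) (B r)) (reflect_mult (A r) (C r)) z)"
    by (rule near0_mono[OF near0_conj[OF near0_reflect[OF A near0_reflect[OF B i]]
            near0_reflect[OF A near0_reflect[OF B near0_reflect[OF C i]]]]])
      (simp add: reflect_mult_apply)
qed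

text \<open>Put h = \<sigma>_S \<circ> \<sigma>_A, which is close to the identity. A fixed point of
  the symmetry at \<open>S\<close> satisfies \<sigma>_S \<sigma>_A \<sigma>_S = \<sigma>_A, hence h
  \<circ> h = id. The mean \<open>m\<close> of \<open>h\<close> and the identity is then invariant
  under \<open>h\<close> and, being close to the identity, injective; so h = id and the two
  reflections agree.\<close>

lemma reflect_mult_isolated:
  fixes A :: "'p::euclidean_space \<Rightarrow> cfun"
  assumes A: "schwarz_family K S A"
  shows "\<forall>\<^sub>F r in nhds 0. near K (\<lambda>z. reflect_mult S (A r) z = A r z) \<longrightarrow> near K (\<lambda>z. A r z = S z)"
proof -
  define h where "h r z = cnj (S (cnj (A r z)))" for r z
  define m where "m r z = (z + h r z) / 2" for r z
  note c = family_const[where 'p='p]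
  note iA = family_involution[OF A] and iS = family_involution[OF c]
  have hs: "hsm h (0, k)" if k: "k \<in> K" for k unfolding h_def
    by (rule hsm_cnj_compose[where h="\<lambda>r. r" and Y="\<lambda>_. S"])
      (use family_hsm[OF A k] family_hsm[OF c k] family_base_at[OF A k] in simp_all)
  have h0: "near K (\<lambda>z. h 0 z = z)"
    by (rule near_mono[OF near_conj[OF near0_at0[OF iS] family_base[OF A]]]) (simp add: h_def)
  have hk: "h 0 k = k" if "k \<in> K" for k using h0 that unfolding near_def by blast
  have ms: "hsm m (0, k)" if "k \<in> K" for k unfolding m_def
    by (intro hsm_divide hsm_add hs that) simp_all
  have mk: "m 0 k = k" if "k \<in> K" for k using hk[OF that] by (simp add: m_def)
  have "deriv (m 0) k = deriv (\<lambda>z. z) k" if "k \<in> K" for k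
  proof (rule deriv_cong_ev)
    have "\<forall>\<^sub>F z in nhds k. h 0 z = z" using h0 that unfolding near_iff by blast
    then show "\<forall>\<^sub>F z in nhds k. m 0 z = z" by eventually_elim (simp add: m_def)
  qed simp
  then have md: "deriv (m 0) k \<noteq> 0" if "k \<in> K" for k using that by simp
  have mi: "inj_on (m 0) K" using mk by (simp add: inj_on_def)
  obtain N U W \<psi> where N: "open N" "(0::'p) \<in> N" "open U" "K \<subseteq> U" and inj: "\<And>r. r \<in> N \<Longrightarrow> inj_on (m r) U"
    using hsm_inverse_family[OF compact_K ms mi md] by (metis (no_types, lifting))
  have NU: "near0 K (\<lambda>r z. r \<in> N \<and> z \<in> U)" unfolding near0_def using N by blast
  have hU: "near0 K (\<lambda>r z. r \<in> N \<and> h r z \<in> U)"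
    by (rule near0_pull[OF NU]) (use hsm_continuous[OF hs] hk in auto)
  have "near0 K (\<lambda>r z. (reflect_mult S (A r) z = A r z \<longrightarrow> A r z = S z))"
  proof (rule near0_mono[OF near0_conj[OF near0_conj[OF NU hU] near0_conj[OF near0_conj[OF iS near0_reflect[OF A iS]]
          near0_conj[OF near0_reflect[OF c near0_reflect[OF A iS]] near0_conj[OF near0_reflect[OF c iA] near0_reflect[OF c iS]]]]]], elim conjE, rule impI)
    fix r z
    assume N: "r \<in> N" "z \<in> U" "h r z \<in> U" and i1: "cnj (S (cnj (S z))) = z" and i2: "cnj (S (cnj (S (cnj (A r z))))) = cnj (A r z)"
      and i3: "cnj (S (cnj (S (cnj (A r (cnj (S z))))))) = cnj (A r (cnj (S z)))"
      and i4: "cnj (A r (cnj (A r (cnj (S z))))) = cnj (S z)"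
      and e: "reflect_mult S (A r) z = A r z"
    have "cnj (S (cnj (A r z))) = cnj (S (cnj (S (cnj (A r (cnj (S z)))))))" using e by (simp add: reflect_mult_apply)
    then have hz: "h r z = cnj (A r (cnj (S z)))" using i3 by (simp add: h_def)
    have "h r (h r z) = z" unfolding hz unfolding h_def i4 using i1 by simp
    then have "m r (h r z) = m r z" by (simp add: m_def add.commute)
    with inj_onD[OF inj[OF N(1)] _ N(3,2)] have "h r z = z" by blast
    then have "cnj (S (cnj (S (cnj (A r z))))) = cnj (S z)" by (simp add: h_def)
    with i2 show "A r z = S z" by simp
  qed
  from near0_eventually[OF this] show ?thesis
  proof eventually_elim
    case (elim r)
    show ?case
    proof
      assume "near K (\<lambda>z. reflect_mult S (A r) z = A r z)"
      from near_conj[OF elim this] show "near K (\<lambda>z. A r z = S z)" by (rule near_mono) simp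
    qed
  qed
qed

end

subsection \<open>Second derivatives along curves\<close>

definition snd_deriv :: "(real \<Rightarrow> 'b::real_normed_vector) \<Rightarrow> 'b" where
  "snd_deriv f = vector_derivative (\<lambda>s. vector_derivative f (at s)) (at 0)"

lemma snd_derivI:
  assumes "\<forall>\<^sub>F s in nhds 0. (f has_vector_derivative g s) (at s)" "(g has_vector_derivative d) (at 0)"
  shows "snd_deriv f = d"
  unfolding snd_deriv_def
proof (rule vector_derivative_at, rule has_vector_derivative_cong_ev[OF assms(2)])
  show "\<forall>\<^sub>F s in nhds 0. g s = vector_derivative f (at s)"
    using assms(1) by eventually_elim (simp add: vector_derivative_at)
qed

lemma snd_deriv_cong:
  assumes "\<forall>\<^sub>F s in nhds 0. f s = g s" shows "snd_deriv f = snd_deriv g"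
proof -
  have "\<forall>\<^sub>F s in nhds 0. vector_derivative f (at s) = vector_derivative g (at s)"
    using eventually_nhds_open[OF assms]
  proof eventually_elim
    case (elim s)
    have "\<forall>\<^sub>F t in nhds s. g t = f t" using elim by eventually_elim simp
    note e = this
    have "(f has_vector_derivative d) (at s) \<longleftrightarrow> (g has_vector_derivative d) (at s)" for d
      by (rule iffI; erule has_vector_derivative_cong_ev) (rule elim e)+
    then show ?case unfolding vector_derivative_def by simp
  qed
  note e = this
  have e': "\<forall>\<^sub>F s in nhds 0. vector_derivative g (at s) = vector_derivative f (at s)" using e by eventually_elim simp
  have "((\<lambda>s. vector_derivative f (at s)) has_vector_derivative d) (at 0)
    \<longleftrightarrow> ((\<lambda>s. vector_derivative g (at s)) has_vector_derivative d) (at 0)" for d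
    by (rule iffI; erule has_vector_derivative_cong_ev) (rule e e')+
  then show ?thesis unfolding snd_deriv_def vector_derivative_def[of _ "at 0"] by simp
qed

definition mixed_deriv :: "(real \<times> real \<Rightarrow> 'b::real_normed_vector) \<Rightarrow> 'b" where
  "mixed_deriv m = frechet_derivative (\<lambda>y. frechet_derivative m (at y) (0, 1)) (at (0, 0)) (1, 0)"

lemma snd_deriv_line:
  fixes m :: "real \<times> real \<Rightarrow> 'b::euclidean_space"
  assumes m: "smooth_at m (0, 0)"
  shows "snd_deriv (\<lambda>s. m (a * s, b * s)) = (a * a) *\<^sub>R frechet_derivative (\<lambda>y. frechet_derivative m (at y) (1, 0)) (at (0, 0)) (1, 0)
    + (2 * a * b) *\<^sub>R mixed_deriv m + (b * b) *\<^sub>R frechet_derivative (\<lambda>y. frechet_derivative m (at y) (0, 1)) (at (0, 0)) (0, 1)"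
proof (rule snd_derivI)
  let ?m1 = "\<lambda>y. frechet_derivative m (at y) (1, 0)" and ?m2 = "\<lambda>y. frechet_derivative m (at y) (0, 1)"
  have c: "isCont (\<lambda>s. (a * s, b * s)) 0" by (intro continuous_intros)
  have "\<forall>\<^sub>F y in nhds (a * 0, b * 0). smooth_at m y" using smooth_at_eventually[OF m] by simp
  from eventually_nhds_compose[OF c this]
  show "\<forall>\<^sub>F s in nhds 0. ((\<lambda>s. m (a * s, b * s)) has_vector_derivative a *\<^sub>R ?m1 (a * s, b * s) + b *\<^sub>R ?m2 (a * s, b * s)) (at s)"
  proof eventually_elim
    case (elim s)
    have "((\<lambda>s. (a * s, b * s)) has_vector_derivative (a, b)) (at s)"
      by (auto intro!: derivative_eq_intros simp: has_real_derivative_iff_has_vector_derivative[symmetric])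
    from line_has_vector_derivative[OF smooth_at_has_derivative[OF elim] this HOL.refl]
    have D: "((\<lambda>s. m (a * s, b * s)) has_vector_derivative frechet_derivative m (at (a * s, b * s)) (a, b)) (at s)" .
    have lin: "linear (frechet_derivative m (at (a * s, b * s)))" by (rule has_derivative_linear[OF smooth_at_has_derivative[OF elim]])
    have "frechet_derivative m (at (a * s, b * s)) (a *\<^sub>R (1, 0) + b *\<^sub>R (0, 1)) = a *\<^sub>R ?m1 (a * s, b * s) + b *\<^sub>R ?m2 (a * s, b * s)"
      by (simp only: linear_add[OF lin] linear_cmul[OF lin])
    with D show ?case by simp
  qed
  note s1 = smooth_at_frechet[OF m, of "(1, 0)"] and s2 = smooth_at_frechet[OF m, of "(0, 1)"]
  have split: "frechet_derivative f (at (0, 0)) (a, b) = a *\<^sub>R frechet_derivative f (at (0, 0)) (1, 0) + b *\<^sub>R frechet_derivative f (at (0, 0)) (0, 1)"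
    if "smooth_at f (0::real, 0::real)" for f :: "real \<times> real \<Rightarrow> 'b"
  proof -
    have lin: "linear (frechet_derivative f (at (0, 0)))" by (rule has_derivative_linear[OF smooth_at_has_derivative[OF that]])
    have "frechet_derivative f (at (0, 0)) (a *\<^sub>R (1, 0) + b *\<^sub>R (0, 1)) = a *\<^sub>R frechet_derivative f (at (0, 0)) (1, 0) + b *\<^sub>R frechet_derivative f (at (0, 0)) (0, 1)"
      by (simp only: linear_add[OF lin] linear_cmul[OF lin])
    then show ?thesis by simp
  qed
  have r: "((\<lambda>s. c *\<^sub>R f (a * s, b * s)) has_vector_derivative c *\<^sub>R frechet_derivative f (at (0, 0)) (a, b)) (at 0)"
    if "smooth_at f (0::real, 0::real)" for c and f :: "real \<times> real \<Rightarrow> 'b"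
    by (rule bounded_linear.has_vector_derivative[OF bounded_linear_scaleR_right line_velocity(1)[OF that]])
  have "((\<lambda>s. a *\<^sub>R ?m1 (a * s, b * s) + b *\<^sub>R ?m2 (a * s, b * s)) has_vector_derivative
      a *\<^sub>R frechet_derivative ?m1 (at (0, 0)) (a, b) + b *\<^sub>R frechet_derivative ?m2 (at (0, 0)) (a, b)) (at 0)"
    by (rule has_vector_derivative_add[OF r[OF s1] r[OF s2]])
  moreover have "frechet_derivative ?m1 (at (0, 0)) (0, 1) = mixed_deriv m"
    unfolding mixed_deriv_def by (rule frechet_derivative_commute[OF m])
  moreover have comb: "a *\<^sub>R (a *\<^sub>R x + b *\<^sub>R y) + b *\<^sub>R (a *\<^sub>R y + b *\<^sub>R w) = (a * a) *\<^sub>R x + (2 * a * b) *\<^sub>R y + (b * b) *\<^sub>R w" for x y w :: 'b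
  proof -
    have "(2 * a * b) *\<^sub>R y = (a * b) *\<^sub>R y + (b * a) *\<^sub>R y" by (simp flip: scaleR_add_left)
    then show ?thesis by (simp add: scaleR_add_right)
  qed
  ultimately show "((\<lambda>s. a *\<^sub>R ?m1 (a * s, b * s) + b *\<^sub>R ?m2 (a * s, b * s)) has_vector_derivative
      (a * a) *\<^sub>R frechet_derivative ?m1 (at (0, 0)) (1, 0) + (2 * a * b) *\<^sub>R mixed_deriv m
      + (b * b) *\<^sub>R frechet_derivative ?m2 (at (0, 0)) (0, 1)) (at 0)"
    unfolding split[OF s1] split[OF s2] mixed_deriv_def[symmetric] by (simp only: comb)
qed

text \<open>Compared with the line, the parabola adds a first-order term, with factor 2 from the
  second derivative of s^2. This term is what the contact argument extracts.\<close>

lemma snd_deriv_parabola: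
  fixes m :: "real \<times> real \<Rightarrow> 'b::euclidean_space"
  assumes m: "smooth_at m (0, 0)"
  shows "snd_deriv (\<lambda>s. m (s, s\<^sup>2)) = frechet_derivative (\<lambda>y. frechet_derivative m (at y) (1, 0)) (at (0, 0)) (1, 0)
    + 2 *\<^sub>R frechet_derivative m (at (0, 0)) (0, 1)"
proof (rule snd_derivI)
  let ?m1 = "\<lambda>y. frechet_derivative m (at y) (1, 0)" and ?m2 = "\<lambda>y. frechet_derivative m (at y) (0, 1)"
  have c: "isCont (\<lambda>s::real. (s, s\<^sup>2)) 0" by (intro continuous_intros)
  have "\<forall>\<^sub>F y in nhds (0, 0\<^sup>2). smooth_at m y" using smooth_at_eventually[OF m] by simp
  from eventually_nhds_compose[OF c this]
  show "\<forall>\<^sub>F s in nhds 0. ((\<lambda>s. m (s, s\<^sup>2)) has_vector_derivative ?m1 (s, s\<^sup>2) + (2 * s) *\<^sub>R ?m2 (s, s\<^sup>2)) (at s)"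
  proof eventually_elim
    case (elim s)
    have "((\<lambda>s. (s, s\<^sup>2)) has_vector_derivative (1, 2 * s)) (at s)"
      by (auto intro!: derivative_eq_intros has_vector_derivative_Pair simp: has_real_derivative_iff_has_vector_derivative[symmetric])
    from line_has_vector_derivative[OF smooth_at_has_derivative[OF elim] this HOL.refl]
    have D: "((\<lambda>s. m (s, s\<^sup>2)) has_vector_derivative frechet_derivative m (at (s, s\<^sup>2)) (1, 2 * s)) (at s)" .
    have lin: "linear (frechet_derivative m (at (s, s\<^sup>2)))" by (rule has_derivative_linear[OF smooth_at_has_derivative[OF elim]])
    have "frechet_derivative m (at (s, s\<^sup>2)) ((1, 0) + (2 * s) *\<^sub>R (0, 1)) = ?m1 (s, s\<^sup>2) + (2 * s) *\<^sub>R ?m2 (s, s\<^sup>2)"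
      by (simp only: linear_add[OF lin] linear_cmul[OF lin])
    with D show ?case by simp
  qed
  have "((\<lambda>s::real. 2 * s) has_real_derivative 2) (at 0)" by (auto intro!: derivative_eq_intros)
  from has_vector_derivative_add[OF line_velocity(2)[OF smooth_at_frechet[OF m, of "(1, 0)"]]
      has_vector_derivative_scaleR[OF this line_velocity(2)[OF smooth_at_frechet[OF m, of "(0, 1)"]]]]
  show "((\<lambda>s. ?m1 (s, s\<^sup>2) + (2 * s) *\<^sub>R ?m2 (s, s\<^sup>2)) has_vector_derivative
      frechet_derivative ?m1 (at (0, 0)) (1, 0) + 2 *\<^sub>R ?m2 (0, 0)) (at 0)" by simp
qed

lemma mixed_deriv_has_vector_derivative:
  assumes m: "smooth_at m (0::real, 0::real)"
  shows "((\<lambda>r. frechet_derivative m (at (r, 0)) (0, 1)) has_vector_derivative mixed_deriv m) (at 0)"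
    "\<forall>\<^sub>F r in nhds 0. ((\<lambda>t. m (r, t)) has_vector_derivative frechet_derivative m (at (r, 0)) (0, 1)) (at 0)"
proof -
  show "((\<lambda>r. frechet_derivative m (at (r, 0)) (0, 1)) has_vector_derivative mixed_deriv m) (at 0)"
    using line_velocity(1)[OF smooth_at_frechet[OF m, of "(0, 1)"], of 1 0] by (simp add: mixed_deriv_def)
  have "\<forall>\<^sub>F y in nhds (0, 0). smooth_at m (fst y, snd y)" using smooth_at_eventually[OF m] by simp
  from eventually_slice_fst[OF this]
  show "\<forall>\<^sub>F r in nhds 0. ((\<lambda>t. m (r, t)) has_vector_derivative frechet_derivative m (at (r, 0)) (0, 1)) (at 0)"
  proof eventually_elim
    case (elim r)
    have "((\<lambda>t. (r, t)) has_vector_derivative (0, 1)) (at (0::real))"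
      by (auto intro!: derivative_eq_intros has_vector_derivative_Pair)
    from line_has_vector_derivative[OF smooth_at_has_derivative[OF elim] this] show ?case by simp
  qed
qed

text \<open>Allows a mixed derivative to be computed by iterated one-variable calculus, with any
  formula \<open>G\<close> for the inner derivative.\<close>

lemma mixed_deriv_eqI:
  assumes m: "smooth_at m (0::real, 0::real)"
    and "\<forall>\<^sub>F r in nhds 0. ((\<lambda>t. m (r, t)) has_vector_derivative G r) (at 0)" "(G has_vector_derivative d) (at 0)"
  shows "mixed_deriv m = d"
proof -
  have "\<forall>\<^sub>F r in nhds 0. G r = frechet_derivative m (at (r, 0)) (0, 1)"
    using assms(2) mixed_deriv_has_vector_derivative(2)[OF m] by eventually_elim (rule vector_derivative_unique_at)
  from has_vector_derivative_cong_ev[OF assms(3) this] mixed_deriv_has_vector_derivative(1)[OF m]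
  show ?thesis by (metis vector_derivative_unique_at)
qed

lemma mixed_partial_eq:
  fixes m :: "real \<times> real \<Rightarrow> real"
  assumes m: "smooth_at m (0, 0)"
  shows "mixed_partial (\<lambda>r t. m (r, t)) = mixed_deriv m"
  unfolding mixed_partial_def
proof (rule DERIV_imp_deriv, unfold has_real_derivative_iff_has_vector_derivative,
    rule has_vector_derivative_cong_ev[OF mixed_deriv_has_vector_derivative(1)[OF m]])
  show "\<forall>\<^sub>F r in nhds 0. frechet_derivative m (at (r, 0)) (0, 1) = deriv (\<lambda>t. m (r, t)) 0"
    using mixed_deriv_has_vector_derivative(2)[OF m]
    by eventually_elim (simp add: DERIV_imp_deriv has_real_derivative_iff_has_vector_derivative)
qed

section \<open>Second-order contact and the canonical connection\<close>

context schwarz_germ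
begin

lemma has_derivation_unique:
  assumes "tangent K S X" "has_derivation K S X F a" "has_derivation K S X F b" shows "a = b"
proof -
  obtain T where T: "variation K S X T" using assms(1) unfolding tangent_def by (elim exE)
  have "((\<lambda>t. F (T t)) has_real_derivative a) (at 0)" "((\<lambda>t. F (T t)) has_real_derivative b) (at 0)"
    using assms(2,3) T unfolding has_derivation_def by blast+
  then show ?thesis by (rule DERIV_unique)
qed

text \<open>For two curves with the same velocity the difference of the second derivatives is twice
  a first-order quantity: \<open>V\<close> is the velocity, in the second parameter, of the family
  joining them. As the same \<open>V\<close> serves for \<open>F\<close> and for the values at each
  \<open>z\<close>, statements about second derivatives of arbitrary functions reduce to
  computations with complex numbers.\<close>

lemma second_order_contact:
  assumes F: "smooth_function K S F" and T1: "variation K S X T1" and T2: "variation K S X T2"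
  obtains V d where "tangent K S V" "has_derivation K S V F d"
    "snd_deriv (\<lambda>s. F (T1 s)) = snd_deriv (\<lambda>s. F (T2 s)) + 2 * d"
    "near K (\<lambda>z. snd_deriv (\<lambda>s. T1 s z) = snd_deriv (\<lambda>s. T2 s z) + 2 * V z)"
proof -
  obtain P :: "real \<times> real \<Rightarrow> cfun" where P: "schwarz_family K S P" "smooth_at (\<lambda>p. F (P p)) (0, 0)"
    "\<forall>\<^sub>F s in nhds 0. F (P (s, 0)) = F (T2 s)" "\<forall>\<^sub>F s in nhds 0. F (P (s, s\<^sup>2)) = F (T1 s)"
    "near0 K (\<lambda>s z. P (s, 0) z = T2 s z)" "near0 K (\<lambda>s z. P (s, s\<^sup>2) z = T1 s z)"
    by (rule function_contact[OF F T1 T2])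
  let ?V = "dpar (\<lambda>_. (0, 1)) P 0"
  have triv: "near K (\<lambda>z. Q z = Q z)" for Q :: cfun unfolding near_def by (intro exI[of _ UNIV]) simp
  have "near K (\<lambda>z. ?V z = of_real 0 * dpar (\<lambda>_. (1, 0)) P 0 z + of_real 1 * ?V z)"
    unfolding near_def by (intro exI[of _ UNIV]) simp
  note v = variation_line[OF P(1) triv triv this]
  let ?d = "frechet_derivative (\<lambda>p. F (P p)) (at (0, 0)) (0, 1)"
  have 1: "tangent K S ?V" unfolding tangent_def by (rule exI[of _ "\<lambda>s. P (0 * s, 1 * s)"]) (rule v)
  have 2: "has_derivation K S ?V F ?d"
    by (rule has_derivationI[OF F v]) (use line_velocity(1)[OF P(2), of 0 1] in \<open>simp add: has_real_derivative_iff_has_vector_derivative\<close>)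
  have line: "snd_deriv (\<lambda>s. m (s, 0)) = frechet_derivative (\<lambda>y. frechet_derivative m (at y) (1, 0)) (at (0, 0)) (1, 0)"
    if "smooth_at m (0, 0)" for m :: "real \<times> real \<Rightarrow> 'b::euclidean_space"
    using snd_deriv_line[OF that, of 1 0] by simp
  have 3: "snd_deriv (\<lambda>s. F (T1 s)) = snd_deriv (\<lambda>s. F (T2 s)) + 2 * ?d"
    using snd_deriv_parabola[OF P(2)] line[OF P(2)] snd_deriv_cong[OF P(3)] snd_deriv_cong[OF P(4)] by simp
  have 4: "near K (\<lambda>z. snd_deriv (\<lambda>s. T1 s z) = snd_deriv (\<lambda>s. T2 s z) + 2 * ?V z)"
  proof (rule near_mono[OF near_conj[OF near0_at0[OF family_near0_hsm[OF P(1)]] near_conj[OF near0_at0[OF near0_open[OF P(5)]] near0_at0[OF near0_open[OF P(6)]]]]], elim conjE)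
    fix z assume h: "hsm P (0, z)" and e: "\<forall>\<^sub>F x in nhds (0, z). P (fst x, 0) (snd x) = T2 (fst x) (snd x)"
      "\<forall>\<^sub>F x in nhds (0, z). P (fst x, (fst x)\<^sup>2) (snd x) = T1 (fst x) (snd x)"
    have m: "smooth_at (\<lambda>p. P p z) (0, 0)" using hsm_slice[OF h] by (simp add: zero_prod_def)
    have "((\<lambda>s. P (0 + s *\<^sub>R (0, 1)) z) has_vector_derivative frechet_derivative (\<lambda>p. P p z) (at (0, 0)) (0, 1)) (at 0)"
      using line_velocity(1)[OF m, of 0 1] by simp
    then have "?V z = frechet_derivative (\<lambda>p. P p z) (at (0, 0)) (0, 1)" by (rule dpar_eqI)
    then show "snd_deriv (\<lambda>s. T1 s z) = snd_deriv (\<lambda>s. T2 s z) + 2 * ?V z"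
      using snd_deriv_parabola[OF m] line[OF m] snd_deriv_cong[OF eventually_slice_fst[OF e(1)]] snd_deriv_cong[OF eventually_slice_fst[OF e(2)]]
      by (simp add: scaleR_conv_of_real)
  qed
  from that[OF 1 2 3 4] show thesis .
qed

text \<open>The factors 2 and -1 are those of any symmetric space: moving the centre doubles the
  velocity, while the symmetry acts by -1 on tangent vectors. In the mixed derivative the reflected
  values are eliminated by tangency of the second velocity.\<close>

lemma reflect_mult_derivatives:
  fixes p :: "real \<times> real \<Rightarrow> cfun"
  assumes p: "schwarz_family K S p"
  defines "Q \<equiv> \<lambda>q. reflect_mult (p (fst q, 0)) (p (0, snd q))"
  shows "near K (\<lambda>z. dpar (\<lambda>_. (1, 0)) Q 0 z = 2 * dpar (\<lambda>_. (1, 0)) p 0 z \<and>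
    dpar (\<lambda>_. (0, 1)) Q 0 z = - dpar (\<lambda>_. (0, 1)) p 0 z \<and>
    mixed_deriv (\<lambda>q. p q z) + mixed_deriv (\<lambda>q. Q q z) / 2 = cov p (\<lambda>_. (1, 0)) (dpar (\<lambda>_. (0, 1)) p) (0, 0) z)"
proof -
  have z0: "((0::real), (0::real)) = 0" by (simp add: zero_prod_def)
  have QA: "schwarz_family K S Q" unfolding Q_def
    by (rule reflect_mult_family[OF family_param[OF p, of "\<lambda>q. (fst q, 0)"] family_param[OF p, of "\<lambda>q. (0, snd q)"]])
      (auto intro!: smooth_at_Pair simp: z0)
  have sA: "smooth_at (\<lambda>r::real. (r, 0::real)) x" for x by (rule smooth_at_Pair_0)
  let ?X = "dpar (\<lambda>_. (1, 0)) p" and ?Y = "dpar (\<lambda>_. (0, 1)) p"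
  note R = family_reflecting[OF p]
  note tY = family_dpar_tangent[OF p, of "\<lambda>_. (0, 1)"]
  have iA: "near0 K (\<lambda>q z. hsm Q (q, z) \<and> hsm p (q, z))" by (rule near0_conj[OF family_near0_hsm[OF QA] family_near0_hsm[OF p]])
  have all: "near K (\<lambda>z. (hsm Q (0, z) \<and> hsm p (0, z)) \<and> (\<forall>\<^sub>F x in nhds (0, z). reflecting p (fst x) (snd x)) \<and> cnj (p 0 (cnj (p 0 z))) = z)"
    by (rule near_conj[OF near0_at0[OF iA] near_conj[OF near0_at0[OF near0_open[OF R]] near0_at0[OF family_involution[OF p]]]])
  then show ?thesis
  proof (rule near_mono, elim conjE)
    fix z assume hQ: "hsm Q (0, z)" and hp: "hsm p (0, z)" and ev: "\<forall>\<^sub>F x in nhds (0, z). reflecting p (fst x) (snd x)"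
      and inv: "cnj (p 0 (cnj (p 0 z))) = z"
    have Rz: "reflecting p 0 z" using eventually_nhds_x_imp_x[OF ev] by simp
    let ?s = "cnj (p 0 z)"
    have hs: "hsm p (0, ?s)" using Rz by (simp add: reflecting_def)
    define A where "A r = p (r, 0)" for r :: real
    have hA: "hsm A (0, z)" "hsm A (0, ?s)" unfolding A_def
      by (rule hsm_compose[where h="\<lambda>r. (r, 0)" and f="\<lambda>r z. z"]; use hp hs sA z0 in simp)+
    have A0: "A 0 = p 0" by (simp add: A_def z0)
    define s1 where "s1 = deriv (p 0) z"
    have s10: "s1 \<noteq> 0" unfolding s1_def by (rule reflecting_deriv_nonzero[OF Rz])
    have Sc: "cnj (deriv (p 0) ?s) = 1 / s1" using reflecting_deriv[OF Rz] s10 unfolding s1_def by (simp add: field_simps)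
    have XA: "dpar (\<lambda>_. 1) A 0 z = ?X 0 z" by (simp add: A_def dpar_def zero_prod_def)
    let ?YY = "?Y 0"
    have hY: "hsm ?Y (0, z)" "hsm ?Y (0, ?s)" by (intro hsm_dpar hp hs smooth_at_const)+
    have Y0: "?YY z = - s1 * cnj (?YY ?s)" using reflecting_dpar_tangent[OF Rz, of "\<lambda>_. (0, 1)"] by (simp add: tangent_at_def s1_def)
    have "\<forall>\<^sub>F w in nhds z. reflecting p 0 w" by (rule eventually_slice_snd[OF ev])
    then have "\<forall>\<^sub>F w in nhds z. tangent_at (p 0) ?YY w" by eventually_elim (rule reflecting_dpar_tangent)
    from tangent_at_deriv[OF Rz hsm_analytic[OF hY(1)] hsm_analytic[OF hY(2)] this]
    have Yd: "cnj (deriv ?YY ?s) = (deriv (deriv (p 0)) z * ?YY z / s1 - deriv ?YY z) / s1\<^sup>2" by (simp add: s1_def)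
    \<comment> \<open>\<open>\<sigma>\<close> is the reflection of \<open>z\<close> in the moving
      curve, and \<open>w\<close> the reflection of that point in the fixed one; at r = 0 they are
      \<open>?s\<close> and \<open>z\<close>.\<close>
    define \<sigma> where "\<sigma> r = cnj (A r z)" for r
    define w where "w r = cnj (p 0 (\<sigma> r))" for r
    have w0: "w 0 = z" "\<sigma> 0 = ?s" using inv by (simp_all add: w_def \<sigma>_def A0)
    have const: "dpar (\<lambda>_. 1) (\<lambda>_::real. f) 0 y = 0" for f :: cfun and y
      by (rule dpar_eqI) (rule has_vector_derivative_const)
    have pathc: "((\<lambda>r. cnj (f (\<sigma> r))) has_vector_derivative cnj (deriv f ?s) * ?X 0 z) (at 0)" if "f analytic_on {?s}" for f
      using hsm_cnj_path[of "\<lambda>_::real. f" 0 A z 1] hsm_analytic_const[of f "(0::real, ?s)"] that hA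
      by (simp add: A0 const XA \<sigma>_def)
    have dw: "(w has_vector_derivative ?X 0 z / s1) (at 0)"
      using pathc[OF hsm_analytic[OF hs]] unfolding w_def Sc by simp
    have dY: "((\<lambda>r. cnj (?YY (\<sigma> r))) has_vector_derivative cnj (deriv ?YY ?s) * ?X 0 z) (at 0)"
      by (rule pathc[OF hsm_analytic[OF hY(2)]])
    have dA: "((\<lambda>r. W (id r) (w r)) has_vector_derivative dpar (\<lambda>_. 1) W 0 z + deriv (W 0) z * (?X 0 z / s1)) (at 0)" if "hsm W (0, z)" for W :: "real \<Rightarrow> cfun"
      using hsm_path[of W id 0 w 1 "?X 0 z / s1"] that dw w0 has_vector_derivative_id by (simp add: id_def)
    have Qeq: "Q (r, t) z = A r (cnj (p (0, t) (\<sigma> r)))" for r t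
      by (simp add: Q_def reflect_mult_apply A_def \<sigma>_def)
    have Q1: "dpar (\<lambda>_. (1, 0)) Q 0 z = 2 * ?X 0 z"
    proof (rule dpar_eqI)
      have "((\<lambda>r. A r (w r)) has_vector_derivative ?X 0 z + s1 * (?X 0 z / s1)) (at 0)"
        using dA[OF hA(1)] by (simp add: XA A0 s1_def)
      moreover have "Q (0 + r *\<^sub>R (1, 0)) z = A r (w r)" for r using Qeq[of r 0] by (simp add: w_def z0)
      ultimately show "((\<lambda>r. Q (0 + r *\<^sub>R (1, 0)) z) has_vector_derivative 2 * ?X 0 z) (at 0)" using s10 by simp
    qed
    \<comment> \<open>The derivative of \<open>Q (r, t) z\<close> in \<open>t\<close> at t = 0, for
      all small \<open>r\<close>; its derivative in \<open>r\<close> is the mixed one.\<close>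
    define G where "G r = deriv (A r) (w r) * cnj (?YY (\<sigma> r))" for r
    have c\<sigma>: "isCont \<sigma> 0" unfolding \<sigma>_def
      using isCont_o2[where f="\<lambda>r. (r, z)" and a="0::real", OF _ hsm_continuous[OF hA(1)]] by (auto intro!: continuous_intros)
    have cw: "isCont w 0" using dw has_vector_derivative_continuous by blast
    have "\<forall>\<^sub>F y in nhds (\<sigma> 0). hsm p (0, y)" unfolding w0
      by (rule eventually_slice_snd[where P="\<lambda>r y. hsm p (r, y)"]) (use hsm_eventually[OF hs] in simp)
    from eventually_nhds_compose[OF c\<sigma> this] have e1: "\<forall>\<^sub>F r in nhds 0. hsm p (0, \<sigma> r)" .
    have "isCont (\<lambda>r::real. (r, w r)) 0" by (intro continuous_Pair cw continuous_ident)
    from eventually_nhds_compose[OF this, of "hsm A"] hsm_eventually[OF hA(1)] have e2: "\<forall>\<^sub>F r in nhds 0. hsm A (r, w r)" by (simp add: w0)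
    have QG: "\<forall>\<^sub>F r in nhds 0. ((\<lambda>t. Q (r, t) z) has_vector_derivative G r) (at 0)"
      using e1 e2
    proof eventually_elim
      case (elim r)
      have "((\<lambda>t. p (0 + t *\<^sub>R (0, 1)) (\<sigma> r)) has_vector_derivative ?YY (\<sigma> r)) (at 0)"
        by (rule hsm_dpar_has_vector_derivative[OF elim(1), of "\<lambda>_. (0, 1)"])
      from bounded_linear.has_vector_derivative[OF bounded_linear_cnj this]
      have "((\<lambda>t. cnj (p (0, t) (\<sigma> r))) has_vector_derivative cnj (?YY (\<sigma> r))) (at 0)" by simp
      from field_vector_diff_chain_at[OF this, of "A r" "deriv (A r) (w r)"] hsm_has_deriv[OF elim(2)]
      show ?case by (simp add: Qeq G_def o_def w_def z0 mult.commute)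
    qed
    have hAd: "hsm (\<lambda>r. deriv (A r)) (0, z)" by (rule hsm_deriv[OF hA(1)])
    have "((\<lambda>r. deriv (A r) (w r)) has_vector_derivative deriv (?X 0) z + deriv (deriv (p 0)) z * (?X 0 z / s1)) (at 0)"
    proof -
      have "dpar (\<lambda>_. 1) (\<lambda>r. deriv (A r)) 0 z = dpar (\<lambda>_. (1, 0)) (\<lambda>r. deriv (p r)) 0 z"
        by (simp add: A_def dpar_def zero_prod_def)
      also have "\<dots> = deriv (?X 0) z" by (rule deriv_dpar[OF hp, symmetric])
      finally show ?thesis using dA[OF hAd] by (simp add: A0)
    qed
    from has_vector_derivative_mult[OF this dY]
    have dG: "(G has_vector_derivative s1 * (cnj (deriv ?YY ?s) * ?X 0 z)
      + (deriv (?X 0) z + deriv (deriv (p 0)) z * (?X 0 z / s1)) * cnj (?YY ?s)) (at 0)"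
      unfolding G_def by (simp add: w0 A0 s1_def)
    have mQ: "smooth_at (\<lambda>q. Q q z) (0, 0)" "smooth_at (\<lambda>q. p q z) (0, 0)"
      using hsm_slice[OF hQ] hsm_slice[OF hp] by (simp_all add: z0)
    have Q2: "dpar (\<lambda>_. (0, 1)) Q 0 z = - ?Y 0 z"
    proof (rule dpar_eqI)
      have "G 0 = - ?Y 0 z" using Y0 by (simp add: G_def w0 A0 s1_def)
      then show "((\<lambda>t. Q (0 + t *\<^sub>R (0, 1)) z) has_vector_derivative - ?Y 0 z) (at 0)"
        using eventually_nhds_x_imp_x[OF QG] by simp
    qed
    have m1: "mixed_deriv (\<lambda>q. Q q z) = s1 * (cnj (deriv ?YY ?s) * ?X 0 z)
      + (deriv (?X 0) z + deriv (deriv (p 0)) z * (?X 0 z / s1)) * cnj (?YY ?s)"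
      by (rule mixed_deriv_eqI[OF mQ(1) QG dG])
    have m2: "mixed_deriv (\<lambda>q. p q z) = dpar (\<lambda>_. (1, 0)) ?Y 0 z"
    proof (rule mixed_deriv_eqI[OF mQ(2)])
      have "((\<lambda>r. ?Y (0 + r *\<^sub>R (1, 0)) z) has_vector_derivative dpar (\<lambda>_. (1, 0)) ?Y 0 z) (at 0)"
        by (rule hsm_dpar_has_vector_derivative[OF hY(1), of "\<lambda>_. (1, 0)"])
      then show "((\<lambda>r. ?Y (r, 0) z) has_vector_derivative dpar (\<lambda>_. (1, 0)) ?Y 0 z) (at 0)" by simp
      have "\<forall>\<^sub>F q in nhds (0, z). hsm p (fst q, snd q)" using hsm_eventually[OF hp] by simp
      from eventually_slice_fst[OF this] have "\<forall>\<^sub>F q in nhds (0, 0). hsm p ((fst q, snd q), z)" by (simp add: z0)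
      from eventually_slice_fst[OF this]
      show "\<forall>\<^sub>F r in nhds 0. ((\<lambda>t. p (r, t) z) has_vector_derivative ?Y (r, 0) z) (at 0)"
      proof eventually_elim
        case (elim r)
        from hsm_dpar_has_vector_derivative[OF elim, of "\<lambda>_. (0, 1)"] show ?case by simp
      qed
    qed
    have cy: "cnj (?YY ?s) = - ?YY z / s1" using Y0 s10 by simp
    have "mixed_deriv (\<lambda>q. p q z) + mixed_deriv (\<lambda>q. Q q z) / 2 = cov p (\<lambda>_. (1, 0)) ?Y 0 z"
      unfolding m1 m2 Yd cy cov_def s1_def[symmetric] using s10 by (simp add: field_simps power2_eq_square)
    with Q1 Q2 show "dpar (\<lambda>_. (1, 0)) Q 0 z = 2 * ?X 0 z \<and> dpar (\<lambda>_. (0, 1)) Q 0 z = - ?Y 0 z \<and>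
      mixed_deriv (\<lambda>q. p q z) + mixed_deriv (\<lambda>q. Q q z) / 2 = cov p (\<lambda>_. (1, 0)) ?Y (0, 0) z" by (simp add: z0)
  qed
qed

text \<open>\<open>Q (s, b * s)\<close> and \<open>p (2 * s, - b * s)\<close> share the velocity 2 X
  - b Y, so their second derivatives differ by twice a derivation. Subtracting the cases b = 1 and b
  = -1 cancels the pure second derivatives: on functions it leaves four times the operator of the
  canonical connection, on values at \<open>z\<close> four times the covariant derivative.\<close>

lemma canonical_connection_reflect_mult: "canonical_connection K S reflect_mult (\<lambda>p. cov p (\<lambda>_. (1, 0)) (dpar (\<lambda>_. (0, 1)) p) (0, 0))"
  unfolding canonical_connection_def
proof (intro allI impI conjI)
  fix p :: "real \<times> real \<Rightarrow> cfun" assume p: "schwarz_family K S p"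
  let ?V = "cov p (\<lambda>_. (1, 0)) (dpar (\<lambda>_. (0, 1)) p) (0, 0)"
  have z0: "((0::real), (0::real)) = 0" by (simp add: zero_prod_def)
  show tV: "tangent K S ?V"
    unfolding z0 by (rule tangent_field_tangent[OF tangent_field_cov[OF p smooth_at_const tangent_field_dpar[OF p smooth_at_const]]])
  fix F assume F: "smooth_function K S F"
  define Q where "Q q = reflect_mult (p (fst q, 0)) (p (0, snd q))" for q :: "real \<times> real"
  have Q: "schwarz_family K S Q" unfolding Q_def
    by (rule reflect_mult_family[OF family_param[OF p, of "\<lambda>q. (fst q, 0)"] family_param[OF p, of "\<lambda>q. (0, snd q)"]])
      (auto intro!: smooth_at_Pair simp: z0)
  note D = reflect_mult_derivatives[OF p, folded Q_def]
  let ?X = "dpar (\<lambda>_. (1, 0)) p 0" and ?Y = "dpar (\<lambda>_. (0, 1)) p 0"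
  have triv: "near K (\<lambda>z. Z z = Z z)" for Z :: cfun unfolding near_def by (intro exI[of _ UNIV]) simp
  have vQ: "variation K S (\<lambda>z. 2 * ?X z - of_real b * ?Y z) (\<lambda>s. Q (1 * s, b * s))" for b
  proof (rule variation_line[OF Q triv triv])
    show "near K (\<lambda>z. 2 * ?X z - of_real b * ?Y z = of_real 1 * dpar (\<lambda>_. (1, 0)) Q 0 z + of_real b * dpar (\<lambda>_. (0, 1)) Q 0 z)"
      by (rule near_mono[OF D]) simp
  qed
  have vp: "variation K S (\<lambda>z. 2 * ?X z - of_real b * ?Y z) (\<lambda>s. p (2 * s, - b * s))" for b
  proof (rule variation_line[OF p triv triv])
    show "near K (\<lambda>z. 2 * ?X z - of_real b * ?Y z = of_real 2 * dpar (\<lambda>_. (1, 0)) p 0 z + of_real (- b) * dpar (\<lambda>_. (0, 1)) p 0 z)"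
      unfolding near_def by (intro exI[of _ UNIV]) simp
  qed
  obtain V1 d1 where 1: "tangent K S V1" "has_derivation K S V1 F d1"
    "snd_deriv (\<lambda>s. F (Q (1 * s, 1 * s))) = snd_deriv (\<lambda>s. F (p (2 * s, - 1 * s))) + 2 * d1"
    "near K (\<lambda>z. snd_deriv (\<lambda>s. Q (1 * s, 1 * s) z) = snd_deriv (\<lambda>s. p (2 * s, - 1 * s) z) + 2 * V1 z)"
    by (rule second_order_contact[OF F vQ[of 1] vp[of 1]])
  obtain V2 d2 where 2: "tangent K S V2" "has_derivation K S V2 F d2"
    "snd_deriv (\<lambda>s. F (Q (1 * s, - 1 * s))) = snd_deriv (\<lambda>s. F (p (2 * s, - (- 1) * s))) + 2 * d2"
    "near K (\<lambda>z. snd_deriv (\<lambda>s. Q (1 * s, - 1 * s) z) = snd_deriv (\<lambda>s. p (2 * s, - (- 1) * s) z) + 2 * V2 z)"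
    by (rule second_order_contact[OF F vQ[of "- 1"] vp[of "- 1"]])
  let ?f = "\<lambda>q. F (p q)" and ?h = "\<lambda>q. F (Q q)"
  have sm: "smooth_at ?f (0, 0)" "smooth_at ?h (0, 0)"
    unfolding z0 by (rule smooth_functionD[OF F p], rule smooth_functionD[OF F Q])
  have eqF: "d1 = d2 + (2 * mixed_deriv ?h + 4 * mixed_deriv ?f)"
    using 1(3) 2(3) unfolding snd_deriv_line[OF sm(1)] snd_deriv_line[OF sm(2)] by simp
  have "near K (\<lambda>z. V1 z = V2 z + of_real 4 * ?V z)"
  proof (rule near_mono[OF near_conj[OF near_conj[OF near0_at0[OF family_near0_hsm[OF p]] near0_at0[OF family_near0_hsm[OF Q]]] near_conj[OF D near_conj[OF 1(4) 2(4)]]]], elim conjE)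
    fix z assume h: "hsm p (0, z)" "hsm Q (0, z)" and V: "mixed_deriv (\<lambda>q. p q z) + mixed_deriv (\<lambda>q. Q q z) / 2 = ?V z"
      and e: "snd_deriv (\<lambda>s. Q (1 * s, 1 * s) z) = snd_deriv (\<lambda>s. p (2 * s, - 1 * s) z) + 2 * V1 z"
        "snd_deriv (\<lambda>s. Q (1 * s, - 1 * s) z) = snd_deriv (\<lambda>s. p (2 * s, - (- 1) * s) z) + 2 * V2 z"
    have m: "smooth_at (\<lambda>q. p q z) (0, 0)" "smooth_at (\<lambda>q. Q q z) (0, 0)"
      using hsm_slice[OF h(1)] hsm_slice[OF h(2)] by (simp_all add: z0)
    from e have "2 * V1 z - 2 * V2 z = 4 * mixed_deriv (\<lambda>q. Q q z) + 8 * mixed_deriv (\<lambda>q. p q z)"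
      unfolding snd_deriv_line[OF m(1)] snd_deriv_line[OF m(2)] by (simp add: scaleR_conv_of_real algebra_simps)
    then have "2 * V1 z = 2 * (V2 z + of_real 4 * ?V z)" unfolding V[symmetric] by (simp add: algebra_simps)
    then show "V1 z = V2 z + of_real 4 * ?V z" by (rule mult_left_cancel[THEN iffD1, rotated]) simp
  qed
  from has_derivation_linear[OF F 2(1) tV 2(2) derivation_eq[OF F tV] this]
  have "has_derivation K S V1 F (d2 + 4 * derivation K S ?V F)" .
  from has_derivation_unique[OF 1(1) 1(2) this] eqF
  have "derivation K S ?V F = mixed_deriv ?f + 1/2 * mixed_deriv ?h" by simp
  moreover have "mixed_partial (\<lambda>r t. F (reflect_mult (p (r, 0)) (p (0, t)))) = mixed_deriv ?h"
    using mixed_partial_eq[OF sm(2)] by (simp add: Q_def)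
  ultimately show "has_derivation K S ?V F (mixed_partial (\<lambda>r t. F (p (r, t)))
      + 1/2 * mixed_partial (\<lambda>r t. F (reflect_mult (p (r, 0)) (p (0, t)))))"
    using derivation_eq[OF F tV] mixed_partial_eq[OF sm(1)] by simp
qed

end

section \<open>Curvature\<close>

text \<open>The Lie bracket of the holomorphic vector fields f d/dz and g d/dz.\<close>

definition brk :: "cfun \<Rightarrow> cfun \<Rightarrow> cfun" where
  "brk f g z = f z * deriv g z - g z * deriv f z"

definition bracket_cov :: "('p::real_normed_vector \<Rightarrow> 'p) \<Rightarrow> ('p \<Rightarrow> cfun) \<Rightarrow> ('p \<Rightarrow> cfun) \<Rightarrow> 'p \<Rightarrow> cfun" where
  "bracket_cov u \<alpha> \<zeta> r z = dpar u \<zeta> r z + brk (\<zeta> r) (\<alpha> r) z / 2"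

text \<open>The quarter of a double bracket of vector fields, multiplied back by S_z so that it
  becomes a tangent field again.\<close>

definition curvature_formula :: curvature where
  "curvature_formula T X Y Z z =
     deriv T z * brk (\<lambda>z. Z z / deriv T z) (brk (\<lambda>z. X z / deriv T z) (\<lambda>z. Y z / deriv T z)) z / 4"

lemma brk_cong:
  assumes "\<forall>\<^sub>F w in nhds z. f w = f' w" "\<forall>\<^sub>F w in nhds z. g w = g' w"
  shows "brk f g z = brk f' g' z"
  using eventually_nhds_x_imp_x[OF assms(1)] eventually_nhds_x_imp_x[OF assms(2)]
    deriv_cong_ev[OF assms(1) HOL.refl] deriv_cong_ev[OF assms(2) HOL.refl] by (simp add: brk_def)

lemma hsm_brk: "hsm X x \<Longrightarrow> hsm Y x \<Longrightarrow> hsm (\<lambda>r. brk (X r) (Y r)) x"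
  unfolding brk_def by (intro hsm_diff hsm_mult hsm_deriv)

text \<open>The products of two first derivatives cancel.\<close>

lemma deriv_brk:
  assumes "hsm X (r, z)" "hsm Y (r, z)"
  shows "deriv (brk (X r) (Y r)) z = X r z * deriv (deriv (Y r)) z - Y r z * deriv (deriv (X r)) z"
proof -
  note d = hsm_has_deriv[OF assms(1)] hsm_has_deriv[OF assms(2)]
    hsm_has_deriv[OF hsm_deriv[OF assms(1)]] hsm_has_deriv[OF hsm_deriv[OF assms(2)]]
  have "((\<lambda>z. X r z * deriv (Y r) z - Y r z * deriv (X r) z) has_field_derivative
      (X r z * deriv (deriv (Y r)) z + deriv (X r) z * deriv (Y r) z)
      - (Y r z * deriv (deriv (X r)) z + deriv (Y r) z * deriv (X r) z)) (at z)"
    by (rule DERIV_diff[OF DERIV_mult'[OF d(1,4)] DERIV_mult'[OF d(2,3)]])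
  from DERIV_imp_deriv[OF this] show ?thesis unfolding brk_def by (simp add: mult.commute)
qed

lemma dpar_brk:
  assumes "hsm X (r, z)" "hsm Y (r, z)"
  shows "dpar u (\<lambda>r. brk (X r) (Y r)) r z = brk (dpar u X r) (Y r) z + brk (X r) (dpar u Y r) z"
proof (rule dpar_eqI)
  note d = hsm_dpar_has_vector_derivative[where u=u]
  have "((\<lambda>t. X (r + t *\<^sub>R u r) z * deriv (Y (r + t *\<^sub>R u r)) z - Y (r + t *\<^sub>R u r) z * deriv (X (r + t *\<^sub>R u r)) z) has_vector_derivative
      (X (r + 0 *\<^sub>R u r) z * dpar u (\<lambda>r. deriv (Y r)) r z + dpar u X r z * deriv (Y (r + 0 *\<^sub>R u r)) z)
      - (Y (r + 0 *\<^sub>R u r) z * dpar u (\<lambda>r. deriv (X r)) r z + dpar u Y r z * deriv (X (r + 0 *\<^sub>R u r)) z)) (at 0)"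
    by (rule has_vector_derivative_diff[OF has_vector_derivative_mult[OF d[OF assms(1)] d[OF hsm_deriv[OF assms(2)]]]
          has_vector_derivative_mult[OF d[OF assms(2)] d[OF hsm_deriv[OF assms(1)]]]])
  then show "((\<lambda>t. brk (X (r + t *\<^sub>R u r)) (Y (r + t *\<^sub>R u r)) z) has_vector_derivative
      brk (dpar u X r) (Y r) z + brk (X r) (dpar u Y r) z) (at 0)"
    unfolding brk_def deriv_dpar[OF assms(1), of u] deriv_dpar[OF assms(2), of u] by (simp add: algebra_simps)
qed

lemma deriv_bracket_cov:
  assumes "hsm \<alpha> (r, z)" "hsm \<zeta> (r, z)" "smooth_at u r"
  shows "deriv (bracket_cov u \<alpha> \<zeta> r) z = deriv (dpar u \<zeta> r) z
    + (\<zeta> r z * deriv (deriv (\<alpha> r)) z - \<alpha> r z * deriv (deriv (\<zeta> r)) z) / 2"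
proof -
  have h: "hsm (dpar u \<zeta>) (r, z)" by (rule hsm_dpar[OF assms(2)]) (simp add: assms(3))
  have "((\<lambda>z. dpar u \<zeta> r z + brk (\<zeta> r) (\<alpha> r) z / 2) has_field_derivative
      deriv (dpar u \<zeta> r) z + deriv (brk (\<zeta> r) (\<alpha> r)) z / 2) (at z)"
    by (rule DERIV_add[OF hsm_has_deriv[OF h] DERIV_cdivide[OF hsm_has_deriv[OF hsm_brk[OF assms(2,1)]]]])
  from DERIV_imp_deriv[OF this] show ?thesis
    unfolding bracket_cov_def deriv_brk[OF assms(2,1)] .
qed

text \<open>Parameter differentiation is a derivation of the bracket, and so is bracketing with a
  fixed field, by the Jacobi identity.\<close>

lemma bracket_cov_derivation:
  assumes \<alpha>: "hsm \<alpha> (r, z)" and \<xi>: "hsm \<xi> (r, z)" and \<eta>: "hsm \<eta> (r, z)" and u: "smooth_at u r"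
  shows "bracket_cov u \<alpha> (\<lambda>r. brk (\<xi> r) (\<eta> r)) r z
    = brk (bracket_cov u \<alpha> \<xi> r) (\<eta> r) z + brk (\<xi> r) (bracket_cov u \<alpha> \<eta> r) z"
proof -
  have "brk (bracket_cov u \<alpha> \<xi> r) (\<eta> r) z + brk (\<xi> r) (bracket_cov u \<alpha> \<eta> r) z
    = bracket_cov u \<alpha> \<xi> r z * deriv (\<eta> r) z - \<eta> r z * deriv (bracket_cov u \<alpha> \<xi> r) z
      + (\<xi> r z * deriv (bracket_cov u \<alpha> \<eta> r) z - bracket_cov u \<alpha> \<eta> r z * deriv (\<xi> r) z)"
    by (simp add: brk_def)
  also have "\<dots> = bracket_cov u \<alpha> (\<lambda>r. brk (\<xi> r) (\<eta> r)) r z"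
    unfolding deriv_bracket_cov[OF \<alpha> \<xi> u] deriv_bracket_cov[OF \<alpha> \<eta> u] unfolding bracket_cov_def dpar_brk[OF \<xi> \<eta>]
    unfolding brk_def[of "brk (\<xi> r) (\<eta> r)"] deriv_brk[OF \<xi> \<eta>] unfolding brk_def
    by (simp add: field_simps)
  finally show ?thesis by (rule sym)
qed

lemma dpar_quotient:
  assumes T: "hsm T (r, z)" and Y: "hsm Y (r, z)" and nz: "deriv (T r) z \<noteq> 0"
  shows "dpar u (\<lambda>r z. Y r z / deriv (T r) z) r z
    = (dpar u Y r z * deriv (T r) z - Y r z * deriv (dpar u T r) z) / (deriv (T r) z)\<^sup>2"
proof -
  have T': "hsm (\<lambda>r. deriv (T r)) (r, z)" by (rule hsm_deriv[OF T])
  have "((\<lambda>t. Y (r + t *\<^sub>R u r) z / deriv (T (r + t *\<^sub>R u r)) z) has_vector_derivative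
      (dpar u Y r z * deriv (T r) z - Y r z * dpar u (\<lambda>r. deriv (T r)) r z) / (deriv (T r) z)\<^sup>2) (at 0)"
  proof -
    note dd = hsm_dpar_has_vector_derivative[OF Y, of u] hsm_dpar_has_vector_derivative[OF T', of u]
    have "((\<lambda>w. inverse w) has_field_derivative - (inverse (deriv (T (r + 0 *\<^sub>R u r)) z) ^ Suc (Suc 0))) (at (deriv (T (r + 0 *\<^sub>R u r)) z))"
      by (rule DERIV_inverse) (use nz in simp)
    from field_vector_diff_chain_at[OF dd(2) this]
    have i: "((\<lambda>t. inverse (deriv (T (r + t *\<^sub>R u r)) z)) has_vector_derivative
        dpar u (\<lambda>r. deriv (T r)) r z * - (inverse (deriv (T (r + 0 *\<^sub>R u r)) z) ^ Suc (Suc 0))) (at 0)" by (simp add: o_def)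
    show ?thesis unfolding divide_inverse
      by (rule has_vector_derivative_eq_rhs[OF has_vector_derivative_mult[OF dd(1) i]])
        (use nz in \<open>simp add: field_simps power2_eq_square\<close>)
  qed
  note dpar_eqI[where Y="\<lambda>r z. Y r z / deriv (T r) z" and r=r and u=u and z=z, OF this]
  then show ?thesis by (simp add: deriv_dpar[OF T])
qed

text \<open>Write Y = S_z \<zeta> and S_u = S_z \<alpha>. Differentiating the factor S_z in the
  parameter contributes (S_z \<alpha>)_z \<zeta>; the correction term removes half of this and half
  of (S_z \<zeta>)_z \<alpha>, and in the remaining difference the terms with S_zz cancel.\<close>

lemma cov_eq_bracket_cov:
  assumes T: "hsm T (r, z)" and Y: "hsm Y (r, z)" and nz: "deriv (T r) z \<noteq> 0" and u: "smooth_at u r"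
  shows "cov T u Y r z = deriv (T r) z * bracket_cov u (\<lambda>r z. dpar u T r z / deriv (T r) z) (\<lambda>r z. Y r z / deriv (T r) z) r z"
proof -
  have hA: "hsm (dpar u T) (r, z)" by (rule hsm_dpar[OF T]) (simp add: u)
  have T': "hsm (\<lambda>r. deriv (T r)) (r, z)" by (rule hsm_deriv[OF T])
  have d: "deriv (\<lambda>z. X r z / deriv (T r) z) z
      = (deriv (X r) z * deriv (T r) z - X r z * deriv (deriv (T r)) z) / (deriv (T r) z * deriv (T r) z)"
    if "hsm X (r, z)" for X
    by (rule DERIV_imp_deriv[OF DERIV_divide[OF hsm_has_deriv[OF that] hsm_has_deriv[OF T'] nz]])
  show ?thesis unfolding bracket_cov_def dpar_quotient[OF T Y nz] brk_def cov_def d[OF Y] d[OF hA]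
    using nz by (simp add: field_simps power2_eq_square)
qed

lemma cov_cong:
  assumes "\<forall>\<^sub>F x in nhds (r, z). T (fst x) (snd x) = T' (fst x) (snd x)"
    and "\<forall>\<^sub>F x in nhds (r, z). Y (fst x) (snd x) = Y' (fst x) (snd x)"
  shows "cov T u Y r z = cov T' u Y' r z"
proof -
  have s: "\<forall>\<^sub>F w in nhds z. T r w = T' r w" "\<forall>\<^sub>F w in nhds z. Y r w = Y' r w"
    by (rule eventually_slice_snd[OF assms(1)], rule eventually_slice_snd[OF assms(2)])
  have "\<forall>\<^sub>F x in nhds (r, z). dpar u T (fst x) (snd x) = dpar u T' (fst x) (snd x)"
    using eventually_nhds_open[OF assms(1)] by eventually_elim (rule dpar_cong, simp)
  from eventually_slice_snd[OF this] have A: "\<forall>\<^sub>F w in nhds z. dpar u T r w = dpar u T' r w" .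
  show ?thesis unfolding cov_def dpar_cong[OF assms(2)]
    using deriv_cong_ev[OF s(1) HOL.refl] deriv_cong_ev[OF s(2) HOL.refl] deriv_cong_ev[OF A HOL.refl]
      eventually_nhds_x_imp_x[OF s(2)] eventually_nhds_x_imp_x[OF A] by simp
qed

lemma bracket_cov_cong:
  assumes "\<forall>\<^sub>F x in nhds (r, z). \<zeta> (fst x) (snd x) = \<zeta>' (fst x) (snd x)"
  shows "bracket_cov u \<alpha> \<zeta> r z = bracket_cov u \<alpha> \<zeta>' r z"
proof -
  have s: "\<forall>\<^sub>F w in nhds z. \<zeta> r w = \<zeta>' r w" by (rule eventually_slice_snd[OF assms])
  have "brk (\<zeta> r) (\<alpha> r) z = brk (\<zeta>' r) (\<alpha> r) z" by (rule brk_cong[OF s]) simp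
  then show ?thesis unfolding bracket_cov_def dpar_cong[OF assms] by simp
qed

definition regular :: "('p::euclidean_space \<Rightarrow> cfun) \<Rightarrow> ('p \<Rightarrow> 'p) \<Rightarrow> 'p \<Rightarrow> complex \<Rightarrow> bool" where
  "regular T u r z \<longleftrightarrow> hsm T (r, z) \<and> deriv (T r) z \<noteq> 0 \<and> smooth_at u r"

text \<open>The double derivatives leave, besides iterated brackets, the parameter derivatives of
  \<alpha> and \<beta>. A structure equation expresses their difference by a bracket and the field
  of the commutator direction, and the Jacobi identity collects the rest.\<close>

lemma curvature_eq:
  assumes ev: "\<forall>\<^sub>F x in nhds (r, z). regular T u (fst x) (snd x) \<and> regular T v (fst x) (snd x) \<and> hsm Z x"
  shows "cov T u (cov T v Z) r z - cov T v (cov T u Z) r z - cov T (bracket u v) Z r z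
    = curvature_formula (T r) (dpar u T r) (dpar v T r) (Z r) z"
proof -
  have R: "regular T u r z" "regular T v r z" and Z: "hsm Z (r, z)"
    using eventually_nhds_x_imp_x[OF ev] by auto
  have T: "hsm T (r, z)" and nz: "deriv (T r) z \<noteq> 0" and u: "smooth_at u r" and v: "smooth_at v r"
    using R by (auto simp: regular_def)
  define \<alpha> where "\<alpha> r z = dpar u T r z / deriv (T r) z" for r z
  define \<beta> where "\<beta> r z = dpar v T r z / deriv (T r) z" for r z
  define \<zeta> where "\<zeta> r z = Z r z / deriv (T r) z" for r z
  have T': "hsm (\<lambda>r. deriv (T r)) (r, z)" by (rule hsm_deriv[OF T])
  have hA: "hsm (dpar u T) (r, z)" "hsm (dpar v T) (r, z)" by (intro hsm_dpar T; simp add: u v)+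
  have h: "hsm \<alpha> (r, z)" "hsm \<beta> (r, z)" "hsm \<zeta> (r, z)"
    unfolding \<alpha>_def \<beta>_def \<zeta>_def by (intro hsm_divide hA T' Z; simp add: nz)+
  have hu: "hsm (dpar u \<zeta>) (r, z)" "hsm (dpar v \<zeta>) (r, z)" by (intro hsm_dpar h; simp add: u v)+
  have inner: "\<forall>\<^sub>F x in nhds (r, z). cov T w Z (fst x) (snd x) / deriv (T (fst x)) (snd x)
        = bracket_cov w (\<lambda>r z. dpar w T r z / deriv (T r) z) \<zeta> (fst x) (snd x)"
    if "w = u \<or> w = v" for w
    using ev
  proof eventually_elim
    case (elim x)
    then have "cov T w Z (fst x) (snd x) = deriv (T (fst x)) (snd x) *
        bracket_cov w (\<lambda>r z. dpar w T r z / deriv (T r) z) \<zeta> (fst x) (snd x)"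
      unfolding \<zeta>_def using that by (intro cov_eq_bracket_cov) (auto simp: regular_def)
    then show ?case using elim by (simp add: regular_def)
  qed
  have hc: "hsm (cov T u Z) (r, z)" "hsm (cov T v Z) (r, z)" by (intro hsm_cov T Z; simp add: u v nz)+
  have c1: "cov T u (cov T v Z) r z = deriv (T r) z * bracket_cov u \<alpha> (bracket_cov v \<beta> \<zeta>) r z"
    using cov_eq_bracket_cov[OF T hc(2) nz u] bracket_cov_cong[OF inner[of v, simplified]]
    by (simp add: \<alpha>_def[abs_def] \<beta>_def[abs_def])
  have c2: "cov T v (cov T u Z) r z = deriv (T r) z * bracket_cov v \<beta> (bracket_cov u \<alpha> \<zeta>) r z"
    using cov_eq_bracket_cov[OF T hc(1) nz v] bracket_cov_cong[OF inner[of u, simplified]]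
    by (simp add: \<alpha>_def[abs_def] \<beta>_def[abs_def])
  have ex: "bracket_cov w1 \<gamma> (bracket_cov w2 \<delta> \<zeta>) r z = dpar w1 (dpar w2 \<zeta>) r z
      + (brk (dpar w1 \<zeta> r) (\<delta> r) z + brk (\<zeta> r) (dpar w1 \<delta> r) z) / 2 + brk (dpar w2 \<zeta> r) (\<gamma> r) z / 2
      + brk (brk (\<zeta> r) (\<delta> r)) (\<gamma> r) z / 4"
    if \<gamma>: "hsm \<gamma> (r, z)" and \<delta>: "hsm \<delta> (r, z)" and w: "smooth_at w1 r" "smooth_at w2 r" for w1 w2 \<gamma> \<delta>
  proof -
    have hd: "hsm (dpar w2 \<zeta>) (r, z)" by (rule hsm_dpar[OF h(3)]) (simp add: w)
    have hb: "hsm (\<lambda>r. brk (\<zeta> r) (\<delta> r)) (r, z)" by (rule hsm_brk[OF h(3) \<delta>])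
    have "((\<lambda>t. dpar w2 \<zeta> (r + t *\<^sub>R w1 r) z + brk (\<zeta> (r + t *\<^sub>R w1 r)) (\<delta> (r + t *\<^sub>R w1 r)) z / 2) has_vector_derivative
        dpar w1 (dpar w2 \<zeta>) r z + dpar w1 (\<lambda>r. brk (\<zeta> r) (\<delta> r)) r z / 2) (at 0)"
      by (rule has_vector_derivative_add[OF hsm_dpar_has_vector_derivative[OF hd]
            has_vector_derivative_divide[OF hsm_dpar_has_vector_derivative[OF hb]]])
    from dpar_eqI[where Y="bracket_cov w2 \<delta> \<zeta>" and r=r and u=w1 and z=z, unfolded bracket_cov_def, OF this]
    have 1: "dpar w1 (bracket_cov w2 \<delta> \<zeta>) r z = dpar w1 (dpar w2 \<zeta>) r z + dpar w1 (\<lambda>r. brk (\<zeta> r) (\<delta> r)) r z / 2"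
      unfolding bracket_cov_def .
    have 2: "brk (bracket_cov w2 \<delta> \<zeta> r) (\<gamma> r) z = brk (dpar w2 \<zeta> r) (\<gamma> r) z + brk (brk (\<zeta> r) (\<delta> r)) (\<gamma> r) z / 2"
      unfolding brk_def[of "bracket_cov w2 \<delta> \<zeta> r"] deriv_bracket_cov[OF \<delta> h(3) w(2)]
      unfolding brk_def[of "brk (\<zeta> r) (\<delta> r)"] deriv_brk[OF h(3) \<delta>] unfolding bracket_cov_def brk_def
      by (simp add: field_simps)
    show ?thesis unfolding bracket_cov_def[of w1] 1 2 dpar_brk[OF h(3) \<delta>] by (simp add: field_simps)
  qed
  define \<gamma> where "\<gamma> r z = dpar (bracket u v) T r z / deriv (T r) z" for r z
  \<comment> \<open>Structure equation of Maurer-Cartan type: the second parameter derivatives of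
    \<open>T\<close> cancel up to the commutator direction, and differentiating the denominators
    produces the bracket.\<close>
  have C: "\<forall>\<^sub>F w in nhds z. dpar u \<beta> r w - dpar v \<alpha> r w = \<gamma> r w + brk (\<alpha> r) (\<beta> r) w" 
  proof -
    have "\<forall>\<^sub>F x in nhds (r, z). (\<lambda>r w. regular T u r w \<and> regular T v r w) (fst x) (snd x)"
      using ev by eventually_elim simp
    from eventually_slice_snd[OF this] show ?thesis
    proof eventually_elim
      case (elim w)
      then have Tw: "hsm T (r, w)" and nw: "deriv (T r) w \<noteq> 0" by (auto simp: regular_def)
      have Tw': "hsm (\<lambda>r. deriv (T r)) (r, w)" by (rule hsm_deriv[OF Tw])
      have hAw: "hsm (dpar u T) (r, w)" "hsm (dpar v T) (r, w)" by (intro hsm_dpar Tw; simp add: u v)+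
      have d: "deriv (\<lambda>z. X r z / deriv (T r) z) w
        = (deriv (X r) w * deriv (T r) w - X r w * deriv (deriv (T r)) w) / (deriv (T r) w * deriv (T r) w)"
        if "hsm X (r, w)" for X
        by (rule DERIV_imp_deriv[OF DERIV_divide[OF hsm_has_deriv[OF that] hsm_has_deriv[OF Tw'] nw]])
      have q: "dpar w1 (\<lambda>r z. dpar w2 T r z / deriv (T r) z) r w
        = (dpar w1 (dpar w2 T) r w * deriv (T r) w - dpar w2 T r w * deriv (dpar w1 T r) w) / (deriv (T r) w)\<^sup>2"
        if w: "smooth_at w1 r" "smooth_at w2 r" for w1 w2
        by (rule dpar_quotient[OF Tw hsm_dpar[OF Tw] nw]) (simp add: w)
      have b: "dpar (bracket u v) T r w = dpar u (dpar v T) r w - dpar v (dpar u T) r w"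
        by (rule dpar_bracket[OF Tw u v, symmetric])
      have B: "brk (\<alpha> r) (\<beta> r) w = (dpar u T r w * deriv (dpar v T r) w - dpar v T r w * deriv (dpar u T r) w) / (deriv (T r) w)\<^sup>2"
        unfolding brk_def \<alpha>_def[abs_def] \<beta>_def[abs_def] d[OF hAw(1)] d[OF hAw(2)] using nw by (simp add: field_simps power2_eq_square)
      show ?case unfolding B \<gamma>_def b unfolding \<alpha>_def[abs_def] \<beta>_def[abs_def] q[OF u v] q[OF v u]
        using nw by (simp add: field_simps power2_eq_square)
    qed
  qed
  have hdb: "hsm (dpar u \<beta>) (r, z)" "hsm (dpar v \<alpha>) (r, z)" by (intro hsm_dpar h; simp add: u v)+
  have h\<gamma>: "hsm (\<lambda>r w. dpar u \<beta> r w - dpar v \<alpha> r w - brk (\<alpha> r) (\<beta> r) w) (r, z)"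
    by (intro hsm_diff hdb hsm_brk h)
  have \<gamma>ev: "\<forall>\<^sub>F w in nhds z. \<gamma> r w = dpar u \<beta> r w - dpar v \<alpha> r w - brk (\<alpha> r) (\<beta> r) w"
    using C by eventually_elim (simp add: algebra_simps)
  have dC: "deriv (\<gamma> r) z = deriv (dpar u \<beta> r) z - deriv (dpar v \<alpha> r) z - deriv (brk (\<alpha> r) (\<beta> r)) z"
  proof -
    have "deriv (\<gamma> r) z = deriv (\<lambda>w. dpar u \<beta> r w - dpar v \<alpha> r w - brk (\<alpha> r) (\<beta> r) w) z"
      by (rule deriv_cong_ev[OF \<gamma>ev HOL.refl])
    also have "\<dots> = deriv (dpar u \<beta> r) z - deriv (dpar v \<alpha> r) z - deriv (brk (\<alpha> r) (\<beta> r)) z"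
      by (rule DERIV_imp_deriv[OF DERIV_diff[OF DERIV_diff[OF hsm_has_deriv[OF hdb(1)] hsm_has_deriv[OF hdb(2)]]
            hsm_has_deriv[OF hsm_brk[OF h(1,2)]]]])
    finally show ?thesis .
  qed
  have Cz: "\<gamma> r z = dpar u \<beta> r z - dpar v \<alpha> r z - brk (\<alpha> r) (\<beta> r) z"
    by (rule eventually_nhds_x_imp_x[OF \<gamma>ev])
  have c3: "cov T (bracket u v) Z r z = deriv (T r) z * (dpar (bracket u v) \<zeta> r z + brk (\<zeta> r) (\<gamma> r) z / 2)"
  proof -
    have d: "deriv (\<lambda>z. X r z / deriv (T r) z) z
      = (deriv (X r) z * deriv (T r) z - X r z * deriv (deriv (T r)) z) / (deriv (T r) z * deriv (T r) z)"
      if "(X r has_field_derivative deriv (X r) z) (at z)" for X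
      by (rule DERIV_imp_deriv[OF DERIV_divide[OF that hsm_has_deriv[OF T'] nz]])
    \<comment> \<open>Derivatives at \<open>r\<close> see only the value of the direction there, so
      \<open>bracket u v\<close> is frozen to a constant field, to which the bracket form of the
      connection applies.\<close>
    have dir: "dpar (\<lambda>_. bracket u v r) W r = dpar (bracket u v) W r" for W
      by (rule ext, rule dpar_direction[of "bracket u v", symmetric])
    have e: "cov T (bracket u v) Z r z = cov T (\<lambda>_. bracket u v r) Z r z"
      unfolding cov_def dir ..
    have g: "(\<lambda>z. dpar (\<lambda>_. bracket u v r) T r z / deriv (T r) z) = \<gamma> r"
      by (simp add: \<gamma>_def fun_eq_iff dir)
    show ?thesis unfolding e cov_eq_bracket_cov[OF T Z nz smooth_at_const] bracket_cov_def g
      by (simp add: \<zeta>_def[abs_def] dir)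
  qed
  have b\<zeta>: "dpar (bracket u v) \<zeta> r z = dpar u (dpar v \<zeta>) r z - dpar v (dpar u \<zeta>) r z"
    by (rule dpar_bracket[OF h(3) u v, symmetric])
  have R0: "curvature_formula (T r) (dpar u T r) (dpar v T r) (Z r) z = deriv (T r) z * (brk (\<zeta> r) (brk (\<alpha> r) (\<beta> r)) z / 4)"
    unfolding curvature_formula_def \<zeta>_def[abs_def] \<alpha>_def[abs_def] \<beta>_def[abs_def] by simp
  \<comment> \<open>The structure equation contributes one half of the double bracket, and by the
    Jacobi identity the iterated brackets subtract a quarter of it.\<close>
  have key: "bracket_cov u \<alpha> (bracket_cov v \<beta> \<zeta>) r z - bracket_cov v \<beta> (bracket_cov u \<alpha> \<zeta>) r z
      - (dpar (bracket u v) \<zeta> r z + brk (\<zeta> r) (\<gamma> r) z / 2) = brk (\<zeta> r) (brk (\<alpha> r) (\<beta> r)) z / 4"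
    unfolding ex[OF h(1,2) u v] ex[OF h(2,1) v u] b\<zeta>
    unfolding brk_def[of "brk (\<zeta> r) (\<alpha> r)"] brk_def[of "brk (\<zeta> r) (\<beta> r)"] brk_def[of "\<zeta> r" "brk (\<alpha> r) (\<beta> r)"]
      brk_def[of "\<zeta> r" "\<gamma> r"] dC Cz deriv_brk[OF h(1,2)] deriv_brk[OF h(3,1)] deriv_brk[OF h(3,2)]
    unfolding brk_def by (simp add: field_simps)
  show ?thesis unfolding c1 c2 c3 R0 key[symmetric] by (simp add: algebra_simps)
qed

text \<open>The curvature is a double bracket, on which the connection acts as a derivation; applied
  to the outer and then to the inner bracket, this gives the three terms.\<close>

lemma curvature_parallel:
  assumes ev: "\<forall>\<^sub>F x in nhds (r, z). regular T u (fst x) (snd x) \<and> hsm X x \<and> hsm Y x \<and> hsm Z x"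
  shows "cov T u (\<lambda>r. curvature_formula (T r) (X r) (Y r) (Z r)) r z
    = curvature_formula (T r) (cov T u X r) (Y r) (Z r) z + curvature_formula (T r) (X r) (cov T u Y r) (Z r) z
      + curvature_formula (T r) (X r) (Y r) (cov T u Z r) z"
proof -
  have R: "regular T u r z" and XYZ: "hsm X (r, z)" "hsm Y (r, z)" "hsm Z (r, z)"
    using eventually_nhds_x_imp_x[OF ev] by auto
  have T: "hsm T (r, z)" and nz: "deriv (T r) z \<noteq> 0" and u: "smooth_at u r"
    using R by (auto simp: regular_def)
  define N where "N W r z = W r z / deriv (T r) z" for W :: "'a \<Rightarrow> cfun" and r z
  define \<alpha> where "\<alpha> = N (dpar u T)"
  have T': "hsm (\<lambda>r. deriv (T r)) (r, z)" by (rule hsm_deriv[OF T])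
  have hN: "hsm (N W) (r, z)" if "hsm W (r, z)" for W unfolding N_def by (rule hsm_divide[OF that T']) (simp add: nz)
  have h\<alpha>: "hsm \<alpha> (r, z)" unfolding \<alpha>_def by (rule hN, rule hsm_dpar[OF T]) (simp add: u)
  let ?b = "\<lambda>r. brk (N X r) (N Y r)" and ?bb = "\<lambda>r. brk (N Z r) (brk (N X r) (N Y r))"
  let ?R = "\<lambda>r. curvature_formula (T r) (X r) (Y r) (Z r)"
  have Req: "?R r z = deriv (T r) z * ?bb r z / 4" for r z
    by (simp add: curvature_formula_def N_def[abs_def])
  have hb: "hsm ?b (r, z)" by (intro hsm_brk hN XYZ)
  have hbb: "hsm ?bb (r, z)" by (intro hsm_brk hN XYZ)
  have hR: "hsm ?R (r, z)" unfolding Req[abs_def] by (intro hsm_divide hsm_mult T' hbb hsm_const) simp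
  have nzev: "\<forall>\<^sub>F x in nhds (r, z). deriv (T (fst x)) (snd x) \<noteq> 0" using ev by eventually_elim (simp add: regular_def)
  have NR: "\<forall>\<^sub>F x in nhds (r, z). N ?R (fst x) (snd x) = ?bb (fst x) (snd x) / 4"
    using nzev by eventually_elim (simp add: N_def Req)
  have covN: "\<forall>\<^sub>F w in nhds z. N (cov T u W) r w = bracket_cov u \<alpha> (N W) r w"
    if "\<forall>\<^sub>F x in nhds (r, z). hsm W x" for W
  proof -
    have "\<forall>\<^sub>F x in nhds (r, z). (\<lambda>r w. N (cov T u W) r w = bracket_cov u \<alpha> (N W) r w) (fst x) (snd x)"
      using ev that
    proof eventually_elim
      case (elim x)
      then have "cov T u W (fst x) (snd x) = deriv (T (fst x)) (snd x) * bracket_cov u \<alpha> (N W) (fst x) (snd x)"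
        unfolding \<alpha>_def N_def[abs_def] by (intro cov_eq_bracket_cov) (auto simp: regular_def)
      then show ?case using elim by (simp add: N_def[of "cov T u W"] regular_def)
    qed
    from eventually_slice_snd[OF this] show ?thesis .
  qed
  have e: "\<forall>\<^sub>F x in nhds (r, z). hsm X x" "\<forall>\<^sub>F x in nhds (r, z). hsm Y x" "\<forall>\<^sub>F x in nhds (r, z). hsm Z x"
    using ev by (eventually_elim, simp)+
  have "cov T u ?R r z = deriv (T r) z * bracket_cov u \<alpha> (N ?R) r z"
    using cov_eq_bracket_cov[OF T hR nz u] by (simp add: \<alpha>_def N_def[abs_def])
  also have "bracket_cov u \<alpha> (N ?R) r z = bracket_cov u \<alpha> (\<lambda>r z. ?bb r z / 4) r z"
    by (rule bracket_cov_cong[OF NR])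
  also have "\<dots> = bracket_cov u \<alpha> ?bb r z / 4"
  proof -
    have "dpar u (\<lambda>r z. ?bb r z / 4) r z = dpar u ?bb r z / 4"
      by (rule dpar_eqI) (rule has_vector_derivative_divide[OF hsm_dpar_has_vector_derivative[OF hbb]])
    moreover have "deriv (\<lambda>z. ?bb r z / 4) z = deriv (?bb r) z / 4"
      by (rule DERIV_imp_deriv[OF DERIV_cdivide[OF hsm_has_deriv[OF hbb]]])
    ultimately show ?thesis by (simp add: bracket_cov_def brk_def[of _ "\<alpha> r"] field_simps)
  qed
  also have "bracket_cov u \<alpha> ?bb r z = brk (bracket_cov u \<alpha> (N Z) r) (?b r) z + brk (N Z r) (bracket_cov u \<alpha> ?b r) z"
    by (rule bracket_cov_derivation[OF h\<alpha> hN[OF XYZ(3)] hb u])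
  also have "brk (bracket_cov u \<alpha> (N Z) r) (?b r) z = brk (N (cov T u Z) r) (?b r) z"
    by (rule brk_cong) (use covN[OF e(3)] in \<open>auto elim: eventually_mono\<close>)
  also have "brk (N Z r) (bracket_cov u \<alpha> ?b r) z
      = brk (N Z r) (brk (N (cov T u X) r) (N Y r)) z + brk (N Z r) (brk (N X r) (N (cov T u Y) r)) z"
  proof -
    have hc: "hsm (N (cov T u X)) (r, z)" "hsm (N (cov T u Y)) (r, z)"
      by (intro hN hsm_cov T XYZ; simp add: u nz)+
    have "\<forall>\<^sub>F x in nhds (r, z). hsm \<alpha> (fst x, snd x) \<and> hsm (N X) (fst x, snd x) \<and> hsm (N Y) (fst x, snd x) \<and> regular T u (fst x) (snd x)"
      using hsm_eventually[OF h\<alpha>] hsm_eventually[OF hN[OF XYZ(1)]] hsm_eventually[OF hN[OF XYZ(2)]] ev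
      by eventually_elim simp
    then have "\<forall>\<^sub>F x in nhds (r, z). (\<lambda>r w. hsm \<alpha> (r, w) \<and> hsm (N X) (r, w) \<and> hsm (N Y) (r, w) \<and> regular T u r w) (fst x) (snd x)" by simp
    from eventually_slice_snd[OF this] covN[OF e(1)] covN[OF e(2)] eventually_nhds_open[OF covN[OF e(1)]] eventually_nhds_open[OF covN[OF e(2)]]
    have "\<forall>\<^sub>F w in nhds z. bracket_cov u \<alpha> ?b r w = brk (N (cov T u X) r) (N Y r) w + brk (N X r) (N (cov T u Y) r) w"
    proof eventually_elim
      case (elim w)
      have "bracket_cov u \<alpha> ?b r w = brk (bracket_cov u \<alpha> (N X) r) (N Y r) w + brk (N X r) (bracket_cov u \<alpha> (N Y) r) w"
        by (rule bracket_cov_derivation) (use elim u in auto)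
      also have "brk (bracket_cov u \<alpha> (N X) r) (N Y r) w = brk (N (cov T u X) r) (N Y r) w"
        by (rule brk_cong[symmetric]) (use elim in auto)
      also have "brk (N X r) (bracket_cov u \<alpha> (N Y) r) w = brk (N X r) (N (cov T u Y) r) w"
        by (rule brk_cong[symmetric]) (use elim in auto)
      finally show ?case .
    qed
    note E = this
    have "brk (N Z r) (bracket_cov u \<alpha> ?b r) z = brk (N Z r) (\<lambda>w. brk (N (cov T u X) r) (N Y r) w + brk (N X r) (N (cov T u Y) r) w) z"
      by (rule brk_cong[OF _ E]) simp
    moreover have "deriv (\<lambda>w. brk (N (cov T u X) r) (N Y r) w + brk (N X r) (N (cov T u Y) r) w) z
        = deriv (brk (N (cov T u X) r) (N Y r)) z + deriv (brk (N X r) (N (cov T u Y) r)) z"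
      by (rule DERIV_imp_deriv[OF DERIV_add[OF hsm_has_deriv[OF hsm_brk[OF hc(1) hN[OF XYZ(2)]]] hsm_has_deriv[OF hsm_brk[OF hN[OF XYZ(1)] hc(2)]]]])
    ultimately show ?thesis by (simp add: brk_def[of "N Z r"] algebra_simps)
  qed
  finally have E: "cov T u ?R r z = deriv (T r) z * ((brk (N (cov T u Z) r) (?b r) z
      + (brk (N Z r) (brk (N (cov T u X) r) (N Y r)) z + brk (N Z r) (brk (N X r) (N (cov T u Y) r)) z)) / 4)" .
  show ?thesis unfolding E by (simp add: curvature_formula_def N_def[abs_def] algebra_simps)
qed

section \<open>The Riemann tensor: existence, uniqueness and parallelism\<close>

context schwarz_germ
begin

lemma family_regular:
  fixes T :: "'p::euclidean_space \<Rightarrow> cfun"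
  assumes T: "schwarz_family K S T" and u: "smooth_at u 0"
  shows "near0 K (regular T u)"
proof (rule near0_mono[OF near0_conj[OF family_reflecting[OF T] near0_smooth[OF u]]], elim conjE)
  fix r z assume R: "reflecting T r z" and s: "smooth_at u r"
  show "regular T u r z"
    using R reflecting_deriv_nonzero[OF R] s by (simp add: regular_def reflecting_def)
qed

lemma curvature_formula_cov:
  fixes T :: "'p::euclidean_space \<Rightarrow> cfun"
  assumes T: "schwarz_family K S T" and u: "smooth_at u 0" and v: "smooth_at v 0" and Z: "tangent_field K S T Z"
  shows "near0 K (\<lambda>r z. curvature_formula (T r) (dpar u T r) (dpar v T r) (Z r) z
    = cov T u (cov T v Z) r z - cov T v (cov T u Z) r z - cov T (bracket u v) Z r z)"
proof (rule near0_mono[OF near0_open[OF near0_conj[OF near0_conj[OF family_regular[OF T u] family_regular[OF T v]] tangent_fieldD(1)[OF T Z]]]])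
  fix r z assume "\<forall>\<^sub>F x in nhds (r, z). (regular T u (fst x) (snd x) \<and> regular T v (fst x) (snd x)) \<and> hsm Z (fst x, snd x)"
  then have "\<forall>\<^sub>F x in nhds (r, z). regular T u (fst x) (snd x) \<and> regular T v (fst x) (snd x) \<and> hsm Z x" by simp
  from curvature_eq[OF this]
  show "curvature_formula (T r) (dpar u T r) (dpar v T r) (Z r) z
    = cov T u (cov T v Z) r z - cov T v (cov T u Z) r z - cov T (bracket u v) Z r z" by (rule sym)
qed

lemma riemann_tensor_curvature_formula: "riemann_tensor K S curvature_formula"
  unfolding riemann_tensor_def smooth_near0_iff by (intro allI impI, elim conjE, rule curvature_formula_cov)

lemma tangent_field_cong_family:
  fixes T :: "'p::euclidean_space \<Rightarrow> cfun"
  assumes Y: "tangent_field K S T Y" and eq: "near0 K (\<lambda>r z. T r z = T1 r z)"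
  shows "tangent_field K S T1 Y"
proof -
  from Y[unfolded tangent_field_def] obtain T' :: "'p \<times> real \<Rightarrow> cfun" where T': "schwarz_family K S T'"
    "near0 K (\<lambda>r z. T' (r, 0) z = T r z)" "near0 K (\<lambda>r z. dpar (\<lambda>_. (0, 1)) T' (r, 0) z = Y r z)"
    by (elim exE conjE)
  have "near0 K (\<lambda>r z. T' (r, 0) z = T1 r z)" by (rule near0_mono[OF near0_conj[OF T'(2) eq]]) simp
  then show ?thesis unfolding tangent_field_def using T'(1,3) by (intro exI conjI)
qed

text \<open>\<open>q\<close> is a left inverse of \<open>i\<close>. Pulled back along
  \<open>q\<close>, the field is in general not tangent to \<open>T1\<close> and has to be
  projected; on the image of \<open>i\<close> it is tangent already, so the projection leaves it
  unchanged there.\<close>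

lemma tangent_field_extend:
  fixes T :: "'p::euclidean_space \<Rightarrow> cfun" and T1 :: "'q::euclidean_space \<Rightarrow> cfun" and i :: "'p \<Rightarrow> 'q" and q :: "'q \<Rightarrow> 'p"
  assumes T: "schwarz_family K S T" and T1: "schwarz_family K S T1" and Y: "tangent_field K S T Y"
    and i: "smooth_at i 0" "i 0 = 0" and q: "smooth_at q 0" "q 0 = 0" "\<And>r. q (i r) = r"
    and eq: "near0 K (\<lambda>r z. T1 (i r) z = T r z)"
  obtains Y1 where "tangent_field K S T1 Y1" "near0 K (\<lambda>r z. Y1 (i r) z = Y r z)"
proof -
  have "near0 K (\<lambda>p z. hsm (\<lambda>p. Y (q p)) (p, z))"
  proof (rule near0_mono[OF near0_conj[OF near0_param[OF tangent_fieldD(1)[OF T Y] smooth_at_continuous[OF q(1)] q(2)] near0_smooth[OF q(1)]]], elim conjE)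
    fix p z assume "hsm Y (q p, z)" "smooth_at q p"
    then show "hsm (\<lambda>p. Y (q p)) (p, z)" using hsm_compose[of Y q "(p, z)" "\<lambda>r z. z"] by simp
  qed
  from tangent_field_proj[OF T1 this] have 1: "tangent_field K S T1 (tangent_proj T1 (\<lambda>p. Y (q p)))" .
  have 2: "near0 K (\<lambda>r z. tangent_proj T1 (\<lambda>p. Y (q p)) (i r) z = Y r z)"
  proof (rule near0_mono[OF near0_conj[OF near0_open[OF eq] tangent_fieldD(2)[OF T Y]]], elim conjE)
    fix r z assume e: "\<forall>\<^sub>F x in nhds (r, z). T1 (i (fst x)) (snd x) = T (fst x) (snd x)" and t: "tangent_at (T r) (Y r) z"
    have "\<forall>\<^sub>F w in nhds z. T1 (i r) w = T r w"
      by (rule eventually_slice_snd[where P="\<lambda>r w. T1 (i r) w = T r w", OF e])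
    from deriv_cong_ev[OF this HOL.refl] eventually_nhds_x_imp_x[OF this] tangent_proj_eq[where T=T and V=Y and r=r and z=z, OF t]
    show "tangent_proj T1 (\<lambda>p. Y (q p)) (i r) z = Y r z" by (simp add: tangent_proj_def q(3))
  qed
  from that[OF 1 2] show thesis .
qed

text \<open>A Riemann tensor is specified only on velocities of three-parameter families, and its
  arguments are whole functions, not germs. So a family is needed whose base, velocities and field
  coincide with the given ones at every point of the plane.\<close>

lemma riemann_tensor_unique:
  fixes T :: "real \<Rightarrow> cfun"
  assumes R: "riemann_tensor K S R" and T: "schwarz_family K S T" and X: "tangent_field K S T X"
    and Y: "tangent_field K S T Y" and Z: "tangent_field K S T Z"
  shows "near0 K (\<lambda>t z. R (T t) (X t) (Y t) (Z t) z = curvature_formula (T t) (X t) (Y t) (Z t) z)"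
proof -
  from X[unfolded tangent_field_def] obtain T1 :: "real \<times> real \<Rightarrow> cfun" where T1: "schwarz_family K S T1"
    and T1T: "near0 K (\<lambda>r z. T1 (r, 0) z = T r z)" and T1X: "near0 K (\<lambda>r z. dpar (\<lambda>_. (0, 1)) T1 (r, 0) z = X r z)"
    by (elim exE conjE)
  have i: "smooth_at (\<lambda>r::real. (r, 0::real)) 0" by (rule smooth_at_Pair_0)
  have z0: "(0::real, 0::real) = 0" "(0::real, 0::real, 0::real) = 0" by (simp_all add: zero_prod_def)
  obtain Y1 where Y1: "tangent_field K S T1 Y1" and Y1Y: "near0 K (\<lambda>r z. Y1 (r, 0) z = Y r z)"
    by (rule tangent_field_extend[OF T T1 Y i _ smooth_at_fst _ _ T1T]) (simp_all add: z0)
  from Y1[unfolded tangent_field_def] obtain T2 :: "(real \<times> real) \<times> real \<Rightarrow> cfun" where T2: "schwarz_family K S T2"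
    and T2T: "near0 K (\<lambda>r z. T2 (r, 0) z = T1 r z)" and T2Y: "near0 K (\<lambda>r z. dpar (\<lambda>_. (0, 1)) T2 (r, 0) z = Y1 r z)"
    by (elim exE conjE)
  \<comment> \<open>Regroups the two successive one-parameter extensions into three parameters: the
    original one, one for \<open>X\<close> and one for \<open>Y\<close>.\<close>
  define h :: "real \<times> real \<times> real \<Rightarrow> (real \<times> real) \<times> real" where "h q = ((fst q, fst (snd q)), snd (snd q))" for q
  have "bounded_linear h" unfolding h_def
    by (intro bounded_linear_Pair bounded_linear_fst bounded_linear_fst_comp bounded_linear_snd_comp bounded_linear_snd)
  then have h: "smooth_at h 0" by (rule smooth_at_bounded_linear[OF _ smooth_at_ident])
  define T3 where "T3 q = T2 (h q)" for q
  have T3: "schwarz_family K S T3" unfolding T3_def[abs_def] by (rule family_param[OF T2 h]) (simp add: h_def zero_prod_def)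
  note pull1 = near0_param[OF _ smooth_at_continuous[OF i] z0(1)]
  have T3T: "near0 K (\<lambda>t z. T3 (t, 0, 0) z = T t z)"
    by (rule near0_mono[OF near0_conj[OF pull1[OF T2T] T1T]]) (simp add: T3_def h_def)
  have T3X: "near0 K (\<lambda>t z. dpar (\<lambda>_. (0, 1, 0)) T3 (t, 0, 0) z = X t z)"
  proof (rule near0_mono[OF near0_conj[OF pull1[OF near0_open[OF T2T]] T1X]], elim conjE)
    fix t z assume e: "\<forall>\<^sub>F x in nhds ((t, 0), z). T2 (fst x, 0) (snd x) = T1 (fst x) (snd x)"
      and x: "dpar (\<lambda>_. (0, 1)) T1 (t, 0) z = X t z"
    have "dpar (\<lambda>_. (0, 1, 0)) T3 (t, 0, 0) z = dpar (\<lambda>_. (0, 1)) (\<lambda>r. T2 (r, 0)) (t, 0) z"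
      by (simp add: dpar_def T3_def h_def)
    with dpar_cong[OF e, of "\<lambda>_. (0, 1)"] x show "dpar (\<lambda>_. (0, 1, 0)) T3 (t, 0, 0) z = X t z" by simp
  qed
  have T3Y: "near0 K (\<lambda>t z. dpar (\<lambda>_. (0, 0, 1)) T3 (t, 0, 0) z = Y t z)"
  proof (rule near0_mono[OF near0_conj[OF pull1[OF T2Y] Y1Y]], elim conjE)
    fix t z assume "dpar (\<lambda>_. (0, 1)) T2 ((t, 0), 0) z = Y1 (t, 0) z" "Y1 (t, 0) z = Y t z"
    then show "dpar (\<lambda>_. (0, 0, 1)) T3 (t, 0, 0) z = Y t z" by (simp add: dpar_def T3_def h_def zero_prod_def)
  qed
  have i3: "smooth_at (\<lambda>t::real. (t, 0::real, 0::real)) 0"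
    by (rule smooth_at_bounded_linear[OF _ smooth_at_ident]) (intro bounded_linear_Pair bounded_linear_ident bounded_linear_zero)
  obtain Z3 where Z3: "tangent_field K S T3 Z3" and Z3Z: "near0 K (\<lambda>t z. Z3 (t, 0, 0) z = Z t z)"
    by (rule tangent_field_extend[OF T T3 Z i3 _ smooth_at_fst _ _ T3T]) (simp_all add: zero_prod_def)
  from near0_conj[OF near0_conj[OF T3T T3X] near0_conj[OF T3Y Z3Z]] obtain N U where NU: "open N" "0 \<in> N" "open U" "K \<subseteq> U"
    and eq: "\<And>t z. t \<in> N \<Longrightarrow> z \<in> U \<Longrightarrow> (T3 (t, 0, 0) z = T t z \<and> dpar (\<lambda>_. (0, 1, 0)) T3 (t, 0, 0) z = X t z)
      \<and> dpar (\<lambda>_. (0, 0, 1)) T3 (t, 0, 0) z = Y t z \<and> Z3 (t, 0, 0) z = Z t z"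
    unfolding near0_def by auto
  \<comment> \<open>Outside the neighbourhood \<open>U\<close> of \<open>K\<close> any values are
    allowed; an affine function of the parameters makes the velocities equal to \<open>X\<close> and
    \<open>Y\<close> there too.\<close>
  define T4 :: "real \<times> real \<times> real \<Rightarrow> cfun" where "T4 p z = (if z \<in> U then T3 p z
      else T (fst p) z + fst (snd p) *\<^sub>R X (fst p) z + snd (snd p) *\<^sub>R Y (fst p) z)" for p z
  define Z4 :: "real \<times> real \<times> real \<Rightarrow> cfun" where "Z4 p z = (if z \<in> U then Z3 p z else Z (fst p) z)" for p z
  have U: "near K (\<lambda>z. z \<in> U)" unfolding near_def using NU by auto
  have T34: "near0 K (\<lambda>p z. T3 p z = T4 p z)" by (rule near0_mono[OF near0_const[OF U]]) (simp add: T4_def)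
  have Z34: "near0 K (\<lambda>p z. Z3 p z = Z4 p z)" by (rule near0_mono[OF near0_const[OF U]]) (simp add: Z4_def)
  have T4: "schwarz_family K S T4" by (rule schwarz_family_cong[OF T3 T34])
  have Z4: "tangent_field K S T4 Z4" by (rule tangent_field_cong_family[OF tangent_field_cong[OF Z3 Z34] T34])
  have ex: "T4 (t, 0, 0) = T t" "Z4 (t, 0, 0) = Z t" "dpar (\<lambda>_. (0, 1, 0)) T4 (t, 0, 0) = X t"
    "dpar (\<lambda>_. (0, 0, 1)) T4 (t, 0, 0) = Y t" if t: "t \<in> N" for t
  proof -
    show "T4 (t, 0, 0) = T t" using eq[OF t] by (auto simp: T4_def)
    show "Z4 (t, 0, 0) = Z t" using eq[OF t] by (auto simp: Z4_def)
    show "dpar (\<lambda>_. (0, 1, 0)) T4 (t, 0, 0) = X t"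
    proof
      fix z show "dpar (\<lambda>_. (0, 1, 0)) T4 (t, 0, 0) z = X t z"
      proof (cases "z \<in> U")
        case True then show ?thesis using eq[OF t True] by (simp add: dpar_def T4_def)
      next
        case False
        have "((\<lambda>s. T t z + s *\<^sub>R X t z) has_vector_derivative X t z) (at 0)"
          by (auto intro!: derivative_eq_intros)
        with False show ?thesis by (intro dpar_eqI) (simp add: T4_def)
      qed
    qed
    show "dpar (\<lambda>_. (0, 0, 1)) T4 (t, 0, 0) = Y t"
    proof
      fix z show "dpar (\<lambda>_. (0, 0, 1)) T4 (t, 0, 0) z = Y t z"
      proof (cases "z \<in> U")
        case True then show ?thesis using eq[OF t True] by (simp add: dpar_def T4_def)
      next
        case False
        have "((\<lambda>s. T t z + s *\<^sub>R Y t z) has_vector_derivative Y t z) (at 0)"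
          by (auto intro!: derivative_eq_intros)
        with False show ?thesis by (intro dpar_eqI) (simp add: T4_def)
      qed
    qed
  qed
  let ?u = "\<lambda>_::real \<times> real \<times> real. (0::real, 1::real, 0::real)" and ?v = "\<lambda>_::real \<times> real \<times> real. (0::real, 0::real, 1::real)"
  have "near0 K (\<lambda>r z. R (T4 r) (dpar ?u T4 r) (dpar ?v T4 r) (Z4 r) z
      = cov T4 ?u (cov T4 ?v Z4) r z - cov T4 ?v (cov T4 ?u Z4) r z - cov T4 (bracket ?u ?v) Z4 r z)"
    using R[unfolded riemann_tensor_def, rule_format, of T4 ?u ?v Z4] T4 Z4 by (simp add: smooth_near0_iff smooth_at_const)
  from near0_conj[OF this curvature_formula_cov[where u="?u" and v="?v", OF T4 smooth_at_const smooth_at_const Z4]]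
  have "near0 K (\<lambda>r z. R (T4 r) (dpar ?u T4 r) (dpar ?v T4 r) (Z4 r) z = curvature_formula (T4 r) (dpar ?u T4 r) (dpar ?v T4 r) (Z4 r) z)"
    by (rule near0_mono) simp
  from near0_param[OF this smooth_at_continuous[OF i3] z0(2)]
  have "near0 K (\<lambda>t z. R (T4 (t, 0, 0)) (dpar ?u T4 (t, 0, 0)) (dpar ?v T4 (t, 0, 0)) (Z4 (t, 0, 0)) z
      = curvature_formula (T4 (t, 0, 0)) (dpar ?u T4 (t, 0, 0)) (dpar ?v T4 (t, 0, 0)) (Z4 (t, 0, 0)) z)" .
  moreover have "near0 K (\<lambda>t z. t \<in> N)" unfolding near0_def using NU by blast
  ultimately show ?thesis
  proof (rule near0_mono[OF near0_conj], elim conjE)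
    fix t z assume e: "R (T4 (t, 0, 0)) (dpar ?u T4 (t, 0, 0)) (dpar ?v T4 (t, 0, 0)) (Z4 (t, 0, 0)) z
        = curvature_formula (T4 (t, 0, 0)) (dpar ?u T4 (t, 0, 0)) (dpar ?v T4 (t, 0, 0)) (Z4 (t, 0, 0)) z"
      and t: "t \<in> N"
    show "R (T t) (X t) (Y t) (Z t) z = curvature_formula (T t) (X t) (Y t) (Z t) z"
      using e unfolding ex[OF t] .
  qed
qed

text \<open>Covariant derivatives of tangent fields are tangent fields, so \<open>R\<close> can be
  replaced by the explicit curvature in every term; under the derivative this is allowed because the
  two agree on an open set.\<close>

lemma riemann_tensor_parallel:
  assumes R: "riemann_tensor K S R"
  shows "covariant_constant K S R"
  unfolding covariant_constant_def Let_def
proof (intro allI impI, elim conjE)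
  fix T :: "real \<Rightarrow> cfun" and X Y Z
  assume T: "schwarz_family K S T" and f: "tangent_field K S T X" "tangent_field K S T Y" "tangent_field K S T Z"
  let ?D = "cov T (\<lambda>_. 1)"
  have D: "tangent_field K S T (?D W)" if "tangent_field K S T W" for W
    by (rule tangent_field_cov[OF T smooth_at_const that])
  note r = riemann_tensor_unique[OF R T]
  have "near0 K (\<lambda>t z. (regular T (\<lambda>_. 1) t z \<and> hsm X (t, z)) \<and> (hsm Y (t, z) \<and> hsm Z (t, z)))"
    by (intro near0_conj family_regular[OF T smooth_at_const] tangent_fieldD(1)[OF T f(1)] tangent_fieldD(1)[OF T f(2)] tangent_fieldD(1)[OF T f(3)])
  from near0_conj[OF near0_conj[OF near0_open[OF r[OF f]] near0_open[OF this]]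
      near0_conj[OF r[OF D[OF f(1)] f(2,3)] near0_conj[OF r[OF f(1) D[OF f(2)] f(3)] r[OF f(1,2) D[OF f(3)]]]]]
  show "near0 K (\<lambda>t z. ?D (\<lambda>t. R (T t) (X t) (Y t) (Z t)) t z - R (T t) (?D X t) (Y t) (Z t) z
      - R (T t) (X t) (?D Y t) (Z t) z - R (T t) (X t) (Y t) (?D Z t) z = 0)"
  proof (rule near0_mono, elim conjE)
    fix t z
    assume e: "\<forall>\<^sub>F x in nhds (t, z). R (T (fst x)) (X (fst x)) (Y (fst x)) (Z (fst x)) (snd x)
          = curvature_formula (T (fst x)) (X (fst x)) (Y (fst x)) (Z (fst x)) (snd x)"
      and s: "\<forall>\<^sub>F x in nhds (t, z). (regular T (\<lambda>_. 1) (fst x) (snd x) \<and> hsm X (fst x, snd x)) \<and> hsm Y (fst x, snd x) \<and> hsm Z (fst x, snd x)"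
      and v: "R (T t) (?D X t) (Y t) (Z t) z = curvature_formula (T t) (?D X t) (Y t) (Z t) z"
        "R (T t) (X t) (?D Y t) (Z t) z = curvature_formula (T t) (X t) (?D Y t) (Z t) z"
        "R (T t) (X t) (Y t) (?D Z t) z = curvature_formula (T t) (X t) (Y t) (?D Z t) z"
    have "\<forall>\<^sub>F x in nhds (t, z). regular T (\<lambda>_. 1) (fst x) (snd x) \<and> hsm X x \<and> hsm Y x \<and> hsm Z x"
      using s by simp
    note p = curvature_parallel[OF this]
    have "?D (\<lambda>t. R (T t) (X t) (Y t) (Z t)) t z = ?D (\<lambda>t. curvature_formula (T t) (X t) (Y t) (Z t)) t z"
      by (rule cov_cong[OF _ e]) simp
    then show "?D (\<lambda>t. R (T t) (X t) (Y t) (Z t)) t z - R (T t) (?D X t) (Y t) (Z t) z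
      - R (T t) (X t) (?D Y t) (Z t) z - R (T t) (X t) (Y t) (?D Z t) z = 0" unfolding v p by simp
  qed
qed


lemma family_base_cong:
  assumes "schwarz_family K S' T" "near K (\<lambda>z. S' z = S z)"
  shows "schwarz_family K S T"
  using assms(1) near_conj[OF assms(2)] unfolding schwarz_family_def
  by (elim conjE, intro conjI) (assumption, rule near_mono[OF near_conj[OF _ assms(2)]], assumption, simp)

lemma family_const_germ:
  assumes "near K (\<lambda>z. S' z = S z)"
  shows "schwarz_family K S (\<lambda>r::'p::euclidean_space. S')"
  by (rule schwarz_family_cong[OF family_const near0_mono[OF near0_const[OF assms]]]) simp

end

lemma has_field_derivative_cbar:
  assumes "(f has_field_derivative a) (at (cnj w))"
  shows "(cbar f has_field_derivative cnj a) (at w)"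
  using has_field_derivative_cnj_compose[where T="\<lambda>z. z", OF assms DERIV_ident] by (simp add: cbar_def)

section \<open>Conformal maps\<close>

locale conformal_germ = schwarz_germ +
  fixes \<phi> :: cfun and V
  assumes open_V: "open V" and K_V: "K \<subseteq> V" and holo: "\<phi> holomorphic_on V" and inj: "inj_on \<phi> V"
begin

abbreviation "f \<equiv> the_inv_into V \<phi>"
abbreviation "B \<equiv> cbar \<phi>"

lemma f_\<phi> [simp]: "z \<in> V \<Longrightarrow> f (\<phi> z) = z"
  by (rule the_inv_into_f_f[OF inj])

lemma f_V: "y \<in> \<phi> ` V \<Longrightarrow> f y \<in> V" and \<phi>_f: "y \<in> \<phi> ` V \<Longrightarrow> \<phi> (f y) = y"
  by auto

lemma open_image: "open (\<phi> ` V)"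
  by (rule open_mapping_thm3[OF holo open_V inj])

lemma f_derivative: "f holomorphic_on \<phi> ` V" "z \<in> V \<Longrightarrow> deriv \<phi> z * deriv f (\<phi> z) = 1"
proof -
  obtain g where g: "g holomorphic_on \<phi> ` V" "\<And>z. z \<in> V \<Longrightarrow> deriv \<phi> z * deriv g (\<phi> z) = 1" "\<And>z. z \<in> V \<Longrightarrow> g (\<phi> z) = z"
    by (rule holomorphic_has_inverse[OF holo open_V inj]) blast
  have eq: "g y = f y" if "y \<in> \<phi> ` V" for y using that g(3) by auto
  show "f holomorphic_on \<phi> ` V" by (rule holomorphic_transform[OF g(1) eq])
  show "deriv \<phi> z * deriv f (\<phi> z) = 1" if z: "z \<in> V" for z
  proof -
    have "\<forall>\<^sub>F y in nhds (\<phi> z). y \<in> \<phi> ` V" by (rule eventually_nhds_in_open[OF open_image]) (use z in blast)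
    then have "\<forall>\<^sub>F y in nhds (\<phi> z). g y = f y" by (rule eventually_mono) (rule eq)
    from deriv_cong_ev[OF this HOL.refl] g(2)[OF z] show ?thesis by simp
  qed
qed

lemma f_has_deriv: "y \<in> \<phi> ` V \<Longrightarrow> (f has_field_derivative deriv f y) (at y)"
  by (rule holomorphic_derivI[OF f_derivative(1) open_image])

lemma f_deriv_nonzero: "y \<in> \<phi> ` V \<Longrightarrow> deriv f y \<noteq> 0"
  using f_derivative(2) by force

lemma B_has_deriv: "cnj w \<in> V \<Longrightarrow> (B has_field_derivative cnj (deriv \<phi> (cnj w))) (at w)"
  by (rule has_field_derivative_cbar[OF holomorphic_derivI[OF holo open_V]])

lemma B_deriv_nonzero: "cnj w \<in> V \<Longrightarrow> deriv B w \<noteq> 0"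
  using DERIV_imp_deriv[OF B_has_deriv] f_derivative(2)[of "cnj w"] by auto

lemma B_analytic: assumes "cnj w \<in> V" shows "B analytic_on {w}"
  unfolding analytic_at_iff_eventually
proof -
  have "isCont cnj w" by (intro continuous_intros)
  from eventually_nhds_compose[OF this eventually_nhds_in_open[OF open_V assms]]
  show "\<forall>\<^sub>F v in nhds w. B field_differentiable (at v)"
    by eventually_elim (unfold field_differentiable_def, rule exI, rule B_has_deriv)
qed

lemma lam_apply: "lam \<phi> V T y = B (T (f y))"
  by (simp add: lam_def)

lemma lam_vec_apply: "lam_vec \<phi> V T X y = deriv B (T (f y)) * X (f y)"
  by (simp add: lam_vec_def)

text \<open>\<phi> is open on \<open>V\<close>, so it carries neighbourhoods of \<open>K\<close> to
  neighbourhoods of the image; injectivity makes \<open>f\<close> return to the original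
  point.\<close>

lemma near_push:
  assumes "near K P" shows "near (\<phi> ` K) (\<lambda>y. y \<in> \<phi> ` V \<and> P (f y))"
proof -
  from assms obtain U where U: "open U" "K \<subseteq> U" "\<And>z. z \<in> U \<Longrightarrow> P z" unfolding near_def by blast
  have "open (\<phi> ` (U \<inter> V))"
    by (rule open_mapping_thm3) (auto intro: holomorphic_on_subset[OF holo] inj_on_subset[OF inj] U open_V)
  moreover have "\<phi> ` K \<subseteq> \<phi> ` (U \<inter> V)" using U K_V by blast
  ultimately show ?thesis unfolding near_def using U(3) by (intro exI[of _ "\<phi> ` (U \<inter> V)"]) auto
qed

lemma near0_push:
  assumes "near0 K P" shows "near0 (\<phi> ` K) (\<lambda>r y. y \<in> \<phi> ` V \<and> P r (f y))"
proof -
  from assms obtain N U where N: "open N" "0 \<in> N" "open U" "K \<subseteq> U" and P: "\<And>r z. r \<in> N \<Longrightarrow> z \<in> U \<Longrightarrow> P r z"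
    unfolding near0_def by blast
  have "near K (\<lambda>z. z \<in> U)" using N unfolding near_def by blast
  from near_push[OF this] obtain U' where U': "open U'" "\<phi> ` K \<subseteq> U'" "\<And>y. y \<in> U' \<Longrightarrow> y \<in> \<phi> ` V \<and> f y \<in> U"
    unfolding near_def by blast
  show ?thesis unfolding near0_def using N(1,2) U' P by (intro exI[of _ N] exI[of _ U']) auto
qed

text \<open>Pushing a straightening coordinate of \<open>K\<close> forward straightens \<open>\<phi> ` K\<close>.\<close>

lemma push_along: "schwarz_along (\<phi> ` K) (lam \<phi> V S)"
proof -
  obtain g where g: "straightening K S g" using straightening_exists by blast
  then obtain a b where ab: "a \<le> b" "g ` K = complex_of_real ` {a..b}" and gan: "\<And>k. k \<in> K \<Longrightarrow> g analytic_on {k}"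
    and gS: "near K (\<lambda>z. g (cnj (S z)) = cnj (g z))" unfolding straightening_def by blast
  have hs: "near0 K (\<lambda>(r::real) z. hsm (\<lambda>_. g) (r, z))"
    unfolding near0_hsm[OF compact_K] using gan by (intro ballI hsm_analytic_const) simp
  have base: "near K (\<lambda>z. g z = g z)" by (simp add: near_iff)
  obtain N U W \<psi> where "open N" "(0::real) \<in> N" and U: "open U" "K \<subseteq> U" and W: "open W" "g ` K \<subseteq> W"
    and inj0: "\<And>r. r \<in> N \<Longrightarrow> inj_on g U"
    and \<psi>0: "\<And>r y. r \<in> N \<Longrightarrow> y \<in> W \<Longrightarrow> \<psi> r y \<in> U \<and> g (\<psi> r y) = y \<and> hsm \<psi> (r, y)"
    using straightening_param[where \<kappa>="\<lambda>_::real. g", OF g hs base] by metis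
  \<comment> \<open>A local parametrization of the curve, the inverse of the coordinate
    \<open>g\<close>; it comes from inverting the family that is constant in the parameter.\<close>
  define \<eta> where "\<eta> = \<psi> 0"
  have injU: "inj_on g U" using inj0 \<open>0 \<in> N\<close> by blast
  have \<eta>: "\<eta> y \<in> U" "g (\<eta> y) = y" "\<eta> analytic_on {y}" if "y \<in> W" for y
    using \<psi>0[OF \<open>0 \<in> N\<close> that] hsm_analytic[of \<psi> 0 y] by (auto simp: \<eta>_def)
  have \<eta>g: "\<eta> (g z) = z" if "z \<in> U" "g z \<in> W" for z
    using inj_onD[OF injU \<eta>(2)[OF that(2)] \<eta>(1)[OF that(2)] that(1)] .
  have hol: "\<eta> holomorphic_on W"
    using \<eta>(3) analytic_imp_holomorphic analytic_on_analytic_at by blast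
  \<comment> \<open>Restricts the parametrization to points landing in \<open>V\<close>, where
    \<phi> can be applied to them.\<close>
  have oW': "open (W \<inter> \<eta> -` V)" by (rule continuous_open_preimage[OF holomorphic_on_imp_continuous_on[OF hol] W(1) open_V])
  have gW': "g ` K \<subseteq> W \<inter> \<eta> -` V" 
  proof (rule image_subsetI)
    fix k assume k: "k \<in> K"
    then have kk: "k \<in> U" "g k \<in> W" "k \<in> V" using W(2) U(2) K_V by auto
    then show "g k \<in> W \<inter> \<eta> -` V" using \<eta>g[OF kk(1,2)] by simp
  qed
  obtain \<Omega> where \<Omega>: "open \<Omega>" "complex_of_real ` {a..b} \<subseteq> \<Omega>" "\<Omega> \<subseteq> W \<inter> \<eta> -` V"
    and c\<Omega>: "\<And>w. w \<in> \<Omega> \<Longrightarrow> cnj w \<in> \<Omega>"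
    and seg: "\<And>\<psi> T V. \<psi> holomorphic_on \<Omega> \<Longrightarrow> inj_on \<psi> \<Omega> \<Longrightarrow> V \<subseteq> \<psi> ` \<Omega> \<Longrightarrow>
      (\<And>w. w \<in> \<Omega> \<Longrightarrow> \<psi> w \<in> V \<Longrightarrow> T (\<psi> w) = cnj (\<psi> (cnj w))) \<Longrightarrow> schwarz_on V T"
    using schwarz_on_of_segment[OF oW' gW'[unfolded ab(2)] ab(1)] by blast
  have "near K (\<lambda>z. (z \<in> U \<and> g z \<in> \<Omega>) \<and> cnj (S z) \<in> U)"
    unfolding near_iff
  proof (intro ballI eventually_conj)
    fix k assume k: "k \<in> K"
    show "\<forall>\<^sub>F z in nhds k. z \<in> U" by (rule eventually_nhds_in_open[OF U(1)]) (use k U in blast)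
    have gk: "g k \<in> \<Omega>" using k ab(2) \<Omega>(2) by blast
    have "isCont g k" using gan[OF k] by (simp add: analytic_at_imp_isCont)
    from eventually_nhds_compose[OF this eventually_nhds_in_open[OF \<Omega>(1) gk]] show "\<forall>\<^sub>F z in nhds k. g z \<in> \<Omega>" .
    have c: "isCont (\<lambda>z. cnj (S z)) k" using S_analytic[OF k] by (intro continuous_intros) (simp add: analytic_at_imp_isCont)
    have "cnj (S k) \<in> U" using S_on_K[OF k] U k by auto
    from eventually_nhds_compose[OF c eventually_nhds_in_open[OF U(1) this]] show "\<forall>\<^sub>F z in nhds k. cnj (S z) \<in> U" .
  qed
  from near_push[OF near_conj[OF this gS]] obtain U' where U': "open U'" "\<phi> ` K \<subseteq> U'"
    and P: "\<And>y. y \<in> U' \<Longrightarrow> y \<in> \<phi> ` V \<and> ((f y \<in> U \<and> g (f y) \<in> \<Omega>) \<and> cnj (S (f y)) \<in> U) \<and> g (cnj (S (f y))) = cnj (g (f y))"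
    unfolding near_def by auto
  have \<Omega>': "w \<in> W" "\<eta> w \<in> V" if "w \<in> \<Omega>" for w using that \<Omega>(3) by auto
  have "schwarz_on U' (lam \<phi> V S)"
  proof (rule seg)
    show "(\<lambda>w. \<phi> (\<eta> w)) holomorphic_on \<Omega>"
    proof -
      have W\<Omega>: "\<Omega> \<subseteq> W" "\<eta> ` \<Omega> \<subseteq> V" using \<Omega>(3) by blast+
      from holomorphic_on_compose_gen[OF holomorphic_on_subset[OF hol W\<Omega>(1)] holo W\<Omega>(2)] show ?thesis
        by (simp add: o_def)
    qed
    show "inj_on (\<lambda>w. \<phi> (\<eta> w)) \<Omega>"
    proof (rule inj_onI)
      fix v w assume vw: "v \<in> \<Omega>" "w \<in> \<Omega>" and e: "\<phi> (\<eta> v) = \<phi> (\<eta> w)"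
      have "v = g (\<eta> v)" by (rule \<eta>(2)[OF \<Omega>'(1)[OF vw(1)], symmetric])
      also have "\<dots> = g (\<eta> w)" using inj_onD[OF inj e \<Omega>'(2)[OF vw(1)] \<Omega>'(2)[OF vw(2)]] by (rule arg_cong)
      also have "\<dots> = w" by (rule \<eta>(2)[OF \<Omega>'(1)[OF vw(2)]])
      finally show "v = w" .
    qed
    show "U' \<subseteq> (\<lambda>w. \<phi> (\<eta> w)) ` \<Omega>"
    proof
      fix y assume "y \<in> U'"
      note p = P[OF this]
      have "y = \<phi> (\<eta> (g (f y)))" using p \<eta>g[of "f y"] \<Omega>'(1) \<phi>_f by simp
      then show "y \<in> (\<lambda>w. \<phi> (\<eta> w)) ` \<Omega>" using p by blast
    qed
    fix w assume w: "w \<in> \<Omega>" and y: "\<phi> (\<eta> w) \<in> U'"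
    have z: "f (\<phi> (\<eta> w)) = \<eta> w" using \<Omega>'(2)[OF w] by simp
    note p = P[OF y, unfolded z]
    have cw: "cnj w \<in> W" by (rule \<Omega>'(1)[OF c\<Omega>[OF w]])
    have "g (cnj (S (\<eta> w))) = g (\<eta> (cnj w))" using p \<eta>(2)[OF \<Omega>'(1)[OF w]] \<eta>(2)[OF cw] by simp
    from inj_onD[OF injU this] p \<eta>(1)[OF cw] have "cnj (S (\<eta> w)) = \<eta> (cnj w)" by blast
    then show "lam \<phi> V S (\<phi> (\<eta> w)) = cnj (\<phi> (\<eta> (cnj w)))" unfolding lam_apply z cbar_def by simp
  qed
  moreover have "continuous_on K \<phi>"
    by (rule continuous_on_subset[OF holomorphic_on_imp_continuous_on[OF holo] K_V])
  then have "compact (\<phi> ` K)" "connected (\<phi> ` K)"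
    using along by (auto simp: schwarz_along_def intro: compact_continuous_image connected_continuous_image)
  moreover have "lam \<phi> V S (\<phi> k) = cnj (\<phi> k)" if "k \<in> K" for k
    using that K_V S_on_K[OF that] by (simp add: lam_apply cbar_def subset_iff)
  ultimately show ?thesis using U' K_nonempty unfolding schwarz_along_def by blast
qed

sublocale push: schwarz_germ "\<phi> ` K" "lam \<phi> V S"
  by unfold_locales (rule push_along)

definition good :: "('p::euclidean_space \<Rightarrow> cfun) \<Rightarrow> 'p \<Rightarrow> complex \<Rightarrow> bool" where
  "good T r z \<longleftrightarrow> z \<in> V \<and> cnj (T r z) \<in> V \<and> hsm T (r, z) \<and> deriv (T r) z \<noteq> 0"

lemma near_V: "near K (\<lambda>z. z \<in> V)"
  unfolding near_def using open_V K_V by blast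

lemma family_good:
  fixes T :: "'p::euclidean_space \<Rightarrow> cfun"
  assumes T: "schwarz_family K S T"
  shows "near0 K (good T)"
proof (rule near0_mono[OF near0_conj[OF near0_conj[OF near0_const[OF near_V] near0_reflect[OF T near0_const[OF near_V]]]
      family_reflecting[OF T]]], elim conjE)
  fix r z assume V: "z \<in> V" "cnj (T r z) \<in> V" and R: "reflecting T r z"
  show "good T r z" using V R reflecting_deriv_nonzero[OF R] by (simp add: good_def reflecting_def)
qed

lemma hsm_f:
  fixes T :: "'p::euclidean_space \<Rightarrow> cfun"
  assumes "y \<in> \<phi> ` V" "hsm T (r, f y)" shows "hsm (\<lambda>r y. T r (f y)) (r, y)"
proof -
  have "f analytic_on {y}" using f_derivative(1) open_image assms(1) by (auto simp: analytic_at)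
  then have "hsm (\<lambda>_. f) (r, y)" by (intro hsm_analytic_const) simp
  then show ?thesis using hsm_compose[of T "\<lambda>r. r" "(r, y)" "\<lambda>_. f"] assms(2) by simp
qed

lemma hsm_lam:
  fixes T :: "'p::euclidean_space \<Rightarrow> cfun"
  assumes y: "y \<in> \<phi> ` V" and T: "good T r (f y)"
  shows "hsm (\<lambda>r. lam \<phi> V (T r)) (r, y)"
proof -
  have h: "hsm (\<lambda>r y. T r (f y)) (r, y)" by (rule hsm_f[OF y]) (use T in \<open>simp add: good_def\<close>)
  have "hsm (\<lambda>r y. B (T r (f y))) (r, y)"
    by (rule hsm_analytic_compose[OF _ h]) (use T in \<open>simp add: good_def B_analytic\<close>)
  then show ?thesis by (simp add: lam_apply[abs_def])
qed

lemma push_family: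
  fixes T :: "'p::euclidean_space \<Rightarrow> cfun"
  assumes T: "schwarz_family K S T"
  shows "schwarz_family (\<phi> ` K) (lam \<phi> V S) (\<lambda>r. lam \<phi> V (T r))"
proof (rule push.schwarz_familyI)
  have "near0 (\<phi> ` K) (\<lambda>r y. hsm (\<lambda>r. lam \<phi> V (T r)) (r, y))"
    by (rule near0_mono[OF near0_push[OF family_good[OF T]]]) (elim conjE, rule hsm_lam)
  then show "hsm (\<lambda>r. lam \<phi> V (T r)) (0, k)" if "k \<in> \<phi> ` K" for k
    using that unfolding near0_hsm[OF push.compact_K] by blast
  show "near (\<phi> ` K) (\<lambda>y. lam \<phi> V (T 0) y = lam \<phi> V S y)"
    by (rule near_mono[OF near_push[OF family_base[OF T]]]) (simp add: lam_apply)
  show "near0 (\<phi> ` K) (\<lambda>r y. cnj (lam \<phi> V (T r) (cnj (lam \<phi> V (T r) y))) = y)"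
  proof (rule near0_mono[OF near0_push[OF near0_conj[OF family_involution[OF T] family_good[OF T]]]], elim conjE)
    fix r y assume y: "y \<in> \<phi> ` V" and i: "cnj (T r (cnj (T r (f y)))) = f y" and g: "good T r (f y)"
    have "cnj (T r (f y)) \<in> V" using g by (simp add: good_def)
    then show "cnj (lam \<phi> V (T r) (cnj (lam \<phi> V (T r) y))) = y"
      using i \<phi>_f[OF y] by (simp add: lam_apply cbar_def)
  qed
qed

lemma dpar_lam:
  fixes T :: "'p::euclidean_space \<Rightarrow> cfun"
  assumes T: "good T r (f y)"
  shows "dpar u (\<lambda>r. lam \<phi> V (T r)) r y = lam_vec \<phi> V (T r) (dpar u T r) y"
proof (rule dpar_eqI)
  have T': "hsm T (r, f y)" and c: "cnj (T (r + 0 *\<^sub>R u r) (f y)) \<in> V" using T by (simp_all add: good_def)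
  from field_vector_diff_chain_at[OF hsm_dpar_has_vector_derivative[OF T', of u] B_has_deriv[OF c]]
  show "((\<lambda>t. lam \<phi> V (T (r + t *\<^sub>R u r)) y) has_vector_derivative lam_vec \<phi> V (T r) (dpar u T r) y) (at 0)"
    using DERIV_imp_deriv[OF B_has_deriv[OF c]] by (simp add: lam_apply lam_vec_apply o_def mult.commute)
qed

text \<open>The parameter derivative of the pushed field contains a term with the second derivative
  of \<open>B\<close>. Each of the two products in the correction term supplies half of it, so with
  the coefficient 1/2 it cancels.\<close>

lemma cov_lam:
  fixes T :: "'p::euclidean_space \<Rightarrow> cfun"
  assumes ev: "\<forall>\<^sub>F x in nhds (r, y). snd x \<in> \<phi> ` V \<and> good T (fst x) (f (snd x))" and W: "hsm W (r, f y)" and u: "smooth_at u r"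
  shows "cov (\<lambda>r. lam \<phi> V (T r)) u (\<lambda>r. lam_vec \<phi> V (T r) (W r)) r y = lam_vec \<phi> V (T r) (cov T u W r) y"
proof -
  have y: "y \<in> \<phi> ` V" and g: "good T r (f y)" using eventually_nhds_x_imp_x[OF ev] by auto
  then have T: "hsm T (r, f y)" and cV: "cnj (T r (f y)) \<in> V" and d: "deriv (T r) (f y) \<noteq> 0" by (simp_all add: good_def)
  have hA: "hsm (dpar u T) (r, f y)" by (rule hsm_dpar[OF T]) (simp add: u)
  let ?b = "deriv B (T r (f y))" and ?b' = "deriv (deriv B) (T r (f y))" and ?c = "deriv f y" and ?d = "deriv (T r) (f y)"
  have nz: "?b \<noteq> 0" "?c \<noteq> 0" by (rule B_deriv_nonzero[OF cV], rule f_deriv_nonzero[OF y])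
  have b: "(B has_field_derivative ?b) (at (T r (f y)))"
    using B_has_deriv[OF cV] DERIV_imp_deriv[OF B_has_deriv[OF cV]] by simp
  have b': "(deriv B has_field_derivative ?b') (at (T r (f y)))"
    by (rule field_differentiable_derivI[OF analytic_on_imp_differentiable_at[OF analytic_deriv[OF B_analytic[OF cV]]]]) simp
  note fd = f_has_deriv[OF y]
  have Tf: "((\<lambda>y. T r (f y)) has_field_derivative ?d * ?c) (at y)" by (rule DERIV_chain2[OF hsm_has_deriv[OF T] fd])
  have 1: "deriv (lam \<phi> V (T r)) y = ?b * (?d * ?c)"
    unfolding lam_apply[abs_def] by (rule DERIV_imp_deriv[OF DERIV_chain2[OF b Tf]])
  have v: "deriv (lam_vec \<phi> V (T r) (X r)) y = ?b * (deriv (X r) (f y) * ?c) + ?b' * (?d * ?c) * X r (f y)" if X: "hsm X (r, f y)" for X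
    unfolding lam_vec_apply[abs_def]
    by (rule DERIV_imp_deriv[OF DERIV_mult'[OF DERIV_chain2[OF b' Tf] DERIV_chain2[OF hsm_has_deriv[OF X] fd]]])
  have "\<forall>\<^sub>F x in nhds (r, y). (\<lambda>r y. good T r (f y)) (fst x) (snd x)" using ev by eventually_elim simp
  from eventually_slice_snd[OF this]
  have "\<forall>\<^sub>F w in nhds y. dpar u (\<lambda>r. lam \<phi> V (T r)) r w = lam_vec \<phi> V (T r) (dpar u T r) w"
    by eventually_elim (rule dpar_lam)
  from deriv_cong_ev[OF this HOL.refl]
  have 2: "deriv (dpar u (\<lambda>r. lam \<phi> V (T r)) r) y = ?b * (deriv (dpar u T r) (f y) * ?c) + ?b' * (?d * ?c) * dpar u T r (f y)"
    unfolding v[OF hA] .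
  have b0: "(deriv B has_field_derivative ?b') (at (T (r + 0 *\<^sub>R u r) (f y)))" using b' by simp
  from has_vector_derivative_mult[OF field_vector_diff_chain_at[OF hsm_dpar_has_vector_derivative[OF T, of u] b0, unfolded o_def]
      hsm_dpar_has_vector_derivative[OF W, of u]]
  have 3: "dpar u (\<lambda>r. lam_vec \<phi> V (T r) (W r)) r y = ?b * dpar u W r (f y) + dpar u T r (f y) * ?b' * W r (f y)"
    by (intro dpar_eqI) (simp add: lam_vec_apply)
  show ?thesis
    unfolding cov_def[of "\<lambda>r. lam \<phi> V (T r)"] 1 2 3 v[OF W] dpar_lam[OF g] unfolding lam_vec_apply cov_def
    using nz d by (simp add: field_simps)
qed

lemma push_tangent_field:
  fixes T :: "'p::euclidean_space \<Rightarrow> cfun"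
  assumes Y: "tangent_field K S T Y"
  shows "tangent_field (\<phi> ` K) (lam \<phi> V S) (\<lambda>r. lam \<phi> V (T r)) (\<lambda>r. lam_vec \<phi> V (T r) (Y r))"
proof -
  from Y[unfolded tangent_field_def] obtain T' :: "'p \<times> real \<Rightarrow> cfun" where T': "schwarz_family K S T'"
    and eq: "near0 K (\<lambda>r z. T' (r, 0) z = T r z)" "near0 K (\<lambda>r z. dpar (\<lambda>_. (0, 1)) T' (r, 0) z = Y r z)"
    by (elim exE conjE)
  have g: "near0 K (\<lambda>r z. good T' (r, 0) z)"
    by (rule near0_param[OF family_good[OF T'] smooth_at_continuous[OF smooth_at_Pair_0]]) (simp add: zero_prod_def)
  have "near0 (\<phi> ` K) (\<lambda>r y. lam \<phi> V (T' (r, 0)) y = lam \<phi> V (T r) y)"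
    by (rule near0_mono[OF near0_push[OF eq(1)]]) (simp add: lam_apply)
  moreover have "near0 (\<phi> ` K) (\<lambda>r y. dpar (\<lambda>_. (0, 1)) (\<lambda>q. lam \<phi> V (T' q)) (r, 0) y = lam_vec \<phi> V (T r) (Y r) y)"
  proof (rule near0_mono[OF near0_push[OF near0_conj[OF g near0_conj[OF eq]]]], elim conjE)
    fix r y assume "good T' (r, 0) (f y)" "T' (r, 0) (f y) = T r (f y)" "dpar (\<lambda>_. (0, 1)) T' (r, 0) (f y) = Y r (f y)"
    then show "dpar (\<lambda>_. (0, 1)) (\<lambda>q. lam \<phi> V (T' q)) (r, 0) y = lam_vec \<phi> V (T r) (Y r) y"
      by (simp add: dpar_lam lam_vec_apply)
  qed
  ultimately show ?thesis unfolding tangent_field_def using push_family[OF T'] by (intro exI conjI)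
qed

section \<open>Inverse images and invariance of the connection\<close>

abbreviation "pull \<equiv> lam (the_inv_into V \<phi>) (\<phi> ` V)"

lemma inj_f: "inj_on f (\<phi> ` V)"
  by (rule inj_onI) (metis \<phi>_f)

lemma f_image: "f ` (\<phi> ` V) = V" "f ` (\<phi> ` K) = K"
  using K_V by (auto simp: image_image subset_iff intro!: image_eqI)

lemma pull_apply: "z \<in> V \<Longrightarrow> pull T z = cnj (f (cnj (T (\<phi> z))))"
  using the_inv_into_f_f[OF inj_f, of "\<phi> z"] by (simp add: lam_def cbar_def)

lemma pull_lam: "z \<in> V \<Longrightarrow> cnj (T z) \<in> V \<Longrightarrow> pull (lam \<phi> V T) z = T z"
  by (simp add: pull_apply lam_apply cbar_def)

lemma lam_pull: "y \<in> \<phi> ` V \<Longrightarrow> cnj (T y) \<in> \<phi> ` V \<Longrightarrow> lam \<phi> V (pull T) y = T y"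
  using \<phi>_f[of "cnj (T y)"] \<phi>_f[of y] f_V[of y] by (simp add: pull_apply lam_apply cbar_def)

lemma near_pull: "near K (\<lambda>z. pull (lam \<phi> V S) z = S z)"
proof (rule near_mono[OF near0_at0[OF family_good[OF family_const[where ?'p=real]]]])
  fix z assume "good (\<lambda>r::real. S) 0 z"
  then show "pull (lam \<phi> V S) z = S z" by (intro pull_lam) (simp_all add: good_def)
qed

lemma conformal_germ_inverse: "conformal_germ (\<phi> ` K) (lam \<phi> V S) f (\<phi> ` V)"
  by unfold_locales (use K_V open_image f_derivative(1) inj_f in auto)

text \<open>The forward construction applied to the inverse map. Its base function agrees with
  \<open>S\<close> as a germ along \<open>K\<close>, which suffices for a family.\<close>

lemma pull_family:
  fixes T :: "'p::euclidean_space \<Rightarrow> cfun"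
  assumes T: "schwarz_family (\<phi> ` K) (lam \<phi> V S) T"
  shows "schwarz_family K S (\<lambda>r. pull (T r))"
proof -
  interpret bwd: conformal_germ "\<phi> ` K" "lam \<phi> V S" f "\<phi> ` V" by (rule conformal_germ_inverse)
  show ?thesis by (rule family_base_cong[OF bwd.push_family[OF T, unfolded f_image] near_pull])
qed

lemma lam_field_apply: "lam_field \<phi> V Y T = lam_vec \<phi> V (pull T) (Y (pull T))"
  by (simp add: lam_field_def Let_def)

text \<open>A family near the image curve is pulled back, the field is evaluated there and pushed
  forward; pulling back and pushing forward reproduces the family as a germ.\<close>

lemma vector_field_lam_field:
  assumes Y: "vector_field K S Y"
  shows "vector_field (\<phi> ` K) (lam \<phi> V S) (lam_field \<phi> V Y)"
  unfolding vector_field_def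
proof (intro allI impI)
  interpret bwd: conformal_germ "\<phi> ` K" "lam \<phi> V S" f "\<phi> ` V" by (rule conformal_germ_inverse)
  fix T :: "real \<times> real \<Rightarrow> cfun" assume T: "schwarz_family (\<phi> ` K) (lam \<phi> V S) T"
  have "near0 (\<phi> ` K) (\<lambda>r y. lam \<phi> V (pull (T r)) y = T r y)"
    by (rule near0_mono[OF bwd.family_good[OF T]]) (simp add: lam_pull bwd.good_def)
  from push.tangent_field_cong_family[OF push_tangent_field[OF vector_fieldD[OF Y pull_family[OF T]]] this]
  show "tangent_field (\<phi> ` K) (lam \<phi> V S) T (\<lambda>p. lam_field \<phi> V Y (T p))"
    unfolding lam_field_apply .
qed

text \<open>Both sides are computed along one curve with velocity \<open>X S\<close> and along its
  image, where the transformation rule of covariant derivatives compares them.\<close>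

lemma lam_vec_nabla:
  assumes X: "vector_field K S X" and Y: "vector_field K S Y"
  shows "near (\<phi> ` K) (\<lambda>y. lam_vec \<phi> V S (nabla K S X Y) y
    = nabla (\<phi> ` K) (lam \<phi> V S) (lam_field \<phi> V X) (lam_field \<phi> V Y) y)"
proof -
  obtain T where "variation K S (X S) T" using vector_field_tangent[OF X] unfolding tangent_def by (elim exE) (rule that)
  note T = variationD[OF this]
  let ?T = "\<lambda>r. lam \<phi> V (T r)" and ?u = "\<lambda>_::real. 1::real"
  note good = family_good[OF T(1)]
  \<comment> \<open>\<open>pull (lam \<phi> V S)\<close> is known to equal \<open>S\<close> only
    near \<open>K\<close>, so the value of the field has to be transferred between the two
    germs.\<close>
  note XS = field_base[OF X family_const_germ[OF near_pull, where ?'p=real]]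
  have vel: "near (\<phi> ` K) (\<lambda>y. dpar ?u ?T 0 y = lam_field \<phi> V X (lam \<phi> V S) y)"
  proof (rule near_mono[OF near_push[OF near_conj[OF near_conj[OF near0_at0[OF good] T(2)] near_conj[OF near_conj[OF XS near_pull] family_base[OF T(1)]]]]], elim conjE)
    fix y assume "good T 0 (f y)" "dpar ?u T 0 (f y) = X S (f y)" "X (pull (lam \<phi> V S)) (f y) = X S (f y)"
      "pull (lam \<phi> V S) (f y) = S (f y)" "T 0 (f y) = S (f y)"
    then show "dpar ?u ?T 0 y = lam_field \<phi> V X (lam \<phi> V S) y"
      by (simp add: dpar_lam lam_field_apply lam_vec_apply)
  qed
  note N' = push.nabla_eq_cov[where u="?u" and X="lam_field \<phi> V X", OF push_family[OF T(1)] vector_field_lam_field[OF Y] vel]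
  note N = nabla_eq_cov[where u="?u" and X=X, OF T(1) Y T(2)]
  have pT: "near0 K (\<lambda>s z. pull (?T s) z = T s z)"
    by (rule near0_mono[OF good]) (simp add: pull_lam good_def)
  have F: "near0 (\<phi> ` K) (\<lambda>s y. lam_field \<phi> V Y (?T s) y = lam_vec \<phi> V (T s) (Y (T s)) y)"
  proof (rule near0_mono[OF near0_push[OF near0_conj[OF pT field_germ[OF Y T(1) pT]]]], elim conjE)
    fix s y assume "pull (?T s) (f y) = T s (f y)" "Y (pull (?T s)) (f y) = Y (T s) (f y)"
    then show "lam_field \<phi> V Y (?T s) y = lam_vec \<phi> V (T s) (Y (T s)) y" by (simp add: lam_field_apply lam_vec_apply)
  qed
  note W = tangent_fieldD(1)[OF T(1) vector_field_curve[OF Y T(1)]]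
  show ?thesis
  proof (rule near_mono[OF near_conj[OF near_conj[OF N' near_push[OF near_conj[OF N family_base[OF T(1)]]]]
        near_conj[OF near0_at0[OF near0_open[OF F]] near_conj[OF near0_at0[OF near0_open[OF near0_push[OF good]]] near_push[OF near0_at0[OF W]]]]]], elim conjE)
    fix y
    assume n': "cov ?T ?u (\<lambda>r. lam_field \<phi> V Y (?T r)) 0 y = nabla (\<phi> ` K) (lam \<phi> V S) (lam_field \<phi> V X) (lam_field \<phi> V Y) y"
      and n: "cov T ?u (\<lambda>r. Y (T r)) 0 (f y) = nabla K S X Y (f y)" and b: "T 0 (f y) = S (f y)"
      and F: "\<forall>\<^sub>F x in nhds (0, y). lam_field \<phi> V Y (?T (fst x)) (snd x) = lam_vec \<phi> V (T (fst x)) (Y (T (fst x))) (snd x)"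
      and g: "\<forall>\<^sub>F x in nhds (0, y). snd x \<in> \<phi> ` V \<and> good T (fst x) (f (snd x))" and W: "hsm (\<lambda>s. Y (T s)) (0, f y)"
    have "cov ?T ?u (\<lambda>r. lam_field \<phi> V Y (?T r)) 0 y = cov ?T ?u (\<lambda>r. lam_vec \<phi> V (T r) (Y (T r))) 0 y"
      by (rule cov_cong[OF _ F]) simp
    also have "\<dots> = lam_vec \<phi> V (T 0) (cov T ?u (\<lambda>r. Y (T r)) 0) y"
      by (rule cov_lam[OF g W smooth_at_const])
    also have "\<dots> = lam_vec \<phi> V S (nabla K S X Y) y" unfolding lam_vec_apply n b ..
    finally show "lam_vec \<phi> V S (nabla K S X Y) y
        = nabla (\<phi> ` K) (lam \<phi> V S) (lam_field \<phi> V X) (lam_field \<phi> V Y) y" using n' by simp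
  qed
qed

end

lemma (in schwarz_germ) nabla_conformal: "conformally_invariant K S nabla"
  unfolding conformally_invariant_def
proof (intro allI impI, elim conjE)
  fix \<phi> V assume "open V" "K \<subseteq> V" "\<phi> holomorphic_on V" "inj_on \<phi> V"
  then interpret conformal_germ K S \<phi> V by unfold_locales
  show "schwarz_along (\<phi> ` K) (lam \<phi> V S) \<and>
        (\<forall>X Y. vector_field K S X \<and> vector_field K S Y \<longrightarrow>
           vector_field (\<phi> ` K) (lam \<phi> V S) (lam_field \<phi> V X) \<and>
           near (\<phi> ` K) (\<lambda>z. lam_vec \<phi> V S (nabla K S X Y) z
             = nabla (\<phi> ` K) (lam \<phi> V S) (lam_field \<phi> V X) (lam_field \<phi> V Y) z))"
    by (intro conjI allI impI push_along; elim conjE; rule vector_field_lam_field lam_vec_nabla; assumption)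
qed

theorem theorem3:
  fixes K :: "complex set" and S :: "complex \<Rightarrow> complex"
  assumes "schwarz_along K S"
  shows
    "(\<forall>T. schwarz_family K S T \<longrightarrow> (geodesic K T \<longleftrightarrow> continuous_reflection K T)) \<and>
     (\<forall>X Y. vector_field K S X \<and> vector_field K S Y \<longrightarrow>
        has_flat_derivative K S (X S) Y (flat_derivative K S (X S) Y)) \<and>
     affine_connection K S (nabla K S) \<and>
     (\<forall>(T :: 'p::euclidean_space \<Rightarrow> complex \<Rightarrow> complex) u X Y.
        schwarz_family K S T \<and> smooth_near0 u \<and> vector_field K S X \<and> vector_field K S Y \<and>
        near K (\<lambda>z. dpar u T 0 z = X S z) \<longrightarrow>
        near K (\<lambda>z. cov T u (\<lambda>r. Y (T r)) 0 z = nabla K S X Y z)) \<and>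
     (\<forall>(T :: 'p \<Rightarrow> complex \<Rightarrow> complex) u Y.
        schwarz_family K S T \<and> smooth_near0 u \<and> tangent_field K S T Y \<longrightarrow>
        tangent_field K S T (cov T u Y)) \<and>
     (\<forall>(T :: 'p \<Rightarrow> complex \<Rightarrow> complex) u v.
        schwarz_family K S T \<and> smooth_near0 u \<and> smooth_near0 v \<longrightarrow>
        near0 K (\<lambda>r z. cov T u (dpar v T) r z - cov T v (dpar u T) r z
          = dpar (bracket u v) T r z)) \<and>
     (\<forall>A B C :: 'p \<Rightarrow> complex \<Rightarrow> complex.
        schwarz_family K S A \<and> schwarz_family K S B \<and> schwarz_family K S C \<longrightarrow>
        schwarz_family K S (\<lambda>r. reflect_mult (A r) (B r)) \<and>
        near0 K (\<lambda>r z. reflect_mult (A r) (A r) z = A r z) \<and>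
        near0 K (\<lambda>r z. reflect_mult (A r) (reflect_mult (A r) (B r)) z = B r z) \<and>
        near0 K (\<lambda>r z. reflect_mult (A r) (reflect_mult (B r) (C r)) z
          = reflect_mult (reflect_mult (A r) (B r)) (reflect_mult (A r) (C r)) z) \<and>
        (\<forall>\<^sub>F r in nhds 0. near K (\<lambda>z. reflect_mult S (A r) z = A r z) \<longrightarrow>
           near K (\<lambda>z. A r z = S z))) \<and>
     canonical_connection K S reflect_mult
       (\<lambda>p. cov p (\<lambda>_. (1, 0)) (dpar (\<lambda>_. (0, 1)) p) (0, 0)) \<and>
     conformally_invariant K S nabla \<and>
     (\<exists>R. riemann_tensor K S R) \<and>
     (\<forall>R. riemann_tensor K S R \<longrightarrow> covariant_constant K S R)"
proof -
  interpret schwarz_germ K S by (rule schwarz_germ.intro[OF assms])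
  have geo: "geodesic K T \<longleftrightarrow> continuous_reflection K T" for T
  proof -
    \<comment> \<open>For equal arguments the two products in the correction coincide and absorb the
      factor 1/2; where the derivative vanishes, both quotients are 0.\<close>
    have "cov T (\<lambda>_. 1) (dpar (\<lambda>_. 1) T) t z
      = dpar (\<lambda>_. 1) (dpar (\<lambda>_. 1) T) t z
        - dpar (\<lambda>_. 1) T t z / deriv (T t) z * deriv (dpar (\<lambda>_. 1) T t) z" for t z
      by (cases "deriv (T t) z = 0") (simp_all add: cov_def field_simps)
    then show ?thesis by (simp add: geodesic_def continuous_reflection_def Let_def)
  qed
  have torsion: "near0 K (\<lambda>r z. cov T u (dpar v T) r z - cov T v (dpar u T) r z = dpar (bracket u v) T r z)"
    if T: "schwarz_family K S T" and u: "smooth_at u 0" and v: "smooth_at v 0"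
    for T :: "'p \<Rightarrow> complex \<Rightarrow> complex" and u v
    by (rule near0_mono[OF near0_conj[OF family_near0_hsm[OF T] near0_conj[OF near0_smooth[OF u] near0_smooth[OF v]]]])
      (elim conjE, rule cov_torsion)
  have flat: "\<forall>X Y. vector_field K S X \<and> vector_field K S Y \<longrightarrow>
      has_flat_derivative K S (X S) Y (flat_derivative K S (X S) Y)"
    by (intro allI impI, elim conjE, rule field_flat)
  have covariant: "\<forall>(T :: 'p \<Rightarrow> complex \<Rightarrow> complex) u X Y.
      schwarz_family K S T \<and> smooth_near0 u \<and> vector_field K S X \<and> vector_field K S Y \<and>
      near K (\<lambda>z. dpar u T 0 z = X S z) \<longrightarrow>
      near K (\<lambda>z. cov T u (\<lambda>r. Y (T r)) 0 z = nabla K S X Y z)"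
    by (intro allI impI, elim conjE, rule nabla_eq_cov)
  have preserve: "\<forall>(T :: 'p \<Rightarrow> complex \<Rightarrow> complex) u Y.
      schwarz_family K S T \<and> smooth_near0 u \<and> tangent_field K S T Y \<longrightarrow>
      tangent_field K S T (cov T u Y)"
    unfolding smooth_near0_iff by (intro allI impI, elim conjE, rule tangent_field_cov)
  have tf: "\<forall>(T :: 'p \<Rightarrow> complex \<Rightarrow> complex) u v.
      schwarz_family K S T \<and> smooth_near0 u \<and> smooth_near0 v \<longrightarrow>
      near0 K (\<lambda>r z. cov T u (dpar v T) r z - cov T v (dpar u T) r z = dpar (bracket u v) T r z)"
    unfolding smooth_near0_iff by (intro allI impI, elim conjE, rule torsion)
  have mult: "schwarz_family K S (\<lambda>r. reflect_mult (A r) (B r)) \<and>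
      near0 K (\<lambda>r z. reflect_mult (A r) (A r) z = A r z) \<and>
      near0 K (\<lambda>r z. reflect_mult (A r) (reflect_mult (A r) (B r)) z = B r z) \<and>
      near0 K (\<lambda>r z. reflect_mult (A r) (reflect_mult (B r) (C r)) z
        = reflect_mult (reflect_mult (A r) (B r)) (reflect_mult (A r) (C r)) z) \<and>
      (\<forall>\<^sub>F r in nhds 0. near K (\<lambda>z. reflect_mult S (A r) z = A r z) \<longrightarrow> near K (\<lambda>z. A r z = S z))"
    if "schwarz_family K S A" "schwarz_family K S B" "schwarz_family K S C"
    for A B C :: "'p \<Rightarrow> complex \<Rightarrow> complex"
    by (intro conjI reflect_mult_family reflect_mult_laws[OF that] reflect_mult_isolated that)
  show ?thesis
  proof (intro conjI flat covariant preserve tf nabla_affine canonical_connection_reflect_mult nabla_conformal)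
    show "\<forall>T. schwarz_family K S T \<longrightarrow> (geodesic K T \<longleftrightarrow> continuous_reflection K T)"
      by (intro allI impI geo)
    show "\<exists>R. riemann_tensor K S R" by (rule exI, rule riemann_tensor_curvature_formula)
    show "\<forall>R. riemann_tensor K S R \<longrightarrow> covariant_constant K S R"
      by (intro allI impI riemann_tensor_parallel)
  qed (intro allI impI, elim conjE, rule mult)
qed

end
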